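(* Let $\ell$ be an odd prime, let $K$ be a finite unramified extension of $\mathbf{Q}_\ell$ with ring of integers $\mathcal{O}_K$, and let $G$ be a finite group which is a semi-direct product $G = HL$ of a normal subgroup $H$ of order prime to $\ell$ and a cyclic $\ell$-group $L$. Assume $K[H]$ is decomposable. Let $W$ be a finite-dimensional $K$-vector space, let $f: W\times W \to K$ be a non-degenerate $K$-bilinear form which is either alternating or symmetric, and let $\tau: H \to \mathrm{Aut}(W,f)$ be a group homomorphism making $W$ a simple $K[H]$-module. Assume that for every $g\in G$ the representation $\tau_g: H \to \mathrm{Aut}(W)$, $h \mapsto \tau(ghg^{-1})$, is isomorphic to $\tau$. Let $T$ be an $H$-stable $\mathcal{O}_K$-lattice in $W$, and suppose $\tau(H)\subseteq \mathrm{Aut}(T,f)$. Then $\tau: H \to \mathrm{Aut}(T,f)\subseteq \mathrm{Aut}(W,f)$ extends to a group homomorphism $\tau_G: G \to \mathrm{Aut}(T,f) \subseteq \mathrm{Aut}(W,f)$ (i.e. $\tau_G|_H = \tau$).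
   Context: $K[H]$ is decomposable if it is isomorphic to a direct sum of full matrix algebras over fields. $\mathrm{Aut}(W,f)$ is the group of $K$-linear automorphisms of $W$ preserving $f$; $\mathrm{Aut}(T,f)$ is the subgroup of those mapping the lattice $T$ onto itself. An $\mathcal{O}_K$-lattice in $W$ is a finitely generated $\mathcal{O}_K$-submodule spanning $W$ over $K$. *)

theory Defs
  imports
    "HOL-Algebra.Algebraic_Closure_Type"
    "HOL-Algebra.Chinese_Remainder"
    "HOL-Algebra.Elementary_Groups"
begin

section \<open>The field of p-adic numbers and its finite unramified extensions\<close>

definition padic_abs :: "nat \<Rightarrow> rat \<Rightarrow> real" where
  "padic_abs p x = (if x = 0 then 0 else
     (case quotient_of x of (a, b) \<Rightarrow>
        real p powi (int (multiplicity (int p) b) - int (multiplicity (int p) a))))"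

definition padic_cauchy :: "nat \<Rightarrow> (nat \<Rightarrow> rat) ring" where
  "padic_cauchy p =
     \<lparr>carrier = {x. \<forall>e>0. \<exists>N. \<forall>m\<ge>N. \<forall>n\<ge>N. padic_abs p (x m - x n) < e},
      monoid.mult = (\<lambda>x y n. x n * y n), monoid.one = (\<lambda>_. 1),
      ring.zero = (\<lambda>_. 0), ring.add = (\<lambda>x y n. x n + y n)\<rparr>"

definition padic_null :: "nat \<Rightarrow> (nat \<Rightarrow> rat) set" where
  "padic_null p = {x \<in> carrier (padic_cauchy p). (\<lambda>n. padic_abs p (x n)) \<longlonglongrightarrow> 0}"

text \<open>For a prime \<open>p\<close>, the completion of the rational numbers with respect to the
  \<open>p\<close>-adic absolute value.\<close>

definition padic_field :: "nat \<Rightarrow> (nat \<Rightarrow> rat) set ring" where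
  "padic_field p = padic_cauchy p Quot padic_null p"

text \<open>The limit does not depend on the representing Cauchy sequence.\<close>

definition padic_norm :: "nat \<Rightarrow> (nat \<Rightarrow> rat) set \<Rightarrow> real" where
  "padic_norm p c = lim (\<lambda>n. padic_abs p ((SOME x. x \<in> c) n))"

definition padic_integers :: "nat \<Rightarrow> (nat \<Rightarrow> rat) set set" where
  "padic_integers p = {c \<in> carrier (padic_field p). padic_norm p c \<le> 1}"

text \<open>The field \<open>'k\<close> is a finite extension of the \<open>p\<close>-adic numbers by means of the field
  embedding \<open>\<iota>\<close>.\<close>

definition finite_padic_extension :: "nat \<Rightarrow> ((nat \<Rightarrow> rat) set \<Rightarrow> 'k::field) \<Rightarrow> bool" where
  "finite_padic_extension p \<iota> \<longleftrightarrow>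
     \<iota> \<in> ring_hom (padic_field p) (ring_of_type_algebra :: 'k ring) \<and>
     ring.finite_dimension (ring_of_type_algebra :: 'k ring) (\<iota> ` carrier (padic_field p)) UNIV"

text \<open>The integral closure of the \<open>p\<close>-adic integers in \<open>'k\<close>.\<close>

definition integers_of :: "nat \<Rightarrow> ((nat \<Rightarrow> rat) set \<Rightarrow> 'k::field) \<Rightarrow> 'k set" where
  "integers_of p \<iota> =
     {x. \<exists>q :: 'k Polynomial.poly. Polynomial.lead_coeff q = 1 \<and>
           (\<forall>i. Polynomial.coeff q i \<in> \<iota> ` padic_integers p) \<and> Polynomial.poly q x = 0}"

text \<open>The ring of integers is a discrete valuation ring, in which \<open>p\<close> generates the \<open>e\<close>-th power
  of the maximal ideal, where \<open>e\<close> is the ramification index; so the condition says \<open>e = 1\<close>.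
  Separability of the residue field extension is automatic because the residue fields are
  finite.\<close>

definition unramified :: "nat \<Rightarrow> ((nat \<Rightarrow> rat) set \<Rightarrow> 'k::field) \<Rightarrow> bool" where
  "unramified p \<iota> \<longleftrightarrow>
     (let R = (ring_of_type_algebra :: 'k ring)\<lparr>carrier := integers_of p \<iota>\<rparr>
      in maximalideal (PIdl\<^bsub>R\<^esub> (of_nat p)) R)"

section \<open>Group algebras and decomposability\<close>

definition group_algebra :: "('g, 'm) monoid_scheme \<Rightarrow> ('g \<Rightarrow> 'k::field) ring" where
  "group_algebra G =
     \<lparr>carrier = {a. \<forall>x. x \<notin> carrier G \<longrightarrow> a x = 0},
      monoid.mult = (\<lambda>a b x. \<Sum>(y, z) \<in> {(y, z) \<in> carrier G \<times> carrier G. y \<otimes>\<^bsub>G\<^esub> z = x}. a y * b z),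
      monoid.one = (\<lambda>x. if x = \<one>\<^bsub>G\<^esub> then 1 else 0),
      ring.zero = (\<lambda>_. 0), ring.add = (\<lambda>a b x. a x + b x)\<rparr>"

definition matrix_ring :: "('f, 'm) ring_scheme \<Rightarrow> nat \<Rightarrow> (nat \<times> nat \<Rightarrow> 'f) ring" where
  "matrix_ring F n =
     \<lparr>carrier = {..<n} \<times> {..<n} \<rightarrow>\<^sub>E carrier F,
      monoid.mult = (\<lambda>A B. \<lambda>(i, j) \<in> {..<n} \<times> {..<n}. \<Oplus>\<^bsub>F\<^esub>k\<in>{..<n}. A (i, k) \<otimes>\<^bsub>F\<^esub> B (k, j)),
      monoid.one = (\<lambda>(i, j) \<in> {..<n} \<times> {..<n}. if i = j then \<one>\<^bsub>F\<^esub> else \<zero>\<^bsub>F\<^esub>),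
      ring.zero = (\<lambda>(i, j) \<in> {..<n} \<times> {..<n}. \<zero>\<^bsub>F\<^esub>),
      ring.add = (\<lambda>A B. \<lambda>(i, j) \<in> {..<n} \<times> {..<n}. A (i, j) \<oplus>\<^bsub>F\<^esub> B (i, j))\<rparr>"

text \<open>The fields may be different from one another; their elements are taken from the type \<open>'f\<close>,
  which is arbitrary wherever decomposability is assumed.\<close>

definition decomposable :: "'f itself \<Rightarrow> ('a, 'm) ring_scheme \<Rightarrow> bool" where
  "decomposable (_ :: 'f itself) R \<longleftrightarrow>
     (\<exists>Fs :: ('f ring \<times> nat) list.
        (\<forall>(F, n) \<in> set Fs. field F \<and> n > 0) \<and>
        R \<simeq> RDirProd_list (map (\<lambda>(F, n). matrix_ring F n) Fs))"

section \<open>Forms, lattices and representations\<close>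

definition bilinear_form ::
    "('k::field \<Rightarrow> 'w::ab_group_add \<Rightarrow> 'w) \<Rightarrow> ('w \<Rightarrow> 'w \<Rightarrow> 'k) \<Rightarrow> bool" where
  "bilinear_form scale f \<longleftrightarrow>
     (\<forall>x. Vector_Spaces.linear scale (*) (\<lambda>y. f x y)) \<and>
     (\<forall>y. Vector_Spaces.linear scale (*) (\<lambda>x. f x y))"

definition nondegenerate :: "('w::ab_group_add \<Rightarrow> 'w \<Rightarrow> 'k::field) \<Rightarrow> bool" where
  "nondegenerate f \<longleftrightarrow>
     (\<forall>x. (\<forall>y. f x y = 0) \<longrightarrow> x = 0) \<and> (\<forall>y. (\<forall>x. f x y = 0) \<longrightarrow> y = 0)"

definition alternating_form :: "('w::ab_group_add \<Rightarrow> 'w \<Rightarrow> 'k::field) \<Rightarrow> bool" where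
  "alternating_form f \<longleftrightarrow> (\<forall>x. f x x = 0)"

definition symmetric_form :: "('w::ab_group_add \<Rightarrow> 'w \<Rightarrow> 'k::field) \<Rightarrow> bool" where
  "symmetric_form f \<longleftrightarrow> (\<forall>x y. f x y = f y x)"

definition aut_form ::
    "('k::field \<Rightarrow> 'w::ab_group_add \<Rightarrow> 'w) \<Rightarrow> ('w \<Rightarrow> 'w \<Rightarrow> 'k) \<Rightarrow> ('w \<Rightarrow> 'w) monoid" where
  "aut_form scale f =
     \<lparr>carrier = {\<phi>. Vector_Spaces.linear scale scale \<phi> \<and> bij \<phi> \<and>
                     (\<forall>x y. f (\<phi> x) (\<phi> y) = f x y)},
      monoid.mult = (\<circ>), monoid.one = id\<rparr>"

definition aut_lattice ::
    "('k::field \<Rightarrow> 'w::ab_group_add \<Rightarrow> 'w) \<Rightarrow> 'w set \<Rightarrow> ('w \<Rightarrow> 'w \<Rightarrow> 'k) \<Rightarrow> ('w \<Rightarrow> 'w) monoid" where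
  "aut_lattice scale T f =
     (aut_form scale f)\<lparr>carrier := {\<phi> \<in> carrier (aut_form scale f). \<phi> ` T = T}\<rparr>"

definition lattice_over ::
    "'k::field set \<Rightarrow> ('k \<Rightarrow> 'w::ab_group_add \<Rightarrow> 'w) \<Rightarrow> 'w set \<Rightarrow> bool" where
  "lattice_over A scale T \<longleftrightarrow>
     (\<exists>S. finite S \<and> T = {\<Sum>s\<in>S. scale (c s) s | c. \<forall>s\<in>S. c s \<in> A}) \<and>
     Modules.module.span scale T = UNIV"

definition group_algebra_act ::
    "('g, 'm) monoid_scheme \<Rightarrow> ('k::field \<Rightarrow> 'w::ab_group_add \<Rightarrow> 'w) \<Rightarrow> ('g \<Rightarrow> 'w \<Rightarrow> 'w) \<Rightarrow>
       ('g \<Rightarrow> 'k) \<Rightarrow> 'w \<Rightarrow> 'w" where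
  "group_algebra_act G scale \<tau> a w = (\<Sum>g\<in>carrier G. scale (a g) (\<tau> g w))"

definition group_algebra_submodule ::
    "('g, 'm) monoid_scheme \<Rightarrow> ('k::field \<Rightarrow> 'w::ab_group_add \<Rightarrow> 'w) \<Rightarrow> ('g \<Rightarrow> 'w \<Rightarrow> 'w) \<Rightarrow>
       'w set \<Rightarrow> bool" where
  "group_algebra_submodule G scale \<tau> U \<longleftrightarrow>
     0 \<in> U \<and> (\<forall>x\<in>U. \<forall>y\<in>U. x + y \<in> U) \<and> (\<forall>x\<in>U. - x \<in> U) \<and>
     (\<forall>a\<in>carrier (group_algebra G). \<forall>x\<in>U. group_algebra_act G scale \<tau> a x \<in> U)"

definition simple_group_algebra_module ::
    "('g, 'm) monoid_scheme \<Rightarrow> ('k::field \<Rightarrow> 'w::ab_group_add \<Rightarrow> 'w) \<Rightarrow> ('g \<Rightarrow> 'w \<Rightarrow> 'w) \<Rightarrow>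
       bool" where
  "simple_group_algebra_module G scale \<tau> \<longleftrightarrow>
     (UNIV :: 'w set) \<noteq> {0} \<and>
     (\<forall>U. group_algebra_submodule G scale \<tau> U \<longrightarrow> U = {0} \<or> U = UNIV)"

definition isomorphic_reps ::
    "('g, 'm) monoid_scheme \<Rightarrow> ('k::field \<Rightarrow> 'w::ab_group_add \<Rightarrow> 'w) \<Rightarrow>
       ('g \<Rightarrow> 'w \<Rightarrow> 'w) \<Rightarrow> ('g \<Rightarrow> 'w \<Rightarrow> 'w) \<Rightarrow> bool" where
  "isomorphic_reps G scale \<rho> \<sigma> \<longleftrightarrow>
     (\<exists>\<phi>. Vector_Spaces.linear scale scale \<phi> \<and> bij \<phi> \<and>
          (\<forall>g\<in>carrier G. \<phi> \<circ> \<rho> g = \<sigma> g \<circ> \<phi>))"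

end

theory Submission
  imports Defs
begin

text \<open>Let \<open>E\<close> be the commutant of \<open>\<tau>(H)\<close> in \<open>End(W)\<close>. It is a field because \<open>K[H]\<close> is decomposable,
  and since the order of \<open>H\<close> is a unit in the integers of \<open>K\<close>, averaging over \<open>H\<close> shows that the
  elements of \<open>E\<close> preserving \<open>T\<close> form a complete discrete valuation ring \<open>R\<close> with uniformizer
  \<open>l\<close>, that every operator normalizing \<open>\<tau>(H)\<close> maps \<open>T\<close> to a multiple of \<open>T\<close>, and that \<open>l\<close> does not
  divide the dimension of \<open>W\<close> over \<open>E\<close>. Let \<open>u\<close> intertwine \<open>\<tau>\<close> with its conjugate by a generator
  \<open>c\<close> of \<open>L\<close>, and let \<open>N\<close> be the order of \<open>c\<close>. After scaling \<open>u\<close> we have \<open>f(ux, uy) = f(ax, y)\<close>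
  with a self-adjoint unit \<open>a\<close> of \<open>R\<close>; as \<open>N\<close> is odd and the squares have index at most 2 in the units
  of the finite residue field, \<open>a\<close> has the form \<open>s\<^sup>* s\<close>, so \<open>u\<close> can be made an isometry. Then \<open>u\<^sup>N\<close>
  is in \<open>E\<close>, and a comparison of determinants over \<open>E\<close> yields a correction of \<open>u\<close> by an element of
  \<open>E\<close> that achieves \<open>u\<^sup>N = 1\<close>. Now \<open>c \<mapsto> u\<close> extends \<open>\<tau>\<close>.\<close>

section \<open>Additive operators on an abelian group\<close>

text \<open>Scalars, the commutant \<open>E\<close>, the group and the operator \<open>u\<close> all
  live in one noncommutative ring of additive operators. The automorphism of \<open>E\<close>
  induced by the generator is then conjugation by \<open>u\<close>, and divisibility by powers of
  \<pi> takes the place of valuations. Because \<open>E\<close> is a field, Hensel's lemma leaves no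
  idempotents modulo \<pi> besides 0 and 1, which is why a normalizing operator can distort
  \<open>T\<close> only by a scalar. The obstacle is the last correction. Replacing \<open>u\<close>
  by \<open>y u\<close> multiplies \<open>u^N\<close> by the norm of \<open>y\<close> along the
  conjugation action, and as \<open>N\<close> is a power of l, Hensel's lemma gives no N-th roots.
  Instead, the class of \<open>u^N\<close> modulo norms is killed by two coprime numbers: by the
  dimension n, because the determinant of the semilinear map \<open>u\<close> has norm
  \<open>(u^N)^n\<close>, and by \<open>N\<close>, because \<open>u\<close> commutes with
  \<open>u^N\<close>. The correction must also preserve the form, so the determinant b gives way to
  \<open>adj b / b\<close>; this costs a factor 2, harmless as \<open>N\<close> is odd.\<close>

text \<open>The operators on the trivial group satisfy \<open>0 = 1\<close>, so the type is not in class
  \<^class>\<open>ring_1\<close>.\<close>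

typedef (overloaded) 'w aend = "{f :: 'w::ab_group_add \<Rightarrow> 'w. \<forall>x y. f (x + y) = f x + f y}"
  morphisms app Aend
  by (rule exI[of _ "\<lambda>x. x"]) simp

notation app (infixr "\<cdot>" 75)

setup_lifting type_definition_aend

instantiation aend :: (ab_group_add) "{ring, monoid_mult}"
begin

lift_definition zero_aend :: "'a aend" is "\<lambda>x. 0" by simp
lift_definition one_aend :: "'a aend" is "\<lambda>x. x" by simp
lift_definition plus_aend :: "'a aend \<Rightarrow> 'a aend \<Rightarrow> 'a aend" is "\<lambda>f g x. f x + g x"
  by (simp add: algebra_simps)
lift_definition minus_aend :: "'a aend \<Rightarrow> 'a aend \<Rightarrow> 'a aend" is "\<lambda>f g x. f x - g x"
  by (simp add: algebra_simps)
lift_definition uminus_aend :: "'a aend \<Rightarrow> 'a aend" is "\<lambda>f x. - f x"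
  by (simp add: algebra_simps)
lift_definition times_aend :: "'a aend \<Rightarrow> 'a aend \<Rightarrow> 'a aend" is "\<lambda>f g x. f (g x)"
  by (simp add: algebra_simps)

instance
  by standard (transfer, simp add: algebra_simps)+

end

lemma app_add [simp]: "x \<cdot> (v + w) = x \<cdot> v + x \<cdot> w"
  by transfer simp

lemma app_0 [simp]: "x \<cdot> 0 = 0"
  using app_add[of x 0 0] by simp

lemma app_minus [simp]: "x \<cdot> (- v) = - (x \<cdot> v)"
  using app_add[of x v "- v"] by (simp add: eq_neg_iff_add_eq_0 add.commute)

lemma app_diff [simp]: "x \<cdot> (v - w) = x \<cdot> v - x \<cdot> w"
  using app_add[of x v "- w"] by simp

lemma app_sum: "x \<cdot> sum f A = (\<Sum>a\<in>A. x \<cdot> f a)"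
  by (induction A rule: infinite_finite_induct) auto

lemma zero_app [simp]: "0 \<cdot> v = 0" by transfer simp
lemma one_app [simp]: "1 \<cdot> v = v" by transfer simp
lemma plus_app [simp]: "(x + y) \<cdot> v = x \<cdot> v + y \<cdot> v" by transfer simp
lemma minus_app [simp]: "(x - y) \<cdot> v = x \<cdot> v - y \<cdot> v" by transfer simp
lemma uminus_app [simp]: "(- x) \<cdot> v = - (x \<cdot> v)" by transfer simp
lemma times_app: "(x * y) \<cdot> v = x \<cdot> y \<cdot> v" by transfer simp

lemma sum_app: "sum f A \<cdot> v = (\<Sum>a\<in>A. f a \<cdot> v)"
  by (induction A rule: infinite_finite_induct) auto

lemma aend_eqI: "(\<And>v. x \<cdot> v = y \<cdot> v) \<Longrightarrow> x = y"
  by (simp add: app_inject[symmetric] fun_eq_iff)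

lemma app_Aend: "(\<And>v w. g (v + w) = g v + g w) \<Longrightarrow> Aend g \<cdot> v = g v"
  by (simp add: Aend_inverse)

lemma inverse_power:
  fixes x y :: "'a::monoid_mult"
  assumes "x * y = 1" "y * x = 1"
  shows "x ^ n * y ^ n = 1"
  using assms by (metis left_right_inverse_power)

text \<open>Stands in for an exact valuation: applied to the statement that a quotient by the i-th
  power of the uniformizer is still integral, it yields the last admissible exponent.\<close>

lemma last_true_nat:
  assumes "P (0::nat)" "\<not> P k"
  obtains m where "P m" "\<not> P (Suc m)"
  using assms by (metis nat_induct)

section \<open>Lattices over a valued field of operators\<close>

definition rspan :: "'w::ab_group_add aend set \<Rightarrow> 'w set \<Rightarrow> 'w set" where
  "rspan R B = {\<Sum>b\<in>B. r b \<cdot> b | r. \<forall>b\<in>B. r b \<in> R}"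

lemma rspanI: "(\<And>b. b \<in> B \<Longrightarrow> r b \<in> R) \<Longrightarrow> w = (\<Sum>b\<in>B. r b \<cdot> b) \<Longrightarrow> w \<in> rspan R B"
  unfolding rspan_def by blast

lemma rspanE:
  assumes "w \<in> rspan R B"
  obtains r where "\<forall>b\<in>B. r b \<in> R" "w = (\<Sum>b\<in>B. r b \<cdot> b)"
  using assms unfolding rspan_def by blast

definition op_indep :: "'w::ab_group_add aend set \<Rightarrow> 'w set \<Rightarrow> bool" where
  "op_indep D B \<longleftrightarrow> (\<forall>r. (\<forall>b\<in>B. r b \<in> D) \<longrightarrow> (\<Sum>b\<in>B. r b \<cdot> b) = 0 \<longrightarrow> (\<forall>b\<in>B. r b = 0))"

locale op_ring =
  fixes R :: "'w::ab_group_add aend set"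
  assumes zero_in [simp, intro]: "0 \<in> R" and one_in [simp, intro]: "1 \<in> R"
    and add_in [intro]: "x \<in> R \<Longrightarrow> y \<in> R \<Longrightarrow> x + y \<in> R"
    and uminus_in [intro]: "x \<in> R \<Longrightarrow> - x \<in> R"
    and mult_in [intro]: "x \<in> R \<Longrightarrow> y \<in> R \<Longrightarrow> x * y \<in> R"
begin

lemma diff_in [intro]: "x \<in> R \<Longrightarrow> y \<in> R \<Longrightarrow> x - y \<in> R"
  using add_in[of x "- y"] uminus_in by simp

lemma sum_in [intro]: "(\<And>a. a \<in> A \<Longrightarrow> g a \<in> R) \<Longrightarrow> sum g A \<in> R"
  by (induction A rule: infinite_finite_induct) auto

lemma power_in [intro]: "x \<in> R \<Longrightarrow> x ^ n \<in> R"
  by (induction n) auto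

lemma rspan_add: "v \<in> rspan R B \<Longrightarrow> w \<in> rspan R B \<Longrightarrow> v + w \<in> rspan R B"
  by (elim rspanE, rule rspanI[of _ "\<lambda>b. _ b + _ b"]) (auto simp: sum.distrib)

lemma rspan_mult: "x \<in> R \<Longrightarrow> v \<in> rspan R B \<Longrightarrow> x \<cdot> v \<in> rspan R B"
  by (elim rspanE, rule rspanI[of _ "\<lambda>b. x * _ b"]) (auto simp: app_sum times_app)

lemma rspan_0: "0 \<in> rspan R B"
  by (rule rspanI[of _ "\<lambda>_. 0"]) auto

lemma rspan_diff: "v \<in> rspan R B \<Longrightarrow> w \<in> rspan R B \<Longrightarrow> v - w \<in> rspan R B"
  using rspan_add[of v B "- 1 \<cdot> w"] rspan_mult[of "- 1" w B] by auto

lemma rspan_sum: "(\<And>a. a \<in> A \<Longrightarrow> g a \<in> rspan R B) \<Longrightarrow> sum g A \<in> rspan R B"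
  by (induction A rule: infinite_finite_induct) (auto intro: rspan_add rspan_0)

lemma rspan_superset: "finite B \<Longrightarrow> b \<in> B \<Longrightarrow> b \<in> rspan R B"
  by (rule rspanI[of _ "\<lambda>c. if c = b then 1 else 0"]) (auto simp: if_distrib[of "\<lambda>x. x \<cdot> _"] cong: if_cong)

lemma rspan_subset: "B \<subseteq> rspan R C \<Longrightarrow> rspan R B \<subseteq> rspan R C"
  by (auto elim!: rspanE intro!: rspan_sum rspan_mult)

end

text \<open>A discretely valued field \<open>D\<close> with ring \<open>R\<close> and uniformizer
  \<open>\<pi>\<close>, described without a valuation: \<open>bounded\<close> and
  \<open>separated\<close> give every nonzero element an exact exponent, and \<open>unit\<close>
  makes the elements of exponent 0 invertible in \<open>R\<close>. It is used for the scalars and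
  again for the commutant \<open>E\<close>.\<close>

locale valued_ops = D: op_ring D + R: op_ring R
  for D R :: "'w::ab_group_add aend set" +
  fixes \<pi> \<pi>i :: "'w aend"
  assumes sub: "R \<subseteq> D"
    and D_comm: "x \<in> D \<Longrightarrow> y \<in> D \<Longrightarrow> x * y = y * x"
    and pi_R: "\<pi> \<in> R" and pii_D: "\<pi>i \<in> D" and pi_pii: "\<pi> * \<pi>i = 1"
    and bounded: "x \<in> D \<Longrightarrow> \<exists>n. \<pi> ^ n * x \<in> R"
    and separated: "x \<in> D \<Longrightarrow> x \<noteq> 0 \<Longrightarrow> \<exists>n. \<pi>i ^ n * x \<notin> R"
    and unit: "x \<in> R \<Longrightarrow> \<pi>i * x \<notin> R \<Longrightarrow> \<exists>y\<in>R. y * x = 1"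
begin

lemma pii_pi: "\<pi>i * \<pi> = 1"
  using D_comm pi_pii pi_R pii_D sub by (metis subsetD)

lemma pipow: "\<pi> ^ n * \<pi>i ^ n = 1" "\<pi>i ^ n * \<pi> ^ n = 1"
  using inverse_power pi_pii pii_pi by auto

lemma pi_power_R: "\<pi> ^ n \<in> R"
  using pi_R by auto

lemma bounded_mono: "\<pi> ^ m * x \<in> R \<Longrightarrow> m \<le> n \<Longrightarrow> \<pi> ^ n * x \<in> R"
  using R.mult_in[OF pi_power_R[of "n - m"], of "\<pi> ^ m * x"]
  by (simp add: mult.assoc[symmetric] power_add[symmetric])

lemma bounded_family:
  assumes "finite B" "\<And>b. b \<in> B \<Longrightarrow> r b \<in> D"
  shows "\<exists>n. \<forall>b\<in>B. \<pi> ^ n * r b \<in> R"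
proof -
  have "\<forall>b\<in>B. \<exists>n. \<pi> ^ n * r b \<in> R" using assms bounded by auto
  then obtain N where N: "\<And>b. b \<in> B \<Longrightarrow> \<pi> ^ N b * r b \<in> R" by metis
  have "\<pi> ^ Max (N ` B) * r b \<in> R" if "b \<in> B" for b
    by (rule bounded_mono[OF N[OF that]]) (use that assms in auto)
  then show ?thesis by blast
qed

text \<open>After clearing denominators, the family is divided by \<open>\<pi>\<close> as long as
  all entries stay integral; the entry that stops this is a unit.\<close>

lemma primitive_multiple:
  assumes "finite B" "\<And>b. b \<in> B \<Longrightarrow> r b \<in> D" "j \<in> B" "r j \<noteq> 0"
  obtains d k where "d \<in> D" "\<And>b. b \<in> B \<Longrightarrow> d * r b \<in> R" "k \<in> B" "\<pi>i * (d * r k) \<notin> R"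
proof -
  obtain n where n: "\<forall>b\<in>B. \<pi> ^ n * r b \<in> R" using bounded_family assms by blast
  have "\<pi> ^ n * r j \<noteq> 0" 
    by (metis assms(4) mult.assoc mult_1 mult_zero_right pipow(2))
  then obtain m where m: "\<pi>i ^ m * (\<pi> ^ n * r j) \<notin> R"
    using separated[of "\<pi> ^ n * r j"] n assms(3) sub by blast
  define P where "P = (\<lambda>m. \<forall>b\<in>B. \<pi>i ^ m * (\<pi> ^ n * r b) \<in> R)"
  have "P 0" "\<not> P m" using n m assms(3) by (auto simp: P_def)
  then obtain i where i: "P i" "\<not> P (Suc i)" by (rule last_true_nat)
  then obtain k where k: "k \<in> B" "\<pi>i ^ Suc i * (\<pi> ^ n * r k) \<notin> R" by (auto simp: P_def)
  show ?thesis
  proof (rule that[of "\<pi>i ^ i * \<pi> ^ n" k])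
    show "\<pi>i ^ i * \<pi> ^ n \<in> D" using pii_D pi_R sub by (auto intro!: D.mult_in)
  qed (use i k in \<open>auto simp: P_def mult.assoc\<close>)
qed

lemma minimal_generators:
  assumes S: "finite S" and T: "T = rspan R S"
  obtains B where "finite B" "T = rspan R B" 
    "op_indep D B"
    "\<forall>r. (\<forall>b\<in>B. r b \<in> R) \<longrightarrow> (\<Sum>b\<in>B. r b \<cdot> b) \<in> M \<longrightarrow> (\<forall>b\<in>B - M. \<pi>i * r b \<in> R)"
proof -
  \<comment> \<open>Dropping a generator lowers the first term and does not raise the second;
    exchanging a generator outside \<open>M\<close> for an element of \<open>M\<close> lowers the
    second and does not raise the first.\<close>
  define \<mu> where "\<mu> = (\<lambda>B. card B + card (B - M))"
  define G where "G = (\<lambda>B. finite B \<and> T = rspan R B)"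
  have "G S" using assms by (auto simp: G_def)
  then obtain B where B: "G B" "\<And>C. G C \<Longrightarrow> \<mu> B \<le> \<mu> C"
    using exists_least_iff[of "\<lambda>n. \<exists>B. G B \<and> \<mu> B = n"] by (metis not_le)
  have fin: "finite B" and TB: "T = rspan R B" using B(1) by (auto simp: G_def)
  \<comment> \<open>A generator \<open>j\<close> with a unit coefficient can be solved for, so every
    \<open>C\<close> that contains the other generators and spans the given combination still
    generates \<open>T\<close>.\<close>
  have exch: False 
    if r: "\<And>b. b \<in> B \<Longrightarrow> r b \<in> R" and j: "j \<in> B" "\<pi>i * r j \<notin> R"
      and C: "finite C" "B - {j} \<subseteq> C" "C \<subseteq> T" "(\<Sum>b\<in>B. r b \<cdot> b) \<in> rspan R C" "\<mu> C < \<mu> B" for r j C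
  proof -
    obtain y where y: "y \<in> R" "y * r j = 1" using unit r j by blast
    have "(\<Sum>b\<in>B - {j}. r b \<cdot> b) \<in> rspan R C" (is "?s \<in> _")
      using C r by (intro R.rspan_sum R.rspan_mult R.rspan_superset) auto
    then have "r j \<cdot> j \<in> rspan R C"
      using R.rspan_diff[OF C(4), of ?s] fin j(1) by (simp add: sum.remove[of B j])
    then have "y \<cdot> r j \<cdot> j \<in> rspan R C" using y R.rspan_mult by blast
    then have "j \<in> rspan R C" using y by (metis one_app times_app)
    then have "B \<subseteq> rspan R C" using C R.rspan_superset by blast
    then have "T = rspan R C" using C(3) R.rspan_subset[of C B] R.rspan_subset[of B C] TB by auto
    then show False using B(2)[of C] C by (auto simp: G_def)
  qed
  have BT: "B \<subseteq> T" using TB R.rspan_superset fin by auto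
  have card: "card (B - {j}) < card B" if "j \<in> B" for j using that fin by (intro card_Diff1_less)
  show ?thesis
  proof (rule that[OF fin TB]; (unfold op_indep_def)?; intro allI impI ballI)
    fix r b assume r: "\<forall>b\<in>B. r b \<in> D" "(\<Sum>b\<in>B. r b \<cdot> b) = 0" "b \<in> B"
    show "r b = 0"
    proof (rule ccontr)
      assume "r b \<noteq> 0"
      then obtain d k where d: "d \<in> D" "\<And>b. b \<in> B \<Longrightarrow> d * r b \<in> R" "k \<in> B" "\<pi>i * (d * r k) \<notin> R"
        using primitive_multiple[of B r b] fin r by auto
      have "(\<Sum>b\<in>B. (d * r b) \<cdot> b) = 0" using r(2) by (simp add: times_app app_sum[symmetric])
      moreover have "\<mu> (B - {k}) < \<mu> B" using card[OF d(3)] fin unfolding \<mu>_def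
        by (intro add_less_le_mono card_mono) auto
      ultimately show False
        using d BT fin by (intro exch[of "\<lambda>b. d * r b" k "B - {k}"]) (auto simp: R.rspan_0)
    qed
  next
    fix r b assume r: "\<forall>b\<in>B. r b \<in> R" "(\<Sum>b\<in>B. r b \<cdot> b) \<in> M" "b \<in> B - M"
    show "\<pi>i * r b \<in> R"
    proof (rule ccontr)
      assume nR: "\<pi>i * r b \<notin> R"
      define t where "t = (\<Sum>b\<in>B. r b \<cdot> b)"
      have tT: "t \<in> T" unfolding TB t_def using r by (intro rspanI) auto
      have "card (insert t (B - {b})) \<le> card B"
        using card[of b] r fin by (simp add: card_insert_if)
      moreover have "card (insert t (B - {b}) - M) < card (B - M)"
        using r fin by (intro psubset_card_mono) (auto simp: t_def)
      ultimately have "\<mu> (insert t (B - {b})) < \<mu> B" unfolding \<mu>_def by simp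
      then show False using r nR fin tT BT
        by (intro exch[of r b "insert t (B - {b})"]) (auto simp: t_def intro!: R.rspan_superset)
    qed
  qed
qed

end

definition coords :: "'w::ab_group_add aend set \<Rightarrow> 'w set \<Rightarrow> ('w \<Rightarrow> 'w \<Rightarrow> 'w aend) \<Rightarrow> bool" where
  "coords D B \<phi> \<longleftrightarrow> (\<forall>b\<in>B. \<forall>w. \<phi> b w \<in> D) \<and> (\<forall>w. w = (\<Sum>b\<in>B. \<phi> b w \<cdot> b)) \<and>
     (\<forall>r w. (\<forall>b\<in>B. r b \<in> D) \<longrightarrow> w = (\<Sum>b\<in>B. r b \<cdot> b) \<longrightarrow> (\<forall>b\<in>B. \<phi> b w = r b)) \<and>
     (\<forall>b\<in>B. \<forall>v w. \<phi> b (v + w) = \<phi> b v + \<phi> b w) \<and>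
     (\<forall>b\<in>B. \<forall>d\<in>D. \<forall>w. \<phi> b (d \<cdot> w) = d * \<phi> b w)"

lemma coordsD:
  assumes "coords D B \<phi>"
  shows "\<And>b w. b \<in> B \<Longrightarrow> \<phi> b w \<in> D" "\<And>w. w = (\<Sum>b\<in>B. \<phi> b w \<cdot> b)"
    "\<And>r b w. (\<And>b. b \<in> B \<Longrightarrow> r b \<in> D) \<Longrightarrow> w = (\<Sum>b\<in>B. r b \<cdot> b) \<Longrightarrow> b \<in> B \<Longrightarrow> \<phi> b w = r b"
    "\<And>b v w. b \<in> B \<Longrightarrow> \<phi> b (v + w) = \<phi> b v + \<phi> b w"
    "\<And>b d w. b \<in> B \<Longrightarrow> d \<in> D \<Longrightarrow> \<phi> b (d \<cdot> w) = d * \<phi> b w"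
  using assms unfolding coords_def by (elim conjE; blast)+

lemma (in op_ring) coords_basis:
  assumes "coords R B \<phi>" "finite B" "b \<in> B" "c \<in> B"
  shows "\<phi> b c = (if b = c then 1 else 0)"
  using assms(2-4) by (intro coordsD(3)[OF assms(1), of "\<lambda>b. if b = c then 1 else 0"])
    (auto simp: if_distrib[of "\<lambda>x. x \<cdot> _"] cong: if_cong)

lemma (in op_ring) coords_exist:
  assumes sp: "rspan R B = UNIV" and ind: "op_indep R B"
  obtains \<phi> where "coords R B \<phi>"
proof -
  have "\<forall>w. \<exists>r. (\<forall>b\<in>B. r b \<in> R) \<and> w = (\<Sum>b\<in>B. r b \<cdot> b)" using sp by (metis UNIV_I rspanE)
  then obtain \<psi> where \<psi>: "\<And>w b. b \<in> B \<Longrightarrow> \<psi> w b \<in> R" "\<And>w. w = (\<Sum>b\<in>B. \<psi> w b \<cdot> b)"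
    by metis
  have uniq: "\<psi> w b = r b"
    if "\<And>b. b \<in> B \<Longrightarrow> r b \<in> R" "w = (\<Sum>b\<in>B. r b \<cdot> b)" "b \<in> B" for r b w
  proof -
    have "(\<Sum>b\<in>B. (\<psi> w b - r b) \<cdot> b) = 0" 
      using trans[OF \<psi>(2)[of w, symmetric] that(2)] by (simp add: sum_subtractf)
    moreover have "\<forall>b\<in>B. \<psi> w b - r b \<in> R" using that \<psi>(1) by auto
    ultimately have "\<forall>b\<in>B. \<psi> w b - r b = 0" using ind unfolding op_indep_def by fast
    then show ?thesis using that by simp
  qed
  have "coords R B (\<lambda>b w. \<psi> w b)" unfolding coords_def
  proof (intro conjI ballI allI impI \<psi>(1))
    fix b v w assume "b \<in> B"
    then show "\<psi> (v + w) b = \<psi> v b + \<psi> w b"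
      using \<psi> by (intro uniq[of "\<lambda>b. \<psi> v b + \<psi> w b"]) (auto simp: sum.distrib)
  next
    fix b d w assume "b \<in> B" "d \<in> R"
    then show "\<psi> (d \<cdot> w) b = d * \<psi> w b"
      using \<psi> by (intro uniq[of "\<lambda>b. d * \<psi> w b"]) (auto simp: times_app app_sum[symmetric])
  qed (use \<psi>(2) uniq in auto)
  then show ?thesis by (rule that)
qed

text \<open>Completeness is stated for power series in \<open>p\<close> with coefficients in
  \<open>\<O>\<close>, as congruences modulo each power of \<open>p\<close>, so that no topology
  occurs. \<open>O_finite\<close> is the finiteness of the residue field, and the last two
  conditions exclude residue characteristic 2.\<close>

locale complete_dvr =
  fixes \<O> :: "'k::field set" and p :: 'k
  assumes O_0: "0 \<in> \<O>" and O_1: "1 \<in> \<O>"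
    and O_add: "x \<in> \<O> \<Longrightarrow> y \<in> \<O> \<Longrightarrow> x + y \<in> \<O>"
    and O_uminus: "x \<in> \<O> \<Longrightarrow> - x \<in> \<O>"
    and O_mult: "x \<in> \<O> \<Longrightarrow> y \<in> \<O> \<Longrightarrow> x * y \<in> \<O>"
    and p_O: "p \<in> \<O>" and p_nz: "p \<noteq> 0"
    and O_bounded: "\<exists>n. p ^ n * x \<in> \<O>"
    and O_separated: "x \<noteq> 0 \<Longrightarrow> \<exists>n. x / p ^ n \<notin> \<O>"
    and O_unit: "x \<in> \<O> \<Longrightarrow> x / p \<notin> \<O> \<Longrightarrow> inverse x \<in> \<O>"
    and O_finite: "\<exists>Y. finite Y \<and> (\<forall>x\<in>\<O>. \<exists>y\<in>Y. (x - y) / p \<in> \<O>)"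
    and O_complete: "(\<And>j::nat. c j \<in> \<O>) \<Longrightarrow> \<exists>x\<in>\<O>. \<forall>n. (x - (\<Sum>j<n. p ^ j * c j)) / p ^ n \<in> \<O>"
    and two_nz: "(2::'k) \<noteq> 0" and half_O: "inverse 2 \<in> \<O>"

section \<open>Operators on a lattice over a complete discrete valuation ring\<close>

locale op_lattice = vector_space scale + complete_dvr \<O> p
  for scale :: "'k::field \<Rightarrow> 'w::ab_group_add \<Rightarrow> 'w" and \<O> :: "'k set" and p +
  fixes S T :: "'w set"
  assumes S_fin: "finite S" and T_gen: "T = {\<Sum>s\<in>S. scale (c s) s | c. \<forall>s\<in>S. c s \<in> \<O>}"
    and T_span: "span T = UNIV" and nontriv: "(UNIV :: 'w set) \<noteq> {0}"
begin

definition sc :: "'k \<Rightarrow> 'w aend" where "sc c = Aend (scale c)"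

lemma sc_app: "sc c \<cdot> v = scale c v"
  unfolding sc_def by (rule app_Aend) (rule scale_right_distrib)

lemma sc_add: "sc (a + b) = sc a + sc b"
  by (rule aend_eqI) (simp add: sc_app scale_left_distrib)

lemma sc_mult: "sc (a * b) = sc a * sc b"
  by (rule aend_eqI) (simp add: sc_app times_app)

lemma sc_1: "sc 1 = 1"
  by (rule aend_eqI) (simp add: sc_app)

lemma sc_0: "sc 0 = 0"
  by (rule aend_eqI) (simp add: sc_app)

lemma sc_minus: "sc (- a) = - sc a"
  by (rule aend_eqI) (simp add: sc_app)

lemma sc_power: "sc (a ^ n) = sc a ^ n"
  by (induction n) (simp_all add: sc_1 sc_mult)

lemma sc_sum: "sc (sum g A) = (\<Sum>a\<in>A. sc (g a))"
  by (induction A rule: infinite_finite_induct) (simp_all add: sc_0 sc_add)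

lemma sc_inj: "sc a = sc b \<Longrightarrow> a = b"
proof -
  assume *: "sc a = sc b"
  obtain v where "v \<noteq> (0::'w)" using nontriv by auto
  then show ?thesis using * by (metis sc_app scale_cancel_right)
qed

lemma one_neq_zero: "(1 :: 'w aend) \<noteq> 0"
  using sc_inj sc_0 sc_1 zero_neq_one by metis

definition lin :: "'w aend set" where "lin = {x. \<forall>c. x * sc c = sc c * x}"

lemma lin_sc: "x \<in> lin \<Longrightarrow> x * sc c = sc c * x"
  by (simp add: lin_def)

lemma lin_ring: "op_ring lin"
proof
  fix x y assume x: "x \<in> lin" and y: "y \<in> lin"
  show "x * y \<in> lin" unfolding lin_def
    by (simp add: mult.assoc lin_sc[OF y]) (simp add: mult.assoc[symmetric] lin_sc[OF x])
qed (auto simp: lin_def distrib_left distrib_right)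

sublocale lin: op_ring lin by (rule lin_ring)

lemma sc_lin: "sc c \<in> lin"
  by (simp add: lin_def sc_mult[symmetric] mult.commute)

definition \<pi> :: "'w aend" where "\<pi> = sc p"
definition \<pi>i :: "'w aend" where "\<pi>i = sc (inverse p)"

lemma pi_lin: "\<pi> \<in> lin" "\<pi>i \<in> lin"
  by (auto simp: \<pi>_def \<pi>i_def sc_lin)

lemma pi_inverse: "\<pi> * \<pi>i = 1" "\<pi>i * \<pi> = 1"
  using p_nz by (auto simp: \<pi>_def \<pi>i_def sc_mult[symmetric] sc_1)

lemma pipow_inverse: "\<pi> ^ n * \<pi>i ^ n = 1" "\<pi>i ^ n * \<pi> ^ n = 1"
  using inverse_power pi_inverse by auto

lemma pipow_sc: "\<pi> ^ n = sc (p ^ n)" "\<pi>i ^ n = sc (inverse p ^ n)"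
  by (auto simp: \<pi>_def \<pi>i_def sc_power)

lemma pi_comm: "x \<in> lin \<Longrightarrow> x * \<pi> ^ n = \<pi> ^ n * x" "x \<in> lin \<Longrightarrow> x * \<pi>i ^ n = \<pi>i ^ n * x"
  by (auto simp: pipow_sc lin_sc)

lemma pi_comm1: "x \<in> lin \<Longrightarrow> x * \<pi> = \<pi> * x" "x \<in> lin \<Longrightarrow> x * \<pi>i = \<pi>i * x"
  using pi_comm[of x 1] by auto

lemma K_valued: "valued_ops (range sc) (sc ` \<O>) \<pi> \<pi>i"
proof
  show "0 \<in> range sc" "1 \<in> range sc" "0 \<in> sc ` \<O>" "1 \<in> sc ` \<O>"
    using sc_0 sc_1 O_0 O_1 by (metis rangeI, metis rangeI, metis image_eqI, metis image_eqI)
  show "\<And>x. x \<in> range sc \<Longrightarrow> x \<noteq> 0 \<Longrightarrow> \<exists>n. \<pi>i ^ n * x \<notin> sc ` \<O>"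
  proof -
    fix x assume "x \<in> range sc" "x \<noteq> 0"
    then obtain a where a: "x = sc a" "a \<noteq> 0" using sc_0 by auto
    then obtain n where "a / p ^ n \<notin> \<O>" using O_separated by blast
    then have "inverse p ^ n * a \<notin> \<O>" by (simp add: field_simps)
    then show "\<exists>n. \<pi>i ^ n * x \<notin> sc ` \<O>" using sc_inj unfolding a pipow_sc sc_mult[symmetric] by blast
  qed
  show "\<And>x. x \<in> sc ` \<O> \<Longrightarrow> \<pi>i * x \<notin> sc ` \<O> \<Longrightarrow> \<exists>y\<in>sc ` \<O>. y * x = 1"
  proof -
    fix x assume "x \<in> sc ` \<O>" and x: "\<pi>i * x \<notin> sc ` \<O>"
    then obtain a where a: "x = sc a" "a \<in> \<O>" by auto
    then have "a / p \<notin> \<O>" using x by (auto simp: \<pi>i_def sc_mult[symmetric] field_simps)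
    then have "inverse a \<in> \<O>" "a \<noteq> 0" using O_unit a(2) O_0 by auto
    then show "\<exists>y\<in>sc ` \<O>. y * x = 1"
      using a by (auto intro!: bexI[of _ "inverse a"] simp: sc_mult[symmetric] sc_1)
  qed
  show "\<And>x. x \<in> range sc \<Longrightarrow> \<exists>n. \<pi> ^ n * x \<in> sc ` \<O>"
    using O_bounded by (fastforce simp: pipow_sc sc_mult[symmetric])
qed (auto simp: \<pi>_def \<pi>i_def sc_mult[symmetric] sc_1[symmetric] p_O p_nz mult.commute O_mult O_add O_uminus
    sc_add[symmetric] sc_minus[symmetric] simp flip: sc_1)

sublocale K: valued_ops "range sc" "sc ` \<O>" \<pi> \<pi>i by (rule K_valued)

lemma T_rspan: "T = rspan (sc ` \<O>) S"
proof
  show "T \<subseteq> rspan (sc ` \<O>) S"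
    unfolding T_gen by (auto simp: sc_app intro!: rspanI[of _ "\<lambda>s. sc (_ s)"])
  show "rspan (sc ` \<O>) S \<subseteq> T"
  proof
    fix w assume "w \<in> rspan (sc ` \<O>) S"
    then obtain r where r: "\<forall>b\<in>S. r b \<in> sc ` \<O>" "w = (\<Sum>b\<in>S. r b \<cdot> b)" by (rule rspanE)
    then have "\<forall>b\<in>S. \<exists>c. c \<in> \<O> \<and> r b = sc c" by auto
    then obtain c where "\<forall>b\<in>S. c b \<in> \<O> \<and> r b = sc (c b)" by (rule bchoice[THEN exE])
    then show "w \<in> T" unfolding T_gen using r by (auto simp: sc_app intro!: exI[of _ c])
  qed
qed

lemma T_add: "v \<in> T \<Longrightarrow> w \<in> T \<Longrightarrow> v + w \<in> T"
  and T_sc: "a \<in> \<O> \<Longrightarrow> v \<in> T \<Longrightarrow> sc a \<cdot> v \<in> T"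
  and T_diff: "v \<in> T \<Longrightarrow> w \<in> T \<Longrightarrow> v - w \<in> T"
  and T_0: "0 \<in> T"
  unfolding T_rspan by (auto intro: K.R.rspan_add K.R.rspan_mult K.R.rspan_0 K.R.rspan_diff)

lemma T_sum: "(\<And>a. a \<in> A \<Longrightarrow> g a \<in> T) \<Longrightarrow> sum g A \<in> T"
  unfolding T_rspan by (rule K.R.rspan_sum)

lemma p_power_O: "p ^ n \<in> \<O>"
  by (induction n) (auto intro: O_1 O_mult p_O)

lemma T_pi: "v \<in> T \<Longrightarrow> \<pi> ^ n \<cdot> v \<in> T" "v \<in> T \<Longrightarrow> \<pi> \<cdot> v \<in> T"
  using T_sc[OF p_O, of v] T_sc[OF p_power_O, of v n] by (auto simp: pipow_sc simp flip: \<pi>_def)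

lemma T_bounded_mono: "\<pi> ^ m \<cdot> v \<in> T \<Longrightarrow> m \<le> n \<Longrightarrow> \<pi> ^ n \<cdot> v \<in> T"
  using T_pi(1)[of "\<pi> ^ m \<cdot> v" "n - m"] by (simp add: times_app[symmetric] power_add[symmetric])

lemma T_bounded: "\<exists>n. \<pi> ^ n \<cdot> v \<in> T"
proof -
  have "v \<in> span T" using T_span by simp
  then show ?thesis
  proof (induction rule: span_induct_alt)
    case base
    then show ?case using T_0 by auto
  next
    case (step c x y)
    obtain m where m: "p ^ m * c \<in> \<O>" using O_bounded by blast
    obtain n where n: "\<pi> ^ n \<cdot> y \<in> T" using step by blast
    have "\<pi> ^ m \<cdot> scale c x = sc (p ^ m * c) \<cdot> x" by (simp add: pipow_sc sc_app)
    then have "\<pi> ^ m \<cdot> scale c x \<in> T" using m T_sc step by simp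
    then have "\<pi> ^ max m n \<cdot> (scale c x + y) \<in> T"
      unfolding app_add using n by (intro T_add) (auto intro: T_bounded_mono)
    then show ?case by blast
  qed
qed

lemma T_bounded_family:
  assumes "finite A"
  shows "\<exists>n. \<forall>a\<in>A. \<pi> ^ n \<cdot> g a \<in> T"
proof -
  have "\<forall>a. \<exists>n. \<pi> ^ n \<cdot> g a \<in> T" using T_bounded by blast
  then obtain N where N: "\<And>a. \<pi> ^ N a \<cdot> g a \<in> T" by metis
  have "\<pi> ^ Max (N ` A) \<cdot> g a \<in> T" if "a \<in> A" for a
    by (rule T_bounded_mono[OF N]) (use that assms in auto)
  then show ?thesis by blast
qed

lemma op_bounded:
  assumes "x \<in> lin"
  shows "\<exists>n. \<forall>t\<in>T. (\<pi> ^ n * x) \<cdot> t \<in> T"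
proof -
  obtain n where n: "\<forall>s\<in>S. \<pi> ^ n \<cdot> x \<cdot> s \<in> T" using T_bounded_family S_fin by blast
  have "(\<pi> ^ n * x) \<cdot> t \<in> T" if t: "t \<in> T" for t
  proof -
    obtain c where c: "\<forall>s\<in>S. c s \<in> \<O>" "t = (\<Sum>s\<in>S. sc (c s) \<cdot> s)" 
      using t unfolding T_gen by (auto simp: sc_app)
    have "(\<pi> ^ n * x) \<cdot> sc a \<cdot> s = sc a \<cdot> \<pi> ^ n \<cdot> x \<cdot> s" for a s
      using assms pi_lin lin_sc by (metis lin.mult_in lin.power_in times_app)
    then have "(\<pi> ^ n * x) \<cdot> t = (\<Sum>s\<in>S. sc (c s) \<cdot> \<pi> ^ n \<cdot> x \<cdot> s)"
      unfolding c app_sum by simp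
    then show ?thesis using c n by (auto intro!: T_sum T_sc)
  qed
  then show ?thesis by blast
qed

text \<open>Linear coordinates on \<open>W\<close> that are integral on \<open>T\<close>, arranged
  so that forgetting the coordinates at vectors outside \<open>M\<close> changes elements of
  \<open>T \<inter> M\<close> only by elements of \<open>\<pi>T\<close>. For \<open>M = UNIV\<close>
  the last clause is empty.\<close>

definition adapted_basis :: "'w set \<Rightarrow> 'w set \<Rightarrow> ('w \<Rightarrow> 'w \<Rightarrow> 'w aend) \<Rightarrow> bool" where
  "adapted_basis M B \<phi> \<longleftrightarrow> finite B \<and> B \<subseteq> T \<and> (\<forall>b\<in>B. \<forall>w. \<phi> b w \<in> range sc) \<and>
     (\<forall>w. w = (\<Sum>b\<in>B. \<phi> b w \<cdot> b)) \<and> (\<forall>b\<in>B. \<forall>v w. \<phi> b (v + w) = \<phi> b v + \<phi> b w) \<and>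
     (\<forall>b\<in>B. \<forall>c w. \<phi> b (sc c \<cdot> w) = sc c * \<phi> b w) \<and>
     (\<forall>b\<in>B. \<forall>t\<in>T. \<phi> b t \<in> sc ` \<O>) \<and>
     (\<forall>b\<in>B - M. \<forall>t\<in>T \<inter> M. \<pi>i * \<phi> b t \<in> sc ` \<O>)"

lemma adapted_basisD:
  assumes "adapted_basis M B \<phi>"
  shows "finite B" "B \<subseteq> T" "\<And>w b. b \<in> B \<Longrightarrow> \<phi> b w \<in> range sc" "\<And>w. w = (\<Sum>b\<in>B. \<phi> b w \<cdot> b)"
    "\<And>b v w. b \<in> B \<Longrightarrow> \<phi> b (v + w) = \<phi> b v + \<phi> b w"
    "\<And>b c w. b \<in> B \<Longrightarrow> \<phi> b (sc c \<cdot> w) = sc c * \<phi> b w"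
    "\<And>b t. b \<in> B \<Longrightarrow> t \<in> T \<Longrightarrow> \<phi> b t \<in> sc ` \<O>"
    "\<And>b t. b \<in> B - M \<Longrightarrow> t \<in> T \<inter> M \<Longrightarrow> \<pi>i * \<phi> b t \<in> sc ` \<O>"
  using assms unfolding adapted_basis_def by (elim conjE; blast)+

lemma adapted_basis:
  obtains B \<phi> where "adapted_basis M B \<phi>"
proof -
  obtain B where B: "finite B" "T = rspan (sc ` \<O>) B" 
    "op_indep (range sc) B"
    "\<forall>r. (\<forall>b\<in>B. r b \<in> sc ` \<O>) \<longrightarrow> (\<Sum>b\<in>B. r b \<cdot> b) \<in> M \<longrightarrow> (\<forall>b\<in>B - M. \<pi>i * r b \<in> sc ` \<O>)"
    by (rule K.minimal_generators[OF S_fin T_rspan, of M])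
  have sp: "rspan (range sc) B = UNIV"
  proof (intro equalityI subsetI UNIV_I)
    fix v :: 'w
    obtain n where "\<pi> ^ n \<cdot> v \<in> T" using T_bounded by blast
    then obtain r where r: "\<forall>b\<in>B. r b \<in> sc ` \<O>" "\<pi> ^ n \<cdot> v = (\<Sum>b\<in>B. r b \<cdot> b)"
      unfolding B(2) by (rule rspanE)
    have "v = \<pi>i ^ n \<cdot> \<pi> ^ n \<cdot> v" by (simp add: times_app[symmetric] pipow_inverse)
    then have "v = (\<Sum>b\<in>B. (\<pi>i ^ n * r b) \<cdot> b)" unfolding r by (simp add: app_sum times_app)
    moreover have "\<pi>i ^ n * r b \<in> range sc" if "b \<in> B" for b
      using r(1) that by (auto simp: pipow_sc sc_mult[symmetric])
    ultimately show "v \<in> rspan (range sc) B" by (intro rspanI[of _ "\<lambda>b. \<pi>i ^ n * r b"]) auto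
  qed
  obtain \<phi> where "coords (range sc) B \<phi>" by (rule K.D.coords_exist[OF sp B(3)])
  note \<phi> = coordsD[OF this]
  have int: "\<phi> b t \<in> sc ` \<O>" if "b \<in> B" "t \<in> T" for b t
  proof -
    obtain r where r: "\<forall>b\<in>B. r b \<in> sc ` \<O>" "t = (\<Sum>b\<in>B. r b \<cdot> b)"
      using \<open>t \<in> T\<close> unfolding B(2) by (rule rspanE)
    then have "\<phi> b t = r b" using \<phi>(3)[of r t b] that by auto
    then show ?thesis using r that by simp
  qed
  have "\<pi>i * \<phi> b t \<in> sc ` \<O>" if "b \<in> B - M" "t \<in> T \<inter> M" for b t
    using B(4)[THEN spec[of _ "\<lambda>b. \<phi> b t"]] that int \<phi>(2)[of t] by auto
  moreover have "B \<subseteq> T" using B(1,2) K.R.rspan_superset by auto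
  ultimately have "adapted_basis M B \<phi>" unfolding adapted_basis_def using \<phi>(2)
    by (intro conjI ballI allI B(1) \<phi>(1,4) int) (auto simp: \<phi>(5))
  then show ?thesis by (rule that)
qed

lemma T_separated:
  assumes "v \<noteq> 0"
  shows "\<exists>n. \<pi>i ^ n \<cdot> v \<notin> T"
proof -
  obtain B \<phi> where "adapted_basis UNIV B \<phi>" by (rule adapted_basis)
  note B = adapted_basisD[OF this]
  obtain b where b: "b \<in> B" "\<phi> b v \<noteq> 0" 
    
  proof (rule ccontr)
    assume "\<not> thesis"
    then have "\<forall>b\<in>B. \<phi> b v = 0" using that by blast
    then have "(\<Sum>b\<in>B. \<phi> b v \<cdot> b) = 0" by simp
    then show False using trans[OF B(4)[of v]] assms by simp
  qed
  then obtain n where "\<pi>i ^ n * \<phi> b v \<notin> sc ` \<O>" 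
    using K.separated[OF B(3)[OF b(1)] b(2)] by (elim exE)
  then have "\<phi> b (\<pi>i ^ n \<cdot> v) \<notin> sc ` \<O>" using B(6) b by (simp add: pipow_sc)
  then show ?thesis using B(7) b by blast
qed

lemma T_complete:
  assumes "\<And>j::nat. t j \<in> T"
  shows "\<exists>x\<in>T. \<forall>n. \<pi>i ^ n \<cdot> (x - (\<Sum>j<n. \<pi> ^ j \<cdot> t j)) \<in> T"
proof -
  have "\<forall>j. \<exists>c. (\<forall>s\<in>S. c s \<in> \<O>) \<and> t j = (\<Sum>s\<in>S. scale (c s) s)"
    using assms unfolding T_gen by blast
  then obtain c where c': "\<forall>j. (\<forall>s\<in>S. c j s \<in> \<O>) \<and> t j = (\<Sum>s\<in>S. scale (c j s) s)"
    using choice[of "\<lambda>j c. (\<forall>s\<in>S. c s \<in> \<O>) \<and> t j = (\<Sum>s\<in>S. scale (c s) s)"] by auto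
  then have c: "\<And>j s. s \<in> S \<Longrightarrow> c j s \<in> \<O>" "\<And>j. t j = (\<Sum>s\<in>S. scale (c j s) s)" by simp_all
  have "\<forall>s\<in>S. \<exists>x\<in>\<O>. \<forall>n. (x - (\<Sum>j<n. p ^ j * c j s)) / p ^ n \<in> \<O>"
    by (intro ballI O_complete c)
  then obtain y where y: "\<And>s. s \<in> S \<Longrightarrow> y s \<in> \<O>"
    "\<And>s n. s \<in> S \<Longrightarrow> (y s - (\<Sum>j<n. p ^ j * c j s)) / p ^ n \<in> \<O>" by metis
  show ?thesis
  proof (intro bexI[of _ "\<Sum>s\<in>S. scale (y s) s"] allI)
    fix n
    have "(\<Sum>j<n. \<pi> ^ j \<cdot> t j) = (\<Sum>s\<in>S. scale (\<Sum>j<n. p ^ j * c j s) s)"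
      unfolding c pipow_sc sc_app scale_sum_right scale_sum_left scale_scale by (rule sum.swap)
    then have "\<pi>i ^ n \<cdot> ((\<Sum>s\<in>S. scale (y s) s) - (\<Sum>j<n. \<pi> ^ j \<cdot> t j)) =
      (\<Sum>s\<in>S. scale ((y s - (\<Sum>j<n. p ^ j * c j s)) / p ^ n) s)"
      unfolding pipow_sc sc_app
      by (simp only: sum_subtractf[symmetric] scale_left_diff_distrib[symmetric] scale_sum_right
          scale_scale divide_inverse power_inverse mult.commute)
    moreover have "(\<Sum>s\<in>S. scale ((y s - (\<Sum>j<n. p ^ j * c j s)) / p ^ n) s) \<in> T"
      unfolding T_gen using y by (intro CollectI exI[of _ "\<lambda>s. (y s - (\<Sum>j<n. p ^ j * c j s)) / p ^ n"]) auto
    ultimately show "\<pi>i ^ n \<cdot> ((\<Sum>s\<in>S. scale (y s) s) - (\<Sum>j<n. \<pi> ^ j \<cdot> t j)) \<in> T"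
      by simp
  qed (use y in \<open>auto simp: T_gen\<close>)
qed

text \<open>The limit is obtained by prescribing its values on a basis of \<open>T\<close>.\<close>

lemma op_complete:
  assumes r: "\<And>j::nat. r j \<in> lin" "\<And>j t. t \<in> T \<Longrightarrow> r j \<cdot> t \<in> T"
  obtains x where "x \<in> lin" "\<And>n t. t \<in> T \<Longrightarrow> (\<pi>i ^ n * (x - (\<Sum>j<n. \<pi> ^ j * r j))) \<cdot> t \<in> T"
proof -
  obtain B \<phi> where "adapted_basis UNIV B \<phi>" by (rule adapted_basis)
  note B = adapted_basisD[OF this]
  have "\<forall>b\<in>B. \<exists>y\<in>T. \<forall>n. \<pi>i ^ n \<cdot> (y - (\<Sum>j<n. \<pi> ^ j \<cdot> r j \<cdot> b)) \<in> T"
    using r B(2) by (intro ballI T_complete) auto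
  then obtain y where y: "\<And>b n. b \<in> B \<Longrightarrow> \<pi>i ^ n \<cdot> (y b - (\<Sum>j<n. \<pi> ^ j \<cdot> r j \<cdot> b)) \<in> T"
    using bchoice[of B "\<lambda>b y. y \<in> T \<and> (\<forall>n. \<pi>i ^ n \<cdot> (y - (\<Sum>j<n. \<pi> ^ j \<cdot> r j \<cdot> b)) \<in> T)"] by blast
  define x where "x = Aend (\<lambda>w. \<Sum>b\<in>B. \<phi> b w \<cdot> y b)"
  have x: "x \<cdot> w = (\<Sum>b\<in>B. \<phi> b w \<cdot> y b)" for w
    unfolding x_def by (rule app_Aend) (simp add: B sum.distrib)
  show ?thesis
  proof (rule that[of x])
    show "x \<in> lin" unfolding lin_def
      by (auto intro!: aend_eqI simp: times_app x B app_sum)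
    fix n t assume t: "t \<in> T"
    define z where "z = \<pi>i ^ n * (\<Sum>j<n. \<pi> ^ j * r j)"
    have "z \<in> lin" unfolding z_def using r pi_lin by auto
    then have zsc: "z \<cdot> sc a \<cdot> v = sc a \<cdot> z \<cdot> v" for a v using lin_sc by (metis times_app)
    have z: "z \<cdot> t = (\<Sum>b\<in>B. \<phi> b t \<cdot> z \<cdot> b)" 
    proof -
      have "z \<cdot> t = (\<Sum>b\<in>B. z \<cdot> \<phi> b t \<cdot> b)" by (subst B(4)[of t]) (simp add: app_sum)
      also have "\<dots> = (\<Sum>b\<in>B. \<phi> b t \<cdot> z \<cdot> b)"
      proof (rule sum.cong[OF refl])
        fix b assume "b \<in> B"
        then obtain a where "\<phi> b t = sc a" using B(3) by blast
        then show "z \<cdot> \<phi> b t \<cdot> b = \<phi> b t \<cdot> z \<cdot> b" using zsc by simp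
      qed
      finally show ?thesis .
    qed
    have px: "\<pi>i ^ n \<cdot> \<phi> b t \<cdot> v = \<phi> b t \<cdot> \<pi>i ^ n \<cdot> v" if "b \<in> B" for b v
      using B(3)[OF that, of t] by (auto simp: pipow_sc sc_app mult.commute)
    have "(\<pi>i ^ n * (x - (\<Sum>j<n. \<pi> ^ j * r j))) \<cdot> t = \<pi>i ^ n \<cdot> x \<cdot> t - z \<cdot> t"
      by (simp add: z_def algebra_simps times_app)
    also have "\<dots> = (\<Sum>b\<in>B. \<phi> b t \<cdot> (\<pi>i ^ n \<cdot> y b - z \<cdot> b))"
      unfolding z x app_sum sum_subtractf[symmetric] app_diff using px by simp
    also have "\<dots> = (\<Sum>b\<in>B. \<phi> b t \<cdot> \<pi>i ^ n \<cdot> (y b - (\<Sum>j<n. \<pi> ^ j \<cdot> r j \<cdot> b)))"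
      by (simp add: z_def times_app sum_app)
    also have "\<dots> \<in> T"
    proof (rule T_sum)
      fix b assume b: "b \<in> B"
      then obtain a where "\<phi> b t = sc a" "a \<in> \<O>" using B(7) t by blast
      then show "\<phi> b t \<cdot> \<pi>i ^ n \<cdot> (y b - (\<Sum>j<n. \<pi> ^ j \<cdot> r j \<cdot> b)) \<in> T"
        using T_sc[OF _ y[OF b, of n]] by simp
    qed
    finally show "(\<pi>i ^ n * (x - (\<Sum>j<n. \<pi> ^ j * r j))) \<cdot> t \<in> T" .
  qed
qed

lemma op_eq_0:
  assumes "x \<in> lin" "\<And>n t. t \<in> T \<Longrightarrow> (\<pi>i ^ n * x) \<cdot> t \<in> T"
  shows "x = 0"
proof (rule aend_eqI)
  fix v :: 'w
  obtain n where n: "\<pi> ^ n \<cdot> v \<in> T" using T_bounded by blast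
  have "x \<cdot> \<pi> ^ n \<cdot> v = 0"
    using assms(2)[OF n] T_separated by (metis times_app)
  then have "\<pi>i ^ n \<cdot> \<pi> ^ n \<cdot> x \<cdot> v = 0" using pi_comm[OF assms(1)] by (metis app_0 times_app)
  then show "x \<cdot> v = 0 \<cdot> v" by (simp add: times_app[symmetric] mult.assoc[symmetric] pipow_inverse)
qed

end

section \<open>The commutant of a representation on a lattice\<close>

locale lattice_rep = op_lattice scale \<O> p S T + Hg: group Hg
  for scale :: "'k::field \<Rightarrow> 'w::ab_group_add \<Rightarrow> 'w" and \<O> :: "'k set" and p S T
    and Hg :: "('g, 'm) monoid_scheme" +
  fixes \<rho> :: "'g \<Rightarrow> 'w aend"
  assumes H_fin: "finite (carrier Hg)"
    and H_unit: "of_nat (card (carrier Hg)) \<noteq> (0::'k)" "inverse (of_nat (card (carrier Hg))) \<in> \<O>"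
    and rho_mult: "\<And>g h. g \<in> carrier Hg \<Longrightarrow> h \<in> carrier Hg \<Longrightarrow> \<rho> (g \<otimes>\<^bsub>Hg\<^esub> h) = \<rho> g * \<rho> h"
    and rho_one: "\<rho> \<one>\<^bsub>Hg\<^esub> = 1"
    and rho_lin: "\<And>h. h \<in> carrier Hg \<Longrightarrow> \<rho> h \<in> lin"
    and rho_T: "\<And>h t. h \<in> carrier Hg \<Longrightarrow> t \<in> T \<Longrightarrow> \<rho> h \<cdot> t \<in> T"
begin

definition E :: "'w aend set" where "E = {x \<in> lin. \<forall>h\<in>carrier Hg. x * \<rho> h = \<rho> h * x}"
definition R :: "'w aend set" where "R = {x \<in> E. \<forall>t\<in>T. x \<cdot> t \<in> T}"

lemma E_lin: "x \<in> E \<Longrightarrow> x \<in> lin" by (simp add: E_def)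
lemma E_rho: "x \<in> E \<Longrightarrow> h \<in> carrier Hg \<Longrightarrow> x * \<rho> h = \<rho> h * x" by (simp add: E_def)
lemma R_E: "x \<in> R \<Longrightarrow> x \<in> E" by (simp add: R_def)
lemma R_T: "x \<in> R \<Longrightarrow> t \<in> T \<Longrightarrow> x \<cdot> t \<in> T" by (simp add: R_def)

lemma E_ring: "op_ring E"
proof
  fix x y assume x: "x \<in> E" and y: "y \<in> E"
  have "x * y * \<rho> h = \<rho> h * (x * y)" if "h \<in> carrier Hg" for h
    by (simp add: mult.assoc E_rho[OF y that]) (simp add: mult.assoc[symmetric] E_rho[OF x that])
  then show "x * y \<in> E" using x y by (auto simp: E_def)
qed (auto simp: E_def distrib_left distrib_right)

sublocale E: op_ring E by (rule E_ring)

lemma R_ring: "op_ring R"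
  by standard (auto simp: R_def T_0 T_add times_app intro: T_diff[OF T_0, simplified])

sublocale R: op_ring R by (rule R_ring)

lemma sc_E: "sc c \<in> E"
  using rho_lin by (auto simp: E_def sc_lin lin_sc)

lemma sc_R: "c \<in> \<O> \<Longrightarrow> sc c \<in> R"
  by (simp add: R_def sc_E T_sc)

lemma pi_E: "\<pi> \<in> E" "\<pi>i \<in> E"
  by (auto simp: \<pi>_def \<pi>i_def sc_E)

lemma pi_R: "\<pi> \<in> R"
  by (simp add: \<pi>_def sc_R p_O)

lemma R_pi_mult:
  assumes "\<pi>i ^ m * x \<in> R" "n \<le> m"
  shows "\<pi>i ^ n * x \<in> R"
proof -
  have "\<pi>i ^ m * x = \<pi>i ^ (m - n) * (\<pi>i ^ n * x)"
    using assms(2) by (simp add: mult.assoc[symmetric] power_add[symmetric])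
  then have "\<pi> ^ (m - n) * (\<pi>i ^ m * x) = \<pi>i ^ n * x"
    by (simp add: mult.assoc[symmetric] pipow_inverse)
  then show ?thesis using R.mult_in[OF R.power_in[OF pi_R, of "m - n"] assms(1)] by simp
qed

text \<open>Membership in \<open>\<pi> ^ n R\<close>. It takes the place of a valuation because at
  this stage \<open>E\<close> is not known to be a field, nor \<open>R\<close> a valuation
  ring.\<close>

definition ord_ge :: "nat \<Rightarrow> 'w aend \<Rightarrow> bool" where "ord_ge n x \<longleftrightarrow> \<pi>i ^ n * x \<in> R"

lemma ord_ge_E: "ord_ge n x \<Longrightarrow> x \<in> E"
  unfolding ord_ge_def using E.mult_in[OF E.power_in[OF pi_E(1), of n], of "\<pi>i ^ n * x"] R_E
  by (simp add: mult.assoc[symmetric] pipow_inverse)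

lemma ord_ge_add: "ord_ge n x \<Longrightarrow> ord_ge n y \<Longrightarrow> ord_ge n (x + y)"
  and ord_ge_diff: "ord_ge n x \<Longrightarrow> ord_ge n y \<Longrightarrow> ord_ge n (x - y)"
  and ord_ge_uminus: "ord_ge n x \<Longrightarrow> ord_ge n (- x)"
  using R.uminus_in by (auto simp: ord_ge_def distrib_left right_diff_distrib)

lemma ord_ge_mult: "ord_ge m x \<Longrightarrow> ord_ge n y \<Longrightarrow> ord_ge (m + n) (x * y)"
proof -
  assume *: "ord_ge m x" "ord_ge n y"
  have "\<pi>i ^ (m + n) * (x * y) = \<pi>i ^ m * (\<pi>i ^ n * x) * y"
    by (simp add: power_add mult.assoc)
  also have "\<dots> = (\<pi>i ^ m * x) * (\<pi>i ^ n * y)"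
    by (simp only: pi_comm(2)[OF E_lin[OF ord_ge_E[OF *(1)]], of n, symmetric] mult.assoc)
  finally show ?thesis using * by (auto simp: ord_ge_def)
qed

lemma ord_ge_mono: "ord_ge m x \<Longrightarrow> n \<le> m \<Longrightarrow> ord_ge n x"
  unfolding ord_ge_def by (rule R_pi_mult)

lemma ord_ge_0: "ord_ge 0 x \<longleftrightarrow> x \<in> R"
  by (simp add: ord_ge_def)

lemma ord_ge_pi: "ord_ge (Suc 0) \<pi>"
  by (simp add: ord_ge_def pi_inverse)

lemma ord_ge_multR: "ord_ge n x \<Longrightarrow> y \<in> R \<Longrightarrow> ord_ge n (x * y)"
  "ord_ge n x \<Longrightarrow> y \<in> R \<Longrightarrow> ord_ge n (y * x)"
  using ord_ge_mult[of n x 0 y] ord_ge_mult[of 0 y n x] by (auto simp: ord_ge_0)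

lemma ord_ge_R: "ord_ge n x \<Longrightarrow> x \<in> R"
  using ord_ge_mono[of n x 0] by (simp add: ord_ge_0)

lemma ord_ge_all: "x = 0" if *: "\<And>n. ord_ge n x"
proof (rule op_eq_0)
  show "x \<in> lin" using ord_ge_E[OF *] E_lin by blast
  show "\<And>n t. t \<in> T \<Longrightarrow> (\<pi>i ^ n * x) \<cdot> t \<in> T" using * by (simp add: ord_ge_def R_def)
qed

text \<open>The limit from \<open>op_complete\<close> is only known to be linear. Its commutator
  with \<open>\<rho> h\<close> agrees modulo every \<open>\<pi> ^ n\<close> with that of a partial
  sum, which is 0, so it vanishes by \<open>op_eq_0\<close>.\<close>

lemma R_complete:
  assumes "\<And>j::nat. r j \<in> R"
  obtains x where "x \<in> R" "\<And>n. ord_ge n (x - (\<Sum>j<n. \<pi> ^ j * r j))"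
proof -
  obtain x where x: "x \<in> lin" "\<And>n t. t \<in> T \<Longrightarrow> (\<pi>i ^ n * (x - (\<Sum>j<n. \<pi> ^ j * r j))) \<cdot> t \<in> T"
    using op_complete[of r] assms by (auto simp: R_def E_def)
  define s where "s n = (\<Sum>j<n. \<pi> ^ j * r j)" for n
  have s: "s n \<in> R" for n unfolding s_def using assms pi_R by auto
  have "x * \<rho> h = \<rho> h * x" if h: "h \<in> carrier Hg" for h
  proof -
    have "x * \<rho> h - \<rho> h * x = 0"
    proof (rule op_eq_0)
      show "x * \<rho> h - \<rho> h * x \<in> lin"
        by (intro lin.diff_in lin.mult_in rho_lin x(1) h)
      fix n t assume t: "t \<in> T"
      have c1: "s n * \<rho> h = \<rho> h * s n" using s h R_E E_rho by auto
      have c2: "\<pi>i ^ n * \<rho> h = \<rho> h * \<pi>i ^ n" using pi_comm(2) rho_lin h by auto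
      have "\<pi>i ^ n * s n * \<rho> h = \<rho> h * (\<pi>i ^ n * s n)" 
        by (simp only: mult.assoc c1) (simp only: mult.assoc[symmetric] c2)
      then have eq: "\<pi>i ^ n * (x * \<rho> h - \<rho> h * x) = \<pi>i ^ n * (x - s n) * \<rho> h - \<rho> h * (\<pi>i ^ n * (x - s n))"
        by (simp add: left_diff_distrib right_diff_distrib mult.assoc[symmetric] c2)
      have Tn: "(\<pi>i ^ n * (x - s n)) \<cdot> v \<in> T" if "v \<in> T" for v
        using x(2)[OF that, of n] by (simp only: s_def)
      show "(\<pi>i ^ n * (x * \<rho> h - \<rho> h * x)) \<cdot> t \<in> T"
        unfolding eq minus_app times_app[of _ "\<rho> h"] times_app[of "\<rho> h"] by (intro T_diff rho_T h t Tn)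
    qed
    then show ?thesis by simp
  qed
  then have xE: "x \<in> E" using x by (simp add: E_def)
  have o: "ord_ge n (x - s n)" for n
  proof -
    have "\<pi>i ^ n * (x - s n) \<in> E" by (intro E.mult_in E.power_in E.diff_in pi_E xE R_E s)
    then show ?thesis unfolding ord_ge_def R_def using x(2) by (simp add: s_def)
  qed
  show ?thesis
  proof (rule that[of x])
    show "x \<in> R" using o[of 0] by (simp add: s_def ord_ge_0)
    show "ord_ge n (x - (\<Sum>j<n. \<pi> ^ j * r j))" for n using o by (simp add: s_def)
  qed
qed

end

section \<open>Hensel's lemma and idempotents modulo \<pi> in the commutant\<close>

locale lattice_rep_field = lattice_rep scale \<O> p S T Hg \<rho>
  for scale :: "'k::field \<Rightarrow> 'w::ab_group_add \<Rightarrow> 'w" and \<O> :: "'k set" and p S T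
    and Hg :: "('g, 'm) monoid_scheme" and \<rho> :: "'g \<Rightarrow> 'w aend" +
  assumes E_comm: "x \<in> E \<Longrightarrow> y \<in> E \<Longrightarrow> x * y = y * x"
    and E_inv: "x \<in> E \<Longrightarrow> x \<noteq> 0 \<Longrightarrow> \<exists>y\<in>E. y * x = 1"
begin

lemma E_nz_div: "x \<in> E \<Longrightarrow> y \<in> E \<Longrightarrow> x * y = 0 \<Longrightarrow> x = 0 \<or> y = 0"
proof -
  assume *: "x \<in> E" "y \<in> E" "x * y = 0"
  have "y = 0" if nz: "x \<noteq> 0"
  proof -
    obtain x' where "x' * x = 1" using E_inv[OF *(1) nz] by blast
    then have "y = x' * (x * y)" by (simp add: mult.assoc[symmetric])
    then show ?thesis using *(3) by simp
  qed
  then show ?thesis by blast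
qed

text \<open>Newton's iteration, with the derivative replaced by its residue 2.\<close>

lemma R_sqrt:
  assumes z: "z \<in> R"
  obtains s where "s \<in> R" "s * s = 1 + \<pi> * z" "ord_ge 1 (s - 1)"
proof -
  define half where "half = sc (inverse 2)"
  have half: "half \<in> R" "half + half = 1"
    using half_O two_nz by (auto simp: half_def sc_R sc_add[symmetric] sc_1[symmetric] field_simps)
  define y where "y = 1 + \<pi> * z"
  have yR: "y \<in> R" unfolding y_def using z pi_R by auto
  define s where "s = rec_nat 1 (\<lambda>_ s. s + half * (y - s * s))"
  have s0: "s 0 = 1" and sS: "s (Suc n) = s n + half * (y - s n * s n)" for n
    by (simp_all add: s_def)
  have inv: "ord_ge 1 (s n - 1) \<and> ord_ge (Suc n) (y - s n * s n)" for n
  proof (induction n)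
    case 0
    then show ?case using ord_ge_multR(1)[OF ord_ge_pi z] pi_R
      by (simp add: s0 y_def ord_ge_def)
  next
    case (Suc n)
    define d where "d = y - s n * s n"
    have d: "ord_ge (Suc n) d" using Suc by (simp add: d_def)
    have sR: "s n \<in> R" using Suc ord_ge_R R.add_in[OF _ R.one_in, of "s n - 1"] by auto
    have comm: "half * d = d * half" "s n * d = d * s n" "s n * half = half * s n"
      using E_comm R_E sR half ord_ge_R[OF d] by auto
    have "s n * (half * d) + half * d * s n = (half + half) * (s n * d)"
      by (simp only: distrib_right mult.assoc comm(2)[symmetric])
         (simp only: mult.assoc[symmetric] comm(3))
    \<comment> \<open>The new error is a combination of \<open>(s n - 1) * d\<close> and the square
      of \<open>half * d\<close>. Each gains at least one power of \<pi> over \<open>d\<close>, the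
      first because \<open>s n\<close> is 1 modulo \<pi>.\<close>
    then have "y - s (Suc n) * s (Suc n) = d - s n * d - half * d * (half * d)"
      using half(2) by (simp add: sS d_def[symmetric] distrib_left distrib_right)
        (simp add: d_def algebra_simps)
    also have "\<dots> = - ((s n - 1) * d) - half * d * (half * d)" by (simp add: algebra_simps)
    finally have eq: "y - s (Suc n) * s (Suc n) = - ((s n - 1) * d) - half * d * (half * d)" .
    have hd: "ord_ge (Suc n) (half * d)" using ord_ge_multR(2) d half by blast
    have "ord_ge (Suc (Suc n)) ((s n - 1) * d)"
      using ord_ge_mult[of 1 "s n - 1" "Suc n" d] Suc d by simp
    moreover have "ord_ge (Suc (Suc n)) (half * d * (half * d))"
      by (rule ord_ge_mono[OF ord_ge_mult[OF hd hd]]) simp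
    ultimately have "ord_ge (Suc (Suc n)) (y - s (Suc n) * s (Suc n))"
      unfolding eq by (intro ord_ge_diff ord_ge_uminus)
    moreover have "ord_ge 1 (s (Suc n) - 1)"
    proof -
      have "s (Suc n) - 1 = (s n - 1) + half * d" by (simp add: sS d_def)
      moreover have "ord_ge 1 \<dots>"
        by (rule ord_ge_add) (use Suc ord_ge_mono[OF hd, of 1] in auto)
      ultimately show ?thesis by (simp only:)
    qed
    ultimately show ?case by blast
  qed
  \<comment> \<open>Increment j is divisible by \<open>\<pi> ^ Suc j\<close>, so
    \<open>s n = 1 + \<pi> * (\<Sum>j<n. \<pi> ^ j * r j)\<close>, and the iteration becomes a
    series to which \<open>R_complete\<close> applies.\<close>
  define r where "r j = \<pi>i ^ Suc j * (s (Suc j) - s j)" for j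
  have rR: "r j \<in> R" for j
  proof -
    have "ord_ge (Suc j) (half * (y - s j * s j))" using ord_ge_multR(2) inv half by blast
    then show ?thesis by (simp add: r_def sS ord_ge_def)
  qed
  have pr: "\<pi> * (\<pi> ^ j * r j) = s (Suc j) - s j" for j
    unfolding r_def by (simp only: mult.assoc[symmetric] power_Suc[symmetric] pipow_inverse mult_1)
  obtain x where x: "x \<in> R" "\<And>n. ord_ge n (x - (\<Sum>j<n. \<pi> ^ j * r j))"
    using R_complete[of r] rR by blast
  have sn: "\<pi> * (\<Sum>j<n. \<pi> ^ j * r j) = s n - 1" for n
    by (induction n) (simp_all add: s0 distrib_left pr)
  have lim: "ord_ge (Suc n) (1 + \<pi> * x - s n)" for n
  proof -
    have "1 + \<pi> * x - s n = \<pi> * (x - (\<Sum>j<n. \<pi> ^ j * r j))"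
      unfolding right_diff_distrib sn by simp
    then show ?thesis using ord_ge_mult[OF ord_ge_pi x(2), of n] by simp
  qed
  define t where "t = 1 + \<pi> * x"
  have tR: "t \<in> R" unfolding t_def using x pi_R by auto
  have sR: "s n \<in> R" for n using inv[of n] ord_ge_R R.add_in[OF _ R.one_in, of "s n - 1"] by auto
  have "ord_ge n (t * t - y)" for n
  proof -
    have eq: "t * t - y = (t - s n) * t + s n * (t - s n) - (y - s n * s n)" by (simp add: algebra_simps)
    have "ord_ge (Suc n) ((t - s n) * t + s n * (t - s n) - (y - s n * s n))"
      using lim[of n] inv[of n] unfolding t_def[symmetric]
      by (intro ord_ge_diff[OF ord_ge_add[OF ord_ge_multR(1)[OF _ tR] ord_ge_multR(2)[OF _ sR]]]) auto
    then show ?thesis unfolding eq by (rule ord_ge_mono) simp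
  qed
  then have "t * t - y = 0" by (rule ord_ge_all)
  show ?thesis
  proof (rule that[OF tR])
    show "t * t = 1 + \<pi> * z" using \<open>t * t - y = 0\<close> by (simp add: y_def)
    show "ord_ge 1 (t - 1)" using ord_ge_multR(1)[OF ord_ge_pi x(1)] by (simp add: t_def)
  qed
qed

text \<open>As \<open>(2x - 1)\<^sup>2\<close> is 1 modulo \<open>\<pi>\<close>, it is the square of some \<open>s\<close> that is 1 modulo \<open>\<pi>\<close>, and
  \<open>2x - 1\<close> is \<open>s\<close> or \<open>-s\<close> because \<open>E\<close> is a field.\<close>

lemma R_idempotent:
  assumes x: "x \<in> R" and i: "ord_ge 1 (x * x - x)"
  shows "ord_ge 1 x \<or> ord_ge 1 (1 - x)"
proof -
  define half where "half = sc (inverse 2)"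
  have half: "half \<in> R" "half + half = 1" 
    using half_O two_nz by (auto simp: half_def sc_R sc_add[symmetric] sc_1[symmetric] field_simps)
  define z where "z = \<pi>i * (x * x - x)"
  have z: "z \<in> R" using i by (simp add: z_def ord_ge_def)
  have pz: "\<pi> * z = x * x - x" by (simp add: z_def mult.assoc[symmetric] pi_inverse)
  have "z + z + (z + z) \<in> R" using z by auto
  then obtain s where s: "s \<in> R" "s * s = 1 + \<pi> * (z + z + (z + z))" "ord_ge 1 (s - 1)"
    by (rule R_sqrt)
  define w where "w = x + x - 1"
  have wR: "w \<in> R" using x by (auto simp: w_def)
  have "w * w = s * s" unfolding s(2) w_def distrib_left pz by (simp add: algebra_simps)
  then have "(s - w) * (s + w) = 0"
    using E_comm[of s w] s(1) wR R_E by (simp add: algebra_simps)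
  moreover have "s - w \<in> E" "s + w \<in> E" using s(1) wR by (auto intro: R_E)
  ultimately consider "s = w" | "s = - w" using E_nz_div[of "s - w" "s + w"] by (auto simp: eq_neg_iff_add_eq_0)
  then show ?thesis
  proof cases
    case 1
    have "half * (s - 1) = - ((half + half) * (1 - x))"
      unfolding 1 w_def distrib_right by (simp add: algebra_simps)
    then have "1 - x = - (half * (s - 1))" using half(2) by simp
    then show ?thesis using ord_ge_uminus[OF ord_ge_multR(2)[OF s(3) half(1)]] by simp
  next
    case 2
    have "half * (s - 1) = - ((half + half) * x)"
      unfolding 2 w_def distrib_right by (simp add: algebra_simps)
    then have "x = - (half * (s - 1))" using half(2) by simp
    then show ?thesis using ord_ge_uminus[OF ord_ge_multR(2)[OF s(3) half(1)]] by simp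
  qed
qed

end

section \<open>Averaging over the group\<close>

context lattice_rep
begin

text \<open>Maschke's averaging. The order of the group is a unit of \<open>\<O>\<close>, so
  integrality and congruences survive it.\<close>

definition avg :: "'w aend \<Rightarrow> 'w aend" where
  "avg x = sc (inverse (of_nat (card (carrier Hg)))) *
     (\<Sum>h\<in>carrier Hg. \<rho> h * x * \<rho> (inv\<^bsub>Hg\<^esub> h))"

lemma rho_inv: "h \<in> carrier Hg \<Longrightarrow> \<rho> (inv\<^bsub>Hg\<^esub> h) * \<rho> h = 1"
  "h \<in> carrier Hg \<Longrightarrow> \<rho> h * \<rho> (inv\<^bsub>Hg\<^esub> h) = 1"
  by (simp_all add: rho_mult[symmetric] rho_one)

lemma avg_E:
  assumes x: "x \<in> lin"
  shows "avg x \<in> E"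
proof -
  define s where "s = (\<Sum>h\<in>carrier Hg. \<rho> h * x * \<rho> (inv\<^bsub>Hg\<^esub> h))"
  have "\<rho> h * x * \<rho> (inv\<^bsub>Hg\<^esub> h) \<in> lin" if "h \<in> carrier Hg" for h
    by (intro lin.mult_in rho_lin x that Hg.inv_closed)
  then have "s \<in> lin" unfolding s_def by (rule lin.sum_in)
  moreover have "s * \<rho> g = \<rho> g * s" if g: "g \<in> carrier Hg" for g
  proof -
    have "\<rho> g * s = (\<Sum>h\<in>carrier Hg. \<rho> (g \<otimes>\<^bsub>Hg\<^esub> h) * x * \<rho> (inv\<^bsub>Hg\<^esub> (g \<otimes>\<^bsub>Hg\<^esub> h)) * \<rho> g)"
      unfolding s_def sum_distrib_left
    proof (rule sum.cong[OF refl])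
      fix h assume h: "h \<in> carrier Hg"
      have "\<rho> (inv\<^bsub>Hg\<^esub> (g \<otimes>\<^bsub>Hg\<^esub> h)) * \<rho> g = \<rho> (inv\<^bsub>Hg\<^esub> h)"
        using g h by (simp add: rho_mult[symmetric] Hg.inv_mult_group Hg.m_assoc)
      then show "\<rho> g * (\<rho> h * x * \<rho> (inv\<^bsub>Hg\<^esub> h)) =
        \<rho> (g \<otimes>\<^bsub>Hg\<^esub> h) * x * \<rho> (inv\<^bsub>Hg\<^esub> (g \<otimes>\<^bsub>Hg\<^esub> h)) * \<rho> g"
        using g h by (simp add: rho_mult mult.assoc)
    qed
    also have "\<dots> = (\<Sum>h\<in>carrier Hg. \<rho> h * x * \<rho> (inv\<^bsub>Hg\<^esub> h) * \<rho> g)"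
      by (rule sum.reindex_bij_witness[of _ "\<lambda>h. inv\<^bsub>Hg\<^esub> g \<otimes>\<^bsub>Hg\<^esub> h" "\<lambda>h. g \<otimes>\<^bsub>Hg\<^esub> h"])
        (use g in \<open>auto simp: Hg.m_assoc[symmetric]\<close>)
    also have "\<dots> = s * \<rho> g" by (simp add: s_def sum_distrib_right)
    finally show ?thesis by simp
  qed
  ultimately have "s \<in> E" by (simp add: E_def)
  then show ?thesis unfolding avg_def s_def[symmetric] by (intro E.mult_in sc_E)
qed

lemma avg_app:
  "avg x \<cdot> v = sc (inverse (of_nat (card (carrier Hg)))) \<cdot>
     (\<Sum>h\<in>carrier Hg. \<rho> h \<cdot> x \<cdot> \<rho> (inv\<^bsub>Hg\<^esub> h) \<cdot> v)"
  by (simp add: avg_def times_app sum_app)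

lemma avg_const: "sc (inverse (of_nat (card (carrier Hg)))) \<cdot> (\<Sum>h\<in>carrier Hg. v) = v"
proof -
  have "(\<Sum>h\<in>carrier Hg. v) = scale (\<Sum>h\<in>carrier Hg. 1) v"
    unfolding scale_sum_left by simp
  then show ?thesis using H_unit(1) by (simp add: sc_app)
qed

text \<open>Source and target are separate because the lemma is applied to congruences: with target
  \<open>\<pi>T\<close> it says that averaging preserves vanishing modulo \<pi>.\<close>

lemma avg_stable:
  assumes M: "\<And>a v. a \<in> \<O> \<Longrightarrow> v \<in> M \<Longrightarrow> sc a \<cdot> v \<in> M" "\<And>u v. u \<in> M \<Longrightarrow> v \<in> M \<Longrightarrow> u + v \<in> M" "0 \<in> M"
    "\<And>h v. h \<in> carrier Hg \<Longrightarrow> v \<in> M \<Longrightarrow> \<rho> h \<cdot> v \<in> M"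
    and N: "\<And>h v. h \<in> carrier Hg \<Longrightarrow> v \<in> N \<Longrightarrow> \<rho> h \<cdot> v \<in> N"
    and x: "\<And>v. v \<in> N \<Longrightarrow> x \<cdot> v \<in> M" and v: "v \<in> N"
  shows "avg x \<cdot> v \<in> M"
proof -
  have "sum g A \<in> M" if "\<And>h. h \<in> A \<Longrightarrow> g h \<in> M" for A :: "'g set" and g
    using that by (induction A rule: infinite_finite_induct) (auto intro: M)
  then show ?thesis unfolding avg_app using assms H_unit by (intro M(1)) auto
qed

lemma avg_diff: "avg x \<cdot> v - v = avg (x - 1) \<cdot> v"
proof -
  have rr: "\<rho> h \<cdot> \<rho> (inv\<^bsub>Hg\<^esub> h) \<cdot> v = v" if "h \<in> carrier Hg" for h
    using rho_inv(2)[OF that] by (simp add: times_app[symmetric])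
  have "(\<Sum>h\<in>carrier Hg. \<rho> h \<cdot> (x - 1) \<cdot> \<rho> (inv\<^bsub>Hg\<^esub> h) \<cdot> v) =
    (\<Sum>h\<in>carrier Hg. \<rho> h \<cdot> x \<cdot> \<rho> (inv\<^bsub>Hg\<^esub> h) \<cdot> v) - (\<Sum>h\<in>carrier Hg. v)"
    unfolding sum_subtractf[symmetric]
    using rr by (intro sum.cong refl) simp
  then show ?thesis unfolding avg_app app_diff using avg_const[of v] by simp
qed

end

section \<open>Stable sublattices and normalizing operators\<close>

context lattice_rep_field
begin

text \<open>If \<open>N\<close> is an \<open>H\<close>-stable sublattice of \<open>T\<close> not contained in \<open>\<pi>T\<close>, then averaging a projection of
  \<open>T\<close> onto \<open>N + \<pi>T\<close> modulo \<open>\<pi>\<close> gives an idempotent modulo \<open>\<pi>\<close> in the field \<open>E\<close>.\<close>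

lemma stable_sublattice:
  assumes N: "N \<subseteq> T" "\<And>a v. a \<in> \<O> \<Longrightarrow> v \<in> N \<Longrightarrow> sc a \<cdot> v \<in> N" "\<And>u v. u \<in> N \<Longrightarrow> v \<in> N \<Longrightarrow> u + v \<in> N"
    "\<And>h v. h \<in> carrier Hg \<Longrightarrow> v \<in> N \<Longrightarrow> \<rho> h \<cdot> v \<in> N"
    and n: "n \<in> N" "\<pi>i \<cdot> n \<notin> T" and t: "t \<in> T"
  shows "\<exists>u\<in>N. \<exists>v\<in>T. t = u + \<pi> \<cdot> v"
proof -
  define M where "M = {u + \<pi> \<cdot> v | u v. u \<in> N \<and> v \<in> T}"
  have N0: "0 \<in> N" using N(2)[OF O_0 n(1)] by (simp add: sc_0)
  have pisc: "\<pi> \<cdot> sc a \<cdot> v = sc a \<cdot> \<pi> \<cdot> v" for a v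
    using lin_sc[OF pi_lin(1)] by (simp add: times_app[symmetric])
  have pirho: "\<pi> \<cdot> \<rho> h \<cdot> v = \<rho> h \<cdot> \<pi> \<cdot> v" if "h \<in> carrier Hg" for h v
    using pi_comm1(1)[OF rho_lin[OF that]] by (simp add: times_app[symmetric])
  have M_add: "u + v \<in> M" if "u \<in> M" "v \<in> M" for u v
  proof -
    obtain a b c d where "u = a + \<pi> \<cdot> b" "v = c + \<pi> \<cdot> d" "a \<in> N" "c \<in> N" "b \<in> T" "d \<in> T"
      using \<open>u \<in> M\<close> \<open>v \<in> M\<close> unfolding M_def by blast
    then show ?thesis unfolding M_def using N(3) T_add
      by (intro CollectI exI[of _ "a + c"] exI[of _ "b + d"]) simp
  qed
  have M_sc: "sc a \<cdot> v \<in> M" if "a \<in> \<O>" "v \<in> M" for a v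
  proof -
    obtain b c where "v = b + \<pi> \<cdot> c" "b \<in> N" "c \<in> T" using \<open>v \<in> M\<close> unfolding M_def by blast
    then show ?thesis unfolding M_def using N(2) T_sc that(1)
      by (intro CollectI exI[of _ "sc a \<cdot> b"] exI[of _ "sc a \<cdot> c"]) (simp add: pisc)
  qed
  have M_rho: "\<rho> h \<cdot> v \<in> M" if "h \<in> carrier Hg" "v \<in> M" for h v
  proof -
    obtain b c where "v = b + \<pi> \<cdot> c" "b \<in> N" "c \<in> T" using \<open>v \<in> M\<close> unfolding M_def by blast
    then show ?thesis unfolding M_def using N(4) rho_T that(1)
      by (intro CollectI exI[of _ "\<rho> h \<cdot> b"] exI[of _ "\<rho> h \<cdot> c"]) (simp add: pirho)
  qed
  have NM: "u \<in> M" if "u \<in> N" for u unfolding M_def using that T_0 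
    by (intro CollectI exI[of _ u] exI[of _ 0]) simp
  have M0: "0 \<in> M" using NM N0 by simp
  have MT: "M \<subseteq> T" unfolding M_def using N(1) T_add T_pi(2) by blast
  have piM: "\<pi> \<cdot> v \<in> M" if "v \<in> T" for v unfolding M_def using that N0
    by (intro CollectI exI[of _ 0] exI[of _ v]) simp
  obtain B \<phi> where "adapted_basis M B \<phi>" by (rule adapted_basis)
  note B = adapted_basisD[OF this]
  \<comment> \<open>By the choice of the coordinates, \<open>q\<close> maps \<open>T\<close> into
    \<open>M\<close> and is the identity on \<open>M\<close> modulo \<open>\<pi>T\<close>. Both
    properties pass to its average \<open>x\<close>, as \<open>T\<close>, \<open>M\<close> and
    \<open>\<pi>T\<close> are stable under the group.\<close>
  define q where "q = Aend (\<lambda>w. \<Sum>b\<in>B \<inter> M. \<phi> b w \<cdot> b)"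
  have q: "q \<cdot> w = (\<Sum>b\<in>B \<inter> M. \<phi> b w \<cdot> b)" for w
    unfolding q_def by (rule app_Aend) (simp add: B sum.distrib)
  have q_lin: "q \<in> lin" unfolding lin_def
    by (auto intro!: aend_eqI simp: times_app q B app_sum)
  have q_M: "q \<cdot> v \<in> M" if v: "v \<in> T" for v
  proof -
    have "\<phi> b v \<cdot> b \<in> M" if b: "b \<in> B \<inter> M" for b
      using B(7)[of b v] b v M_sc by auto
    then have "(\<Sum>b\<in>A. \<phi> b v \<cdot> b) \<in> M" if "A \<subseteq> B \<inter> M" for A
      using that by (induction A rule: infinite_finite_induct) (auto intro: M0 M_add)
    then show ?thesis by (simp add: q)
  qed
  define P where "P = {\<pi> \<cdot> v | v. v \<in> T}"
  have P_I: "v \<in> P" if "\<pi>i \<cdot> v \<in> T" for v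
    unfolding P_def using that
    by (intro CollectI exI[of _ "\<pi>i \<cdot> v"]) (simp add: times_app[symmetric] pi_inverse)
  have P_D: "\<pi>i \<cdot> v \<in> T" if "v \<in> P" for v
    using that unfolding P_def by (auto simp: times_app[symmetric] pi_inverse)
  have pii: "\<pi>i \<cdot> sc a \<cdot> v = sc a \<cdot> \<pi>i \<cdot> v" for a v
    using lin_sc[OF pi_lin(2)] by (simp add: times_app[symmetric])
  have piirho: "\<pi>i \<cdot> \<rho> h \<cdot> v = \<rho> h \<cdot> \<pi>i \<cdot> v" if "h \<in> carrier Hg" for h v
    using pi_comm1(2)[OF rho_lin[OF that]] by (simp add: times_app[symmetric])
  have P_sc: "sc a \<cdot> v \<in> P" if "a \<in> \<O>" "v \<in> P" for a v
    using that P_D T_sc by (intro P_I) (simp add: pii)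
  have P_add: "u + v \<in> P" if "u \<in> P" "v \<in> P" for u v
    using that P_D T_add by (intro P_I) simp
  have P_0: "0 \<in> P" using T_0 by (intro P_I) simp
  have P_rho: "\<rho> h \<cdot> v \<in> P" if "h \<in> carrier Hg" "v \<in> P" for h v
    using that P_D rho_T by (intro P_I) (simp add: piirho)
  have q_P: "(q - 1) \<cdot> v \<in> P" if v: "v \<in> M" for v
  proof -
    have "v = (\<Sum>b\<in>B. \<phi> b v \<cdot> b)" by (rule B(4))
    also have "\<dots> = q \<cdot> v + (\<Sum>b\<in>B - M. \<phi> b v \<cdot> b)"
      unfolding q using B(1) by (subst sum.union_disjoint[symmetric]) (auto intro: sum.cong)
    finally have "(q - 1) \<cdot> v = - (\<Sum>b\<in>B - M. \<phi> b v \<cdot> b)" by (simp add: algebra_simps)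
    moreover have "\<pi>i \<cdot> (\<Sum>b\<in>B - M. \<phi> b v \<cdot> b) \<in> T" unfolding app_sum
    proof (rule T_sum)
      fix b assume b: "b \<in> B - M"
      then obtain a where a: "\<pi>i * \<phi> b v = sc a" "a \<in> \<O>" using B(8)[OF b, of v] v MT by auto
      have "\<pi>i \<cdot> \<phi> b v \<cdot> b = sc a \<cdot> b" using a by (simp add: times_app[symmetric])
      then show "\<pi>i \<cdot> \<phi> b v \<cdot> b \<in> T" using T_sc[OF a(2), of b] B(2) b by auto
    qed
    ultimately show ?thesis using T_diff[OF T_0] by (intro P_I) simp
  qed
  define x where "x = avg q"
  have xM: "x \<cdot> v \<in> M" if "v \<in> T" for v
    unfolding x_def by (rule avg_stable[OF M_sc M_add M0 M_rho rho_T q_M that])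
  have x1: "(x - 1) \<cdot> v \<in> P" if "v \<in> M" for v
    using avg_stable[OF P_sc P_add P_0 P_rho M_rho q_P that] by (simp add: x_def avg_diff)
  have xE: "x \<in> E" unfolding x_def by (rule avg_E[OF q_lin])
  have xR: "x \<in> R" using xE xM MT by (auto simp: R_def)
  have "ord_ge 1 (x * x - x)"
  proof -
    have "(\<pi>i * (x * x - x)) \<cdot> v \<in> T" if "v \<in> T" for v
      using P_D[OF x1[OF xM[OF that]]] by (simp add: times_app algebra_simps)
    then show ?thesis unfolding ord_ge_def R_def using xE pi_E by (auto intro!: E.mult_in E.diff_in)
  qed
  \<comment> \<open>If \<open>x\<close> vanishes modulo \<pi>, then \<open>n\<close>, which it fixes
    modulo \<pi>, lies in \<open>\<pi>T\<close>, contrary to assumption; if \<open>x\<close> is 1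
    modulo \<pi>, then \<open>T\<close> is contained in \<open>M\<close>.\<close>
  then consider "ord_ge 1 x" | "ord_ge 1 (1 - x)" using R_idempotent[OF xR] by blast
  then have "t \<in> M"
  proof cases
    case 1
    then have "x \<cdot> n \<in> P" using n(1) N(1) by (intro P_I) (auto simp: ord_ge_def R_def times_app)
    then have "\<pi>i \<cdot> x \<cdot> n \<in> T" by (rule P_D)
    moreover have "\<pi>i \<cdot> (x - 1) \<cdot> n \<in> T" using P_D x1 NM n(1) by blast
    ultimately have "\<pi>i \<cdot> n \<in> T" using T_diff[of "\<pi>i \<cdot> x \<cdot> n" "\<pi>i \<cdot> (x - 1) \<cdot> n"] by simp
    then show ?thesis using n(2) by blast
  next
    case 2
    then have "\<pi>i \<cdot> (1 - x) \<cdot> t \<in> T" using t by (auto simp: ord_ge_def R_def times_app)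
    then have "\<pi> \<cdot> \<pi>i \<cdot> (1 - x) \<cdot> t \<in> M" by (rule piM)
    then have "(1 - x) \<cdot> t \<in> M" by (simp add: times_app[symmetric] mult.assoc[symmetric] pi_inverse)
    then show ?thesis using M_add[OF _ xM[OF t], of "(1 - x) \<cdot> t"] by simp
  qed
  then show ?thesis unfolding M_def by blast
qed

text \<open>Scale \<open>g\<close> by the power of \<open>p\<close> for which \<open>gT\<close> lies
  in \<open>T\<close> but not in \<open>\<pi>T\<close>. As \<open>g\<close> normalizes the image of
  the group, \<open>gT\<close> is stable, so \<open>T = gT + \<pi>T\<close> by
  \<open>stable_sublattice\<close>, and by iteration \<open>T = gT + \<pi>^j T\<close> for all j.
  For large j the last term lies in \<open>gT\<close>, because \<open>g'\<close> is bounded.\<close>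

lemma normalizer_scaling:
  assumes g: "g \<in> lin" "g' \<in> lin" "g * g' = 1" "g' * g = 1"
    and norm: "\<And>h. h \<in> carrier Hg \<Longrightarrow> \<exists>k\<in>carrier Hg. \<rho> h * g = g * \<rho> k"
  obtains a where "a \<noteq> 0" "\<And>t. t \<in> T \<Longrightarrow> sc a \<cdot> g \<cdot> t \<in> T" "\<And>t. t \<in> T \<Longrightarrow> sc (inverse a) \<cdot> g' \<cdot> t \<in> T"
proof -
  obtain n where n: "\<forall>t\<in>T. (\<pi> ^ n * g) \<cdot> t \<in> T" using op_bounded g(1) by blast
  define Q where "Q i \<longleftrightarrow> (\<forall>t\<in>T. \<pi>i ^ i \<cdot> \<pi> ^ n \<cdot> g \<cdot> t \<in> T)" for i
  obtain w :: 'w where "w \<noteq> 0" using nontriv by auto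
  then obtain t0 where t0: "t0 \<in> T" "t0 \<noteq> 0"
    using T_bounded[of w] by (metis app_0 one_app pipow_inverse(2) times_app)
  have "\<pi> ^ n \<cdot> g \<cdot> t0 \<noteq> 0"
  proof
    assume "\<pi> ^ n \<cdot> g \<cdot> t0 = 0"
    then have "g' \<cdot> \<pi>i ^ n \<cdot> \<pi> ^ n \<cdot> g \<cdot> t0 = 0" by simp
    moreover have "\<pi>i ^ n \<cdot> \<pi> ^ n \<cdot> g \<cdot> t0 = g \<cdot> t0" by (metis one_app pipow_inverse(2) times_app)
    ultimately have "g' \<cdot> g \<cdot> t0 = 0" by simp
    then show False using t0 g(4) by (metis one_app times_app)
  qed
  then obtain m where "\<pi>i ^ m \<cdot> \<pi> ^ n \<cdot> g \<cdot> t0 \<notin> T" using T_separated by blast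
  then have "\<not> Q m" using t0(1) by (auto simp: Q_def)
  moreover have "Q 0" using n by (simp add: Q_def times_app)
  ultimately obtain i where i: "Q i" "\<not> Q (Suc i)" using last_true_nat[of Q] by blast
  define a where "a = inverse p ^ i * p ^ n"
  have a: "a \<noteq> 0" using p_nz by (simp add: a_def)
  have sca: "sc a \<cdot> v = \<pi>i ^ i \<cdot> \<pi> ^ n \<cdot> v" for v
    by (simp add: a_def sc_mult pipow_sc times_app)
  have gT: "sc a \<cdot> g \<cdot> t \<in> T" if "t \<in> T" for t using i(1) that by (simp add: Q_def sca)
  obtain t1 where t1: "t1 \<in> T" "\<pi>i \<cdot> sc a \<cdot> g \<cdot> t1 \<notin> T"
    using i(2) by (auto simp: Q_def sca times_app)
  define N where "N = {sc a \<cdot> g \<cdot> t | t. t \<in> T}"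
  have gsc: "sc a \<cdot> g \<cdot> sc b \<cdot> t = sc b \<cdot> sc a \<cdot> g \<cdot> t" for b t
    using lin_sc[OF lin.mult_in[OF sc_lin g(1)], of a b] by (simp add: times_app[symmetric] mult.assoc)
  have N: "N \<subseteq> T" "\<And>b v. b \<in> \<O> \<Longrightarrow> v \<in> N \<Longrightarrow> sc b \<cdot> v \<in> N" "\<And>u v. u \<in> N \<Longrightarrow> v \<in> N \<Longrightarrow> u + v \<in> N"
  proof -
    show "N \<subseteq> T" unfolding N_def using gT by blast
  next
    fix b v assume b: "b \<in> \<O>" and "v \<in> N"
    then obtain t where "v = sc a \<cdot> g \<cdot> t" "t \<in> T" unfolding N_def by blast
    then show "sc b \<cdot> v \<in> N" unfolding N_def using T_sc[OF b] 
      by (intro CollectI exI[of _ "sc b \<cdot> t"]) (simp add: gsc)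
  next
    fix u v assume "u \<in> N" "v \<in> N"
    then obtain s t where "u = sc a \<cdot> g \<cdot> s" "v = sc a \<cdot> g \<cdot> t" "s \<in> T" "t \<in> T" unfolding N_def by blast
    then show "u + v \<in> N" unfolding N_def using T_add
      by (intro CollectI exI[of _ "s + t"]) simp
  qed
  have N_rho: "\<rho> h \<cdot> v \<in> N" if h: "h \<in> carrier Hg" and v: "v \<in> N" for h v
  proof -
    obtain t where t: "v = sc a \<cdot> g \<cdot> t" "t \<in> T" using v unfolding N_def by blast
    obtain k where k: "k \<in> carrier Hg" "\<rho> h * g = g * \<rho> k" using norm[OF h] by blast
    have "\<rho> h * (sc a * g) = sc a * g * \<rho> k"
      by (simp add: mult.assoc[symmetric] lin_sc[OF rho_lin[OF h]]) (simp add: mult.assoc k(2))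
    then have "\<rho> h \<cdot> v = sc a \<cdot> g \<cdot> \<rho> k \<cdot> t" unfolding t by (simp add: times_app[symmetric] mult.assoc)
    then show ?thesis unfolding N_def using rho_T k(1) t(2) by blast
  qed
  have NpT: "\<exists>u\<in>N. \<exists>v\<in>T. t = u + \<pi> \<cdot> v" if "t \<in> T" for t
    by (rule stable_sublattice[OF N N_rho _ t1(2) that]) (use t1(1) in \<open>auto simp: N_def\<close>)
  have NpTn: "\<exists>u\<in>N. \<exists>v\<in>T. t = u + \<pi> ^ j \<cdot> v" if "t \<in> T" for t j
  proof (induction j)
    case 0
    have "0 \<in> N" unfolding N_def using T_0 by (intro CollectI exI[of _ 0]) simp
    then show ?case using that by (intro bexI[of _ 0] bexI[of _ t]) auto
  next
    case (Suc j)
    then obtain u v where uv: "u \<in> N" "v \<in> T" "t = u + \<pi> ^ j \<cdot> v" by blast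
    obtain u' v' where v': "u' \<in> N" "v' \<in> T" "v = u' + \<pi> \<cdot> v'" using NpT uv by blast
    have "t = (u + \<pi> ^ j \<cdot> u') + \<pi> ^ Suc j \<cdot> v'"
      unfolding uv v' power_Suc2 by (simp add: times_app add.assoc)
    moreover have "u + \<pi> ^ j \<cdot> u' \<in> N" using N(2,3) uv v' p_power_O by (simp add: pipow_sc)
    ultimately show ?case using v' by blast
  qed
  have "sc (inverse a) * g' \<in> lin" using g sc_lin by auto
  then obtain j where j: "\<forall>t\<in>T. (\<pi> ^ j * (sc (inverse a) * g')) \<cdot> t \<in> T" using op_bounded by blast
  show ?thesis
  proof (rule that[OF a gT])
    fix t assume "t \<in> T"
    then obtain u v where uv: "u \<in> N" "v \<in> T" "t = u + \<pi> ^ j \<cdot> v" using NpTn by blast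
    obtain s where s: "u = sc a \<cdot> g \<cdot> s" "s \<in> T" using uv unfolding N_def by blast
    have "sc (inverse a) * g' * (sc a * g) = 1"
    proof -
      have "sc (inverse a) * g' * (sc a * g) = sc (inverse a) * (g' * sc a) * g" by (simp add: mult.assoc)
      also have "\<dots> = sc (inverse a) * sc a * (g' * g)" by (simp add: lin_sc[OF g(2)] mult.assoc)
      finally show ?thesis using a g by (simp add: sc_mult[symmetric] sc_1)
    qed
    then have "sc (inverse a) \<cdot> g' \<cdot> u = s" unfolding s by (simp add: times_app[symmetric] mult.assoc[symmetric])
    moreover have "sc (inverse a) \<cdot> g' \<cdot> \<pi> ^ j \<cdot> v \<in> T"
      using j uv(2) pi_comm(1)[OF \<open>sc (inverse a) * g' \<in> lin\<close>, of j] 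
      by (simp add: times_app[symmetric] mult.assoc[symmetric])
    ultimately show "sc (inverse a) \<cdot> g' \<cdot> t \<in> T" using uv s T_add by simp
  qed
qed

end

section \<open>Determinants of semilinear operators\<close>

text \<open>For \<open>u'\<close> inverse to \<open>u\<close> and \<sigma> the conjugation by
  \<open>u\<close>, this is the product of \<open>b\<close>, \<sigma>(b), ..., \<sigma>^(k-1)(b). It
  satisfies \<open>(b * u) ^ k = twisted_norm u u' k b * u ^ k\<close>.\<close>

primrec twisted_norm :: "'a \<Rightarrow> 'a \<Rightarrow> nat \<Rightarrow> 'a \<Rightarrow> 'a::monoid_mult" where
  "twisted_norm u u' 0 b = 1"
| "twisted_norm u u' (Suc k) b = b * (u * twisted_norm u u' k b * u')"

text \<open>Enumerates the natural numbers other than \<open>i\<close>, so that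
  \<open>x \<circ> skip i\<close> is the family \<open>x\<close> with entry \<open>i\<close>
  deleted, as in a minor.\<close>

definition skip :: "nat \<Rightarrow> nat \<Rightarrow> nat" where "skip i j = (if j < i then j else Suc j)"

text \<open>\<open>W\<close> as a vector space over the field \<open>E\<close>, with basis
  \<open>v\<close> and coordinates \<open>c\<close>. The field is a subset of a noncommutative ring,
  so its elements can be exchanged only by \<open>comm\<close>.\<close>

locale op_field_basis = op_ring E for E :: "'w::ab_group_add aend set" +
  fixes n :: nat and v :: "nat \<Rightarrow> 'w" and c :: "nat \<Rightarrow> 'w \<Rightarrow> 'w aend"
  assumes comm: "x \<in> E \<Longrightarrow> y \<in> E \<Longrightarrow> x * y = y * x"
    and inv: "x \<in> E \<Longrightarrow> x \<noteq> 0 \<Longrightarrow> \<exists>y\<in>E. y * x = 1"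
    and nonzero: "(1 :: 'w aend) \<noteq> 0"
    and c_in: "i < n \<Longrightarrow> c i w \<in> E"
    and c_add: "i < n \<Longrightarrow> c i (w + w') = c i w + c i w'"
    and c_mult: "i < n \<Longrightarrow> d \<in> E \<Longrightarrow> c i (d \<cdot> w) = d * c i w"
    and expand: "w = (\<Sum>i<n. c i w \<cdot> v i)"
    and c_basis: "i < n \<Longrightarrow> j < n \<Longrightarrow> c i (v j) = (if i = j then 1 else 0)"
begin

lemma cancel: "x \<in> E \<Longrightarrow> x \<noteq> 0 \<Longrightarrow> y * x = z * x \<Longrightarrow> y = z"
proof -
  assume x: "x \<in> E" "x \<noteq> 0" and eq: "y * x = z * x"
  obtain x' where x': "x' \<in> E" "x' * x = 1" using inv[OF x] by blast
  then have "x * x' = 1" using comm[OF x(1) x'(1)] by simp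
  then have *: "w * x * x' = w" for w by (simp add: mult.assoc)
  have "y * x * x' = z * x * x'" by (simp only: eq)
  then show ?thesis by (simp only: *)
qed

text \<open>Only adjacent equal entries are required to give 0, which is what an induction along the
  Laplace expansion yields directly; \<open>alternating_eq_0\<close> recovers the general case.
  Families are indexed by all natural numbers, and the second clause makes \<open>F\<close> ignore
  the entries from \<open>m\<close> on.\<close>

definition alternating :: "nat \<Rightarrow> ((nat \<Rightarrow> 'w) \<Rightarrow> 'w aend) \<Rightarrow> bool" where
  "alternating m F \<longleftrightarrow> (\<forall>x. F x \<in> E) \<and> (\<forall>x y. (\<forall>i<m. x i = y i) \<longrightarrow> F x = F y) \<and>
     (\<forall>i<m. \<forall>x a b. F (x(i := a + b)) = F (x(i := a)) + F (x(i := b))) \<and>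
     (\<forall>i<m. \<forall>x a. \<forall>d\<in>E. F (x(i := d \<cdot> a)) = d * F (x(i := a))) \<and>
     (\<forall>i x. Suc i < m \<longrightarrow> x i = x (Suc i) \<longrightarrow> F x = 0)"

lemma alternatingD:
  assumes "alternating m F"
  shows "\<And>x. F x \<in> E" "\<And>x y. (\<And>i. i < m \<Longrightarrow> x i = y i) \<Longrightarrow> F x = F y"
    "\<And>i x a b. i < m \<Longrightarrow> F (x(i := a + b)) = F (x(i := a)) + F (x(i := b))"
    "\<And>i x a d. i < m \<Longrightarrow> d \<in> E \<Longrightarrow> F (x(i := d \<cdot> a)) = d * F (x(i := a))"
    "\<And>i x. Suc i < m \<Longrightarrow> x i = x (Suc i) \<Longrightarrow> F x = 0"
proof -
  note a = assms[unfolded alternating_def]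
  note b = a[THEN conjunct2] note c = b[THEN conjunct2] note d = c[THEN conjunct2]
  show "\<And>x. F x \<in> E" by (rule a[THEN conjunct1, rule_format])
  show "\<And>x y. (\<And>i. i < m \<Longrightarrow> x i = y i) \<Longrightarrow> F x = F y" by (rule b[THEN conjunct1, rule_format])
  show "\<And>i x a b. i < m \<Longrightarrow> F (x(i := a + b)) = F (x(i := a)) + F (x(i := b))"
    by (rule c[THEN conjunct1, rule_format])
  show "\<And>i x a d. i < m \<Longrightarrow> d \<in> E \<Longrightarrow> F (x(i := d \<cdot> a)) = d * F (x(i := a))"
    by (rule d[THEN conjunct1, rule_format])
  show "\<And>i x. Suc i < m \<Longrightarrow> x i = x (Suc i) \<Longrightarrow> F x = 0"
    by (rule d[THEN conjunct2, rule_format])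
qed

text \<open>Laplace expansion along the last coordinate, with sign +1 at the first entry, so the
  value on the basis is 1 or -1. All that matters is that it is not 0.\<close>

primrec det :: "nat \<Rightarrow> (nat \<Rightarrow> 'w) \<Rightarrow> 'w aend" where
  "det 0 x = 1"
| "det (Suc m) x = (\<Sum>i\<le>m. (- 1) ^ i * (c m (x i) * det m (x \<circ> skip i)))"

lemma sign_in: "(- 1) ^ i \<in> E"
  by (intro power_in uminus_in one_in)

lemma skip_update:
  assumes "i \<noteq> j" "i \<le> m" "j \<le> m"
  obtains k where "k < m" "\<And>a (x :: nat \<Rightarrow> 'w). x(i := a) \<circ> skip j = (x \<circ> skip j)(k := a)"
proof (rule that[of "if i < j then i else i - 1"])
  show "x(i := a) \<circ> skip j = (x \<circ> skip j)((if i < j then i else i - 1) := a)" for a and x :: "nat \<Rightarrow> 'w"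
    using assms by (auto simp: fun_eq_iff skip_def)
qed (use assms in \<open>auto simp: skip_def\<close>)

lemma det_update:
  assumes "i \<le> m"
  shows "det (Suc m) (x(i := a)) = (- 1) ^ i * (c m a * det m (x \<circ> skip i)) +
    (\<Sum>j\<in>{..m} - {i}. (- 1) ^ j * (c m (x j) * det m (x(i := a) \<circ> skip j)))"
proof -
  have "x(i := a) \<circ> skip i = x \<circ> skip i" by (auto simp: fun_eq_iff skip_def)
  then show ?thesis using assms by (simp add: sum.remove[of "{..m}" i])
qed

lemma det_alternating: "m \<le> n \<Longrightarrow> alternating m (det m)"
proof (induction m)
  case 0
  then show ?case by (simp add: alternating_def)
next
  case (Suc m)
  then have IH: "alternating m (det m)" and m: "m < n" by auto
  note IHD = alternatingD[OF IH]
  have cin: "c m w \<in> E" for w by (rule c_in[OF m])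
  show ?case unfolding alternating_def
  proof (intro conjI allI impI ballI)
    show "det (Suc m) x \<in> E" for x
      by (auto intro!: sum_in mult_in sign_in cin IHD(1))
  next
    fix x y :: "nat \<Rightarrow> 'w" assume xy: "\<forall>i<Suc m. x i = y i"
    have "det m (x \<circ> skip i) = det m (y \<circ> skip i)" if "i \<le> m" for i
      using xy that by (intro IHD(2)) (auto simp: skip_def)
    then show "det (Suc m) x = det (Suc m) y" using xy by (auto intro!: sum.cong)
  next
    fix i x a b assume i: "i < Suc m"
    have "det m (x(i := a + b) \<circ> skip j) = det m (x(i := a) \<circ> skip j) + det m (x(i := b) \<circ> skip j)"
      if j: "j \<in> {..m} - {i}" for j
    proof -
      obtain k where k: "k < m" "\<And>a (x :: nat \<Rightarrow> 'w). x(i := a) \<circ> skip j = (x \<circ> skip j)(k := a)"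
        using skip_update[of i j m] i j by (metis DiffE atMost_iff insertCI less_Suc_eq_le)
      show ?thesis unfolding k(2) by (rule IHD(3)[OF k(1)])
    qed
    then show "det (Suc m) (x(i := a + b)) = det (Suc m) (x(i := a)) + det (Suc m) (x(i := b))"
      using i m unfolding det_update[of i m, OF less_Suc_eq_le[THEN iffD1, OF i]]
      by (simp add: c_add distrib_left distrib_right sum.distrib)
  next
    fix i x a d assume i: "i < Suc m" and d: "d \<in> E"
    have comms: "(- 1) ^ j * (y * (d * z)) = d * ((- 1) ^ j * (y * z))" if "y \<in> E" for j y z
      by (simp only: mult.assoc[symmetric] comm[OF d sign_in] comm[OF d that])
        (simp only: mult.assoc comm[OF d that])
    have "(- 1) ^ j * (c m (x j) * det m (x(i := d \<cdot> a) \<circ> skip j)) =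
      d * ((- 1) ^ j * (c m (x j) * det m (x(i := a) \<circ> skip j)))"
      if j: "j \<in> {..m} - {i}" for j
    proof -
      obtain k where k: "k < m" "\<And>a (x :: nat \<Rightarrow> 'w). x(i := a) \<circ> skip j = (x \<circ> skip j)(k := a)"
        using skip_update[of i j m] i j by (metis DiffE atMost_iff insertCI less_Suc_eq_le)
      show ?thesis unfolding k(2) IHD(4)[OF k(1) d] by (rule comms[OF cin])
    qed
    moreover have "(- 1) ^ i * (c m (d \<cdot> a) * det m (x \<circ> skip i)) =
      d * ((- 1) ^ i * (c m a * det m (x \<circ> skip i)))"
      using comms[OF one_in, of i "c m a * det m (x \<circ> skip i)"] by (simp add: c_mult[OF m d] mult.assoc)
    ultimately show "det (Suc m) (x(i := d \<cdot> a)) = d * det (Suc m) (x(i := a))"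
      unfolding det_update[of i m, OF less_Suc_eq_le[THEN iffD1, OF i]] distrib_left sum_distrib_left
      by simp
  next
    fix i and x :: "nat \<Rightarrow> 'w" assume i: "Suc i < Suc m" and eq: "x i = x (Suc i)"
    \<comment> \<open>The equal entries stay adjacent when another entry is deleted, so only the
      terms for \<open>i\<close> and \<open>Suc i\<close> survive; their minors agree and their
      signs are opposite.\<close>
    have "det m (x \<circ> skip j) = 0" if j: "j \<in> {..m} - {i} - {Suc i}" for j
    proof (cases "j < i")
      case True
      then show ?thesis using i eq by (intro IHD(5)[of "i - 1"]) (auto simp: skip_def)
    next
      case False
      then show ?thesis using i j eq by (intro IHD(5)[of i]) (auto simp: skip_def)
    qed
    then have "(\<Sum>j\<in>{..m} - {i} - {Suc i}. (- 1) ^ j * (c m (x j) * det m (x \<circ> skip j))) = 0" by simp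
    moreover have "x \<circ> skip i = x \<circ> skip (Suc i)" using eq by (auto simp: fun_eq_iff skip_def less_Suc_eq)
    ultimately show "det (Suc m) x = 0"
      using i eq by (simp add: sum.remove[of "{..m}" i] sum.remove[of "{..m} - {i}" "Suc i"])
  qed
qed

lemma adjacent_swap:
  assumes F: "alternating m F" and i: "Suc i < m"
  shows "F (x(i := a, Suc i := b)) = - F (x(i := b, Suc i := a))"
proof -
  note D = alternatingD[OF F]
  have tw: "x(i := a, Suc i := b) = x(Suc i := b, i := a)" for a b by (simp add: fun_upd_twist)
  have "F (x(i := a + b, Suc i := a + b)) = 0" using i by (intro D(5)[of i]) auto
  moreover have "F (x(i := y, Suc i := y)) = 0" for y using i by (intro D(5)[of i]) auto
  moreover have "F (x(i := a + b, Suc i := a + b)) =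
    F (x(i := a, Suc i := a)) + F (x(i := a, Suc i := b)) + (F (x(i := b, Suc i := a)) + F (x(i := b, Suc i := b)))"
    using i unfolding D(3)[OF i] by (simp add: tw D(3))
  ultimately show ?thesis by (simp add: eq_neg_iff_add_eq_0)
qed

text \<open>Adjacent swaps carry the second of the two equal entries down until it is next to the
  first.\<close>

lemma alternating_eq_0:
  assumes F: "alternating m F"
  shows "i < j \<Longrightarrow> j < m \<Longrightarrow> x i = x j \<Longrightarrow> F x = 0"
proof (induction j arbitrary: x)
  case (Suc j)
  show ?case
  proof (cases "i = j")
    case True
    then show ?thesis using alternatingD(5)[OF F] Suc by auto
  next
    case False
    have "F x = F (x(j := x j, Suc j := x (Suc j)))" by simp
    also have "\<dots> = - F (x(j := x (Suc j), Suc j := x j))" by (rule adjacent_swap[OF F Suc.prems(2)])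
    also have "F (x(j := x (Suc j), Suc j := x j)) = 0" using Suc False by (intro Suc.IH) auto
    finally show ?thesis by simp
  qed
qed simp

lemma alternating_swap:
  assumes F: "alternating m F" and ij: "i < j" "j < m"
  shows "F (x(i := a, j := b)) = - F (x(i := b, j := a))"
proof -
  note D = alternatingD[OF F]
  have tw: "x(i := a, j := b) = x(j := b, i := a)" for a b using ij by (simp add: fun_upd_twist)
  have *: "F (x(i := y, j := y)) = 0" for y using ij by (intro alternating_eq_0[OF F ij]) auto
  have i: "i < m" using ij by simp
  have "F (x(i := a + b, j := a + b)) =
    F (x(i := a, j := a)) + F (x(i := a, j := b)) + (F (x(i := b, j := a)) + F (x(i := b, j := b)))"
    unfolding D(3)[OF ij(2)] by (simp add: tw D(3)[OF i])
  then show ?thesis using * by (simp add: eq_neg_iff_add_eq_0)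
qed

text \<open>Selection sort of the index map \<open>s\<close>: at most the last \<open>k\<close>
  positions are out of place. A repeated index gives 0, and otherwise a transposition fixes the
  first of these positions.\<close>

lemma alternating_basis_0:
  assumes F: "alternating n F" and v0: "F v = 0"
  shows "k \<le> n \<Longrightarrow> (\<And>j. j < n \<Longrightarrow> s j < n) \<Longrightarrow> (\<And>j. j < n - k \<Longrightarrow> s j = j) \<Longrightarrow> F (v \<circ> s) = 0"
proof (induction k arbitrary: s)
  case 0
  have "F (v \<circ> s) = F v" using 0 by (intro alternatingD(2)[OF F]) simp
  then show ?case using v0 by (simp only:)
next
  case (Suc k)
  define m where "m = n - Suc k"
  have m: "m < n" "n - k = Suc m" using Suc.prems(1) by (auto simp: m_def)
  show ?case
  proof (cases "inj_on s {..<n}")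
    case False
    then obtain i j where ij: "i < j" "j < n" "s i = s j"
      unfolding inj_on_def by (metis lessThan_iff linorder_neqE_nat)
    show ?thesis by (rule alternating_eq_0[OF F ij(1,2)]) (simp add: ij(3))
  next
    case True
    then have "s ` {..<n} = {..<n}" using Suc.prems(2) by (intro endo_inj_surj) auto
    then obtain j where j: "j < n" "s j = m" using m(1) by (metis imageE lessThan_iff)
    have jm: "j \<ge> m" using Suc.prems(3)[of j] j by (auto simp: m_def[symmetric] not_le[symmetric])
    show ?thesis
    proof (cases "j = m")
      case True
      then show ?thesis using Suc.prems j m by (intro Suc.IH) (auto simp: m_def[symmetric] less_Suc_eq)
    next
      case False
      define s' where "s' = s(m := m, j := s m)"
      have "v \<circ> s = (v \<circ> s)(m := v (s m), j := v m)" using j by (auto simp: fun_eq_iff)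
      moreover have "v \<circ> s' = (v \<circ> s)(m := v m, j := v (s m))" by (auto simp: fun_eq_iff s'_def)
      ultimately have "F (v \<circ> s) = - F (v \<circ> s')"
        using alternating_swap[OF F, of m j] False jm j by simp
      also have "F (v \<circ> s') = 0" using Suc.prems j m jm False
        by (intro Suc.IH) (auto simp: s'_def m_def[symmetric] less_Suc_eq)
      finally show ?thesis by simp
    qed
  qed
qed

lemma alternating_sum:
  assumes F: "alternating m F" and i: "i < m" and d: "\<And>j. j \<in> A \<Longrightarrow> d j \<in> E"
  shows "F (x(i := (\<Sum>j\<in>A. d j \<cdot> y j))) = (\<Sum>j\<in>A. d j * F (x(i := y j)))"
proof -
  note D = alternatingD[OF F]
  have 0: "F (x(i := 0)) = 0" using D(4)[OF i zero_in, of x 0] by simp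
  show ?thesis using d
    by (induction A rule: infinite_finite_induct) (simp_all add: 0 D(3)[OF i] D(4)[OF i])
qed

text \<open>Multilinear expansion, one entry at a time; \<open>k\<close> counts the leading entries
  that are not yet known to be basis vectors.\<close>

lemma alternating_zero:
  assumes F: "alternating n F" and v0: "F v = 0"
  shows "k \<le> n \<Longrightarrow> (\<And>j. k \<le> j \<Longrightarrow> j < n \<Longrightarrow> \<exists>i<n. x j = v i) \<Longrightarrow> F x = 0"
proof (induction k arbitrary: x)
  case 0
  then have "\<forall>j. \<exists>i. j < n \<longrightarrow> i < n \<and> x j = v i" by blast
  then obtain s where s: "\<And>j. j < n \<Longrightarrow> s j < n \<and> x j = v (s j)" by metis
  have "F x = F (v \<circ> s)" using s by (intro alternatingD(2)[OF F]) auto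
  also have "\<dots> = 0" using s by (intro alternating_basis_0[OF F v0, of n]) auto
  finally show ?case .
next
  case (Suc k)
  have k: "k < n" using Suc by simp
  have "F x = F (x(k := (\<Sum>i<n. c i (x k) \<cdot> v i)))" using expand[of "x k"] by simp
  also have "\<dots> = (\<Sum>i<n. c i (x k) * F (x(k := v i)))"
    by (rule alternating_sum[OF F k]) (simp add: c_in)
  also have "F (x(k := v i)) = 0" if "i < n" for i
    using Suc.prems that by (intro Suc.IH) (auto simp: Suc_le_eq)
  then have "(\<Sum>i<n. c i (x k) * F (x(k := v i))) = 0" by simp
  finally show ?case .
qed

lemma det_basis: "m \<le> n \<Longrightarrow> det m v \<noteq> 0"
proof (induction m)
  case 0
  then show ?case using nonzero by simp
next
  case (Suc m)
  have "det m (v \<circ> skip m) = det m v"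
    using Suc.prems by (intro alternatingD(2)[OF det_alternating]) (auto simp: skip_def)
  moreover have "(\<Sum>i<m. (- 1) ^ i * (c m (v i) * det m (v \<circ> skip i))) = 0"
    using Suc.prems by (intro sum.neutral) (auto simp: c_basis)
  ultimately have "det (Suc m) v = (- 1) ^ m * det m v"
    using Suc.prems by (simp add: lessThan_Suc_atMost[symmetric] c_basis)
  moreover have "(- 1) ^ m * (x :: 'w aend) = 0 \<Longrightarrow> x = 0" for x
    by (induction m arbitrary: x) simp_all
  ultimately show ?case using Suc by auto
qed

text \<open>The space of alternating forms in \<open>n\<close> vectors is one-dimensional: the
  difference of the two sides is alternating and vanishes on the basis.\<close>

lemma det_unique:
  assumes F: "alternating n F"
  shows "F x * det n v = F v * det n x"
proof -
  note D = alternatingD[OF F]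
  note DD = alternatingD[OF det_alternating[OF order_refl]]
  define G where "G x = F x * det n v - F v * det n x" for x
  have "alternating n G" unfolding alternating_def
  proof (intro conjI allI impI ballI)
    show "G x \<in> E" for x using D(1) DD(1) by (auto simp: G_def)
  next
    fix x y :: "nat \<Rightarrow> 'w" assume "\<forall>i<n. x i = y i"
    then show "G x = G y" using D(2)[of x y] DD(2)[of x y] by (simp add: G_def)
  next
    fix i x a b assume "i < n"
    then show "G (x(i := a + b)) = G (x(i := a)) + G (x(i := b))"
      by (simp add: G_def D(3) DD(3) distrib_left distrib_right)
  next
    fix i x a d assume i: "i < n" and d: "d \<in> E"
    have "F v * (d * y) = d * (F v * y)" for y
      by (simp only: mult.assoc[symmetric] comm[OF d D(1)])
    then show "G (x(i := d \<cdot> a)) = d * G (x(i := a))" using i d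
      by (simp add: G_def D(4) DD(4) right_diff_distrib mult.assoc)
  next
    fix i and x :: "nat \<Rightarrow> 'w" assume "Suc i < n" "x i = x (Suc i)"
    then show "G x = 0" by (simp add: G_def D(5) DD(5))
  qed
  moreover have "G v = 0" by (simp add: G_def)
  ultimately have "G x = 0" using alternating_zero[of G n x] by simp
  then show ?thesis by (simp add: G_def)
qed

lemma det_scale: "m \<le> n \<Longrightarrow> d \<in> E \<Longrightarrow> det m (\<lambda>i. d \<cdot> x i) = d ^ m * det m x"
proof (induction m arbitrary: x)
  case (Suc m)
  have "(- 1) ^ i * (c m (d \<cdot> x i) * det m ((\<lambda>i. d \<cdot> x i) \<circ> skip i)) =
    d ^ Suc m * ((- 1) ^ i * (c m (x i) * det m (x \<circ> skip i)))" for i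
  proof -
    have cin: "c m (x i) \<in> E" using Suc.prems by (auto intro: c_in)
    have "(\<lambda>i. d \<cdot> x i) \<circ> skip i = (\<lambda>j. d \<cdot> (x \<circ> skip i) j)" by auto
    then have "det m ((\<lambda>i. d \<cdot> x i) \<circ> skip i) = d ^ m * det m (x \<circ> skip i)"
      using Suc.IH[of "x \<circ> skip i"] Suc.prems by (simp del: o_apply)
    then have "(- 1) ^ i * (c m (d \<cdot> x i) * det m ((\<lambda>i. d \<cdot> x i) \<circ> skip i)) =
       (- 1) ^ i * d * c m (x i) * d ^ m * det m (x \<circ> skip i)"
      using Suc.prems by (simp add: c_mult mult.assoc)
    also have "(- 1) ^ i * d * c m (x i) * d ^ m = (- 1) ^ i * d * d ^ m * c m (x i)"
      by (simp only: mult.assoc comm[OF cin power_in[OF Suc.prems(2)]])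
    also have "(- 1) ^ i * d * d ^ m = d ^ Suc m * (- 1) ^ i"
      using comm[OF sign_in power_in[OF Suc.prems(2)], of i "Suc m"] by (simp add: mult.assoc)
    finally show ?thesis by (simp only: mult.assoc)
  qed
  then show ?case by (simp only: det.simps sum_distrib_left)
qed simp

text \<open>The semilinear map \<open>u\<close> has a determinant b: applying \<open>u\<close> to
  all vectors turns \<open>det n x\<close> into b times its conjugate by \<open>u\<close>. Iterating
  \<open>N\<close> times produces the twisted norm of b, while the scalar \<open>u ^ N\<close>
  multiplies \<open>det n\<close> by its n-th power.\<close>

theorem scalar_power_norm:
  assumes u: "u * u' = 1" "u' * u = 1" and \<sigma>: "\<And>e. e \<in> E \<Longrightarrow> u * e * u' \<in> E" "\<And>e. e \<in> E \<Longrightarrow> u' * e * u \<in> E"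
    and e: "u ^ N \<in> E"
  shows "\<exists>b\<in>E. b \<noteq> 0 \<and> twisted_norm u u' N b = (u ^ N) ^ n"
proof -
  note D = alternatingD[OF det_alternating[OF order_refl]]
  have uu: "u' * (u * z) = z" "u * (u' * z) = z" for z using u by (simp_all add: mult.assoc[symmetric])
  \<comment> \<open>Conjugating back by \<open>u\<close> turns a semilinear alternating function
    into a linear one, to which \<open>det_unique\<close> applies.\<close>
  define F where "F x = u' * det n (\<lambda>i. u \<cdot> x i) * u" for x
  have upd: "(\<lambda>k. u \<cdot> (x(i := a)) k) = (\<lambda>k. u \<cdot> x k)(i := u \<cdot> a)" for x i a by auto
  have "alternating n F" unfolding alternating_def
  proof (intro conjI allI impI ballI)
    show "F x \<in> E" for x unfolding F_def by (intro \<sigma> D)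
  next
    fix x y :: "nat \<Rightarrow> 'w" assume "\<forall>i<n. x i = y i"
    then have "det n (\<lambda>i. u \<cdot> x i) = det n (\<lambda>i. u \<cdot> y i)" by (intro D(2)) auto
    then show "F x = F y" by (simp add: F_def)
  next
    fix i x a b assume "i < n"
    then show "F (x(i := a + b)) = F (x(i := a)) + F (x(i := b))"
      by (simp add: F_def upd D(3) distrib_left distrib_right del: fun_upd_apply)
  next
    fix i x a d assume i: "i < n" and d: "d \<in> E"
    have "u \<cdot> d \<cdot> a = (u * d * u') \<cdot> u \<cdot> a" by (simp add: times_app[symmetric] mult.assoc u)
    then show "F (x(i := d \<cdot> a)) = d * F (x(i := a))"
      using D(4)[OF i \<sigma>(1)[OF d]] by (simp add: F_def upd mult.assoc uu del: fun_upd_apply)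
  next
    fix i and x :: "nat \<Rightarrow> 'w" assume "Suc i < n" "x i = x (Suc i)"
    then show "F x = 0" by (simp add: F_def D(5)[of i])
  qed
  then have uniq: "F x * det n v = F v * det n x" for x by (rule det_unique)
  obtain w where w: "w \<in> E" "w * det n v = 1" using inv[OF D(1) det_basis[OF order_refl]] by blast
  have w': "det n v * w = 1" using w comm[OF D(1)] by metis
  have Fin: "F x \<in> E" for x unfolding F_def by (intro \<sigma> D)
  define b where "b = u * (F v * w) * u'"
  have bE: "b \<in> E" unfolding b_def by (intro \<sigma> mult_in Fin w)
  have step: "det n (\<lambda>i. u \<cdot> x i) = b * (u * det n x * u')" for x
  proof -
    have "F x = F v * det n x * w" using uniq[of x] w' by (metis mult.assoc mult_1_right)
    also have "\<dots> = F v * w * det n x" using comm[OF D(1) w(1)] by (simp add: mult.assoc)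
    finally have "u * F x * u' = u * (F v * w * det n x) * u'" by simp
    then show ?thesis by (simp add: b_def F_def mult.assoc uu u)
  qed
  have iter: "det n (\<lambda>i. u ^ k \<cdot> x i) = twisted_norm u u' k b * (u ^ k * det n x * u' ^ k)" for k x
  proof (induction k)
    case (Suc k)
    have "det n (\<lambda>i. u ^ Suc k \<cdot> x i) = det n (\<lambda>i. u \<cdot> u ^ k \<cdot> x i)" by (simp add: times_app)
    also have "\<dots> = b * (u * (twisted_norm u u' k b * (u ^ k * det n x * u' ^ k)) * u')"
      unfolding step Suc ..
    also have "\<dots> = twisted_norm u u' (Suc k) b * (u ^ Suc k * det n x * u' ^ Suc k)"
      by (simp add: mult.assoc uu power_commutes[of u'])
    finally show ?case .
  qed simp
  have pow: "u ^ N * u' ^ N = 1" by (rule inverse_power[OF u])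
  \<comment> \<open>As \<open>u ^ N\<close> lies in the commutative \<open>E\<close>, the remaining
    conjugation of \<open>det n v\<close> by it is trivial.\<close>
  have "twisted_norm u u' N b * det n v = (u ^ N) ^ n * det n v"
    using iter[of N v] det_scale[OF order_refl e, of v] comm[OF e D(1), of v] pow
    by (simp add: mult.assoc)
  then have nm: "twisted_norm u u' N b = (u ^ N) ^ n"
    by (rule cancel[OF D(1) det_basis[OF order_refl]])
  have "b \<noteq> 0"
  proof
    assume "b = 0"
    then have "det n (\<lambda>i. u \<cdot> u' \<cdot> v i) = 0" using step[of "\<lambda>i. u' \<cdot> v i"] by simp
    then show False using det_basis[OF order_refl] by (simp add: times_app[symmetric] u)
  qed
  then show ?thesis using bE nm by blast
qed

end

section \<open>\<open>W\<close> as a vector space over the commutant\<close>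

context lattice_rep_field
begin

text \<open>A scalar that is not integral has a negative exponent, so its inverse gains a factor
  \<open>p\<close>; this is the form in which failure of integrality is used below.\<close>

lemma O_or_inverse: "a \<notin> \<O> \<Longrightarrow> inverse a / p \<in> \<O>"
proof -
  assume a: "a \<notin> \<O>"
  obtain n where n: "p ^ n * a \<in> \<O>" using O_bounded by blast
  have "\<not> \<not> a \<notin> \<O>" using a by simp
  then obtain m where m: "p ^ m * a \<notin> \<O>" "p ^ Suc m * a \<in> \<O>"
    using last_true_nat[of "\<lambda>n. p ^ n * a \<notin> \<O>" n] n a by auto
  have "(p ^ Suc m * a) / p = p ^ m * a" using p_nz by simp
  then have "inverse (p ^ Suc m * a) \<in> \<O>" using O_unit[OF m(2)] m(1) by simp
  then have "p ^ m * inverse (p ^ Suc m * a) \<in> \<O>" by (intro O_mult p_power_O)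
  moreover have "p ^ m * inverse (p ^ Suc m * a) = inverse a / p" using p_nz by (simp add: field_simps)
  ultimately show ?thesis by simp
qed

lemma pii_not_R: "\<pi>i \<notin> R"
proof
  assume "\<pi>i \<in> R"
  then have "ord_ge n 1" for n using R.power_in by (simp add: ord_ge_def)
  then show False using ord_ge_all one_neq_zero by blast
qed

text \<open>Elements of \<open>E\<close> normalize the image of the group trivially. Hence a nonzero
  element of \<open>E\<close> is a scalar times a unit of \<open>R\<close>, which is to say that
  \<open>E\<close> is unramified over \<open>K\<close> and \<open>\<pi>\<close> is a uniformizer of
  \<open>R\<close>.\<close>

lemma E_normalizer_scaling:
  assumes "x \<in> E" "y \<in> E" "y * x = 1"
  obtains a where "a \<noteq> 0" "sc a * x \<in> R" "sc (inverse a) * y \<in> R"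
proof -
  have n: "\<exists>k\<in>carrier Hg. \<rho> h * x = x * \<rho> k" if "h \<in> carrier Hg" for h
    using E_rho[OF assms(1) that] that by (intro bexI[of _ h]) auto
  obtain a where a: "a \<noteq> 0" "\<And>t. t \<in> T \<Longrightarrow> sc a \<cdot> x \<cdot> t \<in> T" "\<And>t. t \<in> T \<Longrightarrow> sc (inverse a) \<cdot> y \<cdot> t \<in> T"
    by (rule normalizer_scaling[OF E_lin[OF assms(1)] E_lin[OF assms(2)] _ assms(3) n])
      (use assms E_comm in auto)
  show ?thesis
    by (rule that[OF a(1)]) (use a assms sc_E in \<open>auto simp: R_def times_app\<close>)
qed

lemma E_valued: "valued_ops E R \<pi> \<pi>i"
proof
  show "R \<subseteq> E" using R_E by blast
  show "\<exists>n. \<pi> ^ n * x \<in> R" if x: "x \<in> E" for x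
  proof -
    obtain n where "\<forall>t\<in>T. (\<pi> ^ n * x) \<cdot> t \<in> T" using op_bounded[OF E_lin[OF x]] by blast
    then show ?thesis using x pi_E by (auto simp: R_def intro!: exI[of _ n] E.mult_in E.power_in)
  qed
  show "\<exists>n. \<pi>i ^ n * x \<notin> R" if "x \<in> E" "x \<noteq> 0" for x
    using ord_ge_all[of x] that by (auto simp: ord_ge_def)
  show "\<exists>y\<in>R. y * x = 1" if x: "x \<in> R" and px: "\<pi>i * x \<notin> R" for x
  proof -
    have "x \<noteq> 0" using px by auto
    then obtain y where y: "y \<in> E" "y * x = 1" using E_inv R_E x by blast
    obtain a where a: "a \<noteq> 0" "sc a * x \<in> R" "sc (inverse a) * y \<in> R"
      by (rule E_normalizer_scaling[OF R_E[OF x] y])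
    \<comment> \<open>If \<open>a\<close> were not integral, then \<open>inverse a\<close> would be
      divisible by \<open>p\<close>, and \<open>x\<close> by \<open>\<pi>\<close>.\<close>
    have aO: "a \<in> \<O>"
    proof (rule ccontr)
      assume "a \<notin> \<O>"
      then have "sc (inverse a / p) * (sc a * x) \<in> R" by (intro R.mult_in sc_R O_or_inverse a)
      moreover have "inverse a / p * a = inverse p" using a(1) p_nz by (simp add: field_simps)
      then have "sc (inverse a / p) * (sc a * x) = \<pi>i * x"
        by (simp only: mult.assoc[symmetric] sc_mult[symmetric] \<pi>i_def)
      ultimately show False using px by simp
    qed
    have "sc a * (sc (inverse a) * y) = y"
      using a(1) by (simp add: mult.assoc[symmetric] sc_mult[symmetric] sc_1)
    then have "y \<in> R" using R.mult_in[OF sc_R[OF aO] a(3)] by simp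
    then show ?thesis using y by blast
  qed
qed (use E_comm pi_R pi_E pi_inverse in auto)

sublocale V: valued_ops E R \<pi> \<pi>i by (rule E_valued)

lemma T_rspan_R: "T = rspan R S"
proof
  have ST: "S \<subseteq> T" unfolding T_rspan using K.R.rspan_superset S_fin by auto
  show "T \<subseteq> rspan R S"
  proof
    fix t assume "t \<in> T"
    then obtain r where r: "\<forall>b\<in>S. r b \<in> sc ` \<O>" "t = (\<Sum>b\<in>S. r b \<cdot> b)"
      unfolding T_rspan by (rule rspanE)
    then show "t \<in> rspan R S" using sc_R by (intro rspanI[of _ r]) auto
  qed
  show "rspan R S \<subseteq> T" using ST R_T by (auto elim!: rspanE intro!: T_sum)
qed

definition E_basis :: "'w set \<Rightarrow> ('w \<Rightarrow> 'w \<Rightarrow> 'w aend) \<Rightarrow> bool" where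
  "E_basis B \<phi> \<longleftrightarrow> finite B \<and> B \<subseteq> T \<and> coords E B \<phi> \<and> (\<forall>b\<in>B. \<forall>t\<in>T. \<phi> b t \<in> R)"

lemma E_basis_exists: obtains B \<phi> where "E_basis B \<phi>"
proof -
  obtain B where B: "finite B" "T = rspan R B" "op_indep E B"
    by (rule V.minimal_generators[OF S_fin T_rspan_R, of UNIV])
  have TB: "T \<subseteq> rspan R B" and BT: "rspan R B \<subseteq> T"
    by (rule equalityD1[OF B(2)], rule equalityD2[OF B(2)])
  have sp: "rspan E B = UNIV"
  proof (intro equalityI subsetI UNIV_I)
    fix v :: 'w
    obtain n where "\<pi> ^ n \<cdot> v \<in> T" using T_bounded by blast
    from subsetD[OF TB this] obtain r
      where r: "\<forall>b\<in>B. r b \<in> R" "\<pi> ^ n \<cdot> v = (\<Sum>b\<in>B. r b \<cdot> b)" by (rule rspanE)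
    have "v = \<pi>i ^ n \<cdot> \<pi> ^ n \<cdot> v" by (simp add: times_app[symmetric] pipow_inverse)
    also have "\<dots> = (\<Sum>b\<in>B. (\<pi>i ^ n * r b) \<cdot> b)" by (simp add: r(2) app_sum times_app)
    finally have "v = (\<Sum>b\<in>B. (\<pi>i ^ n * r b) \<cdot> b)" .
    moreover have "\<pi>i ^ n * r b \<in> E" if "b \<in> B" for b
      using r(1) that by (intro E.mult_in E.power_in pi_E R_E) auto
    ultimately show "v \<in> rspan E B" by (intro rspanI[of _ "\<lambda>b. \<pi>i ^ n * r b"]) auto
  qed
  obtain \<phi> where \<phi>: "coords E B \<phi>" by (rule E.coords_exist[OF sp B(3)])
  have "\<phi> b t \<in> R" if b: "b \<in> B" and t: "t \<in> T" for b t
  proof -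
    from subsetD[OF TB t] obtain r where r: "\<forall>b\<in>B. r b \<in> R" "t = (\<Sum>b\<in>B. r b \<cdot> b)"
      by (rule rspanE)
    then have "\<phi> b t = r b" using coordsD(3)[OF \<phi>, of r t b] b R_E by auto
    then show ?thesis using r b by simp
  qed
  moreover have "B \<subseteq> T" using BT R.rspan_superset[OF B(1)] by blast
  ultimately show ?thesis using \<phi> B(1) by (intro that[of B \<phi>]) (simp add: E_basis_def)
qed

lemma sum_const_sc: "finite A \<Longrightarrow> (\<Sum>a\<in>A. x) = sc (of_nat (card A)) * x"
proof (induction A rule: finite_induct)
  case (insert a A)
  have "sc (of_nat (card (insert a A))) * x = (sc 1 + sc (of_nat (card A))) * x"
    using insert by (simp add: sc_add[symmetric])
  then show ?case using insert by (simp add: sc_1 distrib_right)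
qed (simp add: sc_0)

text \<open>The average \<open>P\<close> of a projection of \<open>T\<close> onto a line over \<open>R\<close> lies in \<open>R\<close> and its trace over
  \<open>E\<close> is 1, so that the dimension of \<open>W\<close> over \<open>E\<close> is a unit.\<close>

lemma E_dimension_unit:
  assumes B: "E_basis B \<phi>"
  obtains P where "P \<in> R" "sc (of_nat (card B)) * P = 1"
proof -
  have fin: "finite B" and BT: "B \<subseteq> T" and co: "coords E B \<phi>" and int: "\<And>b t. b \<in> B \<Longrightarrow> t \<in> T \<Longrightarrow> \<phi> b t \<in> R"
    using B by (auto simp: E_basis_def)
  note C = coordsD[OF co]
  have "B \<noteq> {}"
  proof
    assume "B = {}"
    then have "w = 0" for w :: 'w using C(2)[of w] by simp
    then show False using nontriv by auto
  qed
  then obtain b0 where b0: "b0 \<in> B" by blast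
  define q where "q = Aend (\<lambda>w. \<phi> b0 w \<cdot> b0)"
  have q: "q \<cdot> w = \<phi> b0 w \<cdot> b0" for w
    unfolding q_def by (rule app_Aend) (simp add: C(4)[OF b0])
  \<comment> \<open>Traces over \<open>E\<close> are cyclic only for \<open>E\<close>-linear
    operators. Both \<open>q\<close> and all \<open>\<rho> h\<close> are such, so every conjugate of
    \<open>q\<close> has the trace of \<open>q\<close>.\<close>
  define CE where "CE = {x. \<forall>e\<in>E. x * e = e * x}"
  have CE_app: "x \<cdot> e \<cdot> w = e \<cdot> x \<cdot> w" if "x \<in> CE" "e \<in> E" for x e w
    using that by (simp add: CE_def times_app[symmetric])
  have CE_mult: "x * y \<in> CE" if "x \<in> CE" "y \<in> CE" for x y
    using that unfolding CE_def by (simp add: mult.assoc) (simp add: mult.assoc[symmetric])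
  have qCE: "q \<in> CE" unfolding CE_def
    by (auto intro!: aend_eqI simp: times_app q C(5)[OF b0])
  have rCE: "\<rho> h \<in> CE" if "h \<in> carrier Hg" for h using that E_rho by (simp add: CE_def)
  have q_lin: "q \<in> lin" using qCE sc_E by (auto simp: CE_def lin_def)
  define tr where "tr x = (\<Sum>b\<in>B. \<phi> b (x \<cdot> b))" for x
  have tr_comm: "tr (x * y) = tr (y * x)" if x: "x \<in> CE" and y: "y \<in> CE" for x y
  proof -
    have *: "\<phi> b ((x * y) \<cdot> b) = (\<Sum>c\<in>B. \<phi> c (y \<cdot> b) * \<phi> b (x \<cdot> c))" if x: "x \<in> CE" and b: "b \<in> B" for x y b
    proof -
      have add: "\<phi> b (sum g A) = (\<Sum>a\<in>A. \<phi> b (g a))" for g and A :: "'w set"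
        using C(5)[OF b E.zero_in, of 0] 
        by (induction A rule: infinite_finite_induct) (simp_all add: C(4)[OF b])
      have "(x * y) \<cdot> b = (\<Sum>c\<in>B. x \<cdot> \<phi> c (y \<cdot> b) \<cdot> c)"
        unfolding times_app by (subst C(2)[of "y \<cdot> b"]) (rule app_sum)
      also have "\<dots> = (\<Sum>c\<in>B. \<phi> c (y \<cdot> b) \<cdot> x \<cdot> c)"
        by (rule sum.cong[OF refl]) (simp add: CE_app[OF x C(1)])
      finally show ?thesis by (simp add: add C(1) C(5)[OF b])
    qed
    have "tr (x * y) = (\<Sum>b\<in>B. \<Sum>c\<in>B. \<phi> c (y \<cdot> b) * \<phi> b (x \<cdot> c))"
      unfolding tr_def using *[OF x] by simp
    also have "\<dots> = (\<Sum>c\<in>B. \<Sum>b\<in>B. \<phi> c (y \<cdot> b) * \<phi> b (x \<cdot> c))" by (rule sum.swap)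
    also have "\<dots> = (\<Sum>c\<in>B. \<Sum>b\<in>B. \<phi> b (x \<cdot> c) * \<phi> c (y \<cdot> b))"
      by (intro sum.cong refl E_comm C(1))
    also have "\<dots> = tr (y * x)" unfolding tr_def using *[OF y] by simp
    finally show ?thesis .
  qed
  have tr_q: "tr q = 1"
  proof -
    have "tr q = (\<Sum>b\<in>B. if b = b0 then 1 else 0)"
      unfolding tr_def using b0 fin
      by (intro sum.cong refl) (auto simp: q C(1) C(5) E.coords_basis[OF co])
    then show ?thesis using b0 fin by simp
  qed
  define P where "P = avg q"
  have PE: "P \<in> E" unfolding P_def by (rule avg_E[OF q_lin])
  have "P \<cdot> t \<in> T" if t: "t \<in> T" for t unfolding P_def
    by (rule avg_stable[OF T_sc T_add T_0 rho_T rho_T _ t]) (use b0 BT R_T int q in auto)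
  then have PR: "P \<in> R" using PE by (simp add: R_def)
  have "tr P = (\<Sum>b\<in>B. P)"
    unfolding tr_def using PE fin
    by (intro sum.cong refl) (simp add: C(5) E.coords_basis[OF co])
  then have trP: "tr P = sc (of_nat (card B)) * P" using sum_const_sc[OF fin] by simp
  have tr_add: "tr (sum g A) = (\<Sum>a\<in>A. tr (g a))" for g and A :: "'g set"
  proof -
    have z: "\<phi> b 0 = 0" if "b \<in> B" for b using C(5)[OF that E.zero_in, of 0] by simp
    show ?thesis
    by (induction A rule: infinite_finite_induct)
      (simp_all add: tr_def C(4) sum.distrib z)
  qed
  define k where "k = inverse (of_nat (card (carrier Hg)) :: 'k)"
  have tr_sc: "tr (sc k * x) = sc k * tr x" for x
    unfolding tr_def times_app sum_distrib_left by (intro sum.cong refl C(5) sc_E)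
  have tr_rho: "tr (\<rho> h * q * \<rho> (inv\<^bsub>Hg\<^esub> h)) = 1" if h: "h \<in> carrier Hg" for h
  proof -
    have "tr (\<rho> h * (q * \<rho> (inv\<^bsub>Hg\<^esub> h))) = tr (q * \<rho> (inv\<^bsub>Hg\<^esub> h) * \<rho> h)"
      by (intro tr_comm CE_mult qCE rCE h Hg.inv_closed)
    then show ?thesis using rho_inv(1)[OF h] tr_q by (simp add: mult.assoc)
  qed
  have "tr P = sc k * (\<Sum>h\<in>carrier Hg. 1)"
    unfolding P_def avg_def k_def[symmetric] tr_sc tr_add using tr_rho by simp
  also have "\<dots> = 1"
    unfolding sum_const_sc[OF H_fin] using H_unit by (simp add: k_def sc_mult[symmetric] sc_1)
  finally show ?thesis using that[OF PR] trP by simp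
qed

text \<open>The dimension is a unit of \<open>R\<close>, whereas a multiple of \<open>l = p\<close>
  is divisible by \<open>\<pi>\<close>.\<close>

lemma E_dimension_coprime:
  assumes B: "E_basis B \<phi>" and p: "p = of_nat l" and l: "prime l"
  shows "coprime (card B) l"
proof -
  have "\<not> l dvd card B"
  proof
    assume "l dvd card B"
    then obtain m where m: "card B = l * m" by auto
    obtain P where P: "P \<in> R" "sc (of_nat (card B)) * P = 1" by (rule E_dimension_unit[OF B])
    have O: "of_nat m \<in> \<O>" by (induction m) (auto intro: O_0 O_1 O_add)
    have "of_nat (card B) = p * of_nat m" by (simp add: m p)
    then have "1 = \<pi> * (sc (of_nat m) * P)" using P(2)
      by (simp only: \<pi>_def sc_mult mult.assoc)
    then have "\<pi>i = \<pi>i * \<pi> * (sc (of_nat m) * P)" by (metis mult.assoc mult_1_right)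
    then have "\<pi>i = sc (of_nat m) * P" by (simp add: pi_inverse)
    then show False using pii_not_R R.mult_in[OF sc_R[OF O] P(1)] by simp
  qed
  then show ?thesis using l prime_imp_coprime coprime_commute by blast
qed

lemma E_scalar_power_norm:
  assumes B: "E_basis B \<phi>" and u: "u * u' = 1" "u' * u = 1"
    and \<sigma>: "\<And>e. e \<in> E \<Longrightarrow> u * e * u' \<in> E" "\<And>e. e \<in> E \<Longrightarrow> u' * e * u \<in> E" and e: "u ^ N \<in> E"
  shows "\<exists>b\<in>E. b \<noteq> 0 \<and> twisted_norm u u' N b = (u ^ N) ^ card B"
proof -
  have fin: "finite B" and co: "coords E B \<phi>" using B by (auto simp: E_basis_def)
  note C = coordsD[OF co]
  obtain v where v: "bij_betw v {..<card B} B" using ex_bij_betw_nat_finite[OF fin] by (auto simp: atLeast0LessThan)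
  then have vB: "\<And>i. i < card B \<Longrightarrow> v i \<in> B" by (auto dest: bij_betwE)
  have "w = (\<Sum>i<card B. \<phi> (v i) w \<cdot> v i)" for w
    using C(2)[of w] sum.reindex_bij_betw[OF v, of "\<lambda>b. \<phi> b w \<cdot> b"] by simp
  then interpret op_field_basis E "card B" v "\<lambda>i. \<phi> (v i)"
    using one_neq_zero E_comm E_inv vB C(1,4,5) E.coords_basis[OF co fin]
      inj_on_eq_iff[OF bij_betw_imp_inj_on[OF v]]
    by unfold_locales auto
  show ?thesis by (rule scalar_power_norm[OF u \<sigma> e])
qed

end

section \<open>Invariant forms\<close>

text \<open>The sign \<open>\<epsilon>\<close> treats both kinds of forms at once: 1 for symmetric
  and -1 for alternating ones.\<close>

locale lattice_rep_form = lattice_rep_field scale \<O> p S T Hg \<rho>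
  for scale :: "'k::field \<Rightarrow> 'w::ab_group_add \<Rightarrow> 'w" and \<O> :: "'k set" and p S T
    and Hg :: "('g, 'm) monoid_scheme" and \<rho> :: "'g \<Rightarrow> 'w aend" +
  fixes f :: "'w \<Rightarrow> 'w \<Rightarrow> 'k" and \<epsilon> :: 'k
  assumes f_add1: "f (x + y) z = f x z + f y z" and f_add2: "f x (y + z) = f x y + f x z"
    and f_scale1: "f (scale a x) y = a * f x y" and f_scale2: "f x (scale a y) = a * f x y"
    and f_nondeg: "(\<And>y. f x y = 0) \<Longrightarrow> x = 0"
    and f_sym: "f y x = \<epsilon> * f x y" and eps: "\<epsilon> * \<epsilon> = 1"
    and f_inv: "h \<in> carrier Hg \<Longrightarrow> f (\<rho> h \<cdot> x) (\<rho> h \<cdot> y) = f x y"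
begin

lemma f_sc: "f (sc a \<cdot> x) y = a * f x y" "f x (sc a \<cdot> y) = a * f x y"
  by (simp_all add: sc_app f_scale1 f_scale2)

lemma f_0: "f 0 x = 0" "f x 0 = 0"
  using f_scale1[of 0 0 x] f_scale2[of x 0 0] by simp_all

lemma f_sum1: "f (sum g A) y = (\<Sum>a\<in>A. f (g a) y)"
  by (induction A rule: infinite_finite_induct) (simp_all add: f_0 f_add1)

lemma f_sum2: "f x (sum g A) = (\<Sum>a\<in>A. f x (g a))"
  by (induction A rule: infinite_finite_induct) (simp_all add: f_0 f_add2)

lemma f_minus: "f (- x) y = - f x y" "f x (- y) = - f x y"
  using f_add1[of x "- x" y] f_add2[of x y "- y"] by (simp_all add: f_0 eq_neg_iff_add_eq_0 add.commute)

lemma f_eqI: "(\<And>y. f x y = f x' y) \<Longrightarrow> x = x'"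
  using f_nondeg[of "x - x'"] f_add1[of "x - x'" x'] by simp

lemma f_eqI2: "(\<And>y. f y x = f y x') \<Longrightarrow> x = x'"
  by (rule f_eqI) (metis f_sym)

lemma span_S: "span S = UNIV"
proof -
  have "T \<subseteq> span S" unfolding T_gen by (auto intro: span_sum span_scale span_base)
  then have "span T \<subseteq> span S" by (metis span_mono span_span)
  then show ?thesis using T_span by auto
qed

text \<open>In finite dimension a nondegenerate form identifies \<open>W\<close> with its dual, so
  every bilinear form arises from \<open>f\<close> by an operator in the first argument.\<close>

lemma representing_op:
  assumes g: "\<And>x x' y. g (x + x') y = g x y + g x' y" "\<And>a x y. g (scale a x) y = a * g x y"
    "\<And>x y y'. g x (y + y') = g x y + g x y'" "\<And>a x y. g x (scale a y) = a * g x y"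
  obtains a where "a \<in> lin" "\<And>x y. g x y = f (a \<cdot> x) y"
proof -
  obtain B where B: "B \<subseteq> S" "independent B" "S \<subseteq> span B" by (rule maximal_independent_subset)
  have fin: "finite B" using B(1) S_fin finite_subset by blast
  have spB: "span B = UNIV"
  proof -
    have "span S \<subseteq> span B" using B(3) by (metis span_mono span_span)
    then show ?thesis using span_S by auto
  qed
  interpret fd: finite_dimensional_vector_space scale B
    by unfold_locales (use fin B spB in auto)
  have expand: "y = (\<Sum>b\<in>B. scale (representation B y b) b)" for y
    using sum_representation_eq[OF B(2) _ fin, of y] spB by simp
  have 0: "g x 0 = 0" for x using g(4)[of x 0 0] by simp
  have g_sum: "g x (sum k A) = (\<Sum>a\<in>A. g x (k a))" for x k and A :: "'w set"
    by (induction A rule: infinite_finite_induct) (simp_all add: 0 g)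
  \<comment> \<open>The functional \<open>f x\<close> is recorded by its values on the basis
    \<open>B\<close>, used as coordinates of a vector. This makes the map to the dual an
    endomorphism of \<open>W\<close>, for which injective implies surjective.\<close>
  define F where "F x = (\<Sum>b\<in>B. scale (f x b) b)" for x
  have "Vector_Spaces.linear scale scale F"
    by unfold_locales (simp_all add: F_def f_add1 f_scale1 scale_left_distrib sum.distrib scale_sum_right)
  moreover have "inj F"
  proof (rule injI)
    fix x x' assume "F x = F x'"
    then have "(\<Sum>b\<in>B. scale (f x b - f x' b) b) = 0" 
      by (simp add: F_def scale_left_diff_distrib sum_subtractf)
    then have *: "f x b = f x' b" if "b \<in> B" for b
      using independentD[OF B(2) fin subset_refl _ that, of "\<lambda>b. f x b - f x' b"] by simp
    show "x = x'"
    proof (rule f_eqI)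
      fix y
      have "f x (\<Sum>b\<in>B. scale (representation B y b) b) = f x' (\<Sum>b\<in>B. scale (representation B y b) b)"
        unfolding f_sum2 f_scale2 using * by simp
      then show "f x y = f x' y" using expand[of y] by simp
    qed
  qed
  ultimately have "surj F" by (rule fd.linear_inj_imp_surj)
  define a where "a x = inv_into UNIV F (\<Sum>b\<in>B. scale (g x b) b)" for x
  have Fa: "F (a x) = (\<Sum>b\<in>B. scale (g x b) b)" for x
    unfolding a_def by (rule surj_f_inv_f[OF \<open>surj F\<close>])
  have fa: "f (a x) b = g x b" if "b \<in> B" for x b
  proof -
    have "(\<Sum>b\<in>B. scale (f (a x) b - g x b) b) = 0" 
      using Fa[of x] unfolding F_def by (simp add: scale_left_diff_distrib sum_subtractf)
    then show ?thesis
      using independentD[OF B(2) fin subset_refl _ that, of "\<lambda>b. f (a x) b - g x b"] by simp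
  qed
  have fg: "f (a x) y = g x y" for x y
  proof -
    have "f (a x) (\<Sum>b\<in>B. scale (representation B y b) b) = g x (\<Sum>b\<in>B. scale (representation B y b) b)"
      unfolding f_sum2 f_scale2 g_sum g(4) using fa by simp
    then show ?thesis using expand[of y] by simp
  qed
  have add: "a (x + x') = a x + a x'" for x x' by (rule f_eqI) (simp add: fg f_add1 g)
  have app: "Aend a \<cdot> x = a x" for x by (rule app_Aend) (rule add)
  have "a (scale k x) = scale k (a x)" for k x by (rule f_eqI) (simp add: fg f_scale1 g)
  then have "Aend a \<in> lin" unfolding lin_def by (auto intro!: aend_eqI simp: times_app app sc_app)
  then show ?thesis by (rule that) (simp add: app fg)
qed

section \<open>Adjoints\<close>

lemma lin_scale: "x \<in> lin \<Longrightarrow> x \<cdot> scale a v = scale a (x \<cdot> v)"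
  using lin_sc[of x a] by (metis sc_app times_app)

definition adj :: "'w aend \<Rightarrow> 'w aend" where
  "adj x = (SOME y. y \<in> lin \<and> (\<forall>v w. f (x \<cdot> v) w = f v (y \<cdot> w)))"

lemma adj:
  assumes "x \<in> lin"
  shows "adj x \<in> lin" "f (x \<cdot> v) w = f v (adj x \<cdot> w)"
proof -
  obtain y where y: "y \<in> lin" "\<And>w v. f w (x \<cdot> v) = f (y \<cdot> w) v"
    by (rule representing_op[of "\<lambda>w v. f w (x \<cdot> v)"])
      (simp_all add: f_add1 f_add2 f_scale1 f_scale2 lin_scale[OF assms])
  have "f (x \<cdot> v) w = f v (y \<cdot> w)" for v w
    using y(2)[of w v] f_sym[of "x \<cdot> v" w] f_sym[of v "y \<cdot> w"] eps
    by (metis mult.assoc mult_1 f_sym)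
  then have "\<exists>y. y \<in> lin \<and> (\<forall>v w. f (x \<cdot> v) w = f v (y \<cdot> w))" using y(1) by blast
  from someI_ex[OF this] show "adj x \<in> lin" "f (x \<cdot> v) w = f v (adj x \<cdot> w)"
    unfolding adj_def by blast+
qed

lemma adj2: "x \<in> lin \<Longrightarrow> f v (x \<cdot> w) = f (adj x \<cdot> v) w"
  using adj(2)[of x w v] f_sym eps by (metis mult.assoc mult_1)

lemma adj_eqI: "x \<in> lin \<Longrightarrow> (\<And>v w. f (x \<cdot> v) w = f v (y \<cdot> w)) \<Longrightarrow> adj x = y"
  by (rule aend_eqI, rule f_eqI2) (simp add: adj(2)[symmetric])

lemma adj_adj: "x \<in> lin \<Longrightarrow> adj (adj x) = x"
  by (rule adj_eqI) (auto simp: adj adj2)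

lemma adj_mult: "x \<in> lin \<Longrightarrow> y \<in> lin \<Longrightarrow> adj (x * y) = adj y * adj x"
  by (rule adj_eqI) (auto simp: adj times_app)

lemma adj_add: "x \<in> lin \<Longrightarrow> y \<in> lin \<Longrightarrow> adj (x + y) = adj x + adj y"
  by (rule adj_eqI) (auto simp: adj f_add1 f_add2)

lemma adj_uminus: "x \<in> lin \<Longrightarrow> adj (- x) = - adj x"
  by (rule adj_eqI) (auto simp: adj f_minus)

lemma adj_sc: "adj (sc a) = sc a"
  by (rule adj_eqI) (auto simp: sc_lin f_sc)

lemma adj_1: "adj 1 = 1"
  using adj_sc[of 1] by (simp add: sc_1)

lemma adj_power: "x \<in> lin \<Longrightarrow> adj (x ^ n) = adj x ^ n"
  by (induction n) (simp_all add: adj_1 adj_mult lin.power_in power_commutes)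

lemma f_rho: "h \<in> carrier Hg \<Longrightarrow> f (\<rho> h \<cdot> v) w = f v (\<rho> (inv\<^bsub>Hg\<^esub> h) \<cdot> w)"
  using f_inv[of "inv\<^bsub>Hg\<^esub> h" "\<rho> h \<cdot> v" w] rho_inv(1)[of h] by (simp add: times_app[symmetric])

lemma adj_E: "x \<in> E \<Longrightarrow> adj x \<in> E"
proof -
  assume x: "x \<in> E"
  have "adj x * \<rho> h = \<rho> h * adj x" if h: "h \<in> carrier Hg" for h
  proof (rule aend_eqI, rule f_eqI2)
    fix w v
    have hi: "inv\<^bsub>Hg\<^esub> h \<in> carrier Hg" using h by simp
    have "f v ((adj x * \<rho> h) \<cdot> w) = f (x \<cdot> v) (\<rho> h \<cdot> w)" by (simp add: times_app adj E_lin x)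
    also have "\<dots> = f (\<rho> (inv\<^bsub>Hg\<^esub> h) \<cdot> x \<cdot> v) w" using f_rho[OF hi] h by simp
    also have "\<rho> (inv\<^bsub>Hg\<^esub> h) \<cdot> x \<cdot> v = x \<cdot> \<rho> (inv\<^bsub>Hg\<^esub> h) \<cdot> v"
      using E_rho[OF x hi] by (simp add: times_app[symmetric])
    also have "f (x \<cdot> \<rho> (inv\<^bsub>Hg\<^esub> h) \<cdot> v) w = f v ((\<rho> h * adj x) \<cdot> w)"
      using f_rho[OF hi] h by (simp add: times_app adj E_lin x)
    finally show "f v ((adj x * \<rho> h) \<cdot> w) = f v ((\<rho> h * adj x) \<cdot> w)" .
  qed
  then show ?thesis using adj(1)[OF E_lin[OF x]] by (simp add: E_def)
qed

text \<open>The set \<open>f(T, T)\<close> of values is bounded and nonzero, so a multiplier mapping it to itself is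
  integral.\<close>

definition values_T :: "'k set" where "values_T = {f s t | s t. s \<in> T \<and> t \<in> T}"

lemma values_T_multiplier:
  assumes a: "\<And>c. c \<in> values_T \<Longrightarrow> a * c \<in> values_T"
  shows "a \<in> \<O>"
proof (rule ccontr)
  assume "a \<notin> \<O>"
  then have ap: "inverse a / p \<in> \<O>" by (rule O_or_inverse)
  have a0: "a \<noteq> 0" using \<open>a \<notin> \<O>\<close> O_0 by auto
  have "\<exists>n. \<forall>c\<in>(\<lambda>(s, t). f s t) ` (S \<times> S). \<pi> ^ n * sc c \<in> sc ` \<O>"
    using K.bounded_family[of "(\<lambda>(s, t). f s t) ` (S \<times> S)" sc] S_fin by auto
  then obtain N where N0: "\<And>s t. s \<in> S \<Longrightarrow> t \<in> S \<Longrightarrow> \<pi> ^ N * sc (f s t) \<in> sc ` \<O>" by fast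
  have N: "p ^ N * f s t \<in> \<O>" if "s \<in> S" "t \<in> S" for s t
    using N0[OF that] sc_inj by (auto simp: pipow_sc sc_mult[symmetric] image_iff)
  have bounded: "p ^ N * c \<in> \<O>" if "c \<in> values_T" for c
  proof -
    obtain s t where st: "c = f s t" "s \<in> T" "t \<in> T" using \<open>c \<in> values_T\<close> by (auto simp: values_T_def)
    obtain x y where xy: "\<forall>b\<in>S. x b \<in> \<O>" "s = (\<Sum>b\<in>S. scale (x b) b)"
      "\<forall>b\<in>S. y b \<in> \<O>" "t = (\<Sum>b\<in>S. scale (y b) b)" using st unfolding T_gen by blast
    have O_sum: "sum g A \<in> \<O>" if "\<And>b. b \<in> A \<Longrightarrow> g b \<in> \<O>" for g and A :: "'w set"
      using that by (induction A rule: infinite_finite_induct) (auto intro: O_0 O_add)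
    have "p ^ N * c = (\<Sum>b\<in>S. \<Sum>b'\<in>S. x b * y b' * (p ^ N * f b b'))"
      unfolding st(1) xy(2,4) f_sum1 f_scale1 unfolding f_sum2 f_scale2 sum_distrib_left
      by (simp add: mult_ac)
    also have "\<dots> \<in> \<O>" using xy N by (intro O_sum O_mult[OF O_mult]) auto
    finally show ?thesis .
  qed
  obtain w :: 'w where "w \<noteq> 0" using nontriv by auto
  then obtain w' where w': "f w w' \<noteq> 0" using f_nondeg by blast
  obtain m where m: "\<forall>x\<in>{w, w'}. \<pi> ^ m \<cdot> x \<in> T" using T_bounded_family[of "{w, w'}" "\<lambda>x. x"] by auto
  define c where "c = f (\<pi> ^ m \<cdot> w) (\<pi> ^ m \<cdot> w')"
  have "c \<in> values_T" unfolding c_def values_T_def using m by blast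
  moreover have "c \<noteq> 0" using w' p_nz by (simp add: c_def pipow_sc f_sc)
  ultimately have c: "c \<in> values_T" "c \<noteq> 0" by auto
  \<comment> \<open>The elements \<open>a ^ k * c\<close> stay bounded while
    \<open>inverse a\<close> is divisible by \<open>p\<close>, so \<open>p ^ N * c\<close> would be
    divisible by every power of \<open>p\<close>.\<close>
  have "a ^ k * c \<in> values_T" for k
    by (induction k) (use c(1) in \<open>auto simp: mult.assoc a\<close>)
  then have "p ^ N * (a ^ k * c) \<in> \<O>" for k by (rule bounded)
  moreover have "(inverse a / p) ^ k \<in> \<O>" for k
    by (induction k) (simp_all only: power_0 power_Suc O_1 O_mult[OF ap])
  ultimately have "(inverse a / p) ^ k * (p ^ N * (a ^ k * c)) \<in> \<O>" for k by (blast intro: O_mult)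
  moreover have "(inverse a / p) ^ k * (p ^ N * (a ^ k * c)) = p ^ N * c / p ^ k" for k
    using a0 by (simp add: power_divide power_inverse field_simps)
  ultimately show False using O_separated[of "p ^ N * c"] c p_nz by auto
qed

lemma inv_p_notin: "inverse p \<notin> \<O>"
proof
  assume "inverse p \<in> \<O>"
  then have "\<pi>i \<in> R" unfolding \<pi>i_def by (rule sc_R)
  then show False using pii_not_R by simp
qed

lemma O_square: "a * a \<in> \<O> \<Longrightarrow> a \<in> \<O>"
proof (rule ccontr)
  assume a: "a * a \<in> \<O>" "a \<notin> \<O>"
  then have a0: "a \<noteq> 0" using O_0 by auto
  have "p * ((inverse a / p) * (inverse a / p) * (a * a)) \<in> \<O>"
    using a(1) O_or_inverse[OF a(2)] by (intro O_mult[OF p_O] O_mult[OF O_mult])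
  moreover have "p * ((inverse a / p) * (inverse a / p) * (a * a)) = inverse p"
    using a0 p_nz by (simp add: field_simps)
  ultimately show False using inv_p_notin by simp
qed

text \<open>By \<open>E_normalizer_scaling\<close>, \<open>x\<close> is \<open>inverse a\<close>
  times a unit of \<open>R\<close>, so the hypothesis makes the scalar \<open>inverse a\<close> a
  multiplier of \<open>values_T\<close> and hence integral.\<close>

lemma form_R:
  assumes x: "x \<in> E" and v: "\<And>s t. s \<in> T \<Longrightarrow> t \<in> T \<Longrightarrow> f (x \<cdot> s) t \<in> values_T"
  shows "x \<in> R"
proof (cases "x = 0")
  case False
  then obtain y where y: "y \<in> E" "y * x = 1" using E_inv x by blast
  have xy: "x * y = 1" using E_comm x y by metis
  obtain a where a: "a \<noteq> 0" "sc a * x \<in> R" "sc (inverse a) * y \<in> R"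
    by (rule E_normalizer_scaling[OF x y])
  have "inverse a \<in> \<O>"
  proof (rule values_T_multiplier)
    fix c assume "c \<in> values_T"
    then obtain s t where st: "c = f s t" "s \<in> T" "t \<in> T" by (auto simp: values_T_def)
    have "inverse a * c = f (x \<cdot> (sc (inverse a) * y) \<cdot> s) t"
    proof -
      have "x * (sc (inverse a) * y) = sc (inverse a)"
        using lin_sc[OF E_lin[OF x]] xy by (simp add: mult.assoc[symmetric]) (simp add: mult.assoc)
      then show ?thesis by (simp add: times_app[symmetric] f_sc st)
    qed
    then show "inverse a * c \<in> values_T" using v R_T[OF a(3)] st by simp
  qed
  then have "sc (inverse a) * (sc a * x) \<in> R" by (rule R.mult_in[OF sc_R a(2)])
  then show ?thesis using a(1) by (simp add: mult.assoc[symmetric] sc_mult[symmetric] sc_1)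
qed auto

text \<open>The lattice \<open>T\<close> need not be self-dual, so its stability under
  \<open>adj x\<close> is not formal; it is read off from the values of the form.\<close>

lemma adj_R: "x \<in> R \<Longrightarrow> adj x \<in> R"
proof (rule form_R)
  assume x: "x \<in> R"
  then show "adj x \<in> E" by (intro adj_E R_E)
  fix s t assume "s \<in> T" "t \<in> T"
  then show "f (adj x \<cdot> s) t \<in> values_T"
    unfolding values_T_def adj2[OF E_lin[OF R_E[OF x]], of s t, symmetric] using R_T[OF x] by blast
qed

section \<open>Self-adjoint units and norms\<close>

definition unit_R :: "'w aend \<Rightarrow> bool" where "unit_R x \<longleftrightarrow> x \<in> R \<and> (\<exists>y\<in>R. y * x = 1)"

lemma unit_RD: "unit_R x \<Longrightarrow> x \<in> R" by (simp add: unit_R_def)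

lemma R_comm: "x \<in> R \<Longrightarrow> y \<in> R \<Longrightarrow> x * y = y * x"
  using E_comm R_E by blast

lemma unit_R_inverse:
  assumes "unit_R x"
  obtains y where "unit_R y" "y * x = 1" "x * y = 1"
proof -
  obtain y where "y \<in> R" "y * x = 1" "x \<in> R" using assms by (auto simp: unit_R_def)
  then show ?thesis using R_comm[of x y] by (intro that[of y]) (auto simp: unit_R_def)
qed

lemma unit_R_mult: "unit_R x \<Longrightarrow> unit_R y \<Longrightarrow> unit_R (x * y)"
proof -
  assume x: "unit_R x" and y: "unit_R y"
  obtain x' where x': "unit_R x'" "x' * x = 1" using unit_R_inverse[OF x] by blast
  obtain y' where y': "unit_R y'" "y' * y = 1" using unit_R_inverse[OF y] by blast
  have "y' * x' * (x * y) = y' * (x' * x) * y" by (simp add: mult.assoc)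
  then have "y' * x' * (x * y) = 1" using x' y' by simp
  then show ?thesis using x y x' y' unit_RD unfolding unit_R_def by blast
qed

lemma unit_R_adj: "unit_R x \<Longrightarrow> unit_R (adj x)"
proof -
  assume x: "unit_R x"
  obtain x' where x': "unit_R x'" "x * x' = 1" using unit_R_inverse[OF x] by blast
  have "adj x' * adj x = 1"
    using adj_mult[of x x'] x' x adj_1 by (simp add: E_lin R_E unit_RD)
  then show ?thesis using x x' adj_R unit_RD unfolding unit_R_def by blast
qed

lemma unit_R_iff: "x \<in> R \<Longrightarrow> \<not> ord_ge 1 x \<Longrightarrow> unit_R x"
  using V.unit[of x] by (auto simp: ord_ge_def unit_R_def)

definition U0 :: "'w aend set" where "U0 = {x. unit_R x \<and> adj x = x}"
text \<open>The norms from the units of \<open>R\<close> for the involution \<open>adj\<close>; they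
  are squares when \<open>adj\<close> is trivial on \<open>R\<close>. Since
  \<open>f (s x) (s y) = f ((adj s * s) x) y\<close>, these are the multipliers \<open>a\<close> for
  which a unit of \<open>R\<close> carries the form \<open>f (a x) y\<close> to
  \<open>f\<close>.\<close>

definition Sq :: "'w aend set" where "Sq = {adj s * s | s. unit_R s}"

lemma U0_R: "x \<in> U0 \<Longrightarrow> x \<in> R" by (simp add: U0_def unit_RD)
lemma U0_lin: "x \<in> U0 \<Longrightarrow> x \<in> lin" by (simp add: U0_R R_E E_lin)
lemma U0_comm: "x \<in> U0 \<Longrightarrow> y \<in> U0 \<Longrightarrow> x * y = y * x" by (simp add: R_comm U0_R)

lemma U0_mult: "x \<in> U0 \<Longrightarrow> y \<in> U0 \<Longrightarrow> x * y \<in> U0"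
  using U0_lin[of x] U0_lin[of y] U0_comm[of x y]
  by (auto simp: U0_def unit_R_mult adj_mult)

lemma Sq_U0: "x \<in> Sq \<Longrightarrow> x \<in> U0"
proof -
  assume "x \<in> Sq"
  then obtain s where s: "x = adj s * s" "unit_R s" by (auto simp: Sq_def)
  have "s \<in> lin" using s(2) by (simp add: E_lin R_E unit_RD)
  then show ?thesis using s unit_R_mult[OF unit_R_adj] by (simp add: U0_def adj_mult adj_adj adj)
qed

lemma U0_inverse:
  assumes "x \<in> U0"
  obtains y where "y \<in> U0" "y * x = 1" "x * y = 1"
proof -
  have x: "unit_R x" "adj x = x" using assms by (auto simp: U0_def)
  obtain y where y: "unit_R y" "y * x = 1" "x * y = 1" by (rule unit_R_inverse[OF x(1)])
  have lin: "x \<in> lin" "y \<in> lin" using x y by (simp_all add: E_lin R_E unit_RD)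
  have "x * adj y = 1" using adj_mult[OF lin(2,1)] y(2) adj_1 x(2) by simp
  then have "adj y = y" using y(2) by (metis mult.assoc mult_1 mult_1_right)
  then show ?thesis using y by (intro that[of y]) (auto simp: U0_def)
qed

lemma Sq_square: "x \<in> U0 \<Longrightarrow> x * x \<in> Sq"
  by (auto simp: Sq_def U0_def intro!: exI[of _ x])

lemma Sq_mult: "x \<in> Sq \<Longrightarrow> y \<in> Sq \<Longrightarrow> x * y \<in> Sq"
proof -
  assume "x \<in> Sq" "y \<in> Sq"
  then obtain s t where st: "x = adj s * s" "unit_R s" "y = adj t * t" "unit_R t" by (auto simp: Sq_def)
  have R: "s \<in> R" "t \<in> R" "adj s \<in> R" "adj t \<in> R" using st adj_R unit_RD by auto
  have "adj s * s * (adj t * t) = adj t * adj s * (s * t)"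
    using R_comm[OF R.mult_in[OF R(3,1)] R(4)] by (simp add: mult.assoc[symmetric])
  also have "\<dots> = adj (s * t) * (s * t)" using R by (simp add: adj_mult E_lin R_E)
  finally show ?thesis using st unit_R_mult by (auto simp: Sq_def)
qed

lemma Sq_cancel: "x \<in> U0 \<Longrightarrow> y \<in> Sq \<Longrightarrow> x * y \<in> Sq \<Longrightarrow> x \<in> Sq"
proof -
  assume x: "x \<in> U0" and y: "y \<in> Sq" and xy: "x * y \<in> Sq"
  obtain z where z: "z \<in> U0" "z * y = 1" "y * z = 1" using U0_inverse[OF Sq_U0[OF y]] by blast
  have "x * y * (y * (z * z)) = x * (y * (y * z) * z)" by (simp add: mult.assoc)
  also have "\<dots> = x" using z by (simp add: mult.assoc)
  finally show ?thesis using Sq_mult[OF xy Sq_mult[OF y Sq_square[OF z(1)]]] by simp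
qed

text \<open>Membership in \<open>Sq\<close> depends only on the residue class. The quotient of
  \<open>x\<close> by \<open>y\<close> is 1 modulo \<pi>, so by Hensel's lemma it is the square of
  some \<open>s\<close> that is 1 modulo \<pi>. As \<open>s * s\<close> is self-adjoint,
  \<open>adj s\<close> is \<open>s\<close> or \<open>- s\<close>; the latter is impossible because
  \<open>adj s\<close> is 1 modulo \<pi> too and 2 is a unit.\<close>

lemma Sq_residue:
  assumes x: "x \<in> U0" and y: "y \<in> Sq" and xy: "ord_ge 1 (x - y)"
  shows "x \<in> Sq"
proof -
  obtain y' where y': "y' \<in> U0" "y' * y = 1" "y * y' = 1" using U0_inverse[OF Sq_U0[OF y]] by blast
  define z where "z = \<pi>i * (y' * (x - y))"
  have zR: "z \<in> R" using ord_ge_multR(2)[OF xy U0_R[OF y'(1)]] by (simp add: z_def ord_ge_def)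
  have z1: "1 + \<pi> * z = y' * x"
    using y' by (simp add: z_def mult.assoc[symmetric] pi_inverse right_diff_distrib)
  obtain s where s: "s \<in> R" "s * s = 1 + \<pi> * z" "ord_ge 1 (s - 1)" by (rule R_sqrt[OF zR])
  have sl: "s \<in> lin" and asR: "adj s \<in> R" using s(1) adj_R by (auto simp: E_lin R_E)
  have "adj (s * s) = s * s"
    unfolding s(2) z1 using U0_mult[OF y'(1) x] by (simp add: U0_def)
  then have "(s - adj s) * (s + adj s) = 0"
    using R_comm[OF s(1) asR] by (simp add: adj_mult sl algebra_simps)
  then consider "s = adj s" | "adj s = - s"
    using E_nz_div[of "s - adj s" "s + adj s"] s(1) asR R_E
    by (auto simp: eq_neg_iff_add_eq_0 add.commute)
  then have ss: "adj s = s"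
  proof cases
    case 2
    have "ord_ge 1 (adj (s - 1))"
    proof -
      have "adj (s - 1) = \<pi> * adj (\<pi>i * (s - 1))"
      proof -
        have "\<pi>i * (s - 1) \<in> lin" using s(3) by (simp add: ord_ge_def R_E E_lin)
        then have "adj (\<pi> * (\<pi>i * (s - 1))) = adj (\<pi>i * (s - 1)) * \<pi>"
          using adj_mult[OF pi_lin(1)] by (simp add: \<pi>_def adj_sc)
        also have "\<dots> = \<pi> * adj (\<pi>i * (s - 1))"
          using pi_comm1(1) adj(1)[OF \<open>\<pi>i * (s - 1) \<in> lin\<close>] by simp
        finally show ?thesis by (simp add: mult.assoc[symmetric] pi_inverse)
      qed
      then show ?thesis using s(3) adj_R ord_ge_multR(1)[OF ord_ge_pi] by (simp add: ord_ge_def)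
    qed
    moreover have "adj (s - 1) = - s - 1"
      using adj_add[OF sl lin.uminus_in[OF lin.one_in]] 2 by (simp add: adj_uminus adj_1)
    ultimately have "ord_ge 1 (- s - 1)" by simp
    then have "ord_ge 1 (- s - 1 + (s - 1))" by (rule ord_ge_add[OF _ s(3)])
    then have "ord_ge 1 (- (sc (inverse 2)) * (- s - 1 + (s - 1)))"
      using half_O by (intro ord_ge_multR) (auto intro: sc_R)
    also have "- (sc (inverse 2)) * (- s - 1 + (s - 1)) = sc (inverse 2 + inverse 2)"
      unfolding sc_add by (simp add: algebra_simps)
    also have "inverse 2 + inverse 2 = (1::'k)" using two_nz by (simp add: field_simps)
    finally have "\<pi>i \<in> R" by (simp add: ord_ge_def sc_1)
    then show ?thesis using pii_not_R by simp
  qed simp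
  have "y * (s * s) = x" unfolding s(2) z1 using y' by (simp add: mult.assoc[symmetric])
  moreover have "unit_R s"
  proof -
    have "unit_R (s * s)" unfolding s(2) z1 using U0_mult[OF y'(1) x] by (simp add: U0_def)
    then obtain r where "r \<in> R" "r * (s * s) = 1" by (auto simp: unit_R_def)
    then show ?thesis using s(1) by (auto simp: unit_R_def mult.assoc[symmetric] intro!: bexI[of _ "r * s"])
  qed
  then have "s * s \<in> Sq" using ss by (intro Sq_square) (simp add: U0_def)
  ultimately show ?thesis using Sq_mult[OF y] by metis
qed

end

lemma card_le_fibres:
  assumes "finite A" "\<And>x. x \<in> A \<Longrightarrow> card {y \<in> A. g y = g x} \<le> k"
  shows "card A \<le> k * card (g ` A)"
proof -
  have "card A = (\<Sum>x\<in>A. 1)" by simp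
  also have "\<dots> = (\<Sum>z\<in>g ` A. \<Sum>x\<in>{x \<in> A. g x = z}. 1)" by (rule sum.image_gen[OF assms(1)])
  also have "\<dots> \<le> (\<Sum>z\<in>g ` A. k)" using assms(2) by (intro sum_mono) auto
  finally show ?thesis by (simp add: mult.commute)
qed

context lattice_rep_form
begin

text \<open>Modulo \<pi> an element of \<open>R\<close> is determined by the images of the
  generators \<open>S\<close> in \<open>T/\<pi>T\<close>, which is finite; \<open>\<kappa>\<close>
  records representatives of these images.\<close>

lemma R_residue_finite:
  obtains \<kappa> :: "'w aend \<Rightarrow> 'w \<Rightarrow> 'w" and Z where "finite Z" "\<kappa> ` R \<subseteq> Z"
    "\<forall>x\<in>R. \<forall>y\<in>R. \<kappa> x = \<kappa> y \<longrightarrow> ord_ge 1 (x - y)"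
proof -
  obtain Y where Y: "finite Y" "\<forall>x\<in>\<O>. \<exists>y\<in>Y. (x - y) / p \<in> \<O>" using O_finite by blast
  define V where "V = (\<lambda>c. \<Sum>s\<in>S. scale (c s) s) ` (S \<rightarrow>\<^sub>E Y)"
  have V: "finite V" unfolding V_def using S_fin Y(1) by (intro finite_imageI finite_PiE) auto
  have "\<exists>v\<in>V. \<pi>i \<cdot> (t - v) \<in> T" if "t \<in> T" for t
  proof -
    obtain c where c: "\<forall>s\<in>S. c s \<in> \<O>" "t = (\<Sum>s\<in>S. scale (c s) s)" using \<open>t \<in> T\<close> unfolding T_gen by blast
    have "\<forall>s\<in>S. \<exists>y. y \<in> Y \<and> (c s - y) / p \<in> \<O>" using c(1) Y(2) by blast
    then obtain d where d: "\<forall>s\<in>S. d s \<in> Y \<and> (c s - d s) / p \<in> \<O>" by (rule bchoice[THEN exE])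
    define v where "v = (\<Sum>s\<in>S. scale (restrict d S s) s)"
    have "v \<in> V" unfolding V_def v_def using d by (intro imageI) auto
    moreover have "\<pi>i \<cdot> (t - v) = (\<Sum>s\<in>S. scale ((c s - d s) / p) s)"
      unfolding c(2) v_def \<pi>i_def sc_app
      by (simp add: sum_subtractf[symmetric] scale_left_diff_distrib[symmetric] scale_sum_right
          divide_inverse mult.commute)
    moreover have "(\<Sum>s\<in>S. scale ((c s - d s) / p) s) \<in> T"
      unfolding T_gen using d by (intro CollectI exI[of _ "\<lambda>s. (c s - d s) / p"]) auto
    ultimately show ?thesis by metis
  qed
  then have "\<forall>t\<in>T. \<exists>v. v \<in> V \<and> \<pi>i \<cdot> (t - v) \<in> T" by blast
  then obtain r where r: "\<forall>t\<in>T. r t \<in> V \<and> \<pi>i \<cdot> (t - r t) \<in> T" by (rule bchoice[THEN exE])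
  have ST: "S \<subseteq> T" unfolding T_rspan using K.R.rspan_superset S_fin by auto
  define \<kappa> where "\<kappa> x = restrict (\<lambda>s. r (x \<cdot> s)) S" for x
  show ?thesis
  proof (rule that[of "S \<rightarrow>\<^sub>E V" \<kappa>]; (intro ballI impI)?)
    show "finite (S \<rightarrow>\<^sub>E V)" using S_fin V by (intro finite_PiE) auto
    show "\<kappa> ` R \<subseteq> S \<rightarrow>\<^sub>E V" using r ST R_T by (auto simp: \<kappa>_def)
    fix x y assume xy: "x \<in> R" "y \<in> R" "\<kappa> x = \<kappa> y"
    define z where "z = \<pi>i * (x - y)"
    have zE: "z \<in> E" unfolding z_def using xy pi_E R_E by (intro E.mult_in E.diff_in) auto
    have zs: "z \<cdot> s \<in> T" if s: "s \<in> S" for s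
    proof -
      have "r (x \<cdot> s) = r (y \<cdot> s)" using fun_cong[OF xy(3), of s] s by (simp add: \<kappa>_def)
      moreover have "x \<cdot> s \<in> T" "y \<cdot> s \<in> T" using xy R_T ST s by auto
      ultimately have "\<pi>i \<cdot> (x \<cdot> s - r (x \<cdot> s)) - \<pi>i \<cdot> (y \<cdot> s - r (x \<cdot> s)) \<in> T"
        using r by (intro T_diff) auto
      then show ?thesis by (simp add: z_def times_app)
    qed
    have "z \<cdot> t \<in> T" if "t \<in> T" for t
    proof -
      obtain c where c: "\<forall>s\<in>S. c s \<in> \<O>" "t = (\<Sum>s\<in>S. scale (c s) s)" using \<open>t \<in> T\<close> unfolding T_gen by blast
      have "z \<cdot> t = (\<Sum>s\<in>S. sc (c s) \<cdot> z \<cdot> s)"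
        unfolding c(2) app_sum lin_scale[OF E_lin[OF zE]] sc_app ..
      then show ?thesis using c(1) zs by (auto intro!: T_sum T_sc)
    qed
    then show "ord_ge 1 (x - y)" using zE by (simp add: ord_ge_def R_def z_def)
  qed
qed

lemma ord_ge_1_prime: "x \<in> R \<Longrightarrow> y \<in> R \<Longrightarrow> ord_ge 1 (x * y) \<Longrightarrow> ord_ge 1 x \<or> ord_ge 1 y"
proof (rule ccontr)
  assume *: "x \<in> R" "y \<in> R" "ord_ge 1 (x * y)" "\<not> (ord_ge 1 x \<or> ord_ge 1 y)"
  then have "unit_R (x * y)" by (intro unit_R_mult unit_R_iff) auto
  then obtain z where "z \<in> R" "z * (x * y) = 1" by (auto simp: unit_R_def)
  then have "ord_ge 1 1" using ord_ge_multR(2)[OF *(3)] by metis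
  then show False using pii_not_R by (simp add: ord_ge_def)
qed

text \<open>The squares have index at most two in the units of a finite field of odd characteristic.
  Here the finite field is the residue field of the subring of \<open>R\<close> fixed by \<open>adj\<close>.\<close>

lemma Sq_index:
  assumes a: "a \<in> U0" "a \<notin> Sq" and b: "b \<in> U0" "b \<notin> Sq"
  shows "a * b \<in> Sq"
proof (rule ccontr)
  assume ab: "a * b \<notin> Sq"
  define cls where "cls x = {y \<in> U0. ord_ge 1 (x - y)}" for x
  have cls_refl: "x \<in> cls x" if "x \<in> U0" for x using that by (simp add: cls_def ord_ge_def)
  have cls_eq: "cls x = cls y \<longleftrightarrow> ord_ge 1 (x - y)" if xy: "x \<in> U0" "y \<in> U0" for x y
  proof
    assume "cls x = cls y"
    then have "y \<in> cls x" using cls_refl[OF xy(2)] by simp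
    then show "ord_ge 1 (x - y)" by (simp add: cls_def)
  next
    assume o: "ord_ge 1 (x - y)"
    have "ord_ge 1 (x - z) \<longleftrightarrow> ord_ge 1 (y - z)" for z
      using ord_ge_add[OF o, of "y - z"] ord_ge_diff[OF _ o, of "x - z"] by auto
    then show "cls x = cls y" by (simp add: cls_def)
  qed
  obtain \<kappa> :: "'w aend \<Rightarrow> 'w \<Rightarrow> 'w" and Z where \<kappa>: "finite Z" "\<kappa> ` R \<subseteq> Z"
    "\<forall>x\<in>R. \<forall>y\<in>R. \<kappa> x = \<kappa> y \<longrightarrow> ord_ge 1 (x - y)"
    by (rule R_residue_finite)
  define Q where "Q = cls ` U0"
  have Q_fin: "finite Q"
  proof -
    have "cls x = cls (inv_into U0 \<kappa> (\<kappa> x))" if x: "x \<in> U0" for x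
    proof -
      have "inv_into U0 \<kappa> (\<kappa> x) \<in> U0" "\<kappa> (inv_into U0 \<kappa> (\<kappa> x)) = \<kappa> x"
        using x by (auto intro: inv_into_into f_inv_into_f)
      then show ?thesis using \<kappa>(3) x U0_R by (subst cls_eq) auto
    qed
    then have "Q \<subseteq> (\<lambda>k. cls (inv_into U0 \<kappa> k)) ` Z" using \<kappa>(2) U0_R by (fastforce simp: Q_def)
    then show ?thesis using \<kappa>(1) finite_surj by blast
  qed
  define rep where "rep q = (SOME x. x \<in> U0 \<and> cls x = q)" for q
  have rep: "rep q \<in> U0" "cls (rep q) = q" if q: "q \<in> Q" for q
  proof -
    have "\<exists>x. x \<in> U0 \<and> cls x = q" using q by (auto simp: Q_def)
    from someI_ex[OF this] show "rep q \<in> U0" "cls (rep q) = q" by (auto simp: rep_def)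
  qed
  define sq where "sq q = cls (rep q * rep q)" for q
  have sqQ: "sq q \<in> Q" if "q \<in> Q" for q using rep[OF that] by (auto simp: sq_def Q_def intro: U0_mult)
  define Y where "Y = sq ` Q"
  have YQ: "Y \<subseteq> Q" using sqQ by (auto simp: Y_def)
  have uminus_U0: "- x \<in> U0" if "x \<in> U0" for x
  proof -
    obtain y where y: "y \<in> R" "y * x = 1" using \<open>x \<in> U0\<close> by (auto simp: U0_def unit_R_def)
    have "- y * - x = 1" using y by simp
    then have "unit_R (- x)" unfolding unit_R_def using y U0_R[OF that] R.uminus_in by blast
    then show ?thesis using that by (simp add: U0_def adj_uminus U0_lin)
  qed
  have fib: "card {q' \<in> Q. sq q' = sq q} \<le> 2" if q: "q \<in> Q" for q
  proof -
    \<comment> \<open>As \<pi> is prime in \<open>R\<close>, classes with equal squares differ by a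
      sign only.\<close>
    have "{q' \<in> Q. sq q' = sq q} \<subseteq> {q, cls (- rep q)}"
    proof
      fix q' assume "q' \<in> {q' \<in> Q. sq q' = sq q}"
      then have q': "q' \<in> Q" "sq q' = sq q" by auto
      define x y where "x = rep q'" and "y = rep q"
      have xy: "x \<in> U0" "y \<in> U0" using rep q q' by (auto simp: x_def y_def)
      have "cls (x * x) = cls (y * y)" using q'(2) unfolding sq_def x_def y_def .
      then have "ord_ge 1 (x * x - y * y)"
        using cls_eq[OF U0_mult[OF xy(1,1)] U0_mult[OF xy(2,2)]] by blast
      also have "x * x - y * y = (x - y) * (x + y)" using U0_comm[OF xy] by (simp add: algebra_simps)
      finally have "ord_ge 1 (x - y) \<or> ord_ge 1 (x + y)"
        using xy U0_R by (intro ord_ge_1_prime) auto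
      then have "cls x = cls y \<or> cls x = cls (- y)"
        using cls_eq[OF xy] cls_eq[OF xy(1) uminus_U0[OF xy(2)]] by auto
      then show "q' \<in> {q, cls (- rep q)}" using rep(2) q q' by (auto simp: x_def y_def)
    qed
    then have "card {q' \<in> Q. sq q' = sq q} \<le> card {q, cls (- rep q)}" by (intro card_mono) auto
    also have "\<dots> \<le> 2" by (simp add: card_insert_if)
    finally show ?thesis .
  qed
  have QY: "card Q \<le> 2 * card Y" unfolding Y_def by (rule card_le_fibres[OF Q_fin fib])
  have rep_Y: "rep y \<in> Sq" if y: "y \<in> Y" for y
  proof -
    obtain q where q: "q \<in> Q" "y = sq q" using y by (auto simp: Y_def)
    have yQ: "y \<in> Q" using y YQ by auto
    have "ord_ge 1 (rep y - rep q * rep q)"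
      using cls_eq[OF rep(1)[OF yQ] U0_mult[OF rep(1)[OF q(1)] rep(1)[OF q(1)]]] rep(2)[OF yQ] q by (simp add: sq_def)
    then show ?thesis using Sq_residue[OF rep(1)[OF yQ] Sq_square[OF rep(1)[OF q(1)]]] by simp
  qed
  \<comment> \<open>If 1, \<open>a\<close> and \<open>b\<close> were in different classes modulo
    \<open>Sq\<close>, the translates by them of the set \<open>Y\<close> of squares would be
    disjoint, so that \<open>3 * card Y \<le> card Q \<le> 2 * card Y\<close>.\<close>
  define tr where "tr c y = cls (c * rep y)" for c y
  have trQ: "tr c ` Y \<subseteq> Q" if "c \<in> U0" for c
    unfolding tr_def Q_def using that rep(1) YQ by (auto intro!: imageI U0_mult)
  have tr_inj: "inj_on (tr c) Y" if c: "c \<in> U0" for c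
  proof (rule inj_onI)
    fix y y' assume y: "y \<in> Y" "y' \<in> Y" "tr c y = tr c y'"
    have r: "rep y \<in> U0" "rep y' \<in> U0" using rep y YQ by auto
    have o: "ord_ge 1 (c * rep y - c * rep y')"
      using y(3) cls_eq[OF U0_mult[OF c r(1)] U0_mult[OF c r(2)]] by (simp add: tr_def)
    obtain d where d: "d \<in> U0" "d * c = 1" using U0_inverse[OF c] by blast
    have "d * (c * rep y - c * rep y') = rep y - rep y'"
      using d(2) by (simp add: right_diff_distrib mult.assoc[symmetric])
    then have "ord_ge 1 (rep y - rep y')" using ord_ge_multR(2)[OF o U0_R[OF d(1)]] by simp
    then show "y = y'" using cls_eq[OF r] rep(2) y YQ by auto
  qed
  have tr_disj: "False" if c: "c \<in> U0" and d: "d \<in> U0" "c * d \<notin> Sq" and y: "y \<in> Y" "y' \<in> Y" "tr c y = tr d y'" for c d y y'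
  proof -
    have r: "rep y \<in> Sq" "rep y' \<in> Sq" using rep_Y y by auto
    note r0 = Sq_U0[OF r(1)] Sq_U0[OF r(2)]
    have o: "ord_ge 1 (c * rep y - d * rep y')"
      using y(3) cls_eq[OF U0_mult[OF c r0(1)] U0_mult[OF d(1) r0(2)]] by (simp add: tr_def)
    have "ord_ge 1 (d * (c * rep y - d * rep y'))" by (rule ord_ge_multR(2)[OF o U0_R[OF d(1)]])
    also have "d * (c * rep y - d * rep y') = c * d * rep y - d * d * rep y'"
      using U0_comm[OF c d(1)] by (simp add: right_diff_distrib mult.assoc[symmetric])
    finally have "c * d * rep y \<in> Sq"
      by (rule Sq_residue[OF U0_mult[OF U0_mult[OF c d(1)] r0(1)] Sq_mult[OF Sq_square[OF d(1)] r(2)]])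
    then have "c * d \<in> Sq" by (rule Sq_cancel[OF U0_mult[OF c d(1)] r(1)])
    then show False using d(2) by simp
  qed
  have one: "1 \<in> U0" unfolding U0_def unit_R_def using adj_1 by (auto intro!: bexI[of _ 1])
  have fin: "finite Y" using Q_fin YQ finite_subset by blast
  have d1: "tr 1 ` Y \<inter> tr a ` Y = {}" using tr_disj[OF one a(1)] a(2) by auto
  have d2: "(tr 1 ` Y \<union> tr a ` Y) \<inter> tr b ` Y = {}"
  proof (intro equals0I; elim IntE UnE imageE)
    fix z y y' assume "z = tr b y" "y \<in> Y" "z = tr 1 y'" "y' \<in> Y"
    then show False using tr_disj[OF one b(1)] b(2) by simp
  next
    fix z y y' assume "z = tr b y" "y \<in> Y" "z = tr a y'" "y' \<in> Y"
    then show False using tr_disj[OF a(1) b(1) ab] by simp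
  qed
  have "card (tr 1 ` Y \<union> tr a ` Y \<union> tr b ` Y) = card Y + card Y + card Y"
    using d1 d2 fin tr_inj[OF one] tr_inj[OF a(1)] tr_inj[OF b(1)]
    by (simp add: card_Un_disjoint card_image)
  moreover have "card (tr 1 ` Y \<union> tr a ` Y \<union> tr b ` Y) \<le> card Q"
    using trQ one a b Q_fin by (intro card_mono) auto
  moreover have "card Y > 0" using one fin by (auto simp: card_gt_0_iff Y_def Q_def)
  ultimately show False using QY by simp
qed

section \<open>Isometric normalizers\<close>

definition normalizes :: "('g \<Rightarrow> 'g) \<Rightarrow> 'w aend \<Rightarrow> 'w aend \<Rightarrow> bool" where
  "normalizes \<kappa> u u' \<longleftrightarrow> u \<in> lin \<and> u' \<in> lin \<and> u * u' = 1 \<and> u' * u = 1 \<and>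
     (\<forall>h\<in>carrier Hg. u * \<rho> h = \<rho> (\<kappa> h) * u)"

lemma normalizesD:
  assumes "normalizes \<kappa> u u'"
  shows "u \<in> lin" "u' \<in> lin" "u * u' = 1" "u' * u = 1"
    "\<And>h. h \<in> carrier Hg \<Longrightarrow> u * \<rho> h = \<rho> (\<kappa> h) * u"
  using assms by (auto simp: normalizes_def)

lemma normalizes_conj:
  assumes u: "normalizes \<kappa> u u'" and \<kappa>: "bij_betw \<kappa> (carrier Hg) (carrier Hg)" and x: "x \<in> E"
  shows "u * x * u' \<in> E" "u' * x * u \<in> E"
proof -
  note D = normalizesD[OF u]
  have lin: "u * x * u' \<in> lin" "u' * x * u \<in> lin" using D E_lin[OF x] by auto
  have uu: "u' * (u * z) = z" "u * (u' * z) = z" for z using D by (simp_all add: mult.assoc[symmetric])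
  have r: "\<rho> (\<kappa> h) = u * \<rho> h * u'" if "h \<in> carrier Hg" for h
    using D(5)[OF that] D(3) by (simp add: mult.assoc)
  have \<kappa>h: "\<kappa> h \<in> carrier Hg" if "h \<in> carrier Hg" for h using \<kappa> that by (auto dest: bij_betwE)
  have "u * x * u' * \<rho> h = \<rho> h * (u * x * u')" if h: "h \<in> carrier Hg" for h
  proof -
    obtain k where k: "k \<in> carrier Hg" "h = \<kappa> k" using \<kappa> h by (auto simp: bij_betw_def)
    have "u * x * u' * \<rho> h = u * (x * \<rho> k) * u'" unfolding k(2) r[OF k(1)] by (simp add: mult.assoc uu)
    also have "\<dots> = \<rho> h * (u * x * u')" unfolding k(2) r[OF k(1)] E_rho[OF x k(1)] by (simp add: mult.assoc uu)
    finally show ?thesis .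
  qed
  then show "u * x * u' \<in> E" using lin by (simp add: E_def)
  have "u' * x * u * \<rho> h = \<rho> h * (u' * x * u)" if h: "h \<in> carrier Hg" for h
  proof -
    have "u' * x * u * \<rho> h = u' * (x * \<rho> (\<kappa> h)) * u" unfolding r[OF h] by (simp add: mult.assoc uu D)
    also have "\<dots> = \<rho> h * (u' * x * u)" unfolding E_rho[OF x \<kappa>h[OF h]] unfolding r[OF h] by (simp add: mult.assoc uu)
    finally show ?thesis .
  qed
  then show "u' * x * u \<in> E" using lin by (simp add: E_def)
qed

lemma normalizes_scaling:
  assumes u: "normalizes \<kappa> u u'" and \<kappa>: "bij_betw \<kappa> (carrier Hg) (carrier Hg)"
  obtains a where "a \<noteq> 0" "\<forall>t\<in>T. sc a \<cdot> u \<cdot> t \<in> T" "\<forall>t\<in>T. sc (inverse a) \<cdot> u' \<cdot> t \<in> T"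
proof (rule normalizer_scaling[OF normalizesD(1-4)[OF u]])
  fix h assume "h \<in> carrier Hg"
  then obtain k where "k \<in> carrier Hg" "h = \<kappa> k" using \<kappa> by (auto simp: bij_betw_def)
  then show "\<exists>k\<in>carrier Hg. \<rho> h * u = u * \<rho> k" using normalizesD(5)[OF u] by auto
qed (use that in blast)

lemma power_inverse_E:
  assumes inv: "u * u' = 1" "u' * u = 1" and e: "u ^ N \<in> E"
  shows "u' ^ N \<in> E"
proof -
  have e': "u' ^ N * u ^ N = 1" "u ^ N * u' ^ N = 1" using inverse_power inv by auto
  have "u ^ N \<noteq> 0" using e' one_neq_zero by auto
  then obtain e'' where e'': "e'' \<in> E" "e'' * u ^ N = 1" using E_inv e by blast
  have "e'' = e'' * u ^ N * u' ^ N" using e' by (simp add: mult.assoc)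
  then show ?thesis using e'' by simp
qed

text \<open>The form \<open>f(ux, uy)\<close> is \<open>f(ax, y)\<close> for a unit \<open>a\<close> of the subring of \<open>R\<close> fixed by \<open>adj\<close>, and
  \<open>\<Prod>\<^sub>k u\<^sup>-\<^sup>k a u\<^sup>k\<close>, over \<open>k < N\<close>, lies in \<open>Sq\<close>. As \<open>N\<close> is odd, so does \<open>a\<close>.\<close>

lemma isometric_normalizer:
  assumes u0: "normalizes \<kappa> u0 u0'" and \<kappa>: "bij_betw \<kappa> (carrier Hg) (carrier Hg)"
    and N: "odd N" "\<And>u u'. normalizes \<kappa> u u' \<Longrightarrow> u ^ N \<in> E"
  obtains u u' where "normalizes \<kappa> u u'" "\<And>x y. f (u \<cdot> x) (u \<cdot> y) = f x y"
proof -
  obtain k where k: "k \<noteq> 0" "\<forall>t\<in>T. sc k \<cdot> u0 \<cdot> t \<in> T" "\<forall>t\<in>T. sc (inverse k) \<cdot> u0' \<cdot> t \<in> T"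
    by (rule normalizes_scaling[OF u0 \<kappa>])
  \<comment> \<open>Scaling by an element of \<open>K\<close> keeps the intertwining property and
    makes \<open>u\<close> map \<open>T\<close> onto itself.\<close>
  define u u' where "u = sc k * u0" and "u' = sc (inverse k) * u0'"
  have uT: "u \<cdot> t \<in> T" "u' \<cdot> t \<in> T" if "t \<in> T" for t using k that by (auto simp: u_def u'_def times_app)
  note D0 = normalizesD[OF u0]
  have kk: "sc k * sc (inverse k) = 1" "sc (inverse k) * sc k = 1" using k(1) by (simp_all add: sc_mult[symmetric] sc_1)
  have inv: "u * u' = 1" "u' * u = 1"
  proof -
    have "u * u' = sc k * (u0 * sc (inverse k)) * u0'" by (simp add: u_def u'_def mult.assoc)
    also have "\<dots> = sc k * sc (inverse k) * (u0 * u0')" unfolding lin_sc[OF D0(1)] by (simp add: mult.assoc)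
    finally show "u * u' = 1" using kk D0 by simp
    have "u' * u = sc (inverse k) * (u0' * sc k) * u0" by (simp add: u_def u'_def mult.assoc)
    also have "\<dots> = sc (inverse k) * sc k * (u0' * u0)" unfolding lin_sc[OF D0(2)] by (simp add: mult.assoc)
    finally show "u' * u = 1" using kk D0 by simp
  qed
  have ulin: "u \<in> lin" "u' \<in> lin" unfolding u_def u'_def using D0 sc_lin by auto
  have kap: "\<kappa> h \<in> carrier Hg" if "h \<in> carrier Hg" for h using \<kappa> that by (auto dest: bij_betwE)
  have u_rho: "u * \<rho> h = \<rho> (\<kappa> h) * u" if h: "h \<in> carrier Hg" for h
    using lin_sc[OF rho_lin[OF kap[OF h]], of k] D0(5)[OF h]
    by (simp add: u_def mult.assoc) (simp add: mult.assoc[symmetric])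
  have nu: "normalizes \<kappa> u u'" using ulin inv u_rho by (simp add: normalizes_def)
  have uu: "u' \<cdot> u \<cdot> z = z" "u \<cdot> u' \<cdot> z = z" for z using inv by (simp_all add: times_app[symmetric])
  obtain a where a: "a \<in> lin" "\<And>x y. f (u \<cdot> x) (u \<cdot> y) = f (a \<cdot> x) y"
    by (rule representing_op[of "\<lambda>x y. f (u \<cdot> x) (u \<cdot> y)"])
      (simp_all add: f_add1 f_add2 f_scale1 f_scale2 lin_scale[OF ulin(1)])
  have aE: "a \<in> E"
  proof -
    have "a * \<rho> h = \<rho> h * a" if h: "h \<in> carrier Hg" for h
    proof (rule aend_eqI, rule f_eqI)
      fix x y
      have hi: "inv\<^bsub>Hg\<^esub> h \<in> carrier Hg" using h by simp
      have ur: "u \<cdot> \<rho> g \<cdot> z = \<rho> (\<kappa> g) \<cdot> u \<cdot> z" if "g \<in> carrier Hg" for g z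
        using u_rho[OF that] by (simp add: times_app[symmetric])
      have "f ((a * \<rho> h) \<cdot> x) y = f (u \<cdot> \<rho> h \<cdot> x) (u \<cdot> \<rho> h \<cdot> \<rho> (inv\<^bsub>Hg\<^esub> h) \<cdot> y)"
        using rho_inv(2)[OF h] by (simp add: times_app a(2)[symmetric]) (simp add: times_app[symmetric])
      also have "\<dots> = f (u \<cdot> x) (u \<cdot> \<rho> (inv\<^bsub>Hg\<^esub> h) \<cdot> y)"
        unfolding ur[OF h] by (rule f_inv[OF kap[OF h]])
      also have "\<dots> = f ((\<rho> h * a) \<cdot> x) y" using f_rho[OF h] by (simp add: times_app a(2))
      finally show "f ((a * \<rho> h) \<cdot> x) y = f ((\<rho> h * a) \<cdot> x) y" .
    qed
    then show ?thesis using a(1) by (simp add: E_def)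
  qed
  have aR: "a \<in> R" using aE
  proof (rule form_R)
    fix s t assume "s \<in> T" "t \<in> T"
    then show "f (a \<cdot> s) t \<in> values_T" unfolding a(2)[symmetric] values_T_def using uT by blast
  qed
  \<comment> \<open>Since \<open>u\<close> maps \<open>T\<close> onto itself, all values in
    \<open>values_T\<close> have the form \<open>f (a x) y\<close> with x and y in \<open>T\<close>.
    If \<open>\<pi>\<close> divided \<open>a\<close>, then \<open>inverse p\<close> would be a
    multiplier of \<open>values_T\<close>.\<close>
  have a_unit: "unit_R a"
  proof (rule ccontr)
    assume "\<not> unit_R a"
    then have "\<pi>i * a \<in> R" using unit_R_iff[OF aR] by (auto simp: ord_ge_def)
    then have "inverse p \<in> \<O>"
    proof (intro values_T_multiplier)
      fix c assume "\<pi>i * a \<in> R" "c \<in> values_T"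
      then obtain s t where st: "c = f s t" "s \<in> T" "t \<in> T" by (auto simp: values_T_def)
      have "c = f (a \<cdot> u' \<cdot> s) (u' \<cdot> t)" unfolding a(2)[symmetric] uu st(1) ..
      then have "inverse p * c = f ((\<pi>i * a) \<cdot> u' \<cdot> s) (u' \<cdot> t)" by (simp add: times_app \<pi>i_def f_sc)
      then show "inverse p * c \<in> values_T" unfolding values_T_def
        using R_T[OF \<open>\<pi>i * a \<in> R\<close>] uT(2) st by blast
    qed
    then show False using inv_p_notin by simp
  qed
  have a_adj: "adj a = a"
  proof (rule adj_eqI[OF a(1)])
    show "f (a \<cdot> v) w = f v (a \<cdot> w)" for v w
      using a(2)[of v w] a(2)[of w v] f_sym[of "u \<cdot> v" "u \<cdot> w"] f_sym[of v "a \<cdot> w"] eps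
      by (metis mult.assoc mult_1)
  qed
  have aU: "a \<in> U0" using a_unit a_adj by (simp add: U0_def)
  define \<sigma> where "\<sigma> x = u' * x * u" for x
  have \<sigma>R: "\<sigma> x \<in> R" if "x \<in> R" for x
    using normalizes_conj(2)[OF nu \<kappa> R_E[OF that]] uT R_T[OF that] by (simp add: R_def \<sigma>_def times_app)
  have uu_mult: "u' * (u * z) = z" "u * (u' * z) = z" for z using inv by (simp_all add: mult.assoc[symmetric])
  have \<sigma>_mult: "\<sigma> (x * y) = \<sigma> x * \<sigma> y" for x y by (simp add: \<sigma>_def mult.assoc uu_mult)
  have \<sigma>_1: "\<sigma> 1 = 1" using inv by (simp add: \<sigma>_def)
  have \<sigma>_unit: "unit_R (\<sigma> x)" if "unit_R x" for x
    using that \<sigma>R unfolding unit_R_def by (metis \<sigma>_1 \<sigma>_mult)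
  obtain ai where ai: "ai \<in> U0" "a * ai = 1" "ai * a = 1" using U0_inverse[OF aU] by blast
  \<comment> \<open>As \<open>u\<close> is not yet an isometry, the adjoint commutes with
    \<open>\<sigma>\<close> only up to conjugation by \<open>a\<close>, which is trivial on the
    commutative \<open>E\<close>.\<close>
  have \<sigma>_adj: "adj (\<sigma> x) = \<sigma> (adj x)" if x: "x \<in> E" for x
  proof (rule adj_eqI)
    have \<sigma>E: "\<sigma> x \<in> E" unfolding \<sigma>_def by (rule normalizes_conj(2)[OF nu \<kappa> x])
    then show "\<sigma> x \<in> lin" by (rule E_lin)
    fix v w
    have "\<sigma> x * a = a * \<sigma> x" using E_comm \<sigma>E aE by blast
    then have "\<sigma> x \<cdot> a \<cdot> ai \<cdot> v = a \<cdot> \<sigma> x \<cdot> ai \<cdot> v"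
      by (simp add: times_app[symmetric] mult.assoc[symmetric])
    moreover have "a \<cdot> ai \<cdot> v = v" using ai by (simp add: times_app[symmetric])
    ultimately have "f (\<sigma> x \<cdot> v) w = f (a \<cdot> \<sigma> x \<cdot> ai \<cdot> v) w" by simp
    also have "\<dots> = f (x \<cdot> u \<cdot> ai \<cdot> v) (u \<cdot> w)" by (simp add: a(2)[symmetric] \<sigma>_def times_app uu)
    also have "\<dots> = f (u \<cdot> ai \<cdot> v) (u \<cdot> u' \<cdot> adj x \<cdot> u \<cdot> w)" by (simp add: adj E_lin[OF x] uu)
    also have "\<dots> = f v (\<sigma> (adj x) \<cdot> w)"
      unfolding a(2) using ai by (simp add: times_app[symmetric] \<sigma>_def mult.assoc)
    finally show "f (\<sigma> x \<cdot> v) w = f v (\<sigma> (adj x) \<cdot> w)" .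
  qed
  have \<sigma>_U0: "\<sigma> x \<in> U0" if "x \<in> U0" for x
    using that \<sigma>_unit \<sigma>_adj[of x] by (auto simp: U0_def unit_RD R_E)
  have \<sigma>_Sq: "\<sigma> x \<in> Sq \<longleftrightarrow> x \<in> Sq" if x: "x \<in> U0" for x
  proof
    assume "x \<in> Sq"
    then obtain s where "x = adj s * s" "unit_R s" by (auto simp: Sq_def)
    then show "\<sigma> x \<in> Sq" unfolding Sq_def using \<sigma>_unit \<sigma>_adj \<sigma>_mult unit_RD R_E by (metis (mono_tags, lifting) mem_Collect_eq)
  next
    assume "\<sigma> x \<in> Sq"
    then obtain s where s: "\<sigma> x = adj s * s" "unit_R s" by (auto simp: Sq_def)
    define t where "t = u * s * u'"
    have tE: "t \<in> E" unfolding t_def by (rule normalizes_conj(1)[OF nu \<kappa> R_E[OF unit_RD[OF s(2)]]])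
    have st: "s = \<sigma> t" by (simp add: t_def \<sigma>_def mult.assoc inv uu_mult)
    have tR: "u * y * u' \<in> R" if "y \<in> R" for y
      using normalizes_conj(1)[OF nu \<kappa> R_E[OF that]] uT R_T[OF that] by (simp add: R_def times_app)
    obtain s' where s': "s' \<in> R" "s' * s = 1" using s(2) by (auto simp: unit_R_def)
    have "u * s' * u' * t = u * (s' * s) * u'" by (simp add: t_def mult.assoc uu_mult)
    then have "u * s' * u' * t = 1" using s' inv by simp
    then have "unit_R t" unfolding unit_R_def using tR s' unit_RD[OF s(2)] by (auto simp: t_def)
    moreover have "\<sigma> x = \<sigma> (adj t * t)" using s(1) st \<sigma>_adj[OF tE] \<sigma>_mult by metis
    then have "u * \<sigma> x * u' = u * \<sigma> (adj t * t) * u'" by simp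
    then have "x = adj t * t" by (simp add: \<sigma>_def mult.assoc inv uu_mult)
    ultimately show "x \<in> Sq" by (auto simp: Sq_def)
  qed
  have a_Sq: "a \<in> Sq"
  proof (rule ccontr)
    assume nSq: "a \<notin> Sq"
    define b where "b j = (\<sigma> ^^ j) a" for j
    have b: "b j \<in> U0 \<and> b j \<notin> Sq" for j
      by (induction j) (use aU nSq \<sigma>_U0 \<sigma>_Sq in \<open>auto simp: b_def\<close>)
    define c where "c = rec_nat 1 (\<lambda>j x. x * b j)"
    have c0: "c 0 = 1" and cS: "c (Suc j) = c j * b j" for j by (simp_all add: c_def)
    have one: "1 \<in> Sq" using unit_R_mult adj_1 unfolding Sq_def
      by (auto intro!: exI[of _ 1] simp: unit_R_def intro: bexI[of _ 1])
    have cU: "c j \<in> U0" for j by (induction j) (auto simp: c0 cS Sq_U0[OF one] U0_mult b)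
    \<comment> \<open>No \<open>b j\<close> is in \<open>Sq\<close>, whose index in
      \<open>U0\<close> is at most 2, so each new factor changes the class of the product.\<close>
    have c: "c j \<in> Sq \<longleftrightarrow> even j" for j
    proof (induction j)
      case 0
      then show ?case using one c0 by simp
    next
      case (Suc j)
      show ?case
      proof (cases "even j")
        case True
        then have "c j \<in> Sq" using Suc by simp
        then have "b j * c j \<notin> Sq" using Sq_cancel b by blast
        then show ?thesis using True U0_comm[OF cU, of "b j" j] b by (simp add: cS)
      next
        case False
        then show ?thesis using Suc Sq_index[OF cU _, of j "b j"] b by (simp add: cS)
      qed
    qed
    have u_b: "u ^ j * b j = a * u ^ j" for j
    proof (induction j)
      case (Suc j)
      have "u ^ Suc j * b (Suc j) = u ^ j * (u * \<sigma> (b j))" by (simp add: b_def power_Suc2 mult.assoc del: power_Suc)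
      also have "u * \<sigma> (b j) = b j * u" by (simp add: \<sigma>_def mult.assoc uu_mult)
      also have "u ^ j * (b j * u) = a * u ^ Suc j" by (simp only: mult.assoc[symmetric] Suc) (simp add: mult.assoc power_commutes)
      finally show ?case .
    qed (simp add: b_def)
    have f_c: "f (u ^ j \<cdot> x) (u ^ j \<cdot> y) = f (c j \<cdot> x) y" for j x y
    proof (induction j arbitrary: x y)
      case (Suc j)
      have "f (u ^ Suc j \<cdot> x) (u ^ Suc j \<cdot> y) = f (a \<cdot> u ^ j \<cdot> x) (u ^ j \<cdot> y)"
        by (simp add: times_app a(2))
      also have "a \<cdot> u ^ j \<cdot> x = u ^ j \<cdot> b j \<cdot> x" using u_b[of j] by (simp add: times_app[symmetric])
      finally show ?case using Suc by (simp add: cS times_app)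
    qed (simp add: c0)
    \<comment> \<open>The N-th power of \<open>u\<close> lies in \<open>E\<close> and is a unit of
      \<open>R\<close>, so its multiplier \<open>c N = adj e * e\<close> is in \<open>Sq\<close>;
      for odd \<open>N\<close> this contradicts the parity.\<close>
    define e where "e = u ^ N"
    have eE: "e \<in> E" unfolding e_def by (rule N(2)[OF nu])
    have "u ^ j \<cdot> t \<in> T \<and> u' ^ j \<cdot> t \<in> T" if "t \<in> T" for j t
      by (induction j) (use that uT in \<open>auto simp: times_app\<close>)
    moreover have "u' ^ N \<in> E" by (rule power_inverse_E[OF inv eE[unfolded e_def]])
    ultimately have "unit_R e" using eE inverse_power[OF inv(2,1), of N]
      by (auto simp: unit_R_def R_def e_def intro!: bexI[of _ "u' ^ N"])
    moreover have "c N = adj e * e"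
    proof (rule aend_eqI, rule f_eqI)
      fix x y
      show "f (c N \<cdot> x) y = f ((adj e * e) \<cdot> x) y"
        using f_c[of N x y] adj2[OF E_lin[OF eE]] by (simp add: e_def[symmetric] times_app)
    qed
    ultimately have "c N \<in> Sq" by (auto simp: Sq_def)
    then show False using c N(1) by simp
  qed
  then obtain s where s: "a = adj s * s" "unit_R s" by (auto simp: Sq_def)
  obtain r where r: "unit_R r" "r * s = 1" "s * r = 1" using unit_R_inverse[OF s(2)] by blast
  have rE: "r \<in> E" "s \<in> E" using r s unit_RD R_E by auto
  \<comment> \<open>Composing \<open>u\<close> with the inverse \<open>r\<close> of \<open>s\<close>
    cancels the multiplier \<open>adj s * s\<close>.\<close>
  have "normalizes \<kappa> (u * r) (s * u')"
  proof -
    have "u * r * \<rho> h = \<rho> (\<kappa> h) * (u * r)" if "h \<in> carrier Hg" for h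
      using E_rho[OF rE(1) that] u_rho[OF that] by (simp add: mult.assoc) (simp add: mult.assoc[symmetric])
    moreover have "u * r * (s * u') = u * (r * s) * u'" "s * u' * (u * r) = s * (u' * u) * r" by (simp_all add: mult.assoc)
    ultimately show ?thesis using ulin rE E_lin inv r by (auto simp: normalizes_def)
  qed
  moreover have "f ((u * r) \<cdot> x) ((u * r) \<cdot> y) = f x y" for x y
  proof -
    have "f ((u * r) \<cdot> x) ((u * r) \<cdot> y) = f ((adj s * s) \<cdot> r \<cdot> x) (r \<cdot> y)" by (simp add: times_app a(2) s(1))
    also have "(adj s * s) \<cdot> r \<cdot> x = adj s \<cdot> x" using r by (simp add: times_app[symmetric] mult.assoc)
    also have "f (adj s \<cdot> x) (r \<cdot> y) = f x (s \<cdot> r \<cdot> y)" using adj2 E_lin rE by simp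
    finally show ?thesis using r by (simp add: times_app[symmetric])
  qed
  ultimately show ?thesis by (rule that)
qed

lemma isometry_T:
  assumes u: "normalizes \<kappa> u u'" and \<kappa>: "bij_betw \<kappa> (carrier Hg) (carrier Hg)"
    and f: "\<And>x y. f (u \<cdot> x) (u \<cdot> y) = f x y" and t: "t \<in> T"
  shows "u \<cdot> t \<in> T" "u' \<cdot> t \<in> T"
proof -
  obtain a where a: "a \<noteq> 0" "\<forall>t\<in>T. sc a \<cdot> u \<cdot> t \<in> T" "\<forall>t\<in>T. sc (inverse a) \<cdot> u' \<cdot> t \<in> T"
    by (rule normalizes_scaling[OF u \<kappa>])
  have f': "f (u' \<cdot> x) (u' \<cdot> y) = f x y" for x y
    using f[of "u' \<cdot> x" "u' \<cdot> y"] normalizesD(3)[OF u] by (simp add: times_app[symmetric])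
  have "a \<in> \<O>"
  proof (rule O_square, rule values_T_multiplier)
    fix c assume "c \<in> values_T"
    then obtain s t where st: "c = f s t" "s \<in> T" "t \<in> T" by (auto simp: values_T_def)
    have "a * a * c = f (sc a \<cdot> u \<cdot> s) (sc a \<cdot> u \<cdot> t)" by (simp add: f_sc f st)
    then show "a * a * c \<in> values_T" unfolding values_T_def using a st by blast
  qed
  moreover have "inverse a \<in> \<O>"
  proof (rule O_square, rule values_T_multiplier)
    fix c assume "c \<in> values_T"
    then obtain s t where st: "c = f s t" "s \<in> T" "t \<in> T" by (auto simp: values_T_def)
    have "inverse a * inverse a * c = f (sc (inverse a) \<cdot> u' \<cdot> s) (sc (inverse a) \<cdot> u' \<cdot> t)"
      by (simp add: f_sc f' st)
    then show "inverse a * inverse a * c \<in> values_T" unfolding values_T_def using a st by blast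
  qed
  ultimately have "sc (inverse a) \<cdot> sc a \<cdot> u \<cdot> t \<in> T" "sc a \<cdot> sc (inverse a) \<cdot> u' \<cdot> t \<in> T"
    using a t T_sc by auto
  then show "u \<cdot> t \<in> T" "u' \<cdot> t \<in> T" using a(1) by (simp_all add: sc_app)
qed

text \<open>For \<open>y \<in> E\<close> the power \<open>(yu)\<^sup>N\<close> is the twisted norm \<open>\<Prod>\<^sub>k u\<^sup>k y u\<^sup>-\<^sup>k\<close>, over \<open>k < N\<close>, times
  \<open>u\<^sup>N\<close>. Taking determinants over \<open>E\<close> shows that \<open>u\<^sup>-\<^sup>2\<^sup>n\<^sup>N\<close>, where \<open>n\<close> is the dimension of \<open>W\<close> over
  \<open>E\<close>, is a twisted norm of an element of norm 1; so is \<open>u\<^sup>N\<^sup>N\<close>, and \<open>2n\<close> is coprime to \<open>N\<close>.\<close>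

lemma isometric_normalizer_of_finite_order:
  assumes B: "E_basis B \<phi>" and N: "odd N" "coprime (card B) N"
    and u: "normalizes \<kappa> u u'" and \<kappa>: "bij_betw \<kappa> (carrier Hg) (carrier Hg)"
    and f: "\<And>x y. f (u \<cdot> x) (u \<cdot> y) = f x y" and eE: "u ^ N \<in> E"
  obtains v v' where "normalizes \<kappa> v v'" "\<And>x y. f (v \<cdot> x) (v \<cdot> y) = f x y" "v ^ N = 1"
proof -
  note D = normalizesD[OF u]
  have uu: "u' * (u * z) = z" "u * (u' * z) = z" for z using D by (simp_all add: mult.assoc[symmetric])
  define n where "n = card B"
  define nm where "nm = twisted_norm u u'"
  have nm0: "nm 0 x = 1" and nmS: "nm (Suc k) x = x * (u * nm k x * u')" for x k by (simp_all add: nm_def)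
  note conj = normalizes_conj[OF u \<kappa>]
  have nmE: "nm k x \<in> E" if "x \<in> E" for k x
    by (induction k) (use that conj in \<open>auto simp: nm0 nmS\<close>)
  have nm_mult: "nm k (x * y) = nm k x * nm k y" if xy: "x \<in> E" "y \<in> E" for k x y
  proof (induction k)
    case (Suc k)
    have "nm (Suc k) (x * y) = x * (y * (u * nm k x * u')) * (u * nm k y * u')"
      by (simp add: nmS Suc mult.assoc uu)
    also have "y * (u * nm k x * u') = (u * nm k x * u') * y" by (intro E_comm conj nmE xy)
    finally show ?case by (simp add: nmS mult.assoc)
  qed (simp add: nm0)
  have nm_1: "nm k 1 = 1" for k by (induction k) (simp_all add: nm0 nmS D)
  have nm_power: "nm k (x ^ j) = nm k x ^ j" if "x \<in> E" for k x j
    by (induction j) (simp_all add: nm_1 nm_mult E.power_in that)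
  have adj_conj: "adj (u * x * u') = u * adj x * u'" if x: "x \<in> E" for x
  proof (rule adj_eqI)
    show "u * x * u' \<in> lin" by (rule E_lin[OF conj(1)[OF x]])
    fix v w
    have "f ((u * x * u') \<cdot> v) w = f (u \<cdot> x \<cdot> u' \<cdot> v) (u \<cdot> u' \<cdot> w)" using D by (simp add: times_app[symmetric] mult.assoc)
    also have "\<dots> = f (u \<cdot> u' \<cdot> v) (u \<cdot> adj x \<cdot> u' \<cdot> w)" by (simp add: f adj E_lin[OF x])
    also have "\<dots> = f v ((u * adj x * u') \<cdot> w)" using D by (simp add: times_app[symmetric] mult.assoc)
    finally show "f ((u * x * u') \<cdot> v) w = f v ((u * adj x * u') \<cdot> w)" .
  qed
  have nm_adj: "nm k (adj x) = adj (nm k x)" if x: "x \<in> E" for k x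
  proof (induction k)
    case (Suc k)
    have "adj (nm (Suc k) x) = adj (u * nm k x * u') * adj x"
      unfolding nmS by (intro adj_mult E_lin conj nmE x)
    also have "\<dots> = u * adj (nm k x) * u' * adj x" by (simp only: adj_conj[OF nmE[OF x]])
    also have "\<dots> = adj x * (u * adj (nm k x) * u')" by (intro E_comm conj nmE x adj_E)
    finally show ?case by (simp add: nmS Suc)
  qed (simp add: nm0 adj_1)
  have mult_power: "(x * u) ^ k = nm k x * u ^ k" for x k
    by (induction k) (simp_all add: nm0 nmS mult.assoc uu)
  define e e' where "e = u ^ N" and "e' = u' ^ N"
  have e: "e \<in> E" "e' \<in> E" using eE power_inverse_E[OF D(3,4) eE] by (auto simp: e_def e'_def)
  have ee: "e * e' = 1" "e' * e = 1" unfolding e_def e'_def using inverse_power D by auto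
  have adj_e: "adj e = e'"
  proof (rule adj_eqI[OF E_lin[OF e(1)]])
    fix v w
    have "f (u ^ k \<cdot> x) (u ^ k \<cdot> y) = f x y" for k x y
      by (induction k) (simp_all add: times_app f)
    from this[of N v "e' \<cdot> w"] show "f (e \<cdot> v) w = f v (e' \<cdot> w)"
      using ee by (simp add: e_def[symmetric] times_app[symmetric])
  qed
  \<comment> \<open>\<open>u\<close> commutes with its own power, so the twisted norm of
    \<open>e\<close> is an ordinary power.\<close>
  have nm_e: "nm k e = e ^ k" for k
  proof (induction k)
    case (Suc k)
    have "u * e ^ k = e ^ k * u" unfolding e_def power_mult[symmetric] by (simp add: power_commutes)
    then show ?case by (simp add: nmS Suc mult.assoc D)
  qed (simp add: nm0)
  obtain b where b: "b \<in> E" "b \<noteq> 0" "nm N b = e ^ n"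
    using E_scalar_power_norm[OF B D(3,4) conj eE] by (auto simp: nm_def n_def e_def)
  obtain bi where bi: "bi \<in> E" "bi * b = 1" using E_inv b by blast
  have bi': "b * bi = 1" using E_comm b bi by metis
  have en: "e ^ k * e' ^ k = 1" "e' ^ k * e ^ k = 1" for k using inverse_power ee by auto
  have nm_bi: "nm N bi = e' ^ n"
  proof -
    have "nm N bi * e ^ n = 1" using nm_mult[OF bi(1) b(1), of N] bi b by (simp add: nm_1)
    then have "nm N bi * e ^ n * e' ^ n = e' ^ n" by simp
    then show ?thesis by (simp add: mult.assoc en)
  qed
  \<comment> \<open>The quotient of \<open>adj b\<close> by \<open>b\<close> satisfies
    \<open>adj c * c = 1\<close>, so powers of \<open>c\<close> preserve the form. Both factors have
    norm \<open>e' ^ n\<close>: \<open>bi\<close> as the inverse of \<open>b\<close>, and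
    \<open>adj b\<close> because \<open>adj e = e'\<close>.\<close>
  define c where "c = adj b * bi"
  have cE: "c \<in> E" unfolding c_def using b bi adj_E by auto
  have nm_c: "nm N c = e' ^ (2 * n)"
    unfolding c_def by (simp add: nm_mult adj_E b bi nm_adj nm_bi adj_power E_lin e adj_e mult_2 power_add)
  have c_adj: "adj c * c = 1"
  proof -
    have "adj c = adj bi * b" using adj_mult[of "adj b" bi] b bi adj_E E_lin by (simp add: c_def adj_adj)
    then have "adj c * c = adj bi * (b * adj b) * bi" by (simp add: c_def mult.assoc)
    also have "b * adj b = adj b * b" by (intro E_comm adj_E b)
    also have "adj bi * (adj b * b) * bi = (adj bi * adj b) * (b * bi)" by (simp add: mult.assoc)
    also have "adj bi * adj b = adj (b * bi)" using b bi E_lin by (simp add: adj_mult)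
    finally show ?thesis using bi' by (simp add: adj_1)
  qed
  have "coprime (2 * n) N" using N by (simp add: n_def)
  have "B \<noteq> {}" 
  proof
    assume "B = {}"
    then have "w = 0" for w :: 'w using coordsD(2)[of E B \<phi> w] B by (simp add: E_basis_def)
    then show False using nontriv by auto
  qed
  then have n_pos: "n > 0" using B by (simp add: n_def E_basis_def card_gt_0_iff)
  \<comment> \<open>With these exponents \<open>y = c ^ m * e ^ j\<close> has norm
    \<open>e' ^ (1 + j * N) * e ^ (j * N) = e'\<close>, which is exactly what cancels
    \<open>u ^ N\<close>.\<close>
  obtain m j where mj: "2 * n * m = 1 + j * N"
  proof -
    obtain x y where xy: "2 * n * x = N * y + 1"
      using bezout_nat[of "2 * n" N] \<open>coprime (2 * n) N\<close> n_pos by (auto simp: coprime_iff_gcd_eq_1)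
    then have "2 * n * x = 1 + y * N" by (simp only: mult.commute add.commute)
    then show ?thesis by (rule that)
  qed
  define y where "y = c ^ m * e ^ j"
  have yE: "y \<in> E" unfolding y_def using cE e by auto
  have "nm N y = e' ^ (2 * n * m) * e ^ (j * N)"
    unfolding y_def by (simp add: nm_mult nm_power E.power_in cE e nm_c nm_e power_mult mult.commute[of j])
  also have "\<dots> = e'" unfolding mj by (simp add: mult.assoc en)
  finally have nm_y: "nm N y = e'" .
  have y_adj: "adj y * y = 1"
  proof -
    have ac: "adj c ^ m * c ^ m = 1" 
      by (rule inverse_power[OF c_adj]) (use E_comm cE adj_E c_adj in metis)
    have "adj y = e' ^ j * adj c ^ m"
      unfolding y_def using cE e by (simp add: adj_mult lin.power_in E_lin adj_power adj_e)
    then have "adj y * y = e' ^ j * (adj c ^ m * c ^ m) * e ^ j" by (simp add: y_def mult.assoc)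
    then show ?thesis using ac en by simp
  qed
  have y_adj': "y * adj y = 1" using y_adj E_comm yE adj_E by metis
  show ?thesis
  proof (rule that[of "y * u" "u' * adj y"])
    have "y * u * \<rho> h = \<rho> (\<kappa> h) * (y * u)" if h: "h \<in> carrier Hg" for h
    proof -
      have "\<kappa> h \<in> carrier Hg" using \<kappa> h by (auto dest: bij_betwE)
      then show ?thesis using E_rho[OF yE] D(5)[OF h] by (simp add: mult.assoc) (simp add: mult.assoc[symmetric])
    qed
    moreover have "y * u * (u' * adj y) = y * adj y" "u' * adj y * (y * u) = u' * (adj y * y) * u"
      by (simp_all add: mult.assoc uu)
    ultimately show "normalizes \<kappa> (y * u) (u' * adj y)"
      using D yE E_lin adj_E y_adj y_adj' by (auto simp: normalizes_def)
    show "f ((y * u) \<cdot> x) ((y * u) \<cdot> x') = f x x'" for x x'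
    proof -
      have "adj y \<cdot> y \<cdot> u \<cdot> x' = (adj y * y) \<cdot> u \<cdot> x'" by (simp only: times_app)
      then show ?thesis
        using adj(2)[OF E_lin[OF yE], of "u \<cdot> x" "y \<cdot> u \<cdot> x'"] y_adj f by (simp add: times_app)
    qed
    show "(y * u) ^ N = 1" unfolding mult_power nm_y using ee by (simp add: e_def)
  qed
qed

end

section \<open>The field of p-adic numbers\<close>

locale padic =
  fixes l :: nat
  assumes l: "prime l"
begin

abbreviation "v \<equiv> multiplicity (int l)"
abbreviation "nrm \<equiv> padic_abs l"

lemma prime_int: "prime (int l)" using l by simp

lemma l_gt_1: "real l > 1" using prime_gt_1_nat[OF l] by simp

lemma v_mult: "a \<noteq> 0 \<Longrightarrow> b \<noteq> 0 \<Longrightarrow> v (a * b) = v a + v b"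
  by (rule prime_elem_multiplicity_mult_distrib) (use prime_int in auto)

text \<open>The absolute value is defined by the reduced fraction; cross-multiplication shows that
  every other fraction has the same difference of multiplicities.\<close>

lemma nrm_frac:
  assumes "a \<noteq> 0" "b \<noteq> 0"
  shows "nrm (of_int a / of_int b) = real l powi (int (v b) - int (v a))"
proof -
  define x where "x = (of_int a / of_int b :: rat)"
  obtain a' b' where q: "quotient_of x = (a', b')" by (cases "quotient_of x")
  have b': "b' > 0" using quotient_of_denom_pos[OF q] .
  have x: "x = of_int a' / of_int b'" using quotient_of_div[OF q] .
  have x0: "x \<noteq> 0" using assms by (simp add: x_def)
  then have a': "a' \<noteq> 0" using x by auto
  have "(of_int (a * b') :: rat) = of_int (a' * b)"
    using x assms b' unfolding x_def by (simp add: field_simps)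
  then have "a * b' = a' * b" by (simp only: of_int_eq_iff)
  then have "v a + v b' = v a' + v b" using v_mult[of a b'] v_mult[of a' b] a' b' assms by simp
  then have "int (v b') - int (v a') = int (v b) - int (v a)" by linarith
  then show ?thesis using q x0 by (simp add: padic_abs_def x_def[symmetric])
qed

lemma nrm_0 [simp]: "nrm 0 = 0" by (simp add: padic_abs_def)

lemma rat_frac: obtains a b where "x = (of_int a / of_int b :: rat)" "b \<noteq> 0"
proof -
  obtain a b where q: "quotient_of x = (a, b)" by (cases "quotient_of x")
  then show ?thesis using quotient_of_denom_pos[OF q] quotient_of_div[OF q] by (intro that[of a b]) auto
qed

lemma nrm_nonzero: assumes "x \<noteq> 0" obtains k where "nrm x = real l powi k"
proof -
  obtain a b where "x = of_int a / of_int b" "b \<noteq> 0" by (rule rat_frac)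
  then show ?thesis using nrm_frac[of a b] assms by (intro that) auto
qed

lemma nrm_ge_0 [simp]: "nrm x \<ge> 0"
proof (cases "x = 0")
  case False
  then obtain k where "nrm x = real l powi k" by (rule nrm_nonzero)
  then show ?thesis by simp
qed simp

lemma nrm_pos: "x \<noteq> 0 \<Longrightarrow> nrm x > 0"
  by (erule nrm_nonzero) (use l_gt_1 in simp)

lemma nrm_eq_0 [simp]: "nrm x = 0 \<longleftrightarrow> x = 0"
  using nrm_pos[of x] by (cases "x = 0") auto

lemma nrm_mult: "nrm (x * y) = nrm x * nrm y"
proof (cases "x = 0 \<or> y = 0")
  case False
  obtain a b where x: "x = of_int a / of_int b" "b \<noteq> 0" by (rule rat_frac)
  obtain c d where y: "y = of_int c / of_int d" "d \<noteq> 0" by (rule rat_frac)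
  have ac: "a \<noteq> 0" "c \<noteq> 0" using False x y by auto
  have "x * y = of_int (a * c) / of_int (b * d)" by (simp add: x y)
  then have "nrm (x * y) = real l powi (int (v (b * d)) - int (v (a * c)))"
    using nrm_frac[of "a * c" "b * d"] ac x y by simp
  also have "int (v (b * d)) - int (v (a * c)) = (int (v b) - int (v a)) + (int (v d) - int (v c))"
    using v_mult ac x(2) y(2) by simp
  also have "real l powi \<dots> = nrm x * nrm y"
    using nrm_frac ac x y l_gt_1 by (subst power_int_add) auto
  finally show ?thesis .
qed auto

lemma nrm_1 [simp]: "nrm 1 = 1"
  using nrm_frac[of 1 1] by simp

lemma nrm_uminus [simp]: "nrm (- x) = nrm x"
proof -
  have "nrm (- 1) * nrm (- 1) = 1" using nrm_mult[of "- 1" "- 1"] by simp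
  then have "nrm (- 1) = 1" using nrm_ge_0[of "- 1"] by (metis abs_of_nonneg abs_square_eq_1 power2_eq_square)
  then show ?thesis using nrm_mult[of "- 1" x] by simp
qed

lemma nrm_inverse: "nrm (inverse x) = inverse (nrm x)"
proof (cases "x = 0")
  case False
  then have "nrm x * nrm (inverse x) = 1" using nrm_mult[of x "inverse x"] by simp
  then show ?thesis by (metis inverse_unique)
qed simp

lemma nrm_power: "nrm (x ^ n) = nrm x ^ n"
  by (induction n) (auto simp: nrm_mult)

lemma nrm_le_1_frac:
  assumes "a \<noteq> 0" "b \<noteq> 0"
  shows "nrm (of_int a / of_int b) \<le> 1 \<longleftrightarrow> v b \<le> v a"
proof -
  have "real l powi k \<le> 1 \<longleftrightarrow> k \<le> 0" for k
    using power_int_strict_increasing[of 0 k "real l"] power_int_increasing[of k 0 "real l"] l_gt_1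
    by (cases "k \<le> 0") auto
  then show ?thesis using nrm_frac[OF assms] by simp
qed

lemma nrm_int: "nrm (of_int a) \<le> 1"
  using nrm_le_1_frac[of a 1] by (cases "a = 0") auto

lemma nrm_add_le_1: "nrm x \<le> 1 \<Longrightarrow> nrm (1 + x) \<le> 1"
proof (cases "x = 0 \<or> 1 + x = 0")
  case False
  assume x1: "nrm x \<le> 1"
  obtain a b where x: "x = of_int a / of_int b" "b \<noteq> 0" by (rule rat_frac)
  have a: "a \<noteq> 0" using False x by auto
  have eq: "1 + x = of_int (a + b) / of_int b" using x by (simp add: field_simps)
  then have ab: "a + b \<noteq> 0" using False by auto
  have "v b \<le> v a" using x1 nrm_le_1_frac[OF a x(2)] x by simp
  then have "int l ^ v b dvd a" by (rule multiplicity_dvd')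
  then have "int l ^ v b dvd a + b" using multiplicity_dvd[of "int l" b] by (intro dvd_add) auto
  then have "v b \<le> v (a + b)" 
    using ab prime_int by (intro multiplicity_geI) auto
  then show ?thesis unfolding eq using nrm_le_1_frac[OF ab x(2)] by simp
qed auto

lemma nrm_add: "nrm (x + y) \<le> max (nrm x) (nrm y)"
proof -
  have *: "nrm (x + y) \<le> nrm x" if "nrm y \<le> nrm x" "x \<noteq> 0" for x y
  proof -
    have "nrm (y / x) = nrm y / nrm x" by (simp only: divide_inverse nrm_mult nrm_inverse)
    then have "nrm (y / x) \<le> 1" using that nrm_pos[of x] by simp
    then have "nrm (1 + y / x) \<le> 1" by (rule nrm_add_le_1)
    then have "nrm x * nrm (1 + y / x) \<le> nrm x * 1" by (intro mult_left_mono) auto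
    moreover have "x * (1 + y / x) = x + y" using that(2) by (simp add: field_simps)
    ultimately show ?thesis using nrm_mult[of x "1 + y / x"] by simp
  qed
  show ?thesis
  proof (cases "x = 0 \<or> y = 0")
    case False
    then show ?thesis using *[of y x] *[of x y] by (cases "nrm y \<le> nrm x") (auto simp: add.commute max_def)
  qed auto
qed

lemma nrm_diff: "nrm (x - y) \<le> max (nrm x) (nrm y)"
  using nrm_add[of x "- y"] by simp

lemma nrm_isosceles: "nrm (x - y) < nrm y \<Longrightarrow> nrm x = nrm y"
  using nrm_add[of "x - y" y] nrm_diff[of x "x - y"] by (simp add: max_def split: if_splits)

lemma nrm_l: "nrm (of_nat l) = 1 / real l"
proof -
  have "v (int l) = 1" using prime_int by (intro multiplicity_self) auto
  then show ?thesis using nrm_frac[of "int l" 1] l_gt_1 by (simp add: power_int_minus field_simps)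
qed

text \<open>Nonzero values of the absolute value are integral powers of \<open>l\<close>, so there
  is a gap below 1.\<close>

lemma nrm_less_1: "nrm x < 1 \<Longrightarrow> nrm x \<le> 1 / real l"
proof (cases "x = 0")
  case False
  assume *: "nrm x < 1"
  obtain k where k: "nrm x = real l powi k" by (rule nrm_nonzero[OF False])
  have "1 \<le> real l powi k" if "0 \<le> k"
    using power_int_increasing[OF that, of "real l"] l_gt_1 by simp
  then have "k < 0" using * k by (cases "k < 0") auto
  then have "real l powi k \<le> real l powi (- 1)" using l_gt_1 by (intro power_int_increasing) auto
  then show ?thesis using k by (simp add: power_int_minus field_simps)
qed auto

lemma nrm_residue: assumes "nrm x \<le> 1" obtains n :: nat where "nrm (x - of_nat n) < 1"
proof (cases "x = 0")
  case False
  obtain a b where q: "quotient_of x = (a, b)" by (cases "quotient_of x")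
  have b: "b > 0" "coprime a b" "x = of_int a / of_int b"
    using quotient_of_denom_pos[OF q] quotient_of_coprime[OF q] quotient_of_div[OF q] by auto
  have a: "a \<noteq> 0" using False b by auto
  have "\<not> int l dvd b"
  proof
    assume d: "int l dvd b"
    have "v b \<ge> 1" using d b(1) prime_int by (intro multiplicity_geI) auto
    then have "v a \<ge> 1" using nrm_le_1_frac[of a b] assms a b by auto
    then have "int l dvd a" using multiplicity_dvd'[of 1 "int l" a] by simp
    then show False using d b(2) prime_int by (meson coprime_common_divisor not_prime_unit)
  qed
  then have cop: "coprime b (int l)" using prime_imp_coprime[OF prime_int] coprime_commute by blast
  obtain u w where uw: "u * b + w * int l = 1"
    using bezout_int[of b "int l"] cop by auto
  \<comment> \<open>\<open>u\<close> inverts the denominator \<open>b\<close> modulo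
    \<open>l\<close>, so \<open>n\<close> is the residue of \<open>a / b\<close>.\<close>
  define n where "n = nat ((a * u) mod int l)"
  have n: "int n = (a * u) mod int l" using l_gt_1 by (simp add: n_def)
  have "a * u mod int l = a * u - int l * (a * u div int l)" by (simp add: minus_div_mult_eq_mod[symmetric] mult.commute)
  then have "a - int n * b = a * (1 - u * b) + int l * (a * u div int l) * b"
    unfolding n by (simp add: left_diff_distrib right_diff_distrib mult_ac)
  also have "1 - u * b = w * int l" using uw by simp
  finally have dvd: "a - int n * b = int l * (a * w + (a * u div int l) * b)" by (simp add: algebra_simps)
  have "x - of_nat n = of_int (a - int n * b) / of_int b" using b by (simp add: field_simps)
  also have "\<dots> = of_nat l * (of_int (a * w + (a * u div int l) * b) / of_int b)" unfolding dvd by simp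
  finally have "nrm (x - of_nat n) = 1 / real l * (nrm (of_int (a * w + (a * u div int l) * b)) * nrm (inverse (of_int b)))"
    by (simp add: nrm_mult nrm_l divide_inverse)
  moreover have "nrm (of_int b) = 1"
    using nrm_frac[of b 1] b(1) \<open>\<not> int l dvd b\<close> by (simp add: not_dvd_imp_multiplicity_0)
  ultimately have "nrm (x - of_nat n) = 1 / real l * nrm (of_int (a * w + (a * u div int l) * b))"
    by (simp add: nrm_inverse)
  also have "\<dots> \<le> 1 / real l * 1" by (intro mult_left_mono nrm_int) auto
  also have "\<dots> < 1" using l_gt_1 by simp
  finally show ?thesis by (rule that)
qed (use that[of 0] in auto)

section \<open>Cauchy sequences of rational numbers\<close>

definition cauchy :: "(nat \<Rightarrow> rat) \<Rightarrow> bool" where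
  "cauchy x \<longleftrightarrow> (\<forall>e>0. \<exists>N. \<forall>m\<ge>N. \<forall>n\<ge>N. nrm (x m - x n) < e)"

definition null :: "(nat \<Rightarrow> rat) \<Rightarrow> bool" where
  "null x \<longleftrightarrow> (\<forall>e>0. \<exists>N. \<forall>n\<ge>N. nrm (x n) < e)"

definition integral :: "(nat \<Rightarrow> rat) \<Rightarrow> bool" where
  "integral x \<longleftrightarrow> (\<exists>N. \<forall>n\<ge>N. nrm (x n) \<le> 1)"

lemma cauchy_const: "cauchy (\<lambda>n. c)" by (auto simp: cauchy_def)

lemma cauchyD: "cauchy x \<Longrightarrow> e > 0 \<Longrightarrow> \<exists>N. \<forall>m\<ge>N. \<forall>n\<ge>N. nrm (x m - x n) < e"
  by (simp add: cauchy_def)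

lemma nrm_add_less: "nrm x < e \<Longrightarrow> nrm y < e \<Longrightarrow> nrm (x + y) < e"
  using nrm_add[of x y] by (simp add: max_def split: if_splits)

lemma nrm_diff_less: "nrm x < e \<Longrightarrow> nrm y < e \<Longrightarrow> nrm (x - y) < e"
  using nrm_diff[of x y] by (simp add: max_def split: if_splits)

lemma cauchy_add: assumes "cauchy x" "cauchy y" shows "cauchy (\<lambda>n. x n + y n)"
  unfolding cauchy_def
proof (intro allI impI)
  fix e :: real assume e: "e > 0"
  obtain M N where MN: "\<forall>m\<ge>M. \<forall>n\<ge>M. nrm (x m - x n) < e" "\<forall>m\<ge>N. \<forall>n\<ge>N. nrm (y m - y n) < e"
    using cauchyD[OF assms(1) e] cauchyD[OF assms(2) e] by blast
  have "nrm (x m + y m - (x n + y n)) < e" if "m \<ge> max M N" "n \<ge> max M N" for m n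
    using nrm_add_less[of "x m - x n" e "y m - y n"] MN that by (simp add: algebra_simps)
  then show "\<exists>N. \<forall>m\<ge>N. \<forall>n\<ge>N. nrm (x m + y m - (x n + y n)) < e" by blast
qed

lemma cauchy_bounded:
  assumes "cauchy x"
  obtains N K where "K > 0" "\<forall>n\<ge>N. nrm (x n) \<le> K"
proof -
  obtain N where N: "\<forall>m\<ge>N. \<forall>n\<ge>N. nrm (x m - x n) < 1" using cauchyD[OF assms, of 1] by auto
  have "nrm (x n) \<le> max 1 (nrm (x N))" if "n \<ge> N" for n
  proof -
    have "nrm (x n - x N) < 1" using N that by simp
    then show ?thesis using nrm_add[of "x n - x N" "x N"] by (auto simp: max_def split: if_splits)
  qed
  then show ?thesis by (intro that[of "max 1 (nrm (x N))" N]) auto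
qed

lemma cauchy_mult: assumes "cauchy x" "cauchy y" shows "cauchy (\<lambda>n. x n * y n)"
  unfolding cauchy_def
proof (intro allI impI)
  fix e :: real assume e: "e > 0"
  obtain A K where K: "K > 0" "\<forall>n\<ge>A. nrm (x n) \<le> K" by (rule cauchy_bounded[OF assms(1)])
  obtain B J where J: "J > 0" "\<forall>n\<ge>B. nrm (y n) \<le> J" by (rule cauchy_bounded[OF assms(2)])
  obtain M N where MN: "\<forall>m\<ge>M. \<forall>n\<ge>M. nrm (x m - x n) < e / J" "\<forall>m\<ge>N. \<forall>n\<ge>N. nrm (y m - y n) < e / K"
    using cauchyD[OF assms(1), of "e / J"] cauchyD[OF assms(2), of "e / K"] e K(1) J(1) by auto
  have "nrm (x m * y m - x n * y n) < e" if mn: "m \<ge> max (max A B) (max M N)" "n \<ge> max (max A B) (max M N)" for m n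
  proof -
    have "nrm (x m * (y m - y n)) \<le> K * nrm (y m - y n)"
      unfolding nrm_mult using K mn by (intro mult_right_mono) auto
    also have "\<dots> < K * (e / K)" using MN(2) mn K(1) by (intro mult_strict_left_mono) auto
    finally have 1: "nrm (x m * (y m - y n)) < e" using K(1) by simp
    have "nrm (y n * (x m - x n)) \<le> J * nrm (x m - x n)"
      unfolding nrm_mult using J mn by (intro mult_right_mono) auto
    also have "\<dots> < J * (e / J)" using MN(1) mn J(1) by (intro mult_strict_left_mono) auto
    finally have 2: "nrm (y n * (x m - x n)) < e" using J(1) by simp
    show ?thesis using nrm_add_less[OF 1 2] by (simp add: algebra_simps)
  qed
  then show "\<exists>N. \<forall>m\<ge>N. \<forall>n\<ge>N. nrm (x m * y m - x n * y n) < e" by blast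
qed

lemma cauchy_uminus: "cauchy x \<Longrightarrow> cauchy (\<lambda>n. - x n)"
  using cauchy_mult[OF cauchy_const[of "- 1"]] by simp

lemma cauchy_diff: "cauchy x \<Longrightarrow> cauchy y \<Longrightarrow> cauchy (\<lambda>n. x n - y n)"
  using cauchy_add[OF _ cauchy_uminus] by fastforce

lemma null_cauchy: "null x \<Longrightarrow> cauchy x"
  unfolding cauchy_def null_def by (meson nrm_diff_less)

lemma null_add: assumes "null x" "null y" shows "null (\<lambda>n. x n + y n)"
  unfolding null_def
proof (intro allI impI)
  fix e :: real assume e: "e > 0"
  obtain M N where "\<forall>n\<ge>M. nrm (x n) < e" "\<forall>n\<ge>N. nrm (y n) < e"
    using assms e unfolding null_def by metis
  then have "\<forall>n\<ge>max M N. nrm (x n + y n) < e" using nrm_add_less by simp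
  then show "\<exists>N. \<forall>n\<ge>N. nrm (x n + y n) < e" by blast
qed

lemma null_mult: assumes "cauchy x" "null y" shows "null (\<lambda>n. x n * y n)"
  unfolding null_def
proof (intro allI impI)
  fix e :: real assume e: "e > 0"
  obtain A K where K: "K > 0" "\<forall>n\<ge>A. nrm (x n) \<le> K" by (rule cauchy_bounded[OF assms(1)])
  obtain N where N: "\<forall>n\<ge>N. nrm (y n) < e / K" using assms(2) e K(1) unfolding null_def by (meson divide_pos_pos)
  have "nrm (x n * y n) < e" if n: "n \<ge> max A N" for n
  proof -
    have "nrm (x n * y n) \<le> K * nrm (y n)" unfolding nrm_mult using K n by (intro mult_right_mono) auto
    also have "\<dots> < K * (e / K)" using N n K(1) by (intro mult_strict_left_mono) auto
    finally show ?thesis using K(1) by simp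
  qed
  then show "\<exists>N. \<forall>n\<ge>N. nrm (x n * y n) < e" by blast
qed

lemma null_0: "null (\<lambda>n. 0)" by (simp add: null_def)

lemma null_uminus: "null x \<Longrightarrow> null (\<lambda>n. - x n)" by (simp add: null_def)

text \<open>In an ultrametric, terms that are closer to each other than the size of one of them all
  have the same absolute value.\<close>

lemma not_null:
  assumes x: "cauchy x" "\<not> null x"
  obtains N c where "c > 0" "\<forall>n\<ge>N. nrm (x n) = c"
proof -
  obtain e where e: "e > 0" "\<And>N. \<exists>n\<ge>N. nrm (x n) \<ge> e" using x(2) unfolding null_def by (metis not_le)
  obtain N where N: "\<forall>m\<ge>N. \<forall>n\<ge>N. nrm (x m - x n) < e" using cauchyD[OF x(1) e(1)] by blast
  obtain k where k: "k \<ge> N" "nrm (x k) \<ge> e" using e(2) by blast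
  have "nrm (x n) = nrm (x k)" if "n \<ge> N" for n
    using N that k by (intro nrm_isosceles) (meson less_le_trans)
  then show ?thesis using k(2) e(1) by (intro that[of "nrm (x k)" N]) auto
qed

lemma cauchy_inverse:
  assumes x: "cauchy x" "\<not> null x"
  shows "cauchy (\<lambda>n. inverse (x n))" "null (\<lambda>n. x n * inverse (x n) - 1)"
proof -
  obtain M c where c: "c > 0" "\<forall>n\<ge>M. nrm (x n) = c" by (rule not_null[OF x])
  \<comment> \<open>Only terms before \<open>M\<close> can vanish; \<open>inverse\<close> sends them
    to 0, which does not affect the limit.\<close>
  have nz: "x n \<noteq> 0" if "n \<ge> M" for n using c that by (metis less_irrefl nrm_0)
  show "cauchy (\<lambda>n. inverse (x n))" unfolding cauchy_def
  proof (intro allI impI)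
    fix e :: real assume e: "e > 0"
    obtain N where N: "\<forall>m\<ge>N. \<forall>n\<ge>N. nrm (x m - x n) < e * (c * c)"
      using cauchyD[OF x(1), of "e * (c * c)"] e c by auto
    have "nrm (inverse (x m) - inverse (x n)) < e" if mn: "m \<ge> max M N" "n \<ge> max M N" for m n
    proof -
      have "inverse (x m) - inverse (x n) = (x n - x m) * (inverse (x m) * inverse (x n))"
        using nz mn by (simp add: field_simps)
      then have "nrm (inverse (x m) - inverse (x n)) = nrm (x n - x m) / (c * c)"
        using c mn by (simp add: nrm_mult nrm_inverse divide_inverse)
      also have "\<dots> < e" using N mn c(1) by (simp add: pos_divide_less_eq)
      finally show ?thesis .
    qed
    then show "\<exists>N. \<forall>m\<ge>N. \<forall>n\<ge>N. nrm (inverse (x m) - inverse (x n)) < e" by blast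
  qed
  show "null (\<lambda>n. x n * inverse (x n) - 1)" unfolding null_def using nz by (auto intro!: exI[of _ M])
qed

end

section \<open>The completion as a quotient ring\<close>

context padic
begin

abbreviation "C \<equiv> padic_cauchy l"
abbreviation "N \<equiv> padic_null l"

lemma carrier_C: "carrier C = {x. cauchy x}"
  by (simp add: padic_cauchy_def cauchy_def)

lemma C_ops: "x \<otimes>\<^bsub>C\<^esub> y = (\<lambda>n. x n * y n)" "x \<oplus>\<^bsub>C\<^esub> y = (\<lambda>n. x n + y n)" "\<one>\<^bsub>C\<^esub> = (\<lambda>_. 1)" "\<zero>\<^bsub>C\<^esub> = (\<lambda>_. 0)"
  by (simp_all add: padic_cauchy_def)

lemma N_iff: "x \<in> N \<longleftrightarrow> null x"
proof -
  have "(\<lambda>n. nrm (x n)) \<longlonglongrightarrow> 0 \<longleftrightarrow> null x"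
    by (simp add: LIMSEQ_iff null_def)
  then show ?thesis using null_cauchy by (auto simp: padic_null_def carrier_C)
qed

lemma C_cring: "cring C"
proof (rule cringI)
  show "abelian_group C"
  proof (rule abelian_groupI)
    fix x assume "x \<in> carrier C"
    then show "\<exists>y\<in>carrier C. y \<oplus>\<^bsub>C\<^esub> x = \<zero>\<^bsub>C\<^esub>"
      by (auto simp: carrier_C C_ops intro!: bexI[of _ "\<lambda>n. - x n"] cauchy_uminus)
  qed (auto simp: carrier_C C_ops cauchy_add cauchy_const algebra_simps)
  show "comm_monoid C"
    by (rule comm_monoidI) (auto simp: carrier_C C_ops cauchy_mult cauchy_const algebra_simps)
qed (auto simp: C_ops algebra_simps)

sublocale C: cring C by (rule C_cring)

lemma C_minus: "cauchy x \<Longrightarrow> \<ominus>\<^bsub>C\<^esub> x = (\<lambda>n. - x n)"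
  by (rule C.minus_equality) (auto simp: carrier_C C_ops cauchy_uminus)

lemma N_ideal: "ideal N C"
proof (rule idealI)
  show "ring C" by (rule C.ring_axioms)
  show "subgroup N (add_monoid C)"
  proof (rule C.add.subgroupI)
    show "N \<subseteq> carrier C" using null_cauchy by (auto simp: N_iff carrier_C)
    show "N \<noteq> {}" using null_0 N_iff by blast
    show "\<ominus>\<^bsub>C\<^esub> x \<in> N" if "x \<in> N" for x
      using that null_cauchy by (simp add: C_minus N_iff null_uminus)
    show "x \<oplus>\<^bsub>C\<^esub> y \<in> N" if "x \<in> N" "y \<in> N" for x y using that by (simp add: N_iff C_ops null_add)
  qed
  fix a x assume "a \<in> N" "x \<in> carrier C"
  then show "x \<otimes>\<^bsub>C\<^esub> a \<in> N" "a \<otimes>\<^bsub>C\<^esub> x \<in> N"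
    using null_mult[of x a] by (simp_all add: N_iff C_ops carrier_C mult.commute)
qed

sublocale N: ideal N C by (rule N_ideal)

definition cl :: "(nat \<Rightarrow> rat) \<Rightarrow> (nat \<Rightarrow> rat) set" where "cl x = N +>\<^bsub>C\<^esub> x"

lemma cl_hom: "cl \<in> ring_hom C (padic_field l)"
  unfolding padic_field_def cl_def by (rule N.rcos_ring_hom)

lemma carrier_F: "carrier (padic_field l) = cl ` {x. cauchy x}"
  unfolding padic_field_def FactRing_def A_RCOSETS_def' cl_def[abs_def] using carrier_C by auto

lemma cl_iff: "y \<in> cl x \<longleftrightarrow> null (\<lambda>n. y n - x n)"
proof
  assume "y \<in> cl x"
  then obtain h where "h \<in> N" "y = h \<oplus>\<^bsub>C\<^esub> x" unfolding cl_def a_r_coset_def' by blast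
  then show "null (\<lambda>n. y n - x n)" by (simp add: N_iff C_ops)
next
  assume "null (\<lambda>n. y n - x n)"
  then have "(\<lambda>n. y n - x n) \<in> N" by (simp add: N_iff)
  then show "y \<in> cl x" unfolding cl_def a_r_coset_def' 
    by (auto simp: C_ops intro!: bexI[of _ "\<lambda>n. y n - x n"])
qed

lemma integral_null: "null x \<Longrightarrow> integral x"
  unfolding null_def integral_def by (meson less_imp_le zero_less_one)

lemma integral_add: "integral x \<Longrightarrow> integral y \<Longrightarrow> integral (\<lambda>n. x n + y n)"
  unfolding integral_def
proof (elim exE)
  fix A B assume "\<forall>n\<ge>A. nrm (x n) \<le> 1" "\<forall>n\<ge>B. nrm (y n) \<le> 1"
  then have "\<forall>n\<ge>max A B. nrm (x n + y n) \<le> 1" using nrm_add order_trans by (metis max.bounded_iff)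
  then show "\<exists>N. \<forall>n\<ge>N. nrm (x n + y n) \<le> 1" by blast
qed

lemma integral_mult: "integral x \<Longrightarrow> integral y \<Longrightarrow> integral (\<lambda>n. x n * y n)"
  unfolding integral_def
proof (elim exE)
  fix A B assume "\<forall>n\<ge>A. nrm (x n) \<le> 1" "\<forall>n\<ge>B. nrm (y n) \<le> 1"
  then have "\<forall>n\<ge>max A B. nrm (x n * y n) \<le> 1" by (simp add: nrm_mult mult_le_one)
  then show "\<exists>N. \<forall>n\<ge>N. nrm (x n * y n) \<le> 1" by blast
qed

lemma integral_uminus: "integral x \<Longrightarrow> integral (\<lambda>n. - x n)"
  by (simp add: integral_def)

lemma integral_int: "integral (\<lambda>n. of_int (c n))"
  by (simp add: integral_def nrm_int)

text \<open>\<open>padic_norm\<close> evaluates an arbitrary representative. Two representatives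
  differ by a null sequence, which is eventually integral, and the absolute values of a Cauchy
  sequence are eventually constant or tend to 0.\<close>

lemma norm_le_1:
  assumes x: "cauchy x"
  shows "padic_norm l (cl x) \<le> 1 \<longleftrightarrow> integral x"
proof -
  define y where "y = (SOME y. y \<in> cl x)"
  have "x \<in> cl x" using null_0 by (simp add: cl_iff)
  then have "y \<in> cl x" unfolding y_def by (rule someI[of "\<lambda>y. y \<in> cl x"])
  then have yx: "null (\<lambda>n. y n - x n)" by (simp add: cl_iff)
  have "cauchy y" using cauchy_add[OF null_cauchy[OF yx] x] by simp
  have "integral y" if "integral x" using integral_add[OF integral_null[OF yx] that] by simp
  moreover have "integral x" if "integral y"
    using integral_add[OF integral_uminus[OF integral_null[OF yx]] that] by simp
  ultimately have xy: "integral x \<longleftrightarrow> integral y" by blast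
  have "lim (\<lambda>n. nrm (y n)) \<le> 1 \<longleftrightarrow> integral y"
  proof (cases "null y")
    case True
    then have "y \<in> N" by (simp only: N_iff)
    then have "(\<lambda>n. nrm (y n)) \<longlonglongrightarrow> 0" unfolding padic_null_def by blast
    then have "lim (\<lambda>n. nrm (y n)) = 0" by (rule limI)
    then show ?thesis using integral_null[OF True] by simp
  next
    case False
    obtain M c where c: "c > 0" "\<forall>n\<ge>M. nrm (y n) = c" by (rule not_null[OF \<open>cauchy y\<close> False])
    have "(\<lambda>n. nrm (y n)) \<longlonglongrightarrow> c"
      by (rule tendsto_eventually) (use c in \<open>auto simp: eventually_sequentially\<close>)
    then have "lim (\<lambda>n. nrm (y n)) = c" by (rule limI)
    moreover have "integral y \<longleftrightarrow> c \<le> 1" unfolding integral_def using c by (metis nat_le_linear)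
    ultimately show ?thesis by simp
  qed
  then show ?thesis using xy by (simp add: padic_norm_def y_def)
qed

lemma carrier_integers: "padic_integers l = cl ` {x. cauchy x \<and> integral x}"
  using norm_le_1 by (auto simp: padic_integers_def carrier_F)

end

text \<open>What is used of the field \<open>Q\<close> of l-adic numbers and its ring \<open>Z\<close> of integers inside a bigger
  field.\<close>

locale padic_subfield =
  fixes Q Z :: "'k::field set" and p :: 'k
  assumes Q: "0 \<in> Q" "1 \<in> Q" "\<And>x y. x \<in> Q \<Longrightarrow> y \<in> Q \<Longrightarrow> x + y \<in> Q" "\<And>x. x \<in> Q \<Longrightarrow> - x \<in> Q"
      "\<And>x y. x \<in> Q \<Longrightarrow> y \<in> Q \<Longrightarrow> x * y \<in> Q" "\<And>x. x \<in> Q \<Longrightarrow> inverse x \<in> Q"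
    and Z_Q: "Z \<subseteq> Q"
    and Z: "0 \<in> Z" "1 \<in> Z" "\<And>x y. x \<in> Z \<Longrightarrow> y \<in> Z \<Longrightarrow> x + y \<in> Z" "\<And>x. x \<in> Z \<Longrightarrow> - x \<in> Z"
      "\<And>x y. x \<in> Z \<Longrightarrow> y \<in> Z \<Longrightarrow> x * y \<in> Z"
    and p_Z: "p \<in> Z" and p_nonzero: "p \<noteq> 0"
    and Z_residue: "\<And>z. z \<in> Z \<Longrightarrow> \<exists>n::nat. (z - of_nat n) / p \<in> Z"
    and Z_bounded: "\<And>q. q \<in> Q \<Longrightarrow> \<exists>i. p ^ i * q \<in> Z"
    and Z_separated: "\<And>q. q \<in> Q \<Longrightarrow> q \<noteq> 0 \<Longrightarrow> \<exists>i. q / p ^ i \<notin> Z"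
    and Z_unit: "\<And>z. z \<in> Z \<Longrightarrow> z / p \<notin> Z \<Longrightarrow> inverse z \<in> Z"
    and Z_complete: "\<And>c :: nat \<Rightarrow> nat. \<exists>z\<in>Z. \<forall>n. (z - (\<Sum>j<n. p ^ j * of_nat (c j))) / p ^ n \<in> Z"

text \<open>\<open>\<iota>\<close> is given only as a ring homomorphism. That integrality can be
  tested on the image, and that \<open>l\<close> is not 0 in \<open>'k\<close>, comes from the
  inverses of non-null Cauchy sequences.\<close>

lemma padic_subfield_image:
  fixes \<iota> :: "(nat \<Rightarrow> rat) set \<Rightarrow> 'k::field"
  assumes l: "prime l" and \<iota>: "\<iota> \<in> ring_hom (padic_field l) (ring_of_type_algebra :: 'k ring)"
  shows "padic_subfield (\<iota> ` carrier (padic_field l)) (\<iota> ` padic_integers l) (of_nat l)"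
proof -
  interpret padic l by unfold_locales (rule l)
  define q where "q x = \<iota> (cl x)" for x
  have clF: "cl x \<in> carrier (padic_field l)" if "cauchy x" for x using that carrier_F by auto
  have q_add: "q (\<lambda>n. x n + y n) = q x + q y" if "cauchy x" "cauchy y" for x y
    using ring_hom_add[OF cl_hom, of x y] ring_hom_add[OF \<iota>, of "cl x" "cl y"] that clF
    by (simp add: q_def carrier_C C_ops ring_of_type_algebra_def)
  have q_mult: "q (\<lambda>n. x n * y n) = q x * q y" if "cauchy x" "cauchy y" for x y
    using ring_hom_mult[OF cl_hom, of x y] ring_hom_mult[OF \<iota>, of "cl x" "cl y"] that clF
    by (simp add: q_def carrier_C C_ops ring_of_type_algebra_def)
  have q_1: "q (\<lambda>_. 1) = 1"
    using ring_hom_one[OF cl_hom] ring_hom_one[OF \<iota>] by (simp add: q_def C_ops ring_of_type_algebra_def)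
  have q_0: "q (\<lambda>_. 0) = 0" using q_add[of "\<lambda>_. 0" "\<lambda>_. 0", OF cauchy_const cauchy_const]
    by (metis (no_types) add_0 add_cancel_left_left)
  have q_uminus: "q (\<lambda>n. - x n) = - q x" if "cauchy x" for x
    using q_add[OF that cauchy_uminus[OF that]] q_0 by (simp add: eq_neg_iff_add_eq_0 add.commute)
  have q_diff: "q (\<lambda>n. x n - y n) = q x - q y" if "cauchy x" "cauchy y" for x y
    using q_add[OF that(1) cauchy_uminus[OF that(2)]] q_uminus[OF that(2)] by simp
  have q_null: "q x = 0" if "null x" for x
  proof -
    have cx: "cauchy x" by (rule null_cauchy[OF that])
    have "cl x = cl (\<lambda>_. 0)"
    proof
      show "cl x \<subseteq> cl (\<lambda>_. 0)" using null_add[OF _ that] by (fastforce simp: cl_iff)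
      show "cl (\<lambda>_. 0) \<subseteq> cl x" using null_add[OF _ null_uminus[OF that]] by (fastforce simp: cl_iff)
    qed
    then show ?thesis using q_0 by (simp add: q_def)
  qed
  have q_inverse: "q (\<lambda>n. inverse (x n)) = inverse (q x)" if "cauchy x" "\<not> null x" for x
  proof -
    have "q (\<lambda>n. x n * inverse (x n) - 1) = 0" by (rule q_null[OF cauchy_inverse(2)[OF that]])
    then have "q x * q (\<lambda>n. inverse (x n)) = 1"
      using q_diff[OF cauchy_mult[OF that(1) cauchy_inverse(1)[OF that]] cauchy_const[of 1]]
        q_mult[OF that(1) cauchy_inverse(1)[OF that]] q_1 by simp
    then show ?thesis by (metis inverse_unique)
  qed
  have q_nat: "q (\<lambda>_. of_nat k) = of_nat k" for k
  proof (induction k)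
    case (Suc k)
    then show ?case using q_add[of "\<lambda>_. 1" "\<lambda>_. of_nat k"] q_1 by (simp add: cauchy_const)
  qed (simp add: q_0)
  have q_power: "q (\<lambda>n. c ^ k) = q (\<lambda>n. c) ^ k" for c k
    by (induction k) (simp_all add: q_1 q_mult cauchy_const)
  have l0: "(of_nat l :: rat) \<noteq> 0" using l_gt_1 by simp
  have lnull: "\<not> null (\<lambda>_. of_nat l)" unfolding null_def using nrm_pos[OF l0] by (auto intro!: exI[of _ "nrm (of_nat l)"])
  have l_nz: "(of_nat l :: 'k) \<noteq> 0"
    using cauchy_inverse(2)[OF cauchy_const lnull] q_mult[OF cauchy_const[of "of_nat l"] cauchy_const[of "inverse (of_nat l)"]] l0 q_1 q_nat[of l] by auto
  have q_div: "q (\<lambda>n. x n / of_nat l ^ k) = q x / of_nat l ^ k" if "cauchy x" for x k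
  proof -
    have "x n = x n / of_nat l ^ k * of_nat l ^ k" for n using l0 by simp
    moreover have "cauchy (\<lambda>n. x n / of_nat l ^ k)"
      using cauchy_mult[OF that cauchy_const[of "inverse (of_nat l ^ k)"]] by (simp add: divide_inverse)
    ultimately have "q x = q (\<lambda>n. x n / of_nat l ^ k) * of_nat l ^ k"
      using q_mult[of "\<lambda>n. x n / of_nat l ^ k" "\<lambda>_. of_nat l ^ k"] cauchy_const q_power[of "of_nat l" k] q_nat by simp
    then show ?thesis using l_nz by (simp add: field_simps)
  qed
  have cauchy_div: "cauchy (\<lambda>n. x n / of_nat l ^ k)" if "cauchy x" for x k
    using cauchy_mult[OF that cauchy_const[of "inverse (of_nat l ^ k)"]] by (simp add: divide_inverse)
  have Q_eq: "\<iota> ` carrier (padic_field l) = q ` {x. cauchy x}" by (auto simp: carrier_F q_def)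
  have Z_eq: "\<iota> ` padic_integers l = q ` {x. cauchy x \<and> integral x}" by (auto simp: carrier_integers q_def)
  have nrm_div: "nrm (a / of_nat l ^ k) = nrm a * real l ^ k" for a k
    using l_gt_1 by (simp add: divide_inverse nrm_mult nrm_inverse nrm_power nrm_l power_inverse[symmetric])
  \<comment> \<open>The injectivity of \<open>\<iota>\<close> in the form needed: sequences with the
    same image differ by a null sequence, as a non-null difference would have an invertible
    image.\<close>
  have q_eq_int: "integral y" if "cauchy x" "integral x" "q y = q x" "cauchy y" for x y
  proof -
    have "null (\<lambda>n. y n - x n)"
    proof (rule ccontr)
      assume nn: "\<not> null (\<lambda>n. y n - x n)"
      have c: "cauchy (\<lambda>n. y n - x n)" using cauchy_diff that by blast
      have "q (\<lambda>n. y n - x n) = 0" using q_diff that by simp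
      then have "q (\<lambda>n. (y n - x n) * inverse (y n - x n) - 1) = - 1"
        using q_diff[OF cauchy_mult[OF c cauchy_inverse(1)[OF c nn]] cauchy_const[of 1]]
          q_mult[OF c cauchy_inverse(1)[OF c nn]] q_1 by simp
      then show False using q_null[OF cauchy_inverse(2)[OF c nn]] by simp
    qed
    then show ?thesis using integral_add[OF integral_null that(2)] by fastforce
  qed
  have Zq: "q x \<in> \<iota> ` padic_integers l \<longleftrightarrow> integral x" if "cauchy x" for x
    unfolding Z_eq using q_eq_int that by auto
  show ?thesis
  proof
    have QI: "q x \<in> \<iota> ` carrier (padic_field l)" if "cauchy x" for x unfolding Q_eq using that by blast
    have ZI: "q x \<in> \<iota> ` padic_integers l" if "cauchy x" "integral x" for x unfolding Z_eq using that by blast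
    show "0 \<in> \<iota> ` carrier (padic_field l)" "1 \<in> \<iota> ` carrier (padic_field l)"
      using QI[OF cauchy_const, of 0] QI[OF cauchy_const, of 1] by (simp_all only: q_0 q_1)
    show "x + y \<in> \<iota> ` carrier (padic_field l)" "x * y \<in> \<iota> ` carrier (padic_field l)"
      if xy: "x \<in> \<iota> ` carrier (padic_field l)" "y \<in> \<iota> ` carrier (padic_field l)" for x y
    proof -
      obtain a b where ab: "x = q a" "y = q b" "cauchy a" "cauchy b" using xy unfolding Q_eq by blast
      show "x + y \<in> \<iota> ` carrier (padic_field l)" "x * y \<in> \<iota> ` carrier (padic_field l)"
        using QI[OF cauchy_add[OF ab(3,4)]] QI[OF cauchy_mult[OF ab(3,4)]] ab
        by (simp_all only: q_add q_mult)
    qed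
    show "- x \<in> \<iota> ` carrier (padic_field l)" if x: "x \<in> \<iota> ` carrier (padic_field l)" for x
    proof -
      obtain a where a: "x = q a" "cauchy a" using x unfolding Q_eq by blast
      show ?thesis using QI[OF cauchy_uminus[OF a(2)]] a by (simp only: q_uminus)
    qed
    show "inverse x \<in> \<iota> ` carrier (padic_field l)" if x: "x \<in> \<iota> ` carrier (padic_field l)" for x
    proof -
      obtain y where y: "x = q y" "cauchy y" using x unfolding Q_eq by blast
      show ?thesis
      proof (cases "null y")
        case True
        then show ?thesis using q_null[OF True] y QI[OF cauchy_const, of 0] q_0 by simp
      next
        case False
        then show ?thesis using q_inverse[OF y(2) False] QI[OF cauchy_inverse(1)[OF y(2) False]] y by simp
      qed
    qed
    show "\<iota> ` padic_integers l \<subseteq> \<iota> ` carrier (padic_field l)" unfolding Q_eq Z_eq by auto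
    have i1: "integral (\<lambda>_. 1)" "integral (\<lambda>_. 0)" using integral_int[of "\<lambda>_. 1"] integral_int[of "\<lambda>_. 0"] by simp_all
    show "0 \<in> \<iota> ` padic_integers l" "1 \<in> \<iota> ` padic_integers l"
      using ZI[OF cauchy_const i1(2)] ZI[OF cauchy_const i1(1)] by (simp_all only: q_0 q_1)
    show "x + y \<in> \<iota> ` padic_integers l" "x * y \<in> \<iota> ` padic_integers l"
      if xy: "x \<in> \<iota> ` padic_integers l" "y \<in> \<iota> ` padic_integers l" for x y
    proof -
      obtain a b where ab: "x = q a" "y = q b" "cauchy a" "cauchy b" "integral a" "integral b"
        using xy unfolding Z_eq by blast
      show "x + y \<in> \<iota> ` padic_integers l" "x * y \<in> \<iota> ` padic_integers l"
        using ZI[OF cauchy_add[OF ab(3,4)] integral_add[OF ab(5,6)]]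
          ZI[OF cauchy_mult[OF ab(3,4)] integral_mult[OF ab(5,6)]] ab
        by (simp_all only: q_add q_mult)
    qed
    show "- x \<in> \<iota> ` padic_integers l" if x: "x \<in> \<iota> ` padic_integers l" for x
    proof -
      obtain a where a: "x = q a" "cauchy a" "integral a" using x unfolding Z_eq by blast
      show ?thesis using ZI[OF cauchy_uminus[OF a(2)] integral_uminus[OF a(3)]] a by (simp only: q_uminus)
    qed
    show "of_nat l \<in> \<iota> ` padic_integers l"
      using Zq[OF cauchy_const, of "of_nat l"] integral_int[of "\<lambda>_. int l"] q_nat[of l] by simp
    show "of_nat l \<noteq> (0 :: 'k)" by (rule l_nz)
    show "\<exists>n::nat. (z - of_nat n) / of_nat l \<in> \<iota> ` padic_integers l" if z: "z \<in> \<iota> ` padic_integers l" for z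
    proof -
      obtain x where x: "z = q x" "cauchy x" "integral x" using z unfolding Z_eq by blast
      obtain M where M: "\<forall>m\<ge>M. nrm (x m) \<le> 1" using x(3) unfolding integral_def by blast
      obtain K where K: "\<forall>m\<ge>K. \<forall>n\<ge>K. nrm (x m - x n) < 1" using cauchyD[OF x(2), of 1] by auto
      \<comment> \<open>The residue of one late term serves for all later ones, which are congruent
        to it.\<close>
      obtain n :: nat where n: "nrm (x (max M K) - of_nat n) < 1" using nrm_residue M by (metis max.cobounded1)
      have "nrm ((x m - of_nat n) / of_nat l) \<le> 1" if m: "m \<ge> max M K" for m
      proof -
        have "nrm (x m - of_nat n) < 1"
        proof -
          have "nrm (x m - x (max M K)) < 1" using K m by simp
          from nrm_add_less[OF this n] show ?thesis by simp
        qed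
        then have "nrm (x m - of_nat n) \<le> 1 / real l" by (rule nrm_less_1)
        then show ?thesis using nrm_div[of "x m - of_nat n" 1] l_gt_1 by (simp add: field_simps)
      qed
      then have "integral (\<lambda>m. (x m - of_nat n) / of_nat l)" unfolding integral_def by blast
      moreover have c: "cauchy (\<lambda>m. x m - of_nat n)" using cauchy_diff[OF x(2) cauchy_const] .
      ultimately have "q (\<lambda>m. (x m - of_nat n) / of_nat l) \<in> \<iota> ` padic_integers l"
        using Zq[OF cauchy_div[OF c, of 1]] by simp
      then have "(z - of_nat n) / of_nat l \<in> \<iota> ` padic_integers l"
        using q_div[OF c, of 1] q_diff[OF x(2) cauchy_const] q_nat x(1) by simp
      then show ?thesis by blast
    qed
    show "\<exists>i. of_nat l ^ i * z \<in> \<iota> ` padic_integers l" if z: "z \<in> \<iota> ` carrier (padic_field l)" for z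
    proof -
      obtain x where x: "z = q x" "cauchy x" using z unfolding Q_eq by blast
      obtain M K where K: "K > 0" "\<forall>n\<ge>M. nrm (x n) \<le> K" by (rule cauchy_bounded[OF x(2)])
      obtain i where i: "K < real l ^ i" using real_arch_pow[OF l_gt_1] by blast
      have "nrm (of_nat l ^ i * x n) \<le> 1" if "n \<ge> M" for n
      proof -
        have "nrm (x n) \<le> real l ^ i" using K that i by (meson less_imp_le order_trans)
        then show ?thesis using l_gt_1 by (simp add: nrm_mult nrm_power nrm_l power_divide field_simps)
      qed
      then have "integral (\<lambda>n. of_nat l ^ i * x n)" unfolding integral_def by blast
      then have "q (\<lambda>n. of_nat l ^ i * x n) \<in> \<iota> ` padic_integers l"
        using Zq[OF cauchy_mult[OF cauchy_const x(2)]] by simp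
      then show ?thesis using q_mult[OF cauchy_const x(2)] q_power q_nat x(1) by metis
    qed
    show "\<exists>i. z / of_nat l ^ i \<notin> \<iota> ` padic_integers l" if z: "z \<in> \<iota> ` carrier (padic_field l)" "z \<noteq> 0" for z
    proof -
      obtain x where x: "z = q x" "cauchy x" using z unfolding Q_eq by blast
      have "\<not> null x" using z(2) x q_null by blast
      then obtain M c where c: "c > 0" "\<forall>n\<ge>M. nrm (x n) = c" by (rule not_null[OF x(2)])
      obtain i where i: "1 / c < real l ^ i" using real_arch_pow[OF l_gt_1] by blast
      have "\<not> integral (\<lambda>n. x n / of_nat l ^ i)"
      proof
        assume "integral (\<lambda>n. x n / of_nat l ^ i)"
        then obtain N where "\<forall>n\<ge>N. nrm (x n / of_nat l ^ i) \<le> 1" unfolding integral_def by blast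
        then have "nrm (x (max M N) / of_nat l ^ i) \<le> 1" by simp
        then have "c * real l ^ i \<le> 1" using c(2) by (simp add: nrm_div)
        then show False using i c(1) by (simp add: field_simps)
      qed
      then show ?thesis using Zq[OF cauchy_div[OF x(2)]] q_div[OF x(2)] x(1) by metis
    qed
    show "inverse z \<in> \<iota> ` padic_integers l" if z: "z \<in> \<iota> ` padic_integers l" "z / of_nat l \<notin> \<iota> ` padic_integers l" for z
    proof -
      obtain x where x: "z = q x" "cauchy x" "integral x" using z unfolding Z_eq by blast
      have ni: "\<not> integral (\<lambda>n. x n / of_nat l)" using Zq[OF cauchy_div[OF x(2), of 1]] q_div[OF x(2), of 1] x(1) z(2) by simp
      have nn: "\<not> null x"
      proof
        assume "null x"
        then have "z = 0" using q_null x by simp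
        then show False using z by simp
      qed
      obtain M c where c: "c > 0" "\<forall>n\<ge>M. nrm (x n) = c" by (rule not_null[OF x(2) nn])
      have "c \<ge> 1"
      proof (rule ccontr)
        assume "\<not> c \<ge> 1"
        then have "c * real l \<le> 1" using nrm_less_1[of "x M"] c(2) l_gt_1 by (simp add: field_simps)
        then have "integral (\<lambda>n. x n / of_nat l)"
          unfolding integral_def using c nrm_div[of _ 1] by auto
        then show False using ni by simp
      qed
      then have "integral (\<lambda>n. inverse (x n))" unfolding integral_def using c
        by (auto simp: nrm_inverse inverse_le_1_iff intro!: exI[of _ M])
      then show ?thesis using Zq[OF cauchy_inverse(1)[OF x(2) nn]] q_inverse[OF x(2) nn] x(1) by simp
    qed
    show "\<exists>z\<in>\<iota> ` padic_integers l. \<forall>n. (z - (\<Sum>j<n. of_nat l ^ j * of_nat (c j))) / of_nat l ^ n \<in> \<iota> ` padic_integers l"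
      for c :: "nat \<Rightarrow> nat"
    proof -
      \<comment> \<open>Because the digits are natural numbers, the partial sums are rational, and
        their sequence itself represents the limit.\<close>
      define s where "s n = (\<Sum>j<n. of_nat l ^ j * of_nat (c j) :: rat)" for n
      have diff: "\<exists>k. s m - s n = of_nat l ^ n * of_int k" if "m \<ge> n" for m n
      proof -
        have "s m - s n = (\<Sum>j=n..<m. of_nat l ^ j * of_nat (c j))"
          unfolding s_def using that by (simp add: sum_diff_nat_ivl lessThan_atLeast0)
        also have "\<dots> = (\<Sum>j=n..<m. of_nat l ^ n * (of_nat l ^ (j - n) * of_nat (c j)))"
          by (rule sum.cong) (auto simp: power_add[symmetric] mult.assoc[symmetric])
        also have "\<dots> = of_nat l ^ n * of_int (\<Sum>j=n..<m. int l ^ (j - n) * int (c j))"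
          by (simp add: sum_distrib_left)
        finally show ?thesis by blast
      qed
      have small: "nrm ((s m - s n) / of_nat l ^ k) \<le> 1" if mn: "m \<ge> k" "n \<ge> k" for m n k
      proof -
        obtain a where "s m - s k = of_nat l ^ k * of_int a" using diff[OF mn(1)] by blast
        moreover obtain b where "s n - s k = of_nat l ^ k * of_int b" using diff[OF mn(2)] by blast
        ultimately have "s m - s n = of_nat l ^ k * of_int (a - b)" by (simp add: algebra_simps)
        then show ?thesis using l0 nrm_int[of "a - b"] by simp
      qed
      have sc: "cauchy s" unfolding cauchy_def
      proof (intro allI impI)
        fix e :: real assume e: "e > 0"
        obtain k where k: "1 / e < real l ^ k" using real_arch_pow[OF l_gt_1] by blast
        have "nrm (s m - s n) < e" if "m \<ge> k" "n \<ge> k" for m n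
        proof -
          have "nrm (s m - s n) * real l ^ k \<le> 1" using small[OF that] by (simp add: nrm_div)
          also have "1 < e * real l ^ k" using k e by (simp add: field_simps)
          finally show ?thesis using l_gt_1 by simp
        qed
        then show "\<exists>N. \<forall>m\<ge>N. \<forall>n\<ge>N. nrm (s m - s n) < e" by blast
      qed
      have qs: "q (\<lambda>_. s n) = (\<Sum>j<n. of_nat l ^ j * of_nat (c j))" for n
      proof (induction n)
        case (Suc n)
        have "q (\<lambda>_. s (Suc n)) = q (\<lambda>_. s n) + q (\<lambda>_. of_nat l ^ n * of_nat (c n))"
          using q_add[OF cauchy_const cauchy_const] by (simp add: s_def)
        then show ?case using Suc q_mult[OF cauchy_const cauchy_const] q_power q_nat by simp
      qed (simp add: s_def q_0)
      have "(q s - (\<Sum>j<n. of_nat l ^ j * of_nat (c j))) / of_nat l ^ n \<in> \<iota> ` padic_integers l" for n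
      proof -
        have c: "cauchy (\<lambda>m. s m - s n)" by (rule cauchy_diff[OF sc cauchy_const])
        have "integral (\<lambda>m. (s m - s n) / of_nat l ^ n)" unfolding integral_def using small by blast
        then have "q (\<lambda>m. (s m - s n) / of_nat l ^ n) \<in> \<iota> ` padic_integers l" using Zq[OF cauchy_div[OF c]] by simp
        then show ?thesis using q_div[OF c] q_diff[OF sc cauchy_const] qs by simp
      qed
      moreover from this[of 0] have "q s \<in> \<iota> ` padic_integers l" by simp
      ultimately show ?thesis by blast
    qed
  qed
qed

section \<open>Rings of integers of unramified extensions\<close>

text \<open>What is used of the integral closure \<open>\<O>\<close>: \<open>dep\<close> bounds the
  degree over \<open>Q\<close>, \<open>monic\<close> says that roots of monic polynomials over
  \<open>Z\<close> belong to \<open>\<O>\<close>, and \<open>maximal\<close> together with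
  \<open>inverse_p\<close> that \<open>p\<close> generates a maximal ideal, which is where the
  extension being unramified enters.\<close>

locale padic_extension = padic_subfield Q Z p for Q Z :: "'k::field set" and p +
  fixes \<O> :: "'k set" and d l :: nat
  assumes dep: "\<And>us :: nat \<Rightarrow> 'k. \<exists>q. (\<forall>i. q i \<in> Q) \<and> (\<exists>i\<le>d. q i \<noteq> 0) \<and> (\<Sum>i\<le>d. q i * us i) = 0"
    and O_zero: "0 \<in> \<O>" and O_one: "1 \<in> \<O>" and O_add: "\<And>x y. x \<in> \<O> \<Longrightarrow> y \<in> \<O> \<Longrightarrow> x + y \<in> \<O>"
    and O_uminus: "\<And>x. x \<in> \<O> \<Longrightarrow> - x \<in> \<O>" and O_mult: "\<And>x y. x \<in> \<O> \<Longrightarrow> y \<in> \<O> \<Longrightarrow> x * y \<in> \<O>"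
    and Z_O: "Z \<subseteq> \<O>" and inverse_p: "inverse p \<notin> \<O>"
    and maximal: "\<And>x. x \<in> \<O> \<Longrightarrow> x / p \<notin> \<O> \<Longrightarrow> \<exists>y\<in>\<O>. \<exists>z\<in>\<O>. x * y = 1 + p * z"
    and monic: "\<And>n c x. (\<And>i. i < n \<Longrightarrow> c i \<in> Z) \<Longrightarrow> x ^ n + (\<Sum>i<n. c i * x ^ i) = 0 \<Longrightarrow> x \<in> \<O>"
    and p_l: "p = of_nat l" "odd l"
begin

lemma O_diff: "x \<in> \<O> \<Longrightarrow> y \<in> \<O> \<Longrightarrow> x - y \<in> \<O>"
  using O_add[of x "- y"] O_uminus by simp

lemma O_sum: "(\<And>a. a \<in> A \<Longrightarrow> g a \<in> \<O>) \<Longrightarrow> sum g A \<in> \<O>"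
  by (induction A rule: infinite_finite_induct) (auto intro: O_add O_zero)

lemma O_power: "x \<in> \<O> \<Longrightarrow> x ^ n \<in> \<O>"
  by (induction n) (auto intro: O_mult O_one)

lemma p_O: "p \<in> \<O>" using p_Z Z_O by auto

lemma Z_power: "x \<in> Z \<Longrightarrow> x ^ n \<in> Z"
  by (induction n) (auto intro: Z)

lemma Z_bounded_family:
  assumes "\<And>i::nat. i \<le> m \<Longrightarrow> q i \<in> Q"
  shows "\<exists>n. \<forall>i\<le>m. p ^ n * q i \<in> Z"
proof -
  have "\<forall>i\<in>{..m}. \<exists>n. p ^ n * q i \<in> Z" using assms Z_bounded by auto
  then obtain M where M: "\<forall>i\<in>{..m}. p ^ M i * q i \<in> Z" by (rule bchoice[THEN exE])
  have "p ^ Max (M ` {..m}) * q i \<in> Z" if "i \<le> m" for i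
  proof -
    have "M i \<le> Max (M ` {..m})" using that by (intro Max_ge) auto
    then have "p ^ Max (M ` {..m}) * q i = p ^ (Max (M ` {..m}) - M i) * (p ^ M i * q i)"
      by (simp add: mult.assoc[symmetric] power_add[symmetric])
    moreover have "p ^ M i * q i \<in> Z" using M that by simp
    ultimately show ?thesis using Z(5)[OF Z_power[OF p_Z]] by (simp only:)
  qed
  then show ?thesis by blast
qed

lemma primitive_relation:
  assumes q: "\<And>i::nat. i \<le> m \<Longrightarrow> q i \<in> Q" and j: "j \<le> m" "q j \<noteq> 0"
  obtains e k where "\<And>i. i \<le> m \<Longrightarrow> e * q i \<in> Z" "k \<le> m" "e * q k / p \<notin> Z"
proof -
  obtain n where n: "\<forall>i\<le>m. p ^ n * q i \<in> Z" using Z_bounded_family[of m q] q by blast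
  obtain t where t: "p ^ n * q j / p ^ t \<notin> Z"
    using Z_separated[of "p ^ n * q j"] n j Z_Q p_nonzero by auto
  define P where "P t \<longleftrightarrow> (\<forall>i\<le>m. p ^ n * q i / p ^ t \<in> Z)" for t
  have "P 0" "\<not> P t" using n t j by (auto simp: P_def)
  then obtain s where s: "P s" "\<not> P (Suc s)" by (rule last_true_nat)
  then obtain k where k: "k \<le> m" "p ^ n * q k / p ^ Suc s \<notin> Z" by (auto simp: P_def)
  show ?thesis
    by (rule that[of "p ^ n / p ^ s" k]) (use s(1) k in \<open>auto simp: P_def field_simps\<close>)
qed

text \<open>The lowest nonzero coefficient of an algebraic relation for \<open>x\<close> is a
  multiple of \<open>x\<close> in \<open>\<O>\<close>. If \<open>x\<close> were divisible by all
  powers of \<open>p\<close>, so would be this coefficient; but it is a unit of \<open>Z\<close>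
  times a power of \<open>p\<close>, and \<open>inverse p\<close> would be integral.\<close>

lemma O_separated: assumes x: "x \<noteq> 0" shows "\<exists>n. x / p ^ n \<notin> \<O>"
proof (rule ccontr)
  assume "\<nexists>n. x / p ^ n \<notin> \<O>"
  then have xn: "x / p ^ n \<in> \<O>" for n by blast
  obtain q where q: "\<forall>i. q i \<in> Q" "\<exists>i\<le>d. q i \<noteq> 0" "(\<Sum>i\<le>d. q i * x ^ i) = 0" using dep by blast
  define m where "m = (LEAST i. q i \<noteq> 0)"
  have m: "q m \<noteq> 0" "m \<le> d" "\<And>i. i < m \<Longrightarrow> q i = 0"
    using q(2) unfolding m_def by (metis (mono_tags, lifting) LeastI, meson LeastI Least_le order_trans, use not_less_Least in blast)
  obtain n where n: "\<forall>i\<le>d. p ^ n * q i \<in> Z" using Z_bounded_family[of d q] q(1) by blast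
  define c where "c i = p ^ n * q i" for i
  have cm: "c m \<in> Q" "c m \<noteq> 0" "c m \<in> Z" using n m(1,2) Z_Q p_nonzero by (auto simp: c_def)
  obtain k' where "c m / p ^ k' \<notin> Z" using Z_separated cm by blast
  then obtain k where k: "c m / p ^ k \<in> Z" "c m / p ^ Suc k \<notin> Z"
    using last_true_nat[of "\<lambda>k. c m / p ^ k \<in> Z" k'] cm by auto
  have u: "inverse (c m / p ^ k) \<in> Z" by (rule Z_unit[OF k(1)]) (use k(2) in \<open>simp add: field_simps\<close>)
  define w where "w = (\<Sum>i=Suc m..d. c i * x ^ (i - Suc m))"
  have xO: "x \<in> \<O>" using xn[of 0] by simp
  have cO: "c i \<in> \<O>" if "i \<le> d" for i using n Z_O that by (auto simp: c_def)
  have wO: "w \<in> \<O>" unfolding w_def using xO by (intro O_sum O_mult[OF cO O_power]) auto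
  have "(\<Sum>i\<le>d. c i * x ^ i) = 0" unfolding c_def mult.assoc sum_distrib_left[symmetric] q(3) by simp
  moreover have "(\<Sum>i\<le>d. c i * x ^ i) = (\<Sum>i=m..d. c i * x ^ i)"
    using m by (intro sum.mono_neutral_right) (auto simp: c_def not_le)
  moreover have "\<dots> = c m * x ^ m + (\<Sum>i=Suc m..d. c i * x ^ i)"
    using m(2) by (simp add: sum.atLeast_Suc_atMost)
  moreover have "(\<Sum>i=Suc m..d. c i * x ^ i) = x ^ m * (x * w)"
    unfolding w_def sum_distrib_left
    by (rule sum.cong) (auto simp: power_add[symmetric] mult_ac simp flip: power_Suc)
  ultimately have "x ^ m * (c m + x * w) = 0" by (simp add: algebra_simps)
  then have cxw: "c m = - (x * w)" using x by (simp add: eq_neg_iff_add_eq_0)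
  have "- (x / p ^ Suc k) * w * inverse (c m / p ^ k) \<in> \<O>"
    by (rule O_mult[OF O_mult[OF O_uminus[OF xn] wO] subsetD[OF Z_O u]])
  moreover have "- (x / p ^ Suc k) * w * inverse (c m / p ^ k) = inverse p"
  proof -
    have "- (x / p ^ Suc k) * w = c m / p ^ Suc k" by (simp add: cxw)
    then show ?thesis using cm(2) p_nonzero by (simp add: field_simps)
  qed
  ultimately show False using inverse_p by simp
qed

text \<open>A family of elements of \<open>\<O>\<close> that is independent modulo \<open>p\<close>
  has at most \<open>d\<close> members, because a relation over \<open>Q\<close> can be made
  primitive. By maximality, the combinations of a largest such family with digits below
  \<open>l\<close> represent \<open>\<O>\<close> modulo \<open>p\<close>.\<close>

lemma O_finite: "\<exists>Y. finite Y \<and> (\<forall>x\<in>\<O>. \<exists>y\<in>Y. (x - y) / p \<in> \<O>)"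
proof -
  \<comment> \<open>There are \<open>m\<close> elements of \<open>\<O>\<close> whose classes modulo
    \<open>p\<close> are linearly independent over the residue field of \<open>Z\<close>.\<close>
  define I where "I m \<longleftrightarrow> (\<exists>b. (\<forall>i<m. b i \<in> \<O>) \<and>
    (\<forall>c. (\<forall>i<m. c i \<in> Z) \<longrightarrow> (\<Sum>i<m. c i * b i) / p \<in> \<O> \<longrightarrow> (\<forall>i<m. c i / p \<in> Z)))" for m :: nat
  have "I 0" by (simp add: I_def)
  moreover have "\<not> I (Suc d)"
  proof
    assume "I (Suc d)"
    then obtain b where b: "\<And>c. (\<forall>i<Suc d. c i \<in> Z) \<Longrightarrow> (\<Sum>i<Suc d. c i * b i) / p \<in> \<O> \<Longrightarrow> (\<forall>i<Suc d. c i / p \<in> Z)"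
      unfolding I_def by blast
    obtain q where q: "\<forall>i. q i \<in> Q" "\<exists>i\<le>d. q i \<noteq> 0" "(\<Sum>i\<le>d. q i * b i) = 0" using dep by blast
    then obtain j where j: "j \<le> d" "q j \<noteq> 0" by blast
    obtain e k where e: "\<And>i. i \<le> d \<Longrightarrow> e * q i \<in> Z" "k \<le> d" "e * q k / p \<notin> Z"
      using primitive_relation[of d q j] q(1) j by blast
    have "(\<Sum>i<Suc d. e * q i * b i) = 0"
      unfolding lessThan_Suc_atMost mult.assoc sum_distrib_left[symmetric] q(3) by simp
    then have "\<forall>i<Suc d. e * q i / p \<in> Z" using b[of "\<lambda>i. e * q i"] e O_zero by (simp add: less_Suc_eq_le)
    then show False using e by (simp add: less_Suc_eq_le)
  qed
  ultimately obtain m where m: "I m" "\<not> I (Suc m)" by (rule last_true_nat)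
  obtain b where b: "\<forall>i<m. b i \<in> \<O>"
    "\<And>c. (\<forall>i<m. c i \<in> Z) \<Longrightarrow> (\<Sum>i<m. c i * b i) / p \<in> \<O> \<Longrightarrow> (\<forall>i<m. c i / p \<in> Z)"
    using m(1) unfolding I_def by blast
  define Y where "Y = (\<lambda>n. \<Sum>i<m. of_nat (n i) * b i) ` ({..<m} \<rightarrow>\<^sub>E {..<l})"
  have "finite Y" unfolding Y_def by (intro finite_imageI finite_PiE) auto
  moreover have "\<exists>y\<in>Y. (x - y) / p \<in> \<O>" if x: "x \<in> \<O>" for x
  proof -
    define b' where "b' = b(m := x)"
    have "\<forall>i<Suc m. b' i \<in> \<O>" using b(1) x by (simp add: b'_def)
    then obtain c where c: "\<forall>i<Suc m. c i \<in> Z" "(\<Sum>i<Suc m. c i * b' i) / p \<in> \<O>" "\<not> (\<forall>i<Suc m. c i / p \<in> Z)"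
      using m(2) unfolding I_def by blast
    have sum: "(\<Sum>i<Suc m. c i * b' i) = (\<Sum>i<m. c i * b i) + c m * x" by (simp add: b'_def)
    have cm: "c m / p \<notin> Z"
    proof
      assume cm: "c m / p \<in> Z"
      have "(\<Sum>i<Suc m. c i * b' i) / p - c m / p * x \<in> \<O>"
        using c(2) cm Z_O x by (intro O_diff O_mult) auto
      also have "(\<Sum>i<Suc m. c i * b' i) / p - c m / p * x = (\<Sum>i<m. c i * b i) / p"
        unfolding sum by (simp add: add_divide_distrib)
      finally have "(\<Sum>i<m. c i * b i) / p \<in> \<O>" .
      then have "\<forall>i<m. c i / p \<in> Z" using b(2) c(1) by auto
      then show False using c(3) cm by (auto simp: less_Suc_eq)
    qed
    have u: "inverse (c m) \<in> Z" using Z_unit[OF _ cm] c(1) by simp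
    have cm0: "c m \<noteq> 0" using cm Z(1) by auto
    \<comment> \<open>The coefficient of \<open>x\<close> in the dependence relation is a unit, so
      the relation can be solved for \<open>x\<close> modulo \<open>p\<close>.\<close>
    define z where "z i = - (inverse (c m) * c i)" for i
    have z: "z i \<in> Z" if "i < m" for i unfolding z_def using c(1) u that by (intro Z) auto
    have "\<exists>n<l. (z i - of_nat n) / p \<in> Z" if i: "i < m" for i
    proof -
      obtain n :: nat where n: "(z i - of_nat n) / p \<in> Z" using Z_residue[OF z[OF i]] by blast
      have "of_nat n = p * of_nat (n div l) + of_nat (n mod l)"
        unfolding p_l(1) by (metis mult_div_mod_eq of_nat_add of_nat_mult)
      then have "(z i - of_nat (n mod l)) / p = (z i - of_nat n) / p + of_nat (n div l)"
        using p_nonzero by (simp add: field_simps)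
      moreover have nat: "of_nat k \<in> Z" for k by (induction k) (auto intro: Z)
      ultimately have "(z i - of_nat (n mod l)) / p \<in> Z" using Z(3)[OF n nat] by simp
      moreover have "n mod l < l" using p_l(2) by (intro mod_less_divisor) (auto intro: Nat.gr0I)
      ultimately show ?thesis by blast
    qed
    then have "\<forall>i\<in>{..<m}. \<exists>n. n < l \<and> (z i - of_nat n) / p \<in> Z" by blast
    then obtain n where n: "\<forall>i\<in>{..<m}. n i < l \<and> (z i - of_nat (n i)) / p \<in> Z" by (rule bchoice[THEN exE])
    define y where "y = (\<Sum>i<m. of_nat (restrict n {..<m} i) * b i)"
    have "y \<in> Y" unfolding Y_def y_def using n by (intro imageI) (auto simp: PiE_iff extensional_def)
    moreover have eq: "(x - y) / p = inverse (c m) * ((\<Sum>i<Suc m. c i * b' i) / p) + (\<Sum>i<m. (z i - of_nat (n i)) / p * b i)"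
    proof -
      have "(\<Sum>i<m. (z i - of_nat (n i)) / p * b i) = ((\<Sum>i<m. z i * b i) - y) / p"
        by (simp add: y_def sum_subtractf[symmetric] sum_divide_distrib left_diff_distrib)
      also have "(\<Sum>i<m. z i * b i) = - (inverse (c m) * (\<Sum>i<m. c i * b i))"
        by (simp add: z_def sum_negf sum_distrib_left mult.assoc)
      finally have e: "(\<Sum>i<m. (z i - of_nat (n i)) / p * b i) = (- (inverse (c m) * (\<Sum>i<m. c i * b i)) - y) / p" .
      show ?thesis unfolding sum e using cm0 p_nonzero by (simp add: field_simps)
    qed
    moreover have "inverse (c m) * ((\<Sum>i<Suc m. c i * b' i) / p) \<in> \<O>" 
      using u Z_O by (intro O_mult[OF _ c(2)]) auto
    moreover have "(z i - of_nat (n i)) / p * b i \<in> \<O>" if "i < m" for i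
      using n b(1) Z_O that by (intro O_mult) auto
    then have "(\<Sum>i<m. (z i - of_nat (n i)) / p * b i) \<in> \<O>" by (intro O_sum) auto
    ultimately have "(x - y) / p \<in> \<O>" unfolding eq by (intro O_add)
    then show ?thesis using \<open>y \<in> Y\<close> by blast
  qed
  ultimately show ?thesis by blast
qed

text \<open>Passing on carries replaces the coefficients by representatives from a finite set.
  Collecting equal coefficients then turns the series into a finite combination of series with
  digits 0 and 1, which converge in \<open>Z\<close>.\<close>

lemma O_complete:
  assumes c: "\<And>j::nat. c j \<in> \<O>"
  shows "\<exists>x\<in>\<O>. \<forall>n. (x - (\<Sum>j<n. p ^ j * c j)) / p ^ n \<in> \<O>"
proof -
  obtain Y where Y: "finite Y" "\<forall>x\<in>\<O>. \<exists>y. y \<in> Y \<and> (x - y) / p \<in> \<O>" using O_finite by blast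
  obtain h where h: "\<forall>x\<in>\<O>. h x \<in> Y \<and> (x - h x) / p \<in> \<O>" using bchoice[OF Y(2)] by blast
  have hO: "h x \<in> \<O>" if "x \<in> \<O>" for x
  proof -
    have "x - p * ((x - h x) / p) \<in> \<O>" using h that by (intro O_diff O_mult p_O) auto
    then show ?thesis using p_nonzero by simp
  qed
  text \<open>\<open>r\<close> is the sequence of carries.\<close>
  define r where "r = rec_nat 0 (\<lambda>j r. (c j + r - h (c j + r)) / p)"
  have r0: "r 0 = 0" and rS: "r (Suc j) = (c j + r j - h (c j + r j)) / p" for j by (simp_all add: r_def)
  have rO: "r j \<in> \<O>" for j
    by (induction j) (use h c in \<open>auto simp: r0 rS O_zero intro: O_add\<close>)
  define y where "y j = h (c j + r j)" for j
  have yY: "y j \<in> Y" "y j \<in> \<O>" for j unfolding y_def using h hO c rO O_add by auto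
  have sums: "(\<Sum>j<n. p ^ j * c j) = (\<Sum>j<n. p ^ j * y j) + p ^ n * r n" for n
  proof (induction n)
    case (Suc n)
    have "p * r (Suc n) = c n + r n - y n" using p_nonzero by (simp add: rS y_def)
    then have "p ^ Suc n * r (Suc n) = p ^ n * (c n + r n - y n)" by (simp add: mult.assoc)
    then show ?case using Suc by (simp add: algebra_simps)
  qed (simp add: r0)
  define Y' where "Y' = Y \<inter> \<O>"
  have Y': "finite Y'" "\<And>j. y j \<in> Y'" "\<And>a. a \<in> Y' \<Longrightarrow> a \<in> \<O>" using Y(1) yY by (auto simp: Y'_def)
  have "\<forall>a. \<exists>\<zeta>. \<zeta> \<in> Z \<and> (\<forall>n. (\<zeta> - (\<Sum>j<n. p ^ j * of_nat (if y j = a then 1 else 0))) / p ^ n \<in> Z)"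
  proof
    fix a
    show "\<exists>\<zeta>. \<zeta> \<in> Z \<and> (\<forall>n. (\<zeta> - (\<Sum>j<n. p ^ j * of_nat (if y j = a then 1 else 0))) / p ^ n \<in> Z)"
      using Z_complete[of "\<lambda>j. if y j = a then 1 else 0"] by (simp only: Bex_def)
  qed
  then obtain \<zeta> where \<zeta>: "\<forall>a. \<zeta> a \<in> Z \<and> (\<forall>n. (\<zeta> a - (\<Sum>j<n. p ^ j * of_nat (if y j = a then 1 else 0))) / p ^ n \<in> Z)"
    by (rule choice[THEN exE])
  define x where "x = (\<Sum>a\<in>Y'. \<zeta> a * a)"
  have "(x - (\<Sum>j<n. p ^ j * c j)) / p ^ n \<in> \<O>" for n
  proof -
    have "(\<Sum>j<n. p ^ j * y j) = (\<Sum>j<n. \<Sum>a\<in>Y'. p ^ j * of_nat (if y j = a then 1 else 0) * a)"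
      using Y' by (intro sum.cong refl) (simp add: if_distrib[of "\<lambda>x. _ * x"] if_distrib[of of_nat] if_distribR cong: if_cong, simp add: if_distrib[of "\<lambda>x. x * _"] cong: if_cong)
    also have "\<dots> = (\<Sum>a\<in>Y'. (\<Sum>j<n. p ^ j * of_nat (if y j = a then 1 else 0)) * a)"
      unfolding sum_distrib_right by (rule sum.swap)
    finally have "(x - (\<Sum>j<n. p ^ j * c j)) / p ^ n =
      (\<Sum>a\<in>Y'. (\<zeta> a - (\<Sum>j<n. p ^ j * of_nat (if y j = a then 1 else 0))) / p ^ n * a) - r n"
      unfolding sums x_def using p_nonzero
      by (simp add: diff_divide_distrib add_divide_distrib left_diff_distrib sum_subtractf
          sum_divide_distrib[of _ Y'])
    also have "\<dots> \<in> \<O>" using \<zeta> Z_O Y'(3) rO by (intro O_diff O_sum O_mult) auto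
    finally show ?thesis .
  qed
  moreover from this[of 0] have "x \<in> \<O>" by simp
  ultimately show ?thesis by blast
qed

text \<open>Maximality inverts \<open>x\<close> modulo \<open>p\<close>, and the geometric series
  for the inverse of \<open>1 + p * z\<close> does the rest.\<close>

lemma O_unit: assumes x: "x \<in> \<O>" "x / p \<notin> \<O>" shows "inverse x \<in> \<O>"
proof -
  obtain y z where yz: "y \<in> \<O>" "z \<in> \<O>" "x * y = 1 + p * z" using maximal[OF x] by blast
  obtain s where s: "s \<in> \<O>" "\<forall>n. (s - (\<Sum>j<n. p ^ j * (- z) ^ j)) / p ^ n \<in> \<O>"
    using O_complete[of "\<lambda>j. (- z) ^ j"] yz O_power O_uminus by blast
  have "(1 + p * z) * s - 1 = 0"
  proof (rule ccontr)
    assume "(1 + p * z) * s - 1 \<noteq> 0"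
    then obtain n where n: "((1 + p * z) * s - 1) / p ^ n \<notin> \<O>" using O_separated by blast
    have g: "(1 + p * z) * (\<Sum>j<n. p ^ j * (- z) ^ j) = 1 - p ^ n * (- z) ^ n"
      by (induction n) (simp_all add: algebra_simps)
    have "((1 + p * z) * s - 1) / p ^ n =
      (1 + p * z) * ((s - (\<Sum>j<n. p ^ j * (- z) ^ j)) / p ^ n) - (- z) ^ n"
    proof -
      have "(1 + p * z) * (s - (\<Sum>j<n. p ^ j * (- z) ^ j)) = (1 + p * z) * s - 1 + p ^ n * (- z) ^ n"
        unfolding right_diff_distrib g by simp
      then show ?thesis using p_nonzero by (simp add: field_simps)
    qed
    also have "\<dots> \<in> \<O>" using s yz by (intro O_diff O_mult O_add O_one p_O O_power O_uminus) auto
    finally show False using n by simp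
  qed
  then have "x * (y * s) = 1" using yz(3) by (simp add: mult.assoc[symmetric])
  then have "inverse x = y * s" by (metis inverse_unique)
  then show ?thesis using O_mult yz s by simp
qed

lemma O_bounded: "\<exists>n. p ^ n * x \<in> \<O>"
proof -
  obtain q where q: "\<forall>i. q i \<in> Q" "\<exists>i\<le>d. q i \<noteq> 0" "(\<Sum>i\<le>d. q i * x ^ i) = 0" using dep by blast
  define m where "m = Max {i. i \<le> d \<and> q i \<noteq> 0}"
  have fin: "finite {i. i \<le> d \<and> q i \<noteq> 0}" by (rule finite_subset[of _ "{..d}"]) auto
  have m: "q m \<noteq> 0" "m \<le> d" "\<And>i. i \<le> d \<Longrightarrow> m < i \<Longrightarrow> q i = 0"
  proof -
    have "m \<in> {i. i \<le> d \<and> q i \<noteq> 0}" unfolding m_def using q(2) by (intro Max_in[OF fin]) auto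
    then show "q m \<noteq> 0" "m \<le> d" by auto
    show "q i = 0" if "i \<le> d" "m < i" for i
      using Max_ge[OF fin, of i] that by (auto simp: m_def[symmetric])
  qed
  have "(\<Sum>i\<le>d. q i * x ^ i) = (\<Sum>i\<le>m. q i * x ^ i)"
    using m by (intro sum.mono_neutral_right) (auto simp: not_le)
  then have s: "q m * x ^ m + (\<Sum>i<m. q i * x ^ i) = 0" using q(3)
    by (simp add: lessThan_Suc_atMost[symmetric] add.commute)
  define a where "a i = inverse (q m) * q i" for i
  have "inverse (q m) * (q m * x ^ m + (\<Sum>i<m. q i * x ^ i)) = 0" unfolding s by simp
  then have a: "x ^ m + (\<Sum>i<m. a i * x ^ i) = 0"
    using m(1) by (simp add: distrib_left sum_distrib_left mult.assoc[symmetric] a_def)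
  obtain n where n: "\<forall>i\<le>m. p ^ n * a i \<in> Z" using Z_bounded_family[of m a] q(1) Q by (auto simp: a_def)
  \<comment> \<open>These are the coefficients of the monic polynomial with root
    \<open>p ^ n * x\<close>; each contains at least one factor \<open>p ^ n\<close>, which clears
    the denominator of \<open>a i\<close>.\<close>
  define c where "c i = p ^ (n * (m - i)) * a i" for i
  have "p ^ n * x \<in> \<O>"
  proof (rule monic[of m c])
    show "c i \<in> Z" if "i < m" for i
    proof -
      have "m - i = Suc (m - i - 1)" using that by simp
      then have "n * (m - i) = n * (m - i - 1) + n" by (metis add.commute mult_Suc_right)
      then have "c i = p ^ (n * (m - i - 1)) * (p ^ n * a i)" by (simp add: c_def power_add mult.assoc)
      then show ?thesis using n that Z(5)[OF Z_power[OF p_Z]] by simp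
    qed
    have "c i * (p ^ n * x) ^ i = p ^ (n * m) * (a i * x ^ i)" if "i < m" for i
    proof -
      have "n * m = n * (m - i) + n * i" using that by (metis add_mult_distrib2 le_add_diff_inverse2 less_imp_le)
      then show ?thesis by (simp add: c_def power_mult_distrib power_mult[symmetric] power_add mult_ac)
    qed
    then have "(\<Sum>i<m. c i * (p ^ n * x) ^ i) = p ^ (n * m) * (\<Sum>i<m. a i * x ^ i)"
      unfolding sum_distrib_left by (intro sum.cong) auto
    moreover have "(p ^ n * x) ^ m = p ^ (n * m) * x ^ m" by (simp add: power_mult_distrib power_mult)
    ultimately show "(p ^ n * x) ^ m + (\<Sum>i<m. c i * (p ^ n * x) ^ i) = 0"
      using a by (simp add: distrib_left[symmetric])
  qed
  then show ?thesis by blast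
qed

lemma complete_dvr: "complete_dvr \<O> p"
proof
  \<comment> \<open>For \<open>l = 2 m + 1\<close>, integrality of \<open>2 / p\<close> would make
    \<open>1 - m * (2 / p) = inverse p\<close> integral.\<close>
  have two: "2 / p \<notin> \<O>"
  proof
    assume a: "2 / p \<in> \<O>"
    obtain m where m: "l = 2 * m + 1" using p_l(2) by (rule oddE)
    have nat: "of_nat k \<in> \<O>" for k by (induction k) (auto intro: O_zero O_one O_add)
    have "1 - of_nat m * (2 / p) \<in> \<O>" using a nat by (intro O_diff O_one O_mult) auto
    moreover have "p = 2 * of_nat m + 1" unfolding p_l(1) m by simp
    then have "1 - of_nat m * (2 / p) = inverse p" using p_nonzero by (simp add: field_simps)
    ultimately show False using inverse_p by simp
  qed
  show "(2::'k) \<noteq> 0" using two O_zero by auto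
  have "1 + 1 \<in> \<O>" by (intro O_add O_one)
  then show "inverse 2 \<in> \<O>" using two by (intro O_unit) auto
  show "\<exists>x\<in>\<O>. \<forall>n. (x - (\<Sum>j<n. p ^ j * c j)) / p ^ n \<in> \<O>" if "\<And>j. c j \<in> \<O>" for c :: "nat \<Rightarrow> 'k"
    by (rule O_complete[OF that])
qed (fact O_zero O_one O_add O_uminus O_mult p_O p_nonzero O_bounded O_separated O_unit O_finite)+

end

lemma finite_dimension_dependent:
  fixes Q :: "'k::field set"
  assumes "subfield Q (ring_of_type_algebra :: 'k ring)"
    and "ring.finite_dimension (ring_of_type_algebra :: 'k ring) Q UNIV"
  obtains d where "\<forall>us :: nat \<Rightarrow> 'k. \<exists>q. (\<forall>i. q i \<in> Q) \<and> (\<exists>i\<le>d. q i \<noteq> 0) \<and> (\<Sum>i\<le>d. q i * us i) = 0"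
proof -
  interpret K: field "ring_of_type_algebra :: 'k ring" ..
  obtain d where d: "K.dimension d Q UNIV" using assms(2) by (auto simp: K.finite_dimension_def)
  have "\<exists>q. (\<forall>i. q i \<in> Q) \<and> (\<exists>i\<le>d. q i \<noteq> 0) \<and> (\<Sum>i\<le>d. q i * us i) = 0" for us :: "nat \<Rightarrow> 'k"
  proof -
    define U where "U = map us [0..<Suc d]"
    have "\<not> K.independent Q U"
      using K.independent_length_le_dimension[OF assms(1) d, of U] by (auto simp: U_def)
    then obtain Ks where Ks: "length Ks = length U" "K.combine Ks U = 0" "set Ks \<subseteq> Q" "set Ks \<noteq> {0}"
      using K.dependent_imp_non_trivial_combine[OF assms(1), of U]
      by (auto simp: ring_of_type_algebra_def)
    have kops: "x \<otimes>\<^bsub>ring_of_type_algebra\<^esub> y = x * y" "x \<oplus>\<^bsub>ring_of_type_algebra\<^esub> y = x + y"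
      "\<zero>\<^bsub>ring_of_type_algebra\<^esub> = 0" for x y :: 'k by (simp_all add: ring_of_type_algebra_def)
    have comb: "length xs = length ys \<Longrightarrow> K.combine xs ys = (\<Sum>i<length xs. xs ! i * ys ! i)" for xs ys
      by (induction xs ys rule: list_induct2)
        (simp_all add: kops sum.lessThan_Suc_shift del: sum.lessThan_Suc)
    have len: "length Ks = Suc d" using Ks(1) by (simp add: U_def)
    have Q0: "0 \<in> Q" using subringE(2)[OF subcring.axioms(1)[OF subdomain.axioms(1)[OF subfield.axioms(1)[OF assms(1)]]]]
      by (simp add: ring_of_type_algebra_def)
    define q where "q i = (if i < Suc d then Ks ! i else 0)" for i
    have "\<forall>i. q i \<in> Q" using Ks(3) Q0 len by (auto simp: q_def)
    moreover have "\<exists>i\<le>d. q i \<noteq> 0"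
    proof (rule ccontr)
      assume "\<not> (\<exists>i\<le>d. q i \<noteq> 0)"
      then have "\<forall>i<length Ks. Ks ! i = 0" using len by (auto simp: q_def less_Suc_eq_le)
      then have "set Ks \<subseteq> {0}" by (auto simp: in_set_conv_nth)
      moreover have "set Ks \<noteq> {}" using len by auto
      ultimately show False using Ks(4) by (simp add: subset_singleton_iff)
    qed
    moreover have "(\<Sum>i\<le>d. q i * us i) = 0"
    proof -
      have "(\<Sum>i\<le>d. q i * us i) = (\<Sum>i<Suc d. Ks ! i * U ! i)"
        unfolding lessThan_Suc_atMost[symmetric] U_def by (intro sum.cong) (auto simp: q_def simp del: upt_Suc)
      then show ?thesis using Ks(2) comb[OF Ks(1)] len by simp
    qed
    ultimately show ?thesis by blast
  qed
  then show ?thesis using that by blast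
qed

theorem integers_complete_dvr:
  fixes \<iota> :: "(nat \<Rightarrow> rat) set \<Rightarrow> 'k::field"
  assumes l: "prime l" "odd l" and K: "finite_padic_extension l \<iota>" "unramified l \<iota>"
  shows "complete_dvr (integers_of l \<iota>) (of_nat l)"
proof -
  define Q where "Q = \<iota> ` carrier (padic_field l)"
  define Z where "Z = \<iota> ` padic_integers l"
  define p where "p = (of_nat l :: 'k)"
  define \<O> where "\<O> = integers_of l \<iota>"
  have \<iota>: "\<iota> \<in> ring_hom (padic_field l) (ring_of_type_algebra :: 'k ring)"
    and fd: "ring.finite_dimension (ring_of_type_algebra :: 'k ring) Q UNIV"
    using K(1) by (auto simp: finite_padic_extension_def Q_def)
  interpret padic_subfield Q Z p
    unfolding Q_def Z_def p_def by (rule padic_subfield_image[OF l(1) \<iota>])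
  interpret K: field "ring_of_type_algebra :: 'k ring" ..
  note ops = ring_of_type_algebra_def
  have Kminus: "\<ominus>\<^bsub>ring_of_type_algebra\<^esub> x = - x" for x :: 'k
    by (rule K.minus_equality) (auto simp: ops)
  have "subring Q (ring_of_type_algebra :: 'k ring)"
    by (rule K.subringI) (use Q in \<open>auto simp: ops Kminus[unfolded ops]\<close>)
  moreover have "inv\<^bsub>ring_of_type_algebra\<^esub> x \<in> Q" if "x \<in> Q - {\<zero>\<^bsub>ring_of_type_algebra\<^esub>}" for x :: 'k
  proof -
    have "inv\<^bsub>ring_of_type_algebra\<^esub> x = inverse x"
      using that by (intro K.comm_inv_char) (auto simp: ops)
    then show ?thesis using Q(6) that by auto
  qed
  ultimately have "subfield Q (ring_of_type_algebra :: 'k ring)" by (rule K.subfieldI')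
  then obtain d where d: "\<forall>us :: nat \<Rightarrow> 'k. \<exists>q. (\<forall>i. q i \<in> Q) \<and> (\<exists>i\<le>d. q i \<noteq> 0) \<and> (\<Sum>i\<le>d. q i * us i) = 0"
    by (rule finite_dimension_dependent[OF _ fd])
  define A where "A = (ring_of_type_algebra :: 'k ring)\<lparr>carrier := \<O>\<rparr>"
  have max: "maximalideal (PIdl\<^bsub>A\<^esub> p) A"
    using K(2) by (simp add: unramified_def A_def \<O>_def p_def Let_def)
  interpret M: maximalideal "PIdl\<^bsub>A\<^esub> p" A by (rule max)
  have A: "carrier A = \<O>" "x \<otimes>\<^bsub>A\<^esub> y = x * y" "x \<oplus>\<^bsub>A\<^esub> y = x + y" "\<one>\<^bsub>A\<^esub> = 1" "\<zero>\<^bsub>A\<^esub> = 0" for x y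
    by (simp_all add: A_def ops)
  have "comm_monoid A" by (rule M.monoid_comm_monoidI) (simp add: A mult.commute)
  then interpret A: cring A by (intro cring.intro M.ring_axioms)
  have I: "PIdl\<^bsub>A\<^esub> a = {x * a | x. x \<in> \<O>}" for a by (simp add: cgenideal_def A)
  have pO_eq: "x \<in> PIdl\<^bsub>A\<^esub> p \<longleftrightarrow> x / p \<in> \<O>" for x
    unfolding I using p_nonzero by (auto intro!: exI[of _ "x / p"])
  \<comment> \<open>That sums and products of integral elements are integral is contained in
    \<open>maximalideal\<close>, which asserts that the ambient structure is a ring.\<close>
  have O_add: "x + y \<in> \<O>" and O_mult: "x * y \<in> \<O>" if "x \<in> \<O>" "y \<in> \<O>" for x y
    using M.a_closed[of x y] M.m_closed[of x y] that by (simp_all add: A)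
  have O_uminus: "- x \<in> \<O>" if "x \<in> \<O>" for x
  proof -
    have "\<ominus>\<^bsub>A\<^esub> x \<in> \<O>" "x + \<ominus>\<^bsub>A\<^esub> x = 0" using M.a_inv_closed[of x] M.r_neg[of x] that by (simp_all add: A)
    then show ?thesis by (metis minus_unique)
  qed
  have monic: "x \<in> \<O>" if c: "\<And>i. i < n \<Longrightarrow> c i \<in> Z" and x: "x ^ n + (\<Sum>i<n. c i * x ^ i) = 0" for n c x
  proof -
    define q where "q = Polynomial.monom 1 n + (\<Sum>i<n. Polynomial.monom (c i) i)"
    have co: "Polynomial.coeff q j = (if j = n then 1 else if j < n then c j else 0)" for j
      by (simp add: q_def Polynomial.coeff_sum Polynomial.coeff_monom)
    have "Polynomial.degree q = n"
      by (rule antisym[OF degree_le le_degree]) (auto simp: co)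
    then have "Polynomial.lead_coeff q = 1" by (simp add: co)
    moreover have "\<forall>i. Polynomial.coeff q i \<in> Z" using c Z by (simp add: co)
    moreover have "Polynomial.poly q x = 0" using x by (simp add: q_def poly_sum Polynomial.poly_monom)
    ultimately show ?thesis unfolding \<O>_def integers_of_def Z_def by blast
  qed
  have "padic_extension Q Z p \<O> d l"
  proof
    show "\<exists>q. (\<forall>i. q i \<in> Q) \<and> (\<exists>i\<le>d. q i \<noteq> 0) \<and> (\<Sum>i\<le>d. q i * us i) = 0" for us :: "nat \<Rightarrow> 'k" using d by blast
    show "0 \<in> \<O>" "1 \<in> \<O>" using M.zero_closed M.one_closed by (simp_all add: A)
    show "Z \<subseteq> \<O>"
    proof
      fix z assume "z \<in> Z"
      then show "z \<in> \<O>" using monic[of 1 "\<lambda>_. - z" z] Z(4) by simp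
    qed
    then have pO: "p \<in> \<O>" using p_Z by blast
    show "inverse p \<notin> \<O>"
    proof
      assume ip: "inverse p \<in> \<O>"
      have "x / p \<in> \<O>" if "x \<in> \<O>" for x using O_mult[OF that ip] by (simp add: divide_inverse)
      then have "\<O> \<subseteq> PIdl\<^bsub>A\<^esub> p" using pO_eq by blast
      moreover have "PIdl\<^bsub>A\<^esub> p \<subseteq> \<O>" unfolding I using O_mult[OF _ pO] by blast
      ultimately have "PIdl\<^bsub>A\<^esub> p = \<O>" by (rule antisym[rotated])
      then show False using M.I_notcarr by (simp add: A)
    qed
    show "\<exists>y\<in>\<O>. \<exists>z\<in>\<O>. x * y = 1 + p * z" if x: "x \<in> \<O>" "x / p \<notin> \<O>" for x
    proof -
      \<comment> \<open>The ideal generated by \<open>p\<close> and \<open>x\<close> properly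
        contains the maximal ideal generated by \<open>p\<close>, so it contains 1.\<close>
      define J where "J = PIdl\<^bsub>A\<^esub> p <+>\<^bsub>A\<^esub> PIdl\<^bsub>A\<^esub> x"
      have ids: "ideal (PIdl\<^bsub>A\<^esub> p) A" "ideal (PIdl\<^bsub>A\<^esub> x) A"
        using A.cgenideal_ideal pO x(1) by (simp_all add: A)
      have J: "ideal J A" unfolding J_def by (rule M.add_ideals[OF ids])
      have Jm: "u \<in> J \<longleftrightarrow> (\<exists>a\<in>\<O>. \<exists>b\<in>\<O>. u = a * p + b * x)" for u
        unfolding J_def set_add_def' I by (auto simp: A)
      have "PIdl\<^bsub>A\<^esub> p \<subseteq> J" 
      proof
        fix u assume "u \<in> PIdl\<^bsub>A\<^esub> p"
        then obtain a where "a \<in> \<O>" "u = a * p" unfolding I by blast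
        then show "u \<in> J" unfolding Jm using M.zero_closed by (intro bexI[of _ a] bexI[of _ 0]) (simp_all add: A)
      qed
      moreover have "x \<in> J" unfolding Jm using M.zero_closed M.one_closed
        by (intro bexI[of _ 0] bexI[of _ 1]) (simp_all add: A)
      moreover have "x \<notin> PIdl\<^bsub>A\<^esub> p" using x(2) pO_eq by simp
      moreover have "J \<subseteq> carrier A" using ideal.Icarr[OF J] by blast
      ultimately have "J = carrier A" using M.I_maximal[OF J] by blast
      then have "1 \<in> J" using M.one_closed by (simp add: A)
      then obtain a b where "a \<in> \<O>" "b \<in> \<O>" "1 = a * p + b * x" unfolding Jm by blast
      then show ?thesis using O_uminus by (intro bexI[of _ b] bexI[of _ "- a"]) (auto simp: algebra_simps)
    qed
    show "x \<in> \<O>" if "\<And>i. i < n \<Longrightarrow> c i \<in> Z" "x ^ n + (\<Sum>i<n. c i * x ^ i) = 0" for n c x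
      using that by (rule monic)
  qed (use O_add O_mult O_uminus l in \<open>simp_all add: p_def\<close>)
  then show ?thesis using padic_extension.complete_dvr by (simp add: \<O>_def p_def)
qed

section \<open>Commutants of decomposable group algebras\<close>

text \<open>Elements \<open>q\<close> for which the corner \<open>qSq\<close> is commutative, in a form that does not presuppose
  that \<open>q\<close> is idempotent.\<close>

definition commutative_corner :: "('a, 'm) ring_scheme \<Rightarrow> 'a \<Rightarrow> bool" where
  "commutative_corner S q \<longleftrightarrow> q \<in> carrier S \<and>
     (\<forall>x\<in>carrier S. \<forall>y\<in>carrier S.
        q \<otimes>\<^bsub>S\<^esub> x \<otimes>\<^bsub>S\<^esub> q \<otimes>\<^bsub>S\<^esub> y \<otimes>\<^bsub>S\<^esub> q = q \<otimes>\<^bsub>S\<^esub> y \<otimes>\<^bsub>S\<^esub> q \<otimes>\<^bsub>S\<^esub> x \<otimes>\<^bsub>S\<^esub> q)"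

inductive_set corner_sums :: "('a, 'm) ring_scheme \<Rightarrow> 'a set" for S :: "('a, 'm) ring_scheme" where
  base: "commutative_corner S q \<Longrightarrow> q \<in> corner_sums S"
| sum: "x \<in> corner_sums S \<Longrightarrow> y \<in> corner_sums S \<Longrightarrow> x \<oplus>\<^bsub>S\<^esub> y \<in> corner_sums S"

text \<open>These weak closure properties are all that is needed of the ring \<open>S\<close>.\<close>

definition corner_decomposition :: "('a, 'm) ring_scheme \<Rightarrow> bool" where
  "corner_decomposition S \<longleftrightarrow> \<zero>\<^bsub>S\<^esub> \<in> carrier S \<and>
     (\<forall>x\<in>carrier S. \<forall>y\<in>carrier S. x \<oplus>\<^bsub>S\<^esub> y \<in> carrier S \<and> x \<otimes>\<^bsub>S\<^esub> y \<in> carrier S) \<and>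
     (\<forall>x\<in>carrier S. x \<oplus>\<^bsub>S\<^esub> \<zero>\<^bsub>S\<^esub> = x \<and> \<zero>\<^bsub>S\<^esub> \<oplus>\<^bsub>S\<^esub> x = x \<and> x \<otimes>\<^bsub>S\<^esub> \<zero>\<^bsub>S\<^esub> = \<zero>\<^bsub>S\<^esub> \<and> \<zero>\<^bsub>S\<^esub> \<otimes>\<^bsub>S\<^esub> x = \<zero>\<^bsub>S\<^esub>) \<and>
     \<one>\<^bsub>S\<^esub> \<in> corner_sums S"

lemma corner_sums_carrier:
  assumes "corner_decomposition S" and "x \<in> corner_sums S"
  shows "x \<in> carrier S"
  using assms(2,1) by induction (auto simp: corner_decomposition_def commutative_corner_def)

text \<open>The corner of a diagonal matrix unit is a copy of \<open>F\<close>, hence commutative,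
  and the diagonal matrix units add up to 1.\<close>

lemma matrix_ring_corner_decomposition:
  assumes F: "field F" and n: "n > 0"
  shows "corner_decomposition (matrix_ring F n)"
proof -
  interpret F: field F by (rule F)
  define M where "M = matrix_ring F n"
  have M: "carrier M = {..<n} \<times> {..<n} \<rightarrow>\<^sub>E carrier F"
    "\<And>A B. A \<otimes>\<^bsub>M\<^esub> B = (\<lambda>(i, j) \<in> {..<n} \<times> {..<n}. \<Oplus>\<^bsub>F\<^esub>k\<in>{..<n}. A (i, k) \<otimes>\<^bsub>F\<^esub> B (k, j))"
    "\<one>\<^bsub>M\<^esub> = (\<lambda>(i, j) \<in> {..<n} \<times> {..<n}. if i = j then \<one>\<^bsub>F\<^esub> else \<zero>\<^bsub>F\<^esub>)"
    "\<zero>\<^bsub>M\<^esub> = (\<lambda>(i, j) \<in> {..<n} \<times> {..<n}. \<zero>\<^bsub>F\<^esub>)"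
    "\<And>A B. A \<oplus>\<^bsub>M\<^esub> B = (\<lambda>(i, j) \<in> {..<n} \<times> {..<n}. A (i, j) \<oplus>\<^bsub>F\<^esub> B (i, j))"
    by (simp_all add: M_def matrix_ring_def)
  have ent: "A (i, j) \<in> carrier F" if "A \<in> carrier M" "i < n" "j < n" for A i j
    using that by (auto simp: M(1))
  have eqI: "A = B" if "A \<in> carrier M" "B \<in> carrier M" "\<And>i j. i < n \<Longrightarrow> j < n \<Longrightarrow> A (i, j) = B (i, j)" for A B
    using that unfolding M(1) by (intro PiE_ext) auto
  have closed: "A \<oplus>\<^bsub>M\<^esub> B \<in> carrier M" "A \<otimes>\<^bsub>M\<^esub> B \<in> carrier M" if AB: "A \<in> carrier M" "B \<in> carrier M" for A B
    unfolding M(2,5) using ent[OF AB(1)] ent[OF AB(2)]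
    by (auto simp: M(1) PiE_iff extensional_def intro!: F.finsum_closed)
  have zero: "\<zero>\<^bsub>M\<^esub> \<in> carrier M" by (auto simp: M(1,4) PiE_iff extensional_def)
  have e_add: "(A \<oplus>\<^bsub>M\<^esub> B) (i, j) = A (i, j) \<oplus>\<^bsub>F\<^esub> B (i, j)" if "i < n" "j < n" for A B i j
    using that by (simp add: M(5))
  have e_mult: "(A \<otimes>\<^bsub>M\<^esub> B) (i, j) = (\<Oplus>\<^bsub>F\<^esub>k\<in>{..<n}. A (i, k) \<otimes>\<^bsub>F\<^esub> B (k, j))" if "i < n" "j < n" for A B i j
    using that by (simp add: M(2))
  have e_zero: "\<zero>\<^bsub>M\<^esub> (i, j) = \<zero>\<^bsub>F\<^esub>" if "i < n" "j < n" for i j using that by (simp add: M(4))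
  have sum0: "(\<Oplus>\<^bsub>F\<^esub>k\<in>{..<n}. g k) = \<zero>\<^bsub>F\<^esub>" if "\<And>k. k < n \<Longrightarrow> g k = \<zero>\<^bsub>F\<^esub>" for g
  proof -
    have "(\<Oplus>\<^bsub>F\<^esub>k\<in>{..<n}. g k) = (\<Oplus>\<^bsub>F\<^esub>k\<in>{..<n}. \<zero>\<^bsub>F\<^esub>)" using that by (intro F.finsum_cong') auto
    then show ?thesis by (simp add: F.finsum_zero)
  qed
  have sum1: "(\<Oplus>\<^bsub>F\<^esub>k\<in>{..<n}. g k) = g a"
    if "a < n" "g a \<in> carrier F" "\<And>k. k < n \<Longrightarrow> k \<noteq> a \<Longrightarrow> g k = \<zero>\<^bsub>F\<^esub>" for g a
  proof -
    have "(\<Oplus>\<^bsub>F\<^esub>k\<in>{..<n}. g k) = (\<Oplus>\<^bsub>F\<^esub>k\<in>{..<n}. if a = k then g a else \<zero>\<^bsub>F\<^esub>)"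
      using that by (intro F.finsum_cong') auto
    then show ?thesis using F.finsum_singleton[of a "{..<n}" "\<lambda>_. g a"] that by auto
  qed
  have zeros: "A \<oplus>\<^bsub>M\<^esub> \<zero>\<^bsub>M\<^esub> = A" "\<zero>\<^bsub>M\<^esub> \<oplus>\<^bsub>M\<^esub> A = A" "A \<otimes>\<^bsub>M\<^esub> \<zero>\<^bsub>M\<^esub> = \<zero>\<^bsub>M\<^esub>" "\<zero>\<^bsub>M\<^esub> \<otimes>\<^bsub>M\<^esub> A = \<zero>\<^bsub>M\<^esub>"
    if A: "A \<in> carrier M" for A
    using ent[OF A] by (auto intro!: eqI closed zero A sum0 simp: e_add e_mult e_zero)
  define q where "q a = (\<lambda>(i, j) \<in> {..<n} \<times> {..<n}. if i = a \<and> j = a then \<one>\<^bsub>F\<^esub> else \<zero>\<^bsub>F\<^esub>)" for a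
  have qM: "q a \<in> carrier M" for a by (auto simp: M(1) q_def PiE_iff extensional_def)
  have e_q: "q a (i, j) = (if i = a \<and> j = a then \<one>\<^bsub>F\<^esub> else \<zero>\<^bsub>F\<^esub>)" if "i < n" "j < n" for a i j
    using that by (simp add: q_def)
  have q_left: "(q a \<otimes>\<^bsub>M\<^esub> A) (i, j) = (if i = a then A (a, j) else \<zero>\<^bsub>F\<^esub>)" if "A \<in> carrier M" "i < n" "j < n" "a < n" for a A i j
  proof (cases "i = a")
    case True
    have "(q a \<otimes>\<^bsub>M\<^esub> A) (i, j) = q a (i, a) \<otimes>\<^bsub>F\<^esub> A (a, j)"
      unfolding e_mult[OF that(2,3)] using that ent[OF that(1)] ent[OF qM]
      by (intro sum1) (auto simp: e_q)
    then show ?thesis using True that ent[OF that(1)] by (simp add: e_q)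
  next
    case False
    then show ?thesis unfolding e_mult[OF that(2,3)] using that ent[OF that(1)] by (simp add: sum0 e_q)
  qed
  have q_right: "(A \<otimes>\<^bsub>M\<^esub> q a) (i, j) = (if j = a then A (i, a) else \<zero>\<^bsub>F\<^esub>)" if "A \<in> carrier M" "i < n" "j < n" "a < n" for a A i j
  proof (cases "j = a")
    case True
    have "(A \<otimes>\<^bsub>M\<^esub> q a) (i, j) = A (i, a) \<otimes>\<^bsub>F\<^esub> q a (a, j)"
      unfolding e_mult[OF that(2,3)] using that ent[OF that(1)] ent[OF qM]
      by (intro sum1) (auto simp: e_q)
    then show ?thesis using True that ent[OF that(1)] by (simp add: e_q)
  next
    case False
    then show ?thesis unfolding e_mult[OF that(2,3)] using that ent[OF that(1)] by (simp add: sum0 e_q)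
  qed
  have corner: "commutative_corner M (q a)" if a: "a < n" for a
    unfolding commutative_corner_def
  proof (intro conjI ballI qM)
    fix A B assume A: "A \<in> carrier M" and B: "B \<in> carrier M"
    have *: "(q a \<otimes>\<^bsub>M\<^esub> A \<otimes>\<^bsub>M\<^esub> q a \<otimes>\<^bsub>M\<^esub> B \<otimes>\<^bsub>M\<^esub> q a) (i, j) =
      (if i = a \<and> j = a then A (a, a) \<otimes>\<^bsub>F\<^esub> B (a, a) else \<zero>\<^bsub>F\<^esub>)"
      if A: "A \<in> carrier M" and B: "B \<in> carrier M" and ij: "i < n" "j < n" for A B i j
    proof -
      have qAq: "(q a \<otimes>\<^bsub>M\<^esub> A \<otimes>\<^bsub>M\<^esub> q a) (i, k) = (if i = a \<and> k = a then A (a, a) else \<zero>\<^bsub>F\<^esub>)" if "k < n" for k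
        using q_right[OF closed(2)[OF qM A] ij(1) that a] q_left[OF A ij(1) a a] by auto
      have "(q a \<otimes>\<^bsub>M\<^esub> A \<otimes>\<^bsub>M\<^esub> q a \<otimes>\<^bsub>M\<^esub> B) (i, a) = (q a \<otimes>\<^bsub>M\<^esub> A \<otimes>\<^bsub>M\<^esub> q a) (i, a) \<otimes>\<^bsub>F\<^esub> B (a, a)"
        using a ent[OF B] ent[OF A a a] by (intro trans[OF e_mult[OF ij(1) a] sum1]) (auto simp: qAq)
      then show ?thesis
        using q_right[OF closed(2)[OF closed(2)[OF closed(2)[OF qM A] qM] B] ij a] qAq[OF a] ent[OF B a a]
        by auto
    qed
    show "q a \<otimes>\<^bsub>M\<^esub> A \<otimes>\<^bsub>M\<^esub> q a \<otimes>\<^bsub>M\<^esub> B \<otimes>\<^bsub>M\<^esub> q a = q a \<otimes>\<^bsub>M\<^esub> B \<otimes>\<^bsub>M\<^esub> q a \<otimes>\<^bsub>M\<^esub> A \<otimes>\<^bsub>M\<^esub> q a"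
      using F.m_comm ent[OF A a a] ent[OF B a a]
      by (intro eqI closed(2) qM A B) (simp add: *[OF A B] *[OF B A])
  qed
  \<comment> \<open>Partial sums of the diagonal matrix units. They begin with the single unit at
    index 0, since \<open>corner_sums\<close> contains no empty sum; this is where
    \<open>n > 0\<close> is used.\<close>
  define D where "D m = (\<lambda>(i, j) \<in> {..<n} \<times> {..<n}. if i = j \<and> i \<le> m then \<one>\<^bsub>F\<^esub> else \<zero>\<^bsub>F\<^esub>)" for m
  have DM: "D m \<in> carrier M" for m by (auto simp: M(1) D_def PiE_iff extensional_def)
  have "m < n \<Longrightarrow> D m \<in> corner_sums M" for m
  proof (induction m)
    case 0
    have "D 0 = q 0" by (rule eqI[OF DM qM]) (auto simp: D_def q_def)
    then show ?case using corner[OF 0] corner_sums.base by metis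
  next
    case (Suc m)
    have "D (Suc m) = D m \<oplus>\<^bsub>M\<^esub> q (Suc m)"
      by (rule eqI[OF DM closed(1)[OF DM qM]]) (auto simp: e_add D_def q_def)
    then show ?case using Suc corner_sums.sum corner_sums.base corner by (metis Suc_lessD)
  qed
  then have "D (n - 1) \<in> corner_sums M" using n by simp
  moreover have "D (n - 1) = \<one>\<^bsub>M\<^esub>" unfolding D_def M(3) by (auto simp: restrict_def fun_eq_iff)
  ultimately show ?thesis
    using closed zero zeros unfolding M_def[symmetric] corner_decomposition_def by auto
qed

lemma RDirProd_list_Cons:
  "carrier (RDirProd_list (R # Rs)) = {x # xs | x xs. x \<in> carrier R \<and> xs \<in> carrier (RDirProd_list Rs)}"
  "x \<in> carrier R \<Longrightarrow> xs \<in> carrier (RDirProd_list Rs) \<Longrightarrow> y \<in> carrier R \<Longrightarrow> ys \<in> carrier (RDirProd_list Rs) \<Longrightarrow>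
    (x # xs) \<otimes>\<^bsub>RDirProd_list (R # Rs)\<^esub> (y # ys) = (x \<otimes>\<^bsub>R\<^esub> y) # (xs \<otimes>\<^bsub>RDirProd_list Rs\<^esub> ys)"
  "x \<in> carrier R \<Longrightarrow> xs \<in> carrier (RDirProd_list Rs) \<Longrightarrow> y \<in> carrier R \<Longrightarrow> ys \<in> carrier (RDirProd_list Rs) \<Longrightarrow>
    (x # xs) \<oplus>\<^bsub>RDirProd_list (R # Rs)\<^esub> (y # ys) = (x \<oplus>\<^bsub>R\<^esub> y) # (xs \<oplus>\<^bsub>RDirProd_list Rs\<^esub> ys)"
  "\<one>\<^bsub>RDirProd_list (R # Rs)\<^esub> = \<one>\<^bsub>R\<^esub> # \<one>\<^bsub>RDirProd_list Rs\<^esub>"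
  using ring_hom_mult[OF RDirProd_list_hom1[of R Rs], of "(x, xs)" "(y, ys)"]
    ring_hom_add[OF RDirProd_list_hom1[of R Rs], of "(x, xs)" "(y, ys)"]
  by (auto simp: RDirProd_list_carrier RDirProd_carrier RDirProd_list_one RDirProd_def DirProd_def monoid.defs)

text \<open>Elements with commutative corners of one factor keep this property when padded by 0 in
  the other factors. The empty product is the zero ring, where 1 itself has a commutative
  corner.\<close>

lemma RDirProd_list_corner_decomposition:
  "(\<And>R. R \<in> set Rs \<Longrightarrow> corner_decomposition R) \<Longrightarrow> corner_decomposition (RDirProd_list Rs)"
proof (induction Rs)
  case Nil
  have "\<one>\<^bsub>nil_ring\<^esub> \<in> corner_sums nil_ring"
    by (rule corner_sums.base) (auto simp: commutative_corner_def monoid.defs)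
  then show ?case by (auto simp: corner_decomposition_def monoid.defs)
next
  case (Cons R Rs)
  define S where "S = RDirProd_list Rs"
  define P where "P = RDirProd_list (R # Rs)"
  have R: "corner_decomposition R" and S: "corner_decomposition S" using Cons by (auto simp: S_def)
  note P = RDirProd_list_Cons[where R=R and Rs=Rs, folded S_def P_def]
  have P0: "\<zero>\<^bsub>P\<^esub> = \<zero>\<^bsub>R\<^esub> # \<zero>\<^bsub>S\<^esub>" unfolding P_def S_def by (rule RDirProd_list_zero')
  note Rd = R[unfolded corner_decomposition_def] and Sd = S[unfolded corner_decomposition_def]
  have q1: "x # \<zero>\<^bsub>S\<^esub> \<in> corner_sums P" if "x \<in> corner_sums R" for x
    using that
  proof (induction rule: corner_sums.induct)
    case (base q)
    have "commutative_corner P (q # \<zero>\<^bsub>S\<^esub>)"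
      unfolding commutative_corner_def P(1) using base Rd Sd
      by (auto simp: P(2) commutative_corner_def)
    then show ?case by (rule corner_sums.base)
  next
    case (sum x y)
    have "x \<in> carrier R" "y \<in> carrier R" using sum corner_sums_carrier[OF R] by auto
    then have "(x # \<zero>\<^bsub>S\<^esub>) \<oplus>\<^bsub>P\<^esub> (y # \<zero>\<^bsub>S\<^esub>) = (x \<oplus>\<^bsub>R\<^esub> y) # \<zero>\<^bsub>S\<^esub>" using Sd by (simp add: P(3))
    then show ?case using corner_sums.sum[OF sum.IH] by simp
  qed
  have q2: "\<zero>\<^bsub>R\<^esub> # x \<in> corner_sums P" if "x \<in> corner_sums S" for x
    using that
  proof (induction rule: corner_sums.induct)
    case (base q)
    have "commutative_corner P (\<zero>\<^bsub>R\<^esub> # q)"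
      unfolding commutative_corner_def P(1) using base Rd Sd
      by (auto simp: P(2) commutative_corner_def)
    then show ?case by (rule corner_sums.base)
  next
    case (sum x y)
    have "x \<in> carrier S" "y \<in> carrier S" using sum corner_sums_carrier[OF S] by auto
    then have "(\<zero>\<^bsub>R\<^esub> # x) \<oplus>\<^bsub>P\<^esub> (\<zero>\<^bsub>R\<^esub> # y) = \<zero>\<^bsub>R\<^esub> # (x \<oplus>\<^bsub>S\<^esub> y)" using Rd by (simp add: P(3))
    then show ?case using corner_sums.sum[OF sum.IH] by simp
  qed
  have one: "\<one>\<^bsub>R\<^esub> \<in> carrier R" "\<one>\<^bsub>S\<^esub> \<in> carrier S" using Rd Sd corner_sums_carrier[OF R] corner_sums_carrier[OF S] by auto
  have "(\<one>\<^bsub>R\<^esub> # \<zero>\<^bsub>S\<^esub>) \<oplus>\<^bsub>P\<^esub> (\<zero>\<^bsub>R\<^esub> # \<one>\<^bsub>S\<^esub>) \<in> corner_sums P"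
    using Rd Sd by (intro corner_sums.sum q1 q2) auto
  moreover have "(\<one>\<^bsub>R\<^esub> # \<zero>\<^bsub>S\<^esub>) \<oplus>\<^bsub>P\<^esub> (\<zero>\<^bsub>R\<^esub> # \<one>\<^bsub>S\<^esub>) = \<one>\<^bsub>P\<^esub>"
    using Rd Sd one by (simp add: P(3,4))
  ultimately have "\<one>\<^bsub>P\<^esub> \<in> corner_sums P" by simp
  then have "corner_decomposition P"
    unfolding corner_decomposition_def P0 P(1) using Rd Sd by (auto simp: P(2,3))
  then show ?case by (simp add: P_def)
qed

lemma decomposable_corner_decomposition:
  assumes "decomposable TYPE('f) R"
  obtains S :: "(nat \<times> nat \<Rightarrow> 'f) list ring" and h where "corner_decomposition S" "h \<in> ring_iso R S"
proof -
  obtain Fs :: "('f ring \<times> nat) list" where Fs: "\<forall>(F, n) \<in> set Fs. field F \<and> n > 0"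
    "R \<simeq> RDirProd_list (map (\<lambda>(F, n). matrix_ring F n) Fs)"
    using assms unfolding decomposable_def by blast
  have "corner_decomposition (RDirProd_list (map (\<lambda>(F, n). matrix_ring F n) Fs))"
    using Fs(1) by (intro RDirProd_list_corner_decomposition) (auto intro: matrix_ring_corner_decomposition)
  then show ?thesis using Fs(2) that unfolding is_ring_iso_def by blast
qed

section \<open>The action of the group algebra\<close>

context lattice_rep
begin

definition act :: "('g \<Rightarrow> 'k) \<Rightarrow> 'w aend" where "act a = (\<Sum>h\<in>carrier Hg. sc (a h) * \<rho> h)"

lemma act_app: "act a \<cdot> w = group_algebra_act Hg scale (\<lambda>h. app (\<rho> h)) a w"
  by (simp add: act_def group_algebra_act_def sum_app times_app sc_app)

lemma act_add: "act (a \<oplus>\<^bsub>group_algebra Hg\<^esub> b) = act a + act b"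
  by (simp add: act_def group_algebra_def sc_add distrib_right sum.distrib)

lemma act_one: "act \<one>\<^bsub>group_algebra Hg\<^esub> = 1"
proof -
  have "act \<one>\<^bsub>group_algebra Hg\<^esub> = (\<Sum>h\<in>carrier Hg. if h = \<one>\<^bsub>Hg\<^esub> then 1 else 0)"
    unfolding act_def by (intro sum.cong) (auto simp: group_algebra_def sc_0 sc_1 rho_one)
  then show ?thesis using H_fin by simp
qed

lemma act_mult: "act (a \<otimes>\<^bsub>group_algebra Hg\<^esub> b) = act a * act b"
proof -
  define C where "C = carrier Hg"
  define F where "F = (\<lambda>(y, z). sc (a y * b z) * \<rho> (y \<otimes>\<^bsub>Hg\<^esub> z))"
  define P where "P x = {(y, z) \<in> C \<times> C. y \<otimes>\<^bsub>Hg\<^esub> z = x}" for x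
  have PE: "{u. u \<in> C \<times> C \<and> (\<lambda>(y, z). y \<otimes>\<^bsub>Hg\<^esub> z) u = x} = P x" for x by (auto simp: P_def)
  have m: "(a \<otimes>\<^bsub>group_algebra Hg\<^esub> b) x = (\<Sum>u\<in>P x. (\<lambda>(y, z). a y * b z) u)" for x
    unfolding P_def C_def by (simp add: group_algebra_def)
  have t: "(sc (a y) * \<rho> y) * (sc (b z) * \<rho> z) = F (y, z)" if yz: "y \<in> C" "z \<in> C" for y z
  proof -
    have "(sc (a y) * \<rho> y) * (sc (b z) * \<rho> z) = sc (a y) * (\<rho> y * sc (b z)) * \<rho> z" by (simp add: mult.assoc)
    also have "\<dots> = sc (a y) * sc (b z) * (\<rho> y * \<rho> z)"
      using lin_sc[OF rho_lin, of y "b z"] yz by (simp add: C_def mult.assoc)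
    finally show ?thesis using yz by (simp add: F_def rho_mult sc_mult C_def)
  qed
  have "act a * act b = (\<Sum>y\<in>C. \<Sum>z\<in>C. F (y, z))"
    unfolding act_def sum_product C_def[symmetric] using t by (intro sum.cong refl) auto
  also have "\<dots> = sum F (C \<times> C)" by (simp add: sum.cartesian_product)
  also have "\<dots> = (\<Sum>x\<in>C. \<Sum>u | u \<in> C \<times> C \<and> (\<lambda>(y, z). y \<otimes>\<^bsub>Hg\<^esub> z) u = x. F u)"
    by (rule sum.group[symmetric]) (auto simp: C_def H_fin)
  also have "\<dots> = (\<Sum>x\<in>C. sum F (P x))" by (simp only: PE)
  also have "\<dots> = (\<Sum>x\<in>C. sc ((a \<otimes>\<^bsub>group_algebra Hg\<^esub> b) x) * \<rho> x)"
  proof (rule sum.cong[OF refl])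
    fix x
    have "sum F (P x) = (\<Sum>u\<in>P x. sc ((\<lambda>(y, z). a y * b z) u) * \<rho> x)"
      by (rule sum.cong) (auto simp: F_def P_def)
    then show "sum F (P x) = sc ((a \<otimes>\<^bsub>group_algebra Hg\<^esub> b) x) * \<rho> x"
      by (simp add: sc_sum sum_distrib_right m)
  qed
  finally show ?thesis by (simp add: act_def C_def)
qed

lemma group_algebra_closed:
  fixes a b :: "'g \<Rightarrow> 'k"
  shows "\<one>\<^bsub>group_algebra Hg\<^esub> \<in> carrier (group_algebra Hg :: ('g \<Rightarrow> 'k) ring)"
  "a \<in> carrier (group_algebra Hg) \<Longrightarrow> b \<in> carrier (group_algebra Hg) \<Longrightarrow>
    a \<oplus>\<^bsub>group_algebra Hg\<^esub> b \<in> carrier (group_algebra Hg)"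
  "a \<in> carrier (group_algebra Hg) \<Longrightarrow> b \<in> carrier (group_algebra Hg) \<Longrightarrow>
    a \<otimes>\<^bsub>group_algebra Hg\<^esub> b \<in> carrier (group_algebra Hg)"
proof -
  have e: "{(y, z). y \<in> carrier Hg \<and> z \<in> carrier Hg \<and> y \<otimes>\<^bsub>Hg\<^esub> z = x} = {}" if "x \<notin> carrier Hg" for x
    using that by auto
  show "a \<in> carrier (group_algebra Hg) \<Longrightarrow> b \<in> carrier (group_algebra Hg) \<Longrightarrow>
    a \<otimes>\<^bsub>group_algebra Hg\<^esub> b \<in> carrier (group_algebra Hg)"
    by (auto simp: group_algebra_def e)
qed (auto simp: group_algebra_def)

lemma E_act: "x \<in> E \<Longrightarrow> x * act a = act a * x"
proof -
  assume x: "x \<in> E"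
  have "x * (sc (a h) * \<rho> h) = sc (a h) * \<rho> h * x" if "h \<in> carrier Hg" for h
  proof -
    have "x * (sc (a h) * \<rho> h) = sc (a h) * (x * \<rho> h)"
      by (simp add: mult.assoc[symmetric] lin_sc[OF E_lin[OF x]])
    then show ?thesis by (simp add: E_rho[OF x that] mult.assoc)
  qed
  then show ?thesis unfolding act_def sum_distrib_left sum_distrib_right by (intro sum.cong refl)
qed

lemma E_act_app: "x \<in> E \<Longrightarrow> x \<cdot> act a \<cdot> w = act a \<cdot> x \<cdot> w"
  by (simp add: E_act times_app[symmetric])

lemma simple_submodule:
  assumes "simple_group_algebra_module Hg scale (\<lambda>h. app (\<rho> h))"
    and "0 \<in> U" "\<And>x y. x \<in> U \<Longrightarrow> y \<in> U \<Longrightarrow> x + y \<in> U" "\<And>x. x \<in> U \<Longrightarrow> - x \<in> U"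
    and "\<And>a x. a \<in> carrier (group_algebra Hg) \<Longrightarrow> x \<in> U \<Longrightarrow> act a \<cdot> x \<in> U"
  shows "U = {0} \<or> U = UNIV"
proof -
  have "group_algebra_submodule Hg scale (\<lambda>h. app (\<rho> h)) U"
    unfolding group_algebra_submodule_def act_app[symmetric] using assms by blast
  then show ?thesis using assms(1) unfolding simple_group_algebra_module_def by blast
qed

text \<open>Schur's lemma: kernel and image of \<open>x\<close> are submodules. The inverse map
  commutes with everything that \<open>x\<close> commutes with, so it is in \<open>E\<close>
  again.\<close>

lemma simple_E_inverse:
  assumes simple: "simple_group_algebra_module Hg scale (\<lambda>h. app (\<rho> h))" and x: "x \<in> E" "x \<noteq> 0"
  shows "\<exists>y\<in>E. y * x = 1"
proof -
  have nz: "\<exists>w. x \<cdot> w \<noteq> 0" using x(2) aend_eqI[of x 0] by auto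
  have "{w. x \<cdot> w = 0} = {0} \<or> {w. x \<cdot> w = 0} = UNIV"
    by (rule simple_submodule[OF simple]) (simp_all add: E_act_app[OF x(1)])
  then have ker: "x \<cdot> w = 0 \<Longrightarrow> w = 0" for w using nz by auto
  have "range (app x) = {0} \<or> range (app x) = UNIV"
  proof (rule simple_submodule[OF simple])
    show "0 \<in> range (app x)" using app_0[of x] by (metis rangeI)
    show "u + w \<in> range (app x)" if "u \<in> range (app x)" "w \<in> range (app x)" for u w
      using that by (auto simp flip: app_add)
    show "- u \<in> range (app x)" if "u \<in> range (app x)" for u
      using that by (auto simp flip: app_minus)
    show "act a \<cdot> u \<in> range (app x)" if "u \<in> range (app x)" for a u
      using that by (auto simp flip: E_act_app[OF x(1)])
  qed
  then have surj: "range (app x) = UNIV" using nz by auto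
  have "inj (app x)"
  proof (rule injI)
    fix u w assume "x \<cdot> u = x \<cdot> w"
    then show "u = w" using ker[of "u - w"] by simp
  qed
  define y where "y = Aend (inv_into UNIV (app x))"
  have xi: "x \<cdot> inv_into UNIV (app x) w = w" for w using surj by (intro f_inv_into_f) simp
  have y: "y \<cdot> w = inv_into UNIV (app x) w" for w
    unfolding y_def
  proof (rule app_Aend)
    fix u w
    show "inv_into UNIV (app x) (u + w) = inv_into UNIV (app x) u + inv_into UNIV (app x) w"
      by (rule injD[OF \<open>inj (app x)\<close>]) (simp add: xi)
  qed
  have xy: "x * y = 1" by (rule aend_eqI) (simp add: times_app y xi)
  have yx: "y * x = 1" by (rule aend_eqI) (simp add: times_app y inv_into_f_f[OF \<open>inj (app x)\<close>])
  have c: "y * z = z * y" if "x * z = z * x" for z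
  proof -
    have "y * z = y * (z * x) * y" by (simp add: mult.assoc xy)
    also have "\<dots> = (y * x) * (z * y)" unfolding that[symmetric] by (simp add: mult.assoc)
    finally show ?thesis by (simp add: yx)
  qed
  have "y \<in> E" unfolding E_def lin_def using c lin_sc[OF E_lin[OF x(1)]] E_rho[OF x(1)] by simp
  then show ?thesis using yx by blast
qed

text \<open>Transported back along the isomorphism, 1 is a sum of elements with commutative corners.
  Not all of them can act as 0, since 1 acts as the identity on a nonzero space.\<close>

lemma decomposable_cyclic_generator:
  assumes "decomposable TYPE('f) (group_algebra Hg :: ('g \<Rightarrow> 'k) ring)"
  shows "\<exists>q\<in>carrier (group_algebra Hg). act q \<noteq> 0 \<and>
    (\<forall>x\<in>carrier (group_algebra Hg). \<forall>y\<in>carrier (group_algebra Hg).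
      act q * act x * act q * act y * act q = act q * act y * act q * act x * act q)"
proof (rule ccontr)
  assume neg: "\<not> ?thesis"
  define A where "A = (group_algebra Hg :: ('g \<Rightarrow> 'k) ring)"
  note closed = group_algebra_closed[folded A_def] and hom = act_add[folded A_def] act_mult[folded A_def] act_one[folded A_def]
  obtain S :: "(nat \<times> nat \<Rightarrow> 'f) list ring" and h where S: "corner_decomposition S" and h: "h \<in> ring_iso A S"
    using assms unfolding A_def by (rule decomposable_corner_decomposition)
  have hh: "h \<in> ring_hom A S" and hb: "bij_betw h (carrier A) (carrier S)" using h by (auto simp: ring_iso_def)
  note hm = ring_hom_mult[OF hh] and ha = ring_hom_add[OF hh]
  have q0: "act q = 0" if q: "q \<in> carrier A" "commutative_corner S (h q)" for q
  proof (rule ccontr)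
    assume nz: "act q \<noteq> 0"
    have "act q * act x * act q * act y * act q = act q * act y * act q * act x * act q"
      if xy: "x \<in> carrier A" "y \<in> carrier A" for x y
    proof -
      have hxy: "h x \<in> carrier S" "h y \<in> carrier S" using xy hb by (auto dest: bij_betwE)
      have "h (q \<otimes>\<^bsub>A\<^esub> x \<otimes>\<^bsub>A\<^esub> q \<otimes>\<^bsub>A\<^esub> y \<otimes>\<^bsub>A\<^esub> q) = h (q \<otimes>\<^bsub>A\<^esub> y \<otimes>\<^bsub>A\<^esub> q \<otimes>\<^bsub>A\<^esub> x \<otimes>\<^bsub>A\<^esub> q)"
        using q(2) hxy unfolding commutative_corner_def by (simp add: hm closed q(1) xy)
      then have "q \<otimes>\<^bsub>A\<^esub> x \<otimes>\<^bsub>A\<^esub> q \<otimes>\<^bsub>A\<^esub> y \<otimes>\<^bsub>A\<^esub> q = q \<otimes>\<^bsub>A\<^esub> y \<otimes>\<^bsub>A\<^esub> q \<otimes>\<^bsub>A\<^esub> x \<otimes>\<^bsub>A\<^esub> q"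
        using bij_betw_imp_inj_on[OF hb] closed(3) q(1) xy by (simp add: inj_on_eq_iff)
      then show ?thesis using arg_cong[of _ _ act] by (simp flip: hom(2))
    qed
    then show False using neg q(1) nz unfolding A_def by blast
  qed
  have "s \<in> corner_sums S \<Longrightarrow> \<exists>a\<in>carrier A. h a = s \<and> act a = 0" for s
  proof (induction rule: corner_sums.induct)
    case (base s)
    then have "s \<in> h ` carrier A" using hb by (simp add: commutative_corner_def bij_betw_def)
    then show ?case using q0 base by blast
  next
    case (sum x y)
    then obtain a b where "a \<in> carrier A" "h a = x" "act a = 0" "b \<in> carrier A" "h b = y" "act b = 0" by blast
    then show ?case by (intro bexI[of _ "a \<oplus>\<^bsub>A\<^esub> b"]) (simp_all add: ha hom closed)
  qed
  then obtain a where a: "a \<in> carrier A" "h a = \<one>\<^bsub>S\<^esub>" "act a = 0"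
    using S unfolding corner_decomposition_def by blast
  then have "a = \<one>\<^bsub>A\<^esub>"
    using bij_betw_imp_inj_on[OF hb] closed(1) ring_hom_one[OF hh] by (auto simp: inj_on_def)
  then have "(1 :: 'w aend) = 0" using a(3) hom(3) by simp
  then have "w = 0" for w :: 'w using one_app[of w] by simp
  then show False using nontriv by auto
qed

text \<open>For \<open>w0 = q w'\<close> with \<open>qAq\<close> commutative, an endomorphism is determined by its value at \<open>w0\<close>,
  and the endomorphisms with \<open>w' \<mapsto> x w0\<close> and \<open>w' \<mapsto> y w0\<close> compose on \<open>w0\<close> as \<open>qxq\<close> and \<open>qyq\<close>.\<close>

lemma simple_decomposable_field:
  assumes simple: "simple_group_algebra_module Hg scale (\<lambda>h. app (\<rho> h))"
    and dec: "decomposable TYPE('f) (group_algebra Hg :: ('g \<Rightarrow> 'k) ring)"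
  shows "lattice_rep_field scale \<O> p S T Hg \<rho>"
proof unfold_locales
  show "\<exists>y\<in>E. y * x = 1" if "x \<in> E" "x \<noteq> 0" for x using simple that by (rule simple_E_inverse)
  obtain q where q: "q \<in> carrier (group_algebra Hg)" "act q \<noteq> 0"
    "\<And>x y. x \<in> carrier (group_algebra Hg) \<Longrightarrow> y \<in> carrier (group_algebra Hg) \<Longrightarrow>
      act q * act x * act q * act y * act q = act q * act y * act q * act x * act q"
    using decomposable_cyclic_generator[OF dec] by blast
  obtain w' where w': "act q \<cdot> w' \<noteq> 0" using q(2) aend_eqI[of "act q" 0] by auto
  define w0 where "w0 = act q \<cdot> w'"
  define U where "U = {act a \<cdot> w0 | a. a \<in> carrier (group_algebra Hg)}"
  have UI: "act a \<cdot> w0 \<in> U" if "a \<in> carrier (group_algebra Hg)" for a using that by (auto simp: U_def)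
  have "U = {0} \<or> U = UNIV"
  proof (rule simple_submodule[OF simple])
    have "act (\<lambda>_. 0) \<cdot> w0 = 0" by (simp add: act_def sc_0 sum_app)
    moreover have "(\<lambda>_. 0) \<in> carrier (group_algebra Hg)" by (simp add: group_algebra_def)
    ultimately show "0 \<in> U" using UI by metis
    show "u + w \<in> U" if uw: "u \<in> U" "w \<in> U" for u w
    proof -
      obtain a b where "a \<in> carrier (group_algebra Hg)" "u = act a \<cdot> w0"
        "b \<in> carrier (group_algebra Hg)" "w = act b \<cdot> w0" using uw unfolding U_def by blast
      then show ?thesis using UI[of "a \<oplus>\<^bsub>group_algebra Hg\<^esub> b"] group_algebra_closed(2) by (simp add: act_add)
    qed
    show "- u \<in> U" if u: "u \<in> U" for u
    proof -
      obtain a where a: "a \<in> carrier (group_algebra Hg)" "u = act a \<cdot> w0" using u unfolding U_def by blast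
      have "act (\<lambda>h. - a h) = - act a" by (simp add: act_def sc_minus sum_negf)
      moreover have "(\<lambda>h. - a h) \<in> carrier (group_algebra Hg)" using a(1) by (simp add: group_algebra_def)
      ultimately show ?thesis using UI[of "\<lambda>h. - a h"] a(2) by simp
    qed
    show "act b \<cdot> u \<in> U" if b: "b \<in> carrier (group_algebra Hg)" and u: "u \<in> U" for b u
    proof -
      obtain a where a: "a \<in> carrier (group_algebra Hg)" "u = act a \<cdot> w0" using u unfolding U_def by blast
      then show ?thesis using UI[OF group_algebra_closed(3)[OF b a(1)]] by (simp add: act_mult times_app)
    qed
  qed
  moreover have "w0 \<in> U" using UI[OF group_algebra_closed(1)] by (simp add: act_one)
  ultimately have U: "U = UNIV" using w' by (auto simp: w0_def)
  show "x * y = y * x" if x: "x \<in> E" and y: "y \<in> E" for x y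
  proof -
    have "x \<cdot> w' \<in> U" "y \<cdot> w' \<in> U" using U by auto
    then obtain a b where a: "a \<in> carrier (group_algebra Hg)" "x \<cdot> w' = act a \<cdot> w0"
      and b: "b \<in> carrier (group_algebra Hg)" "y \<cdot> w' = act b \<cdot> w0" unfolding U_def by blast
    have "(x * y) \<cdot> w0 = (act q * act b * act q * act a * act q) \<cdot> w'"
      by (simp add: times_app w0_def E_act_app[OF x] E_act_app[OF y] a(2)[unfolded w0_def] b(2)[unfolded w0_def])
    moreover have "(y * x) \<cdot> w0 = (act q * act a * act q * act b * act q) \<cdot> w'"
      by (simp add: times_app w0_def E_act_app[OF x] E_act_app[OF y] a(2)[unfolded w0_def] b(2)[unfolded w0_def])
    ultimately have w0: "(x * y) \<cdot> w0 = (y * x) \<cdot> w0" using q(3)[OF a(1) b(1)] by simp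
    show ?thesis
    proof (rule aend_eqI)
      fix w
      have "w \<in> U" using U by simp
      then obtain c where c: "w = act c \<cdot> w0" unfolding U_def by blast
      show "(x * y) \<cdot> w = (y * x) \<cdot> w"
        unfolding c E_act_app[OF E.mult_in[OF x y]] E_act_app[OF E.mult_in[OF y x]] w0 ..
    qed
  qed
qed

end

section \<open>Extension to a semidirect product\<close>

context complete_dvr
begin

lemma of_nat_O: "of_nat n \<in> \<O>"
  by (induction n) (simp_all add: O_0 O_1 O_add)

lemma of_int_O: "of_int a \<in> \<O>"
  by (cases a rule: int_cases2) (simp_all add: of_nat_O O_uminus)

lemma inverse_p_notin: "inverse p \<notin> \<O>"
proof
  assume ip: "inverse p \<in> \<O>"
  have "1 / p ^ n \<in> \<O>" for n
  proof (induction n)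
    case (Suc n)
    then show ?case using O_mult[OF ip] by (simp add: divide_inverse)
  qed (simp add: O_1)
  then show False using O_separated[of 1] by auto
qed

text \<open>By Bezout, integrality of \<open>n / p\<close> would imply that of
  \<open>inverse p\<close>. This makes the order of the group a unit, as averaging requires.\<close>

lemma of_nat_unit:
  assumes p: "p = of_nat l" and n: "coprime n l"
  shows "of_nat n \<noteq> (0 :: 'k)" "inverse (of_nat n) \<in> \<O>"
proof -
  have np: "of_nat n / p \<notin> \<O>"
  proof
    assume np: "of_nat n / p \<in> \<O>"
    obtain a b :: int where ab: "a * int n + b * int l = 1"
      using bezout_int[of "int n" "int l"] n by auto
    have "of_int a * of_nat n + of_int b * of_nat l = (1 :: 'k)"
      using arg_cong[OF ab, of of_int] by simp
    then have "of_int a * (of_nat n / p) + of_int b = inverse p"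
      using p_nz unfolding p by (simp add: field_simps)
    then show False using O_add[OF O_mult[OF of_int_O np] of_int_O] inverse_p_notin by metis
  qed
  then show "of_nat n \<noteq> (0 :: 'k)" using O_0 by auto
  show "inverse (of_nat n) \<in> \<O>" by (rule O_unit[OF of_nat_O np])
qed

end

lemma linear_additive:
  assumes "Vector_Spaces.linear s1 s2 g"
  shows "g (x + y) = g x + g y" "g (s1 c x) = s2 c (g x)"
proof -
  interpret Vector_Spaces.linear s1 s2 g by (rule assms)
  show "g (x + y) = g x + g y" "g (s1 c x) = s2 c (g x)" by (rule add, rule scale)
qed

text \<open>The normal form \<open>h c^i\<close>, with \<open>i\<close> determined modulo the order
  of \<open>L\<close>, is what makes the extension well defined. Exponents are natural numbers so
  that the same powers can be formed in the monoid of operators.\<close>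

lemma semidirect_cyclic_generator:
  fixes G (structure)
  assumes G: "group G" "finite (carrier G)" and H: "H \<lhd> G"
    and L: "subgroup L G" "cyclic_group (G\<lparr>carrier := L\<rparr>)"
    and HL: "H <#>\<^bsub>G\<^esub> L = carrier G" "H \<inter> L = {\<one>\<^bsub>G\<^esub>}"
  obtains c where "c \<in> carrier G" "c [^] card L = \<one>"
    "\<forall>g\<in>carrier G. \<exists>h\<in>H. \<exists>i::nat. g = h \<otimes> c [^] i"
    "\<forall>h\<in>H. \<forall>h'\<in>H. \<forall>i j::nat. h \<otimes> c [^] i = h' \<otimes> c [^] j \<longrightarrow> h = h' \<and> i mod card L = j mod card L"
proof -
  interpret G: group G by (rule G)
  interpret H: normal H G by (rule H)
  define N where "N = card L"
  have sL: "L \<subseteq> carrier G" using L(1) by (rule subgroup.subset)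
  have finL: "finite L" by (rule finite_subset[OF sL G(2)])
  have Npos: "N > 0" unfolding N_def using finL subgroup.one_closed[OF L(1)] by (auto simp: card_gt_0_iff)
  interpret Lg: group "G\<lparr>carrier := L\<rparr>" by (rule G.subgroup_imp_group[OF L(1)])
  obtain c where c: "c \<in> L" "L = range (\<lambda>n::int. c [^]\<^bsub>G\<lparr>carrier := L\<rparr>\<^esub> n)"
    using L(2) unfolding Lg.cyclic_group by auto
  have cG: "c \<in> carrier G" using c(1) sL by blast
  have int_pow: "L = range (\<lambda>n::int. c [^] n)"
    using c(2) G.int_pow_consistent[OF L(1) c(1)] by simp
  have "c [^]\<^bsub>G\<lparr>carrier := L\<rparr>\<^esub> Coset.order (G\<lparr>carrier := L\<rparr>) = \<one>\<^bsub>G\<lparr>carrier := L\<rparr>\<^esub>"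
    using c(1) by (intro Lg.pow_order_eq_1) simp
  then have cN: "c [^] N = \<one>" by (simp add: Coset.order_def N_def nat_pow_def)
  have powmod: "c [^] i = c [^] (i mod N)" for i :: nat
  proof -
    have "c [^] i = c [^] (N * (i div N) + i mod N)" by simp
    also have "\<dots> = c [^] (i mod N)"
      using cG by (simp only: G.nat_pow_mult[symmetric] G.nat_pow_pow[symmetric] cN) simp
    finally show ?thesis .
  qed
  have Lpow: "L = (\<lambda>i::nat. c [^] i) ` {..<N}"
  proof
    show "(\<lambda>i::nat. c [^] i) ` {..<N} \<subseteq> L" using int_pow by (auto simp flip: int_pow_int)
    show "L \<subseteq> (\<lambda>i::nat. c [^] i) ` {..<N}"
    proof
      fix x assume "x \<in> L"
      then obtain n :: int where n: "x = c [^] n" using int_pow by blast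
      define r where "r = nat (n mod int N)"
      have r: "int r = n mod int N" "r < N" using Npos by (auto simp: r_def nat_less_iff)
      have "x = c [^] (int N * (n div int N) + int r)" by (simp add: n r(1))
      also have "\<dots> = c [^] r"
        using cG cN by (simp add: G.int_pow_mult G.int_pow_pow[symmetric] int_pow_int)
      finally show "x \<in> (\<lambda>i::nat. c [^] i) ` {..<N}" using r(2) by auto
    qed
  qed
  have inj: "inj_on (\<lambda>i::nat. c [^] i) {..<N}"
    using Lpow by (intro eq_card_imp_inj_on) (simp_all add: N_def)
  have cL: "c [^] i \<in> L" for i :: nat using int_pow by (auto simp flip: int_pow_int)
  show thesis
  proof (rule that[OF cG])
    show "c [^] card L = \<one>" using cN by (simp add: N_def)
    show "\<forall>g\<in>carrier G. \<exists>h\<in>H. \<exists>i::nat. g = h \<otimes> c [^] i"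
    proof
      fix g assume "g \<in> carrier G"
      then obtain h x where "h \<in> H" "x \<in> L" "g = h \<otimes> x" using HL(1) unfolding set_mult_def by blast
      then show "\<exists>h\<in>H. \<exists>i::nat. g = h \<otimes> c [^] i" using Lpow by blast
    qed
    show "\<forall>h\<in>H. \<forall>h'\<in>H. \<forall>i j::nat. h \<otimes> c [^] i = h' \<otimes> c [^] j \<longrightarrow> h = h' \<and> i mod card L = j mod card L"
    proof (intro ballI allI impI)
      fix h h' and i j :: nat
      assume h: "h \<in> H" "h' \<in> H" and e: "h \<otimes> c [^] i = h' \<otimes> c [^] j"
      have hG: "h \<in> carrier G" "h' \<in> carrier G" using h H.subset by auto
      have cG': "c [^] k \<in> carrier G" for k :: nat using cG by simp
      have "inv h' \<otimes> h = inv h' \<otimes> (h \<otimes> c [^] i) \<otimes> inv (c [^] i)"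
        using hG cG' by (simp add: G.m_assoc)
      also have "\<dots> = c [^] j \<otimes> inv (c [^] i)"
        unfolding e using hG cG' by (simp add: G.m_assoc[symmetric])
      finally have "inv h' \<otimes> h = c [^] j \<otimes> inv (c [^] i)" .
      moreover have "c [^] j \<otimes> inv (c [^] i) \<in> L"
        using L(1) cL by (intro subgroup.m_closed subgroup.m_inv_closed)
      moreover have "inv h' \<otimes> h \<in> H" using h by simp
      ultimately have "inv h' \<otimes> h = \<one>" using HL(2) by auto
      then have "h = h'" using hG G.inv_equality G.inv_inv by (metis G.inv_closed G.inv_solve_left' G.r_one)
      moreover have "c [^] i = c [^] j" using e \<open>h = h'\<close> hG cG' by simp
      then have "c [^] (i mod N) = c [^] (j mod N)" using powmod by metis
      then have "i mod N = j mod N" using inj Npos by (auto dest: inj_onD)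
      ultimately show "h = h' \<and> i mod card L = j mod card L" by (simp add: N_def)
    qed
  qed
qed

section \<open>The extended homomorphism\<close>

context lattice_rep_form
begin

text \<open>The operator version of \<open>aut_lattice\<close>: stability of \<open>T\<close> under
  the inverse as well gives \<open>x T = T\<close>.\<close>

definition lattice_auts :: "'w aend set" where
  "lattice_auts = {x \<in> lin. (\<forall>t\<in>T. x \<cdot> t \<in> T) \<and> (\<forall>v w. f (x \<cdot> v) (x \<cdot> w) = f v w) \<and>
     (\<exists>y. x * y = 1 \<and> y * x = 1 \<and> (\<forall>t\<in>T. y \<cdot> t \<in> T))}"

lemma lattice_auts_mult:
  assumes "x \<in> lattice_auts" "y \<in> lattice_auts"
  shows "x * y \<in> lattice_auts"
proof -
  obtain x' y' where *: "x * x' = 1" "x' * x = 1" "\<forall>t\<in>T. x' \<cdot> t \<in> T" "y * y' = 1" "y' * y = 1" "\<forall>t\<in>T. y' \<cdot> t \<in> T"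
    using assms unfolding lattice_auts_def by blast
  have "x * y * (y' * x') = x * (y * y') * x'" "y' * x' * (x * y) = y' * (x' * x) * y" by (simp_all add: mult.assoc)
  then have "x * y * (y' * x') = 1 \<and> y' * x' * (x * y) = 1 \<and> (\<forall>t\<in>T. (y' * x') \<cdot> t \<in> T)"
    using * by (simp add: times_app)
  moreover have "x * y \<in> lin" using assms by (auto simp: lattice_auts_def)
  ultimately show ?thesis using assms unfolding lattice_auts_def by (auto simp: times_app)
qed

lemma lattice_auts_1: "1 \<in> lattice_auts"
  by (auto simp: lattice_auts_def lin_def intro!: exI[of _ 1])

lemma lattice_auts_power: "x \<in> lattice_auts \<Longrightarrow> x ^ n \<in> lattice_auts"
  by (induction n) (simp_all add: lattice_auts_1 lattice_auts_mult)

lemma lattice_auts_rho: "h \<in> carrier Hg \<Longrightarrow> \<rho> h \<in> lattice_auts"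
proof -
  assume h: "h \<in> carrier Hg"
  have "\<rho> h * \<rho> (inv\<^bsub>Hg\<^esub> h) = 1" "\<rho> (inv\<^bsub>Hg\<^esub> h) * \<rho> h = 1"
    using h by (simp_all add: rho_mult[symmetric] rho_one)
  then show ?thesis using h rho_lin rho_T f_inv unfolding lattice_auts_def by (auto intro!: exI[of _ "\<rho> (inv\<^bsub>Hg\<^esub> h)"])
qed

lemma lattice_auts_aut_lattice:
  assumes "x \<in> lattice_auts"
  shows "app x \<in> carrier (aut_lattice scale T f)"
proof -
  obtain y where y: "x * y = 1" "y * x = 1" "\<forall>t\<in>T. y \<cdot> t \<in> T" using assms unfolding lattice_auts_def by blast
  have x: "x \<in> lin" "\<forall>t\<in>T. x \<cdot> t \<in> T" "\<And>v w. f (x \<cdot> v) (x \<cdot> w) = f v w" using assms by (auto simp: lattice_auts_def)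
  have xy: "x \<cdot> y \<cdot> w = w" "y \<cdot> x \<cdot> w = w" for w using y by (simp_all add: times_app[symmetric])
  have "Vector_Spaces.linear scale scale (app x)"
    by unfold_locales (simp_all add: lin_scale[OF x(1)])
  moreover have "bij (app x)" by (rule o_bij[of "app y"]) (simp_all add: fun_eq_iff xy)
  moreover have "app x ` T = T"
  proof
    show "T \<subseteq> app x ` T" using xy(1) y(3) by (metis imageI subsetI)
  qed (use x(2) in auto)
  ultimately show ?thesis by (simp add: aut_lattice_def aut_form_def x(3))
qed

text \<open>The extension sends \<open>h c^i\<close> to \<open>\<rho> h * v ^ i\<close>, where
  \<open>v\<close> is an isometric normalizer with \<open>v ^ N = 1\<close>. It is multiplicative
  because \<open>v\<close> conjugates the operators \<open>\<rho> h\<close> as \<open>c\<close>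
  conjugates the elements of \<open>H\<close>.\<close>

lemma extension_of_normalizer:
  fixes G :: "('g, 'm) monoid_scheme"
  assumes Hg: "Hg = G\<lparr>carrier := H\<rparr>" and G: "group G" and H: "H \<lhd> G"
    and c: "c \<in> carrier G" "c [^]\<^bsub>G\<^esub> N = \<one>\<^bsub>G\<^esub>" "\<forall>g\<in>carrier G. \<exists>h\<in>H. \<exists>i::nat. g = h \<otimes>\<^bsub>G\<^esub> c [^]\<^bsub>G\<^esub> i"
      "\<forall>h\<in>H. \<forall>h'\<in>H. \<forall>i j::nat. h \<otimes>\<^bsub>G\<^esub> c [^]\<^bsub>G\<^esub> i = h' \<otimes>\<^bsub>G\<^esub> c [^]\<^bsub>G\<^esub> j \<longrightarrow> h = h' \<and> i mod N = j mod N"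
    and N: "N = l ^ k" "prime l" "odd l" "p = of_nat l"
    and u0: "normalizes (\<lambda>h. c \<otimes>\<^bsub>G\<^esub> h \<otimes>\<^bsub>G\<^esub> inv\<^bsub>G\<^esub> c) u0 u0'"
  shows "\<exists>\<sigma>\<in>hom G (aut_lattice scale T f). \<forall>h\<in>H. \<sigma> h = app (\<rho> h)"
proof -
  interpret G: group G by (rule G)
  interpret H: normal H G by (rule H)
  define \<kappa> where "\<kappa> = (\<lambda>h. c \<otimes>\<^bsub>G\<^esub> h \<otimes>\<^bsub>G\<^esub> inv\<^bsub>G\<^esub> c)"
  have cH: "carrier Hg = H" by (simp add: Hg)
  have HG: "h \<in> carrier G" if "h \<in> H" for h using that H.subset by blast
  have ci: "c [^]\<^bsub>G\<^esub> i \<in> carrier G" for i :: nat using c(1) by simp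
  have conj: "x \<otimes>\<^bsub>G\<^esub> h \<otimes>\<^bsub>G\<^esub> inv\<^bsub>G\<^esub> x \<in> H" if "x \<in> carrier G" "h \<in> H" for x h using H.inv_op_closed2 that by blast
  have \<kappa>: "bij_betw \<kappa> (carrier Hg) (carrier Hg)"
    unfolding cH
  proof (rule bij_betwI[where g = "\<lambda>h. inv\<^bsub>G\<^esub> c \<otimes>\<^bsub>G\<^esub> h \<otimes>\<^bsub>G\<^esub> c"])
    show "\<kappa> \<in> H \<rightarrow> H" using conj[OF c(1)] by (auto simp: \<kappa>_def)
    show "(\<lambda>h. inv\<^bsub>G\<^esub> c \<otimes>\<^bsub>G\<^esub> h \<otimes>\<^bsub>G\<^esub> c) \<in> H \<rightarrow> H" using H.inv_op_closed1[OF c(1)] by auto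
    show "inv\<^bsub>G\<^esub> c \<otimes>\<^bsub>G\<^esub> \<kappa> h \<otimes>\<^bsub>G\<^esub> c = h" if "h \<in> H" for h
    proof -
      have "inv\<^bsub>G\<^esub> c \<otimes>\<^bsub>G\<^esub> \<kappa> h \<otimes>\<^bsub>G\<^esub> c = (inv\<^bsub>G\<^esub> c \<otimes>\<^bsub>G\<^esub> c) \<otimes>\<^bsub>G\<^esub> h \<otimes>\<^bsub>G\<^esub> (inv\<^bsub>G\<^esub> c \<otimes>\<^bsub>G\<^esub> c)"
        unfolding \<kappa>_def using c(1) HG[OF that] by (simp only: G.m_assoc G.m_closed G.inv_closed)
      then show ?thesis using c(1) HG[OF that] by simp
    qed
    show "\<kappa> (inv\<^bsub>G\<^esub> c \<otimes>\<^bsub>G\<^esub> h \<otimes>\<^bsub>G\<^esub> c) = h" if "h \<in> H" for h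
    proof -
      have "\<kappa> (inv\<^bsub>G\<^esub> c \<otimes>\<^bsub>G\<^esub> h \<otimes>\<^bsub>G\<^esub> c) = (c \<otimes>\<^bsub>G\<^esub> inv\<^bsub>G\<^esub> c) \<otimes>\<^bsub>G\<^esub> h \<otimes>\<^bsub>G\<^esub> (c \<otimes>\<^bsub>G\<^esub> inv\<^bsub>G\<^esub> c)"
        unfolding \<kappa>_def using c(1) HG[OF that] by (simp only: G.m_assoc G.m_closed G.inv_closed)
      then show ?thesis using c(1) HG[OF that] by simp
    qed
  qed
  have pow: "u ^ i * \<rho> h = \<rho> (c [^]\<^bsub>G\<^esub> i \<otimes>\<^bsub>G\<^esub> h \<otimes>\<^bsub>G\<^esub> inv\<^bsub>G\<^esub> (c [^]\<^bsub>G\<^esub> i)) * u ^ i"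
    if u: "normalizes \<kappa> u u'" and h: "h \<in> H" for u u' i h
  proof (induction i)
    case 0
    then show ?case using HG[OF h] by simp
  next
    case (Suc i)
    define g where "g = c [^]\<^bsub>G\<^esub> i \<otimes>\<^bsub>G\<^esub> h \<otimes>\<^bsub>G\<^esub> inv\<^bsub>G\<^esub> (c [^]\<^bsub>G\<^esub> i)"
    have g: "g \<in> H" unfolding g_def by (rule conj[OF ci h])
    have s: "c [^]\<^bsub>G\<^esub> Suc i = c \<otimes>\<^bsub>G\<^esub> c [^]\<^bsub>G\<^esub> i" by (rule G.nat_pow_Suc2[OF c(1)])
    have \<kappa>g: "\<kappa> g = c [^]\<^bsub>G\<^esub> Suc i \<otimes>\<^bsub>G\<^esub> h \<otimes>\<^bsub>G\<^esub> inv\<^bsub>G\<^esub> (c [^]\<^bsub>G\<^esub> Suc i)"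
      unfolding s G.inv_mult_group[OF c(1) ci] \<kappa>_def g_def using c(1) ci HG[OF h]
      by (simp only: G.m_assoc G.m_closed G.inv_closed)
    have "u ^ Suc i * \<rho> h = u * \<rho> g * u ^ i" using Suc unfolding g_def[symmetric] by (simp add: mult.assoc)
    also have "\<dots> = \<rho> (\<kappa> g) * u ^ Suc i" using normalizesD(5)[OF u, of g] g cH by (simp add: mult.assoc)
    finally show ?case unfolding \<kappa>g .
  qed
  have NE: "u ^ N \<in> E" if u: "normalizes \<kappa> u u'" for u u'
  proof -
    have "u ^ N * \<rho> h = \<rho> h * u ^ N" if "h \<in> carrier Hg" for h
      using pow[OF u, of h N] that HG[of h] c(2) by (simp add: cH)
    moreover have "u ^ N \<in> lin" using normalizesD(1)[OF u] op_ring.power_in[OF lin_ring] by blast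
    ultimately show ?thesis by (simp add: E_def)
  qed
  have oN: "odd N" using N by simp
  obtain u u' where u: "normalizes \<kappa> u u'" "\<And>x y. f (u \<cdot> x) (u \<cdot> y) = f x y"
    by (rule isometric_normalizer[OF u0[folded \<kappa>_def] \<kappa> oN]) (erule NE, rule that)
  obtain B \<phi> where B: "E_basis B \<phi>" by (rule E_basis_exists)
  have BN: "coprime (card B) N" using E_dimension_coprime[OF B N(4,2)] by (simp add: N(1))
  obtain v v' where v: "normalizes \<kappa> v v'" "\<And>x y. f (v \<cdot> x) (v \<cdot> y) = f x y" "v ^ N = 1"
    by (rule isometric_normalizer_of_finite_order[OF B oN BN u(1) \<kappa> u(2) NE[OF u(1)]]) (rule that)
  have vmod: "v ^ i = v ^ (i mod N)" for i
  proof -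
    have "v ^ i = v ^ (N * (i div N) + i mod N)" by simp
    also have "\<dots> = v ^ (i mod N)" by (simp only: power_add power_mult v(3)) simp
    finally show ?thesis .
  qed
  have vA: "v \<in> lattice_auts"
    using normalizesD(1,3,4)[OF v(1)] v(2) isometry_T[OF v(1) \<kappa> v(2)] unfolding lattice_auts_def by blast
  \<comment> \<open>All ways of writing \<open>g\<close> in normal form have the same
    \<open>h\<close> and exponents congruent modulo \<open>N\<close>, so \<open>v ^ N = 1\<close>
    leaves \<open>SOME\<close> a single value to choose.\<close>
  define \<sigma> where "\<sigma> g = (SOME \<phi>. \<exists>h\<in>H. \<exists>i::nat. g = h \<otimes>\<^bsub>G\<^esub> c [^]\<^bsub>G\<^esub> i \<and> \<phi> = app (\<rho> h * v ^ i))" for g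
  have \<sigma>: "\<sigma> (h \<otimes>\<^bsub>G\<^esub> c [^]\<^bsub>G\<^esub> i) = app (\<rho> h * v ^ i)" if h: "h \<in> H" for h and i :: nat
    unfolding \<sigma>_def
  proof (rule some_equality)
    show "\<exists>h'\<in>H. \<exists>j::nat. h \<otimes>\<^bsub>G\<^esub> c [^]\<^bsub>G\<^esub> i = h' \<otimes>\<^bsub>G\<^esub> c [^]\<^bsub>G\<^esub> j \<and> app (\<rho> h * v ^ i) = app (\<rho> h' * v ^ j)"
      using h by blast
    fix \<phi> assume "\<exists>h'\<in>H. \<exists>j::nat. h \<otimes>\<^bsub>G\<^esub> c [^]\<^bsub>G\<^esub> i = h' \<otimes>\<^bsub>G\<^esub> c [^]\<^bsub>G\<^esub> j \<and> \<phi> = app (\<rho> h' * v ^ j)"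
    then obtain h' and j :: nat where *: "h' \<in> H" "h \<otimes>\<^bsub>G\<^esub> c [^]\<^bsub>G\<^esub> i = h' \<otimes>\<^bsub>G\<^esub> c [^]\<^bsub>G\<^esub> j" "\<phi> = app (\<rho> h' * v ^ j)" by blast
    then have "h = h'" "i mod N = j mod N" using c(4) h by blast+
    then show "\<phi> = app (\<rho> h * v ^ i)" using * vmod[of i] vmod[of j] by simp
  qed
  have mult: "h \<otimes>\<^bsub>G\<^esub> x \<otimes>\<^bsub>G\<^esub> (h' \<otimes>\<^bsub>G\<^esub> y) = h \<otimes>\<^bsub>G\<^esub> (x \<otimes>\<^bsub>G\<^esub> h' \<otimes>\<^bsub>G\<^esub> inv\<^bsub>G\<^esub> x) \<otimes>\<^bsub>G\<^esub> (x \<otimes>\<^bsub>G\<^esub> y)"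
    if "h \<in> carrier G" "h' \<in> carrier G" "x \<in> carrier G" "y \<in> carrier G" for h h' x y
  proof -
    have "h \<otimes>\<^bsub>G\<^esub> (x \<otimes>\<^bsub>G\<^esub> h' \<otimes>\<^bsub>G\<^esub> inv\<^bsub>G\<^esub> x) \<otimes>\<^bsub>G\<^esub> (x \<otimes>\<^bsub>G\<^esub> y) = h \<otimes>\<^bsub>G\<^esub> x \<otimes>\<^bsub>G\<^esub> h' \<otimes>\<^bsub>G\<^esub> (inv\<^bsub>G\<^esub> x \<otimes>\<^bsub>G\<^esub> x) \<otimes>\<^bsub>G\<^esub> y"
      using that by (simp only: G.m_assoc G.m_closed G.inv_closed)
    then show ?thesis using that by (simp add: G.m_assoc)
  qed
  have "\<sigma> \<in> hom G (aut_lattice scale T f)"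
  proof (rule homI)
    fix g assume "g \<in> carrier G"
    then obtain h and i :: nat where "h \<in> H" "g = h \<otimes>\<^bsub>G\<^esub> c [^]\<^bsub>G\<^esub> i" using c(3) by blast
    then show "\<sigma> g \<in> carrier (aut_lattice scale T f)"
      using lattice_auts_aut_lattice[OF lattice_auts_mult[OF lattice_auts_rho lattice_auts_power[OF vA]]] cH
      by (simp add: \<sigma>)
  next
    fix g g' assume g: "g \<in> carrier G" and g': "g' \<in> carrier G"
    obtain h and i :: nat where h1: "h \<in> H" "g = h \<otimes>\<^bsub>G\<^esub> c [^]\<^bsub>G\<^esub> i" using c(3) g by blast
    obtain h' and j :: nat where h2: "h' \<in> H" "g' = h' \<otimes>\<^bsub>G\<^esub> c [^]\<^bsub>G\<^esub> j" using c(3) g' by blast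
    note h = h1 h2
    define k where "k = c [^]\<^bsub>G\<^esub> i \<otimes>\<^bsub>G\<^esub> h' \<otimes>\<^bsub>G\<^esub> inv\<^bsub>G\<^esub> (c [^]\<^bsub>G\<^esub> i)"
    have k: "k \<in> H" unfolding k_def by (rule conj[OF ci h(3)])
    have "g \<otimes>\<^bsub>G\<^esub> g' = (h \<otimes>\<^bsub>G\<^esub> k) \<otimes>\<^bsub>G\<^esub> c [^]\<^bsub>G\<^esub> (i + j)"
      unfolding h(2,4) k_def mult[OF HG[OF h(1)] HG[OF h(3)] ci ci] by (simp add: G.nat_pow_mult c(1))
    then have "\<sigma> (g \<otimes>\<^bsub>G\<^esub> g') = app (\<rho> (h \<otimes>\<^bsub>G\<^esub> k) * v ^ (i + j))" using \<sigma>[of "h \<otimes>\<^bsub>G\<^esub> k" "i + j"] h(1) k by simp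
    also have "\<rho> (h \<otimes>\<^bsub>G\<^esub> k) * v ^ (i + j) = \<rho> h * (\<rho> k * v ^ i) * v ^ j"
      using rho_mult[of h k] h(1) k by (simp add: Hg power_add mult.assoc)
    also have "\<rho> k * v ^ i = v ^ i * \<rho> h'" unfolding k_def by (rule pow[OF v(1) h(3), symmetric])
    also have "\<rho> h * (v ^ i * \<rho> h') * v ^ j = \<rho> h * v ^ i * (\<rho> h' * v ^ j)" by (simp add: mult.assoc)
    also have "app \<dots> = \<sigma> g \<circ> \<sigma> g'"
      unfolding h(2,4) \<sigma>[OF h(1)] \<sigma>[OF h(3)] by (simp add: fun_eq_iff times_app)
    finally show "\<sigma> (g \<otimes>\<^bsub>G\<^esub> g') = \<sigma> g \<otimes>\<^bsub>aut_lattice scale T f\<^esub> \<sigma> g'"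
      by (simp add: aut_lattice_def aut_form_def)
  qed
  moreover have "\<forall>h\<in>H. \<sigma> h = app (\<rho> h)"
  proof
    fix h assume h: "h \<in> H"
    then show "\<sigma> h = app (\<rho> h)" using \<sigma>[OF h, of 0] HG[OF h] by simp
  qed
  ultimately show ?thesis by blast
qed

end

theorem theorem1p2:
  fixes l :: nat
    and \<iota> :: "(nat \<Rightarrow> rat) set \<Rightarrow> 'k::field"
    and G :: "('g, 'm) monoid_scheme"
    and H L :: "'g set"
    and scale :: "'k \<Rightarrow> 'w::ab_group_add \<Rightarrow> 'w"
    and f :: "'w \<Rightarrow> 'w \<Rightarrow> 'k"
    and \<tau> :: "'g \<Rightarrow> 'w \<Rightarrow> 'w"
    and T :: "'w set"
  assumes l: "prime l" "odd l"
    and K: "finite_padic_extension l \<iota>" "unramified l \<iota>"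
    and G: "group G" "finite (carrier G)"
    and H: "H \<lhd> G" "coprime (card H) l"
    and L: "subgroup L G" "cyclic_group (G\<lparr>carrier := L\<rparr>)" "\<exists>k. card L = l ^ k"
    and semidirect: "H <#>\<^bsub>G\<^esub> L = carrier G" "H \<inter> L = {\<one>\<^bsub>G\<^esub>}"
    and decomp: "decomposable TYPE('f) (group_algebra (G\<lparr>carrier := H\<rparr>) :: ('g \<Rightarrow> 'k) ring)"
    and W: "vector_space scale" "\<exists>B. finite B \<and> Modules.module.span scale B = UNIV"
    and f: "bilinear_form scale f" "nondegenerate f" "alternating_form f \<or> symmetric_form f"
    and \<tau>: "\<tau> \<in> hom (G\<lparr>carrier := H\<rparr>) (aut_form scale f)"
      "simple_group_algebra_module (G\<lparr>carrier := H\<rparr>) scale \<tau>"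
    and \<tau>_conj: "\<And>g. g \<in> carrier G \<Longrightarrow>
      isomorphic_reps (G\<lparr>carrier := H\<rparr>) scale (\<lambda>h. \<tau> (g \<otimes>\<^bsub>G\<^esub> h \<otimes>\<^bsub>G\<^esub> inv\<^bsub>G\<^esub> g)) \<tau>"
    and T: "lattice_over (integers_of l \<iota>) scale T" "\<And>h. h \<in> H \<Longrightarrow> \<tau> h ` T \<subseteq> T"
    and \<tau>_T: "\<tau> ` H \<subseteq> carrier (aut_lattice scale T f)"
  shows "\<exists>\<tau>\<^sub>G \<in> hom G (aut_lattice scale T f). \<forall>h\<in>H. \<tau>\<^sub>G h = \<tau> h"
proof -
  define Hr where "Hr = G\<lparr>carrier := H\<rparr>"
  define \<O> where "\<O> = integers_of l \<iota>"
  define p where "p = (of_nat l :: 'k)"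
  interpret W: vector_space scale by (rule W(1))
  interpret G: group G by (rule G(1))
  interpret H: normal H G by (rule H(1))
  interpret Hr: group Hr unfolding Hr_def by (rule G.subgroup_imp_group[OF H.subgroup_axioms])
  interpret complete_dvr \<O> p unfolding \<O>_def p_def by (rule integers_complete_dvr[OF l K])
  have cH: "carrier Hr = H" by (simp add: Hr_def)
  have \<tau>_aut: "Vector_Spaces.linear scale scale (\<tau> h)" "bij (\<tau> h)" "f (\<tau> h x) (\<tau> h y) = f x y"
    if "h \<in> H" for h x y
    using hom_in_carrier[OF \<tau>(1), of h] that by (auto simp: aut_form_def)
  have \<tau>_mult: "\<tau> (g \<otimes>\<^bsub>G\<^esub> h) = \<tau> g \<circ> \<tau> h" if "g \<in> H" "h \<in> H" for g h
    using hom_mult[OF \<tau>(1), of g h] that by (simp add: aut_form_def)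
  \<comment> \<open>Membership in \<open>hom\<close> provides only multiplicativity;
    \<open>\<tau> \<one>\<close> is the identity because it is idempotent and injective.\<close>
  have \<tau>_one: "\<tau> \<one>\<^bsub>G\<^esub> x = x" for x
  proof -
    have "\<tau> \<one>\<^bsub>G\<^esub> (\<tau> \<one>\<^bsub>G\<^esub> x) = \<tau> \<one>\<^bsub>G\<^esub> x" using \<tau>_mult[of "\<one>\<^bsub>G\<^esub>" "\<one>\<^bsub>G\<^esub>"] by (simp add: fun_eq_iff)
    then show ?thesis using bij_is_inj[OF \<tau>_aut(2)[OF H.one_closed]] by (auto dest: injD)
  qed
  define \<rho> where "\<rho> h = Aend (\<tau> h)" for h
  have \<rho>: "\<rho> h \<cdot> x = \<tau> h x" if "h \<in> H" for h x
    unfolding \<rho>_def by (rule app_Aend) (rule linear_additive(1)[OF \<tau>_aut(1)[OF that]])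
  obtain S where S: "finite S" "T = {\<Sum>s\<in>S. scale (c s) s | c. \<forall>s\<in>S. c s \<in> \<O>}" "W.span T = UNIV"
    using T(1) unfolding lattice_over_def \<O>_def by blast
  have nontriv: "(UNIV :: 'w set) \<noteq> {0}" using \<tau>(2) by (simp add: simple_group_algebra_module_def)
  interpret op_lattice scale \<O> p S T by unfold_locales (rule S nontriv)+
  interpret D: lattice_rep scale \<O> p S T Hr \<rho>
  proof unfold_locales
    show "finite (carrier Hr)" unfolding cH by (rule finite_subset[OF H.subset G(2)])
    show "of_nat (card (carrier Hr)) \<noteq> (0 :: 'k)" "inverse (of_nat (card (carrier Hr))) \<in> \<O>"
      unfolding cH by (rule of_nat_unit[OF p_def H(2)])+
    show "\<rho> (g \<otimes>\<^bsub>Hr\<^esub> h) = \<rho> g * \<rho> h" if "g \<in> carrier Hr" "h \<in> carrier Hr" for g h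
      using that H.m_closed[of g h] \<tau>_mult[of g h] unfolding cH
      by (intro aend_eqI) (simp add: times_app \<rho> Hr_def)
    show "\<rho> \<one>\<^bsub>Hr\<^esub> = 1" by (rule aend_eqI) (simp add: Hr_def \<rho> \<tau>_one)
    show "\<rho> h \<in> lin" if "h \<in> carrier Hr" for h
      using that linear_additive(2)[OF \<tau>_aut(1)] unfolding cH lin_def
      by (auto intro!: aend_eqI simp: times_app sc_app \<rho>)
    show "\<rho> h \<cdot> t \<in> T" if "h \<in> carrier Hr" "t \<in> T" for h t
      using that T(2)[of h] \<rho>[of h t] unfolding cH by auto
  qed
  have act: "group_algebra_act Hr scale (\<lambda>h. app (\<rho> h)) = (group_algebra_act Hr scale \<tau> :: ('g \<Rightarrow> 'k) \<Rightarrow> 'w \<Rightarrow> 'w)"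
    by (auto simp: fun_eq_iff group_algebra_act_def cH \<rho> intro!: sum.cong)
  have "simple_group_algebra_module Hr scale (\<lambda>h. app (\<rho> h))"
    using \<tau>(2)[folded Hr_def] unfolding simple_group_algebra_module_def group_algebra_submodule_def act .
  then interpret lattice_rep_field scale \<O> p S T Hr \<rho>
    by (rule D.simple_decomposable_field[OF _ decomp[folded Hr_def]])
  have f1: "Vector_Spaces.linear scale (*) (\<lambda>x. f x y)" and f2: "Vector_Spaces.linear scale (*) (\<lambda>y. f x y)" for x y
    using f(1) by (auto simp: bilinear_form_def)
  \<comment> \<open>Polarization of \<open>f x x = 0\<close> gives the sign -1 in the alternating
    case.\<close>
  obtain \<epsilon> where \<epsilon>: "\<epsilon> * \<epsilon> = 1" "\<And>x y. f y x = \<epsilon> * f x y"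
  proof (cases "symmetric_form f")
    case True
    then show ?thesis by (intro that[of 1]) (auto simp: symmetric_form_def)
  next
    case False
    then have alt: "f x x = 0" for x using f(3) by (simp add: alternating_form_def)
    have a1: "f (x + y) z = f x z + f y z" for x y z by (rule linear_additive(1)[OF f1])
    have a2: "f z (x + y) = f z x + f z y" for x y z by (rule linear_additive(1)[OF f2])
    have skew: "f y x = - 1 * f x y" for x y
    proof -
      have "f (x + y) (x + y) = f x x + f x y + (f y x + f y y)" by (simp only: a1 a2 add_ac)
      then have "f x y + f y x = 0" by (simp add: alt)
      then show ?thesis using minus_unique[of "f x y" "f y x"] by simp
    qed
    show ?thesis by (rule that[OF _ skew]) simp
  qed
  interpret lattice_rep_form scale \<O> p S T Hr \<rho> f \<epsilon>
  proof unfold_locales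
    show "x = 0" if "\<And>y. f x y = 0" for x using f(2) that by (simp add: nondegenerate_def)
    show "f (\<rho> h \<cdot> x) (\<rho> h \<cdot> y) = f x y" if "h \<in> carrier Hr" for h x y
      using that by (simp add: cH \<rho> \<tau>_aut(3))
  qed (rule linear_additive[OF f1] linear_additive[OF f2] \<epsilon>)+
  obtain k where k: "card L = l ^ k" using L(3) by blast
  obtain c where c: "c \<in> carrier G" "c [^]\<^bsub>G\<^esub> card L = \<one>\<^bsub>G\<^esub>"
    "\<forall>g\<in>carrier G. \<exists>h\<in>H. \<exists>i::nat. g = h \<otimes>\<^bsub>G\<^esub> c [^]\<^bsub>G\<^esub> i"
    "\<forall>h\<in>H. \<forall>h'\<in>H. \<forall>i j::nat. h \<otimes>\<^bsub>G\<^esub> c [^]\<^bsub>G\<^esub> i = h' \<otimes>\<^bsub>G\<^esub> c [^]\<^bsub>G\<^esub> j \<longrightarrow> h = h' \<and> i mod card L = j mod card L"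
    by (rule semidirect_cyclic_generator[OF G H(1) L(1,2) semidirect]) (rule that)
  obtain \<phi> where \<phi>: "Vector_Spaces.linear scale scale \<phi>" "bij \<phi>"
    "\<And>h. h \<in> H \<Longrightarrow> \<phi> \<circ> \<tau> (c \<otimes>\<^bsub>G\<^esub> h \<otimes>\<^bsub>G\<^esub> inv\<^bsub>G\<^esub> c) = \<tau> h \<circ> \<phi>"
    using \<tau>_conj[OF c(1)] by (auto simp: isomorphic_reps_def)
  have \<phi>i: "\<phi> (inv_into UNIV \<phi> x) = x" "inv_into UNIV \<phi> (\<phi> x) = x" for x
    using \<phi>(2) by (simp_all add: bij_is_surj surj_f_inv_f bij_is_inj)
  \<comment> \<open>The isomorphism \<phi> carries the conjugated representation to
    \<open>\<tau>\<close>, so it is its inverse that takes \<open>\<rho> h\<close> to the operator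
    of the conjugate of \<open>h\<close> by \<open>c\<close>.\<close>
  define u u' where "u = Aend (inv_into UNIV \<phi>)" and "u' = Aend \<phi>"
  have u': "u' \<cdot> x = \<phi> x" for x unfolding u'_def by (rule app_Aend) (rule linear_additive(1)[OF \<phi>(1)])
  have u: "u \<cdot> x = inv_into UNIV \<phi> x" for x
    unfolding u_def
  proof (rule app_Aend)
    fix x y
    show "inv_into UNIV \<phi> (x + y) = inv_into UNIV \<phi> x + inv_into UNIV \<phi> y"
      by (rule injD[OF bij_is_inj[OF \<phi>(2)]]) (simp add: \<phi>i linear_additive(1)[OF \<phi>(1)])
  qed
  have uu: "u * u' = 1" "u' * u = 1" by (rule aend_eqI, simp add: times_app u u' \<phi>i)+
  have intertwine: "u * x = y * u" if "u' * y = x * u'" for x y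
  proof -
    have "u * x = u * (x * u') * u" by (simp add: mult.assoc uu)
    also have "\<dots> = (u * u') * y * u" unfolding that[symmetric] by (simp add: mult.assoc)
    finally show ?thesis by (simp add: uu)
  qed
  have u'_sc: "u' * sc a = sc a * u'" for a
    by (rule aend_eqI) (simp add: times_app sc_app u' linear_additive(2)[OF \<phi>(1)])
  have "u * \<rho> h = \<rho> (c \<otimes>\<^bsub>G\<^esub> h \<otimes>\<^bsub>G\<^esub> inv\<^bsub>G\<^esub> c) * u" if h: "h \<in> carrier Hr" for h
  proof (rule intertwine, rule aend_eqI)
    fix x
    have hH: "h \<in> H" "c \<otimes>\<^bsub>G\<^esub> h \<otimes>\<^bsub>G\<^esub> inv\<^bsub>G\<^esub> c \<in> H" using h H.inv_op_closed2[OF c(1)] by (simp_all add: cH)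
    show "(u' * \<rho> (c \<otimes>\<^bsub>G\<^esub> h \<otimes>\<^bsub>G\<^esub> inv\<^bsub>G\<^esub> c)) \<cdot> x = (\<rho> h * u') \<cdot> x"
      using fun_cong[OF \<phi>(3)[OF hH(1)], of x] by (simp add: times_app u' \<rho>[OF hH(1)] \<rho>[OF hH(2)])
  qed
  then have "normalizes (\<lambda>h. c \<otimes>\<^bsub>G\<^esub> h \<otimes>\<^bsub>G\<^esub> inv\<^bsub>G\<^esub> c) u u'"
    unfolding normalizes_def lin_def using uu u'_sc intertwine[OF u'_sc] by simp
  from extension_of_normalizer[OF Hr_def G(1) H(1) c k l p_def this]
  obtain \<sigma> where \<sigma>: "\<sigma> \<in> hom G (aut_lattice scale T f)" "\<forall>h\<in>H. \<sigma> h = app (\<rho> h)" by blast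
  have "\<forall>h\<in>H. \<sigma> h = \<tau> h" using \<sigma>(2) \<rho> by (simp add: fun_eq_iff)
  then show ?thesis using \<sigma>(1) by blast
qed

end
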